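(* Let $c,d\in\mathbb{N}$. There is an algorithm which, given a prime finite field $\mathbb{F}$, $n\in\mathbb{N}$, and polynomials $P_1,\ldots,P_c,Q\in\mathcal{P}_d(\mathbb{F}^n)$ (given by their coefficients), performs $n^{O_{d,c}(1)}$ field operations and decides whether $Q\in\sqrt{I}$, where $I=\langle P_1,\ldots,P_c\rangle$ is the ideal generated by $P_1,\ldots,P_c$ in $\mathbb{F}[x_1,\ldots,x_n]$. Here the constant in $O_{d,c}(1)$ depends only on $d$ and $c$.
   Context: $\mathbb{F}$ is a prime finite field; $\mathcal{P}_d(\mathbb{F}^n)$ denotes the polynomials in $n$ variables over $\mathbb{F}$ of total degree at most $d$. For an ideal $I$, $\sqrt{I}=\{f: f^m\in I\text{ for some }m\ge 1\}$. *)

theory Defs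
  imports
    "HOL-Algebra.Ideal"
    "HOL-Library.Multiset"
    "HOL-Computational_Algebra.Primes"
    "HOL-Number_Theory.Residues"
begin

section \<open>Polynomials in finitely many variables\<close>

text \<open>
  As in HOL-Algebra, a monomial is the multiset of its variables
  and a polynomial is the function sending a monomial to its coefficient. The variables of
  \<open>mpoly_ring R n\<close> are \<open>0, \<dots>, n - 1\<close>.
\<close>

definition mpoly_carrier :: "('a, 'b) ring_scheme \<Rightarrow> nat \<Rightarrow> (nat multiset \<Rightarrow> 'a) set" where
  "mpoly_carrier R n =
     {f. (\<forall>m. f m \<in> carrier R) \<and> finite {m. f m \<noteq> \<zero>\<^bsub>R\<^esub>} \<and>
         (\<forall>m. f m \<noteq> \<zero>\<^bsub>R\<^esub> \<longrightarrow> set_mset m \<subseteq> {..<n})}"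

definition mpoly_ring :: "('a, 'b) ring_scheme \<Rightarrow> nat \<Rightarrow> (nat multiset \<Rightarrow> 'a) ring" where
  "mpoly_ring R n =
     \<lparr>carrier = mpoly_carrier R n,
      monoid.mult = (\<lambda>f g m. \<Oplus>\<^bsub>R\<^esub>a\<in>{a. a \<subseteq># m}. f a \<otimes>\<^bsub>R\<^esub> g (m - a)),
      one = (\<lambda>m. if m = {#} then \<one>\<^bsub>R\<^esub> else \<zero>\<^bsub>R\<^esub>),
      zero = (\<lambda>m. \<zero>\<^bsub>R\<^esub>),
      add = (\<lambda>f g m. f m \<oplus>\<^bsub>R\<^esub> g m)\<rparr>"

text \<open>
  The operations above do form a commutative ring. In particular \<open>Idl\<close> in \<open>mpoly_ring R n\<close> is an
  intersection of a nonempty family of ideals.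
\<close>

lemma finite_submultisets: "finite {a. a \<subseteq># (m::'a multiset)}"
proof (induction m)
  case (add x m)
  have "{a. a \<subseteq># add_mset x m} \<subseteq> {a. a \<subseteq># m} \<union> add_mset x ` {a. a \<subseteq># m}"
  proof
    fix a assume a: "a \<in> {a. a \<subseteq># add_mset x m}"
    show "a \<in> {a. a \<subseteq># m} \<union> add_mset x ` {a. a \<subseteq># m}"
    proof (cases "x \<in># a")
      case True
      then obtain b where "a = add_mset x b" by (metis multi_member_split)
      with a show ?thesis by auto
    next
      case False
      then show ?thesis using a
        by (metis UnI1 diff_single_trivial mem_Collect_eq subset_eq_diff_conv add_mset_add_single)
    qed
  qed
  then show ?case using add finite_subset by blast
qed auto

lemma (in abelian_monoid) finsum_Sigma:
  assumes "finite A" "\<And>x. x \<in> A \<Longrightarrow> finite (B x)"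
    "\<And>x y. x \<in> A \<Longrightarrow> y \<in> B x \<Longrightarrow> f x y \<in> carrier G"
  shows "(\<Oplus>x\<in>A. \<Oplus>y\<in>B x. f x y) = (\<Oplus>z\<in>Sigma A B. f (fst z) (snd z))"
proof -
  have "(\<Oplus>z\<in>Sigma A B. f (fst z) (snd z)) = (\<Oplus>z\<in>(\<Union>x\<in>A. Pair x ` B x). f (fst z) (snd z))"
    by (rule arg_cong[where f = "finsum G _"]) auto
  also have "\<dots> = (\<Oplus>x\<in>A. \<Oplus>z\<in>Pair x ` B x. f (fst z) (snd z))"
    by (rule add.finprod_UN_disjoint) (use assms in \<open>auto simp: pairwise_def disjnt_def\<close>)
  also have "\<dots> = (\<Oplus>x\<in>A. \<Oplus>y\<in>B x. f x y)"
  proof (rule finsum_cong')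
    fix x assume x: "x \<in> A"
    show "(\<Oplus>z\<in>Pair x ` B x. f (fst z) (snd z)) = (\<Oplus>y\<in>B x. f x y)"
      by (subst finsum_reindex) (use assms x in \<open>auto simp: inj_on_def\<close>)
  qed (use assms in \<open>auto intro!: finsum_closed\<close>)
  finally show ?thesis ..
qed

lemma (in cring) mpoly_ring_cring: "cring (mpoly_ring R n)"
proof -
  let ?S = "mpoly_ring R n"
  have cl: "f m \<in> carrier R" if "f \<in> carrier ?S" for f m
    using that by (auto simp: mpoly_ring_def mpoly_carrier_def)
  have mult: "f \<otimes>\<^bsub>?S\<^esub> g = (\<lambda>m. \<Oplus>a\<in>{a. a \<subseteq># m}. f a \<otimes> g (m - a))" for f g
    by (simp add: mpoly_ring_def)
  have add: "f \<oplus>\<^bsub>?S\<^esub> g = (\<lambda>m. f m \<oplus> g m)" for f g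
    by (simp add: mpoly_ring_def)
  have zero: "\<zero>\<^bsub>?S\<^esub> = (\<lambda>m. \<zero>)" and one: "\<one>\<^bsub>?S\<^esub> = (\<lambda>m. if m = {#} then \<one> else \<zero>)"
    by (simp_all add: mpoly_ring_def)
  have carI: "f \<in> carrier ?S"
    if "\<And>m. f m \<in> carrier R" "finite {m. f m \<noteq> \<zero>}" "\<And>m. f m \<noteq> \<zero> \<Longrightarrow> set_mset m \<subseteq> {..<n}" for f
    using that by (auto simp: mpoly_ring_def mpoly_carrier_def)
  have fin: "finite {m. f m \<noteq> \<zero>}" and vars: "\<And>m. f m \<noteq> \<zero> \<Longrightarrow> set_mset m \<subseteq> {..<n}"
    if "f \<in> carrier ?S" for f
    using that by (auto simp: mpoly_ring_def mpoly_carrier_def)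
  have mult_nz: "\<exists>a b. m = a + b \<and> f a \<noteq> \<zero> \<and> g b \<noteq> \<zero>"
    if "f \<in> carrier ?S" "g \<in> carrier ?S" "(f \<otimes>\<^bsub>?S\<^esub> g) m \<noteq> \<zero>" for f g m
  proof (rule ccontr)
    assume neg: "\<not> ?thesis"
    have "(\<Oplus>a\<in>{a. a \<subseteq># m}. f a \<otimes> g (m - a)) = \<zero>"
    proof (rule add.finprod_one_eqI)
      fix a assume "a \<in> {a. a \<subseteq># m}"
      then have "m = a + (m - a)" by simp
      then have "f a = \<zero> \<or> g (m - a) = \<zero>" using neg by metis
      then show "f a \<otimes> g (m - a) = \<zero>" using cl that by auto
    qed
    with that(3) show False by (simp add: mult)
  qed
  have mult_cl: "f \<otimes>\<^bsub>?S\<^esub> g \<in> carrier ?S" if fg: "f \<in> carrier ?S" "g \<in> carrier ?S" for f g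
  proof (rule carI)
    show "(f \<otimes>\<^bsub>?S\<^esub> g) m \<in> carrier R" for m
      using cl fg by (auto simp: mult intro!: finsum_closed)
    have "{m. (f \<otimes>\<^bsub>?S\<^esub> g) m \<noteq> \<zero>} \<subseteq> (\<lambda>(a, b). a + b) ` ({a. f a \<noteq> \<zero>} \<times> {b. g b \<noteq> \<zero>})"
      using mult_nz[OF fg] by force
    then show "finite {m. (f \<otimes>\<^bsub>?S\<^esub> g) m \<noteq> \<zero>}"
      by (rule finite_subset) (use fin fg in auto)
    show "set_mset m \<subseteq> {..<n}" if nz: "(f \<otimes>\<^bsub>?S\<^esub> g) m \<noteq> \<zero>" for m
      using mult_nz[OF fg nz] vars fg by fastforce
  qed
  have comm: "f \<otimes>\<^bsub>?S\<^esub> g = g \<otimes>\<^bsub>?S\<^esub> f" if fg: "f \<in> carrier ?S" "g \<in> carrier ?S" for f g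
  proof
    fix m :: "nat multiset"
    have im: "(\<lambda>a. m - a) ` {a. a \<subseteq># m} = {a. a \<subseteq># m}"
    proof (intro equalityI subsetI)
      fix a assume a: "a \<in> {a. a \<subseteq># m}"
      then obtain b where "m = a + b" by (metis mem_Collect_eq subset_mset.le_iff_add)
      then have "a = m - b" "b \<in> {a. a \<subseteq># m}" by auto
      then show "a \<in> (\<lambda>a. m - a) ` {a. a \<subseteq># m}" by blast
    qed auto
    have inj: "inj_on (\<lambda>a. m - a) {a. a \<subseteq># m}"
    proof (rule inj_onI)
      fix a b assume ab: "a \<in> {a. a \<subseteq># m}" "b \<in> {a. a \<subseteq># m}" "m - a = m - b"
      then have "(m - a) + a = (m - a) + b" by (metis mem_Collect_eq subset_mset.diff_add)
      then show "a = b" by simp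
    qed
    have "(\<Oplus>a\<in>{a. a \<subseteq># m}. g a \<otimes> f (m - a))
        = (\<Oplus>a\<in>(\<lambda>a. m - a) ` {a. a \<subseteq># m}. g a \<otimes> f (m - a))"
      by (simp add: im)
    also have "\<dots> = (\<Oplus>a\<in>{a. a \<subseteq># m}. g (m - a) \<otimes> f (m - (m - a)))"
      by (rule finsum_reindex) (use cl fg inj in auto)
    also have "\<dots> = (\<Oplus>a\<in>{a. a \<subseteq># m}. f a \<otimes> g (m - a))"
      by (rule finsum_cong')
         (use cl fg in \<open>auto simp: m_comm subset_mset.le_iff_add\<close>)
    finally show "(f \<otimes>\<^bsub>?S\<^esub> g) m = (g \<otimes>\<^bsub>?S\<^esub> f) m" by (simp add: mult)
  qed
  have assoc: "(f \<otimes>\<^bsub>?S\<^esub> g) \<otimes>\<^bsub>?S\<^esub> h = f \<otimes>\<^bsub>?S\<^esub> (g \<otimes>\<^bsub>?S\<^esub> h)"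
    if fgh: "f \<in> carrier ?S" "g \<in> carrier ?S" "h \<in> carrier ?S" for f g h
  proof
    fix m :: "nat multiset"
    let ?A = "Sigma {s. s \<subseteq># m} (\<lambda>s. {a. a \<subseteq># s})" and ?B = "Sigma {a. a \<subseteq># m} (\<lambda>a. {b. b \<subseteq># m - a})"
    let ?t = "\<lambda>a b. f a \<otimes> (g b \<otimes> h (m - a - b))"
    have im: "(\<lambda>z. (snd z, fst z - snd z)) ` ?A = ?B"
    proof (intro equalityI subsetI)
      fix z assume "z \<in> (\<lambda>z. (snd z, fst z - snd z)) ` ?A"
      then obtain s a where "z = (a, s - a)" "s \<subseteq># m" "a \<subseteq># s" by auto
      then show "z \<in> ?B"
        by (auto simp: subset_mset.le_iff_add ac_simps)
    next
      fix z assume z: "z \<in> ?B"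
      obtain a b where ab: "z = (a, b)" by fastforce
      have "(a + b, a) \<in> ?A" using z ab
        by (auto simp: subset_mset.le_iff_add)
      then show "z \<in> (\<lambda>z. (snd z, fst z - snd z)) ` ?A" using ab by force
    qed
    have inj: "inj_on (\<lambda>z. (snd z, fst z - snd z)) ?A"
      by (rule inj_onI) (auto simp: subset_mset.le_iff_add)
    have "((f \<otimes>\<^bsub>?S\<^esub> g) \<otimes>\<^bsub>?S\<^esub> h) m
        = (\<Oplus>s\<in>{s. s \<subseteq># m}. \<Oplus>a\<in>{a. a \<subseteq># s}. ?t a (s - a))"
      unfolding mult
    proof (rule finsum_cong')
      fix s assume s: "s \<in> {s. s \<subseteq># m}"
      have "(\<Oplus>a\<in>{a. a \<subseteq># s}. f a \<otimes> g (s - a)) \<otimes> h (m - s)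
          = (\<Oplus>a\<in>{a. a \<subseteq># s}. f a \<otimes> g (s - a) \<otimes> h (m - s))"
        by (rule finsum_ldistr) (use cl fgh in \<open>auto simp: finite_submultisets\<close>)
      also have "\<dots> = (\<Oplus>a\<in>{a. a \<subseteq># s}. ?t a (s - a))"
      proof (rule finsum_cong')
        fix a assume a: "a \<in> {a. a \<subseteq># s}"
        then have "m - a - (s - a) = m - s"
          by (metis diff_diff_add_mset mem_Collect_eq subset_mset.add_diff_inverse)
        then show "f a \<otimes> g (s - a) \<otimes> h (m - s) = ?t a (s - a)"
          using cl fgh m_assoc by simp
      qed (use cl fgh in auto)
      finally show "(\<Oplus>a\<in>{a. a \<subseteq># s}. f a \<otimes> g (s - a)) \<otimes> h (m - s) = \<dots>" .
    qed (use cl fgh in \<open>auto intro!: finsum_closed\<close>)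
    also have "\<dots> = (\<Oplus>z\<in>?A. ?t (snd z) (fst z - snd z))"
      by (rule finsum_Sigma) (use cl fgh in \<open>auto simp: finite_submultisets\<close>)
    also have "\<dots> = (\<Oplus>z\<in>(\<lambda>z. (snd z, fst z - snd z)) ` ?A. ?t (fst z) (snd z))"
      by (subst finsum_reindex) (use cl fgh inj in auto)
    also have "\<dots> = (\<Oplus>z\<in>?B. ?t (fst z) (snd z))"
      by (simp only: im)
    also have "\<dots> = (\<Oplus>a\<in>{a. a \<subseteq># m}. \<Oplus>b\<in>{b. b \<subseteq># m - a}. ?t a b)"
      by (rule finsum_Sigma[symmetric]) (use cl fgh in \<open>auto simp: finite_submultisets\<close>)
    also have "\<dots> = (f \<otimes>\<^bsub>?S\<^esub> (g \<otimes>\<^bsub>?S\<^esub> h)) m"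
      unfolding mult
      by (rule finsum_cong')
         (use cl fgh in \<open>auto simp: finite_submultisets finsum_rdistr intro!: finsum_closed\<close>)
    finally show "((f \<otimes>\<^bsub>?S\<^esub> g) \<otimes>\<^bsub>?S\<^esub> h) m = (f \<otimes>\<^bsub>?S\<^esub> (g \<otimes>\<^bsub>?S\<^esub> h)) m" .
  qed
  have add_cl: "f \<oplus>\<^bsub>?S\<^esub> g \<in> carrier ?S" if "f \<in> carrier ?S" "g \<in> carrier ?S" for f g
  proof (rule carI)
    have "{m. (f \<oplus>\<^bsub>?S\<^esub> g) m \<noteq> \<zero>} \<subseteq> {m. f m \<noteq> \<zero>} \<union> {m. g m \<noteq> \<zero>}"
      by (auto simp: add)
    then show "finite {m. (f \<oplus>\<^bsub>?S\<^esub> g) m \<noteq> \<zero>}"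
      by (rule finite_subset) (use fin that in auto)
    show "set_mset m \<subseteq> {..<n}" if nz: "(f \<oplus>\<^bsub>?S\<^esub> g) m \<noteq> \<zero>" for m
    proof -
      have "f m \<noteq> \<zero> \<or> g m \<noteq> \<zero>" using nz by (auto simp: add)
      then show ?thesis using vars \<open>f \<in> carrier ?S\<close> \<open>g \<in> carrier ?S\<close> by blast
    qed
  qed (use that cl in \<open>auto simp: add\<close>)
  have grp: "abelian_group ?S"
  proof (rule abelian_groupI)
    show "\<zero>\<^bsub>?S\<^esub> \<in> carrier ?S" by (rule carI) (auto simp: zero)
    fix f assume f: "f \<in> carrier ?S"
    have "(\<lambda>m. \<ominus> f m) \<in> carrier ?S"
    proof (rule carI)
      have "{m. \<ominus> f m \<noteq> \<zero>} \<subseteq> {m. f m \<noteq> \<zero>}" by auto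
      then show "finite {m. \<ominus> f m \<noteq> \<zero>}" by (rule finite_subset) (use fin f in auto)
      show "set_mset m \<subseteq> {..<n}" if "\<ominus> f m \<noteq> \<zero>" for m
        using that vars[OF f] by (metis minus_zero)
    qed (use f cl in auto)
    moreover have "(\<lambda>m. \<ominus> f m) \<oplus>\<^bsub>?S\<^esub> f = \<zero>\<^bsub>?S\<^esub>" using f cl by (auto simp: add zero l_neg)
    ultimately show "\<exists>g\<in>carrier ?S. g \<oplus>\<^bsub>?S\<^esub> f = \<zero>\<^bsub>?S\<^esub>" by blast
  qed (use cl add_cl in \<open>auto simp: add zero a_ac\<close>)
  have one_cl: "\<one>\<^bsub>?S\<^esub> \<in> carrier ?S"
    by (rule carI) (auto simp: one split: if_splits)
  have one_l: "\<one>\<^bsub>?S\<^esub> \<otimes>\<^bsub>?S\<^esub> f = f" if f: "f \<in> carrier ?S" for f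
  proof
    fix m :: "nat multiset"
    have "(\<one>\<^bsub>?S\<^esub> \<otimes>\<^bsub>?S\<^esub> f) m = (\<Oplus>a\<in>{a. a \<subseteq># m}. if {#} = a then f m else \<zero>)"
      unfolding mult by (rule finsum_cong') (use cl f in \<open>auto simp: one\<close>)
    also have "\<dots> = f m"
      by (rule finsum_singleton[of "{#}" _ "\<lambda>_. f m"]) (use cl f in \<open>auto simp: finite_submultisets\<close>)
    finally show "(\<one>\<^bsub>?S\<^esub> \<otimes>\<^bsub>?S\<^esub> f) m = f m" .
  qed
  show ?thesis
  proof (rule cringI[OF grp])
    show "comm_monoid ?S"
      by (rule comm_monoidI) (use mult_cl one_cl assoc one_l comm in auto)
    fix f g h assume fgh: "f \<in> carrier ?S" "g \<in> carrier ?S" "h \<in> carrier ?S"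
    show "(f \<oplus>\<^bsub>?S\<^esub> g) \<otimes>\<^bsub>?S\<^esub> h = f \<otimes>\<^bsub>?S\<^esub> h \<oplus>\<^bsub>?S\<^esub> g \<otimes>\<^bsub>?S\<^esub> h"
    proof
      fix m
      have "((f \<oplus>\<^bsub>?S\<^esub> g) \<otimes>\<^bsub>?S\<^esub> h) m
          = (\<Oplus>a\<in>{a. a \<subseteq># m}. f a \<otimes> h (m - a) \<oplus> g a \<otimes> h (m - a))"
        unfolding mult add by (rule finsum_cong') (use cl fgh in \<open>auto simp: l_distr\<close>)
      also have "\<dots> = (f \<otimes>\<^bsub>?S\<^esub> h \<oplus>\<^bsub>?S\<^esub> g \<otimes>\<^bsub>?S\<^esub> h) m"
        unfolding mult add by (rule finsum_addf) (use cl fgh in auto)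
      finally show "((f \<oplus>\<^bsub>?S\<^esub> g) \<otimes>\<^bsub>?S\<^esub> h) m = (f \<otimes>\<^bsub>?S\<^esub> h \<oplus>\<^bsub>?S\<^esub> g \<otimes>\<^bsub>?S\<^esub> h) m" .
    qed
  qed
qed

definition mpoly_deg_le :: "('a, 'b) ring_scheme \<Rightarrow> nat \<Rightarrow> nat \<Rightarrow> (nat multiset \<Rightarrow> 'a) set" where
  "mpoly_deg_le R n d = {f \<in> carrier (mpoly_ring R n). \<forall>m. f m \<noteq> \<zero>\<^bsub>R\<^esub> \<longrightarrow> size m \<le> d}"

definition radical :: "('a, 'b) ring_scheme \<Rightarrow> 'a set \<Rightarrow> 'a set" where
  "radical R I = {f \<in> carrier R. \<exists>m\<ge>1::nat. f [^]\<^bsub>R\<^esub> m \<in> I}"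


section \<open>Algorithms over a field\<close>

text \<open>
  A uniform algebraic random access machine. A state consists of a memory of natural numbers
  (for addresses, counters and flags) and a memory of field elements. Field elements are
  accessible only through the field operations and equality tests. Arithmetic on natural numbers
  is limited to addition and truncated subtraction, so that they cannot be used as a source of
  unbounded parallelism.
\<close>

datatype iexp =
    Const nat
  | Cell iexp   \<comment> \<open>content of the natural-number memory at the address given by the argument\<close>
  | Plus iexp iexp
  | Minus iexp iexp

fun ival :: "(nat \<Rightarrow> nat) \<Rightarrow> iexp \<Rightarrow> nat" where
  "ival N (Const k) = k"
| "ival N (Cell e) = N (ival N e)"
| "ival N (Plus e1 e2) = ival N e1 + ival N e2"
| "ival N (Minus e1 e2) = ival N e1 - ival N e2"

datatype fop = FAdd | FSub | FMul | FDiv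

fun fop_defined :: "('a, 'b) ring_scheme \<Rightarrow> fop \<Rightarrow> 'a \<Rightarrow> bool" where
  "fop_defined R FDiv y \<longleftrightarrow> y \<noteq> \<zero>\<^bsub>R\<^esub>"
| "fop_defined R _ y \<longleftrightarrow> True"

fun fop_val :: "('a, 'b) ring_scheme \<Rightarrow> fop \<Rightarrow> 'a \<Rightarrow> 'a \<Rightarrow> 'a" where
  "fop_val R FAdd x y = x \<oplus>\<^bsub>R\<^esub> y"
| "fop_val R FSub x y = x \<ominus>\<^bsub>R\<^esub> y"
| "fop_val R FMul x y = x \<otimes>\<^bsub>R\<^esub> y"
| "fop_val R FDiv x y = x \<otimes>\<^bsub>R\<^esub> inv\<^bsub>R\<^esub> y"

datatype test =
    Less iexp iexp
  | EqF iexp iexp   \<comment> \<open>equality of the field elements at the two addresses\<close>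
  | Neg test

fun holds :: "(nat \<Rightarrow> nat) \<times> (nat \<Rightarrow> 'a) \<Rightarrow> test \<Rightarrow> bool" where
  "holds (N, F) (Less e1 e2) \<longleftrightarrow> ival N e1 < ival N e2"
| "holds (N, F) (EqF e1 e2) \<longleftrightarrow> F (ival N e1) = F (ival N e2)"
| "holds s (Neg b) \<longleftrightarrow> \<not> holds s b"

text \<open>The first argument of each assignment is the target address.\<close>

datatype prog =
    Skip
  | SetI iexp iexp
  | SetZero iexp
  | SetOne iexp
  | SetF iexp fop iexp iexp   \<comment> \<open>the operands are given by their addresses\<close>
  | Seq prog prog
  | Cond test prog prog
  | While test prog

text \<open>
  \<open>exec R P s t s'\<close>: started in state \<open>s\<close>, the program \<open>P\<close> over the field \<open>R\<close> halts in state \<open>s'\<close>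
  after \<open>t\<close> steps. Every field operation, every evaluation of a test and every assignment counts
  as a step; hence \<open>t\<close> bounds the number of field operations as well as all the bookkeeping. There
  is no transition for a division by zero, so a program attempting one does not halt.
\<close>

inductive exec ::
  "('a, 'b) ring_scheme \<Rightarrow> prog \<Rightarrow> (nat \<Rightarrow> nat) \<times> (nat \<Rightarrow> 'a) \<Rightarrow> nat \<Rightarrow>
   (nat \<Rightarrow> nat) \<times> (nat \<Rightarrow> 'a) \<Rightarrow> bool" for R where
  Skip: "exec R Skip s 1 s"
| SetI: "exec R (SetI e1 e2) (N, F) 1 (N(ival N e1 := ival N e2), F)"
| SetZero: "exec R (SetZero e) (N, F) 1 (N, F(ival N e := \<zero>\<^bsub>R\<^esub>))"
| SetOne: "exec R (SetOne e) (N, F) 1 (N, F(ival N e := \<one>\<^bsub>R\<^esub>))"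
| SetF: "fop_defined R op (F (ival N e2)) \<Longrightarrow>
    exec R (SetF e0 op e1 e2) (N, F) 1
      (N, F(ival N e0 := fop_val R op (F (ival N e1)) (F (ival N e2))))"
| Seq: "exec R P1 s t1 s1 \<Longrightarrow> exec R P2 s1 t2 s2 \<Longrightarrow> exec R (Seq P1 P2) s (t1 + t2) s2"
| IfTrue: "holds s b \<Longrightarrow> exec R P1 s t s1 \<Longrightarrow> exec R (Cond b P1 P2) s (t + 1) s1"
| IfFalse: "\<not> holds s b \<Longrightarrow> exec R P2 s t s1 \<Longrightarrow> exec R (Cond b P1 P2) s (t + 1) s1"
| WhileFalse: "\<not> holds s b \<Longrightarrow> exec R (While b P) s 1 s"
| WhileTrue: "holds s b \<Longrightarrow> exec R P s t1 s1 \<Longrightarrow> exec R (While b P) s1 t2 s2 \<Longrightarrow>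
    exec R (While b P) s (t1 + t2 + 1) s2"

lemma exec_deterministic:
  assumes "exec R P s t s'" "exec R P s u s''"
  shows "t = u \<and> s' = s''"
  using assms
proof (induction arbitrary: u s'' rule: exec.induct)
  case (Seq P1 s t1 s1 P2 t2 s2)
  from Seq.prems show ?case
    by cases (use Seq.IH in blast)
next
  case (IfTrue s b P1 t s1 P2)
  from IfTrue.prems show ?case
    by cases (use IfTrue in blast)+
next
  case (IfFalse s b P2 t s1 P1)
  from IfFalse.prems show ?case
    by cases (use IfFalse in blast)+
next
  case (WhileFalse s b P)
  from WhileFalse.prems show ?case
    by cases (use WhileFalse in blast)+
next
  case (WhileTrue s b P t1 s1 t2 s2)
  from WhileTrue.prems show ?case
    by cases (use WhileTrue in blast)+
qed (auto elim: exec.cases)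


section \<open>Input encoding\<close>

text \<open>
  A monomial of degree at most \<open>d\<close> in \<open>n\<close> variables is written as a product of \<open>d\<close> factors, each
  of them a variable \<open>0, \<dots>, n - 1\<close> or the constant \<open>1\<close>, the latter being represented by \<open>n\<close>.
  The factors are read off as the \<open>d\<close> lowest digits of \<open>j\<close> in base \<open>n + 1\<close>; every such monomial
  occurs for some \<open>j < (n + 1) ^ d\<close>, in general for several.
\<close>

definition monomial_at :: "nat \<Rightarrow> nat \<Rightarrow> nat \<Rightarrow> nat multiset" where
  "monomial_at n d j =
     filter_mset (\<lambda>i. i < n) (mset (map (\<lambda>l. j div (n + 1) ^ l mod (n + 1)) [0..<d]))"

text \<open>
  The characteristic \<open>p\<close> and the number of variables are in the cells \<open>0\<close> and \<open>1\<close> of the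
  natural-number memory. The field memory starts with the coefficient tables of
  \<open>P 0, \<dots>, P (c - 1), Q\<close>, each of length \<open>(n + 1) ^ d\<close>.
\<close>

definition input ::
  "('a, 'b) ring_scheme \<Rightarrow> nat \<Rightarrow> nat \<Rightarrow> nat \<Rightarrow> nat \<Rightarrow> (nat \<Rightarrow> nat multiset \<Rightarrow> 'a) \<Rightarrow>
   (nat multiset \<Rightarrow> 'a) \<Rightarrow> (nat \<Rightarrow> nat) \<times> (nat \<Rightarrow> 'a)" where
  "input R c d p n P Q =
     ((\<lambda>i. if i = 0 then p else if i = 1 then n else 0),
      (\<lambda>j. let k = j div (n + 1) ^ d; m = monomial_at n d (j mod (n + 1) ^ d) in
           if k < c then P k m else if k = c then Q m else \<zero>\<^bsub>R\<^esub>))"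

end

theory Submission
  imports Defs "HOL-Library.Poly_Mapping" "HOL-Library.Multiset_Order"
    "Jordan_Normal_Form.Char_Poly" "Berlekamp_Zassenhaus.Unique_Factorization_Poly"
    "Berlekamp_Zassenhaus.Finite_Field"
begin


text \<open>By Rabinowitsch's trick, \<open>Q\<close> lies in the radical iff
  \<open>1 = sum g_j P_j + g (1 - y Q)\<close> is solvable in polynomials with one further variable
  \<open>y\<close>. The crux is that solvability implies solvability with cofactors whose degree is
  bounded in terms of \<open>c\<close> and \<open>d\<close> alone, independently of \<open>n\<close>
  (\<open>radical_membership_bounded\<close>). The unknown coefficients then form a linear system of
  size polynomial in \<open>n\<close>, which Gaussian elimination decides.

  The degree bound: let \<open>f_0, ..., f_(c-1)\<close> of degree at most \<open>d\<close> generate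
  the unit ideal over an infinite field \<open>K\<close>. With a new variable \<open>z\<close>, let
  theta (\<open>gen_map\<close>) map \<open>K[t]\<close> to \<open>K[x][z]\<close>, sending
  \<open>t_i\<close> to \<open>f_i z\<close> for \<open>i < c\<close> and the other
  \<open>t\<close>'s to the \<open>x\<close>'s. It is onto, because
  \<open>z = sum g_i f_i z\<close>. As in Noether normalization, while theta has a nontrivial
  kernel, a generic linear change allows one generator to be dropped such that
  \<open>K[x][z]\<close> stays a finite module over the image (\<open>gen_map_eliminate\<close>).
  After \<open>m\<close> rounds the generators are \<open>f_i z + l_i\<close> and
  \<open>x_(m+j) + l_(c+j)\<close>, where the \<open>l\<close>'s are linear forms in
  \<open>x_0, ..., x_(m-1)\<close>. Counting dimensions forces \<open>m < c\<close>
  (\<open>gen_map_module_finite_less\<close>), so the process stops, with theta injective and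
  finite, after a number of rounds independent of \<open>n\<close>.

  Now \<open>z\<close> satisfies a monic equation over \<open>K[t]\<close>
  (\<open>monic_relation_of_module_finite\<close>), and by Gauss's lemma there is a monic one,
  \<open>R\<close>, that divides all others (\<open>monic_minimal_relation\<close>). The coefficient
  of \<open>z^(deg R)\<close> in \<open>R(z) = 0\<close> expresses \<open>1\<close> through the
  \<open>f_i\<close>, since every positive power of \<open>z\<close> in an image under theta carries
  some \<open>f_i\<close> (\<open>unit_ideal_of_monic_relation\<close>). The degrees of these
  cofactors are controlled by the degree of \<open>R\<close> in the \<open>t\<close>'s, which is at
  most that of any nonzero relation \<open>G\<close> (\<open>mdeg_le_coeff_dvd\<close>). A small
  \<open>G\<close> comes from counting (\<open>bounded_relation\<close>): products of powers of the
  first \<open>c\<close> generators and of \<open>z\<close> have \<open>c + 1\<close> free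
  exponents, whereas over the ring of the remaining generators they are combinations of monomials in
  only \<open>m + 1 <= c\<close> variables. Hence a linear dependence appears at a size depending on
  \<open>c\<close> and \<open>d\<close> only. For finite \<open>K\<close> one passes to
  \<open>K(X)\<close> and projects the cofactors back
  (\<open>weak_nullstellensatz_bounded_field\<close>).

  The program enumerates monomials by nested counters, since the machine cannot multiply naturals,
  writes the matrix and eliminates. Correctness and running time are proved together in a timed
  Hoare calculus (\<open>tri\<close>). The algebra is done over field types and reaches the residue
  rings through the locale \<open>prime_field_type\<close>.\<close>

hide_const (open) UnivPoly.monom Module.smult Module.module.smult module.smult
hide_const (open) Divisibility.irreducible up_ring.coeff up_ring.monom

section \<open>Multivariate polynomials: evaluation, degree bounds, occurring variables\<close>

type_synonym 'k mpoly = "nat multiset \<Rightarrow>\<^sub>0 'k"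

abbreviation mcoeff :: "'k::zero mpoly \<Rightarrow> nat multiset \<Rightarrow> 'k" where
  "mcoeff \<equiv> Poly_Mapping.lookup"

abbreviation msupp :: "'k::zero mpoly \<Rightarrow> nat multiset set" where
  "msupp \<equiv> Poly_Mapping.keys"

abbreviation mterm :: "nat multiset \<Rightarrow> 'k::zero \<Rightarrow> 'k mpoly" where
  "mterm \<equiv> Poly_Mapping.single"

definition Cst :: "'k::zero \<Rightarrow> 'k mpoly" where
  "Cst a = mterm {#} a"

definition Var :: "nat \<Rightarrow> 'k::zero_neq_one mpoly" where
  "Var i = mterm {#i#} 1"

lemma mterm_sum: "A = (\<Sum>m\<in>msupp A. mterm m (mcoeff A m))"
proof (rule poly_mapping_eqI)
  fix k
  have "mcoeff (\<Sum>m\<in>msupp A. mterm m (mcoeff A m)) k = (\<Sum>m\<in>msupp A. if m = k then mcoeff A m else 0)"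
    by (auto simp: lookup_sum lookup_single when_def intro!: sum.cong)
  also have "\<dots> = mcoeff A k" by (auto simp: in_keys_iff)
  finally show "mcoeff A k = mcoeff (\<Sum>m\<in>msupp A. mterm m (mcoeff A m)) k" by simp
qed

lemma mterm_conv: "mterm m a = Cst a * (\<Prod>i\<in>#m. Var i)" for a :: "'k::comm_ring_1"
proof -
  have "(\<Prod>i\<in>#m. Var i) = (mterm m 1 :: 'k mpoly)"
    by (induction m) (auto simp: Var_def mult_single)
  then show ?thesis by (simp add: Cst_def mult_single)
qed

lemma Cst_hom: "comm_ring_hom (Cst :: 'k::comm_ring_1 \<Rightarrow> _)"
proof unfold_locales
  show "Cst (x + y) = Cst x + Cst y" "Cst (x * y) = Cst x * Cst y" for x y :: 'k
    by (simp_all add: Cst_def single_add mult_single)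
  show "Cst (0::'k) = 0" "Cst (1::'k) = 1" by (simp_all add: Cst_def)
qed

interpretation Cst: comm_ring_hom "Cst :: 'k::comm_ring_1 \<Rightarrow> _" by (rule Cst_hom)

lemma mpoly_induct [case_names Cst Var add mult]:
  fixes A :: "'k::comm_ring_1 mpoly"
  assumes "\<And>a. P (Cst a)" "\<And>i. P (Var i)" "\<And>A B. P A \<Longrightarrow> P B \<Longrightarrow> P (A + B)"
    "\<And>A B. P A \<Longrightarrow> P B \<Longrightarrow> P (A * B)"
  shows "P A"
proof -
  have 1: "P 1" "P 0" using assms(1)[of 1] assms(1)[of 0] by simp_all
  have "P (\<Prod>i\<in>#m. Var i)" for m by (induction m) (auto intro: assms 1)
  then have t: "P (mterm m a)" for m a by (simp add: mterm_conv assms)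
  have "P (\<Sum>m\<in>S. mterm m (mcoeff A m))" if "finite S" for S
    using that by (induction S rule: finite_induct) (auto intro: assms 1 t)
  then show ?thesis by (subst mterm_sum) simp
qed

text \<open>The general substitution: coefficients go through \<open>h\<close>, variable
  \<open>i\<close> goes to \<open>b i\<close>. The ring maps \<open>split_var\<close>,
  \<open>shift_grade\<close>, \<open>gen_map\<close> and \<open>restrict_vars\<close> below are all
  instances, and \<open>mev_hom\<close> makes each a homomorphism.\<close>

definition mev :: "('k::zero \<Rightarrow> 'r) \<Rightarrow> (nat \<Rightarrow> 'r) \<Rightarrow> 'k mpoly \<Rightarrow> 'r::comm_ring_1" where
  "mev h b A = (\<Sum>m\<in>msupp A. h (mcoeff A m) * (\<Prod>i\<in>#m. b i))"

lemma mev_superset: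
  assumes "finite S" "msupp A \<subseteq> S" "h 0 = 0"
  shows "mev h b A = (\<Sum>m\<in>S. h (mcoeff A m) * (\<Prod>i\<in>#m. b i))"
  unfolding mev_def by (rule sum.mono_neutral_left) (use assms in \<open>auto simp: in_keys_iff\<close>)

lemma mev_mterm: "h 0 = 0 \<Longrightarrow> mev h b (mterm m a) = h a * (\<Prod>i\<in>#m. b i)"
  by (subst mev_superset[of "{m}"]) auto

lemma mev_hom:
  assumes "comm_ring_hom (h :: 'k::comm_ring_1 \<Rightarrow> 'r::comm_ring_1)"
  shows "comm_ring_hom (mev h b)"
proof -
  interpret h: comm_ring_hom h by fact
  have add: "mev h b (A + B) = mev h b A + mev h b B" for A B
  proof -
    let ?S = "msupp A \<union> msupp B"
    have "mev h b (A + B) = (\<Sum>m\<in>?S. h (mcoeff (A + B) m) * (\<Prod>i\<in>#m. b i))"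
      by (rule mev_superset) (use keys_add[of A B] in auto)
    also have "\<dots> = (\<Sum>m\<in>?S. h (mcoeff A m) * (\<Prod>i\<in>#m. b i)) + (\<Sum>m\<in>?S. h (mcoeff B m) * (\<Prod>i\<in>#m. b i))"
      by (simp add: lookup_add h.hom_add distrib_right sum.distrib)
    also have "\<dots> = mev h b A + mev h b B"
      by (simp add: mev_superset[of ?S A h] mev_superset[of ?S B h])
    finally show ?thesis .
  qed
  have sum: "mev h b (sum f S) = (\<Sum>x\<in>S. mev h b (f x))" for f :: "nat multiset \<Rightarrow> _" and S
    by (induction S rule: infinite_finite_induct) (simp_all add: add, simp_all add: mev_def)
  show ?thesis
  proof unfold_locales
    show "mev h b (A + B) = mev h b A + mev h b B" for A B by (rule add)
    show "mev h b 0 = 0" by (simp add: mev_def)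
    show "mev h b 1 = 1" unfolding single_one[symmetric] by (subst mev_mterm) auto
    fix A B
    have t: "mev h b (mterm m x * mterm n y) = mev h b (mterm m x) * mev h b (mterm n y)" for m n x y
      by (simp add: mult_single mev_mterm h.hom_mult ac_simps)
    have "mev h b (A * B) = mev h b ((\<Sum>m\<in>msupp A. mterm m (mcoeff A m)) * (\<Sum>m\<in>msupp B. mterm m (mcoeff B m)))"
      by (simp flip: mterm_sum)
    also have "\<dots> = (\<Sum>m\<in>msupp A. mev h b (mterm m (mcoeff A m))) * (\<Sum>m\<in>msupp B. mev h b (mterm m (mcoeff B m)))"
      by (simp only: sum_product sum t)
    also have "\<dots> = mev h b A * mev h b B"
      by (simp only: mterm_sum[symmetric] sum[symmetric])
    finally show "mev h b (A * B) = mev h b A * mev h b B" .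
  qed
qed

lemma mev_Cst: "h 0 = 0 \<Longrightarrow> mev h b (Cst a) = h a"
  by (simp add: Cst_def mev_mterm)

lemma mev_Var: "h 0 = 0 \<Longrightarrow> h 1 = 1 \<Longrightarrow> mev h b (Var i) = b i"
  by (simp add: Var_def mev_mterm)

text \<open>The uniqueness half of the universal property; most identities between substitutions
  below reduce through it to their values on constants and variables.\<close>

lemma mpoly_hom_eqI:
  fixes A :: "'k::comm_ring_1 mpoly"
  assumes "comm_ring_hom F" "comm_ring_hom G" "\<And>a. F (Cst a) = G (Cst a)" "\<And>i. F (Var i) = G (Var i)"
  shows "F A = G A"
proof -
  interpret F: comm_ring_hom F by fact
  interpret G: comm_ring_hom G by fact
  show ?thesis by (induction A rule: mpoly_induct) (auto simp: assms F.hom_add G.hom_add F.hom_mult G.hom_mult)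
qed

lemma mcoeff_times:
  "mcoeff (A * B) k = (\<Sum>m\<in>msupp A. \<Sum>n\<in>msupp B. if m + n = k then mcoeff A m * mcoeff B n else 0)"
proof -
  have "mcoeff (A * B) k = mcoeff ((\<Sum>m\<in>msupp A. mterm m (mcoeff A m)) * (\<Sum>m\<in>msupp B. mterm m (mcoeff B m))) k"
    by (simp flip: mterm_sum)
  also have "\<dots> = (\<Sum>m\<in>msupp A. \<Sum>n\<in>msupp B. if m + n = k then mcoeff A m * mcoeff B n else 0)"
    by (auto simp: sum_product lookup_sum mult_single lookup_single when_def intro!: sum.cong)
  finally show ?thesis .
qed

lemma mcoeff_mterm_times: "mcoeff (mterm m a * A) k = (if m \<subseteq># k then a * mcoeff A (k - m) else 0)"
proof (cases "a = 0")
  case False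
  have "mcoeff (mterm m a * A) k = (\<Sum>n\<in>msupp A. if m + n = k then a * mcoeff A n else 0)"
    using False by (simp add: mcoeff_times cong: if_cong)
  also have "\<dots> = (if m \<subseteq># k then a * mcoeff A (k - m) else 0)"
  proof (cases "m \<subseteq># k")
    case True
    then have "m + n = k \<longleftrightarrow> n = k - m" for n by (metis add_diff_cancel_left' subset_mset.add_diff_inverse)
    then have "(\<Sum>n\<in>msupp A. if m + n = k then a * mcoeff A n else 0) = (\<Sum>n\<in>msupp A. if n = k - m then a * mcoeff A n else 0)"
      by simp
    also have "\<dots> = a * mcoeff A (k - m)" by (auto simp: in_keys_iff)
    finally show ?thesis using True by simp
  qed (auto intro!: sum.neutral)
  finally show ?thesis .
qed simp

lemma Cst_times_coeff: "mcoeff (Cst a * A) k = a * mcoeff A k"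
  by (simp add: Cst_def mcoeff_mterm_times)

lemma Cst_eq_0 [simp]: "Cst a = 0 \<longleftrightarrow> a = 0"
  by (metis Cst_def lookup_single_eq lookup_zero single_zero)

definition mdeg_le :: "nat \<Rightarrow> 'k::zero mpoly \<Rightarrow> bool" where
  "mdeg_le e A \<longleftrightarrow> (\<forall>m\<in>msupp A. size m \<le> e)"

definition mvars_in :: "nat set \<Rightarrow> 'k::zero mpoly \<Rightarrow> bool" where
  "mvars_in V A \<longleftrightarrow> (\<forall>m\<in>msupp A. set_mset m \<subseteq> V)"

lemma mdeg_le_mono: "mdeg_le e A \<Longrightarrow> e \<le> e' \<Longrightarrow> mdeg_le e' A"
  by (auto simp: mdeg_le_def)

lemma mdeg_le_0 [simp]: "mdeg_le e 0" and mdeg_le_1 [simp]: "mdeg_le e (1::'k::comm_ring_1 mpoly)"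
  by (auto simp: mdeg_le_def)

lemma mdeg_le_Cst [simp]: "mdeg_le e (Cst a)"
  by (auto simp: mdeg_le_def Cst_def split: if_splits)

lemma mdeg_le_Var: "1 \<le> e \<Longrightarrow> mdeg_le e (Var i)"
  by (auto simp: mdeg_le_def Var_def split: if_splits)

lemma mdeg_le_add: "mdeg_le e A \<Longrightarrow> mdeg_le e B \<Longrightarrow> mdeg_le e (A + B)"
  using keys_add[of A B] by (auto simp: mdeg_le_def)

lemma mdeg_le_uminus: "mdeg_le e A \<Longrightarrow> mdeg_le e (- A)" for A :: "'k::comm_ring_1 mpoly"
  by (auto simp: mdeg_le_def in_keys_iff)

lemma mdeg_le_diff: "mdeg_le e A \<Longrightarrow> mdeg_le e B \<Longrightarrow> mdeg_le e (A - B)" for A :: "'k::comm_ring_1 mpoly"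
  using mdeg_le_add[of e A "- B"] mdeg_le_uminus[of e B] by simp

lemma mdeg_le_mult: "mdeg_le e A \<Longrightarrow> mdeg_le e' B \<Longrightarrow> mdeg_le (e + e') (A * B)"
  using keys_mult[of A B] by (fastforce simp: mdeg_le_def intro: add_mono)

lemma mdeg_le_sum: "(\<And>x. x \<in> S \<Longrightarrow> mdeg_le e (f x)) \<Longrightarrow> mdeg_le e (sum f S)"
  by (induction S rule: infinite_finite_induct) (auto intro: mdeg_le_add)

lemma mdeg_le_power: "mdeg_le e A \<Longrightarrow> mdeg_le (n * e) (A ^ n)" for A :: "'k::comm_ring_1 mpoly"
  by (induction n) (auto intro: mdeg_le_mult)

lemma mdeg_le_prod_mset:
  "(\<And>i. i \<in># m \<Longrightarrow> mdeg_le e (f i)) \<Longrightarrow> mdeg_le (size m * e) (\<Prod>i\<in>#m. f i)" for f :: "_ \<Rightarrow> 'k::comm_ring_1 mpoly"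
  by (induction m) (auto intro: mdeg_le_mult)

lemma mvars_in_0 [simp]: "mvars_in V 0" and mvars_in_1 [simp]: "mvars_in V (1::'k::comm_ring_1 mpoly)"
  by (auto simp: mvars_in_def)

lemma mvars_in_Cst [simp]: "mvars_in V (Cst a)"
  by (auto simp: mvars_in_def Cst_def split: if_splits)

lemma mvars_in_Var: "i \<in> V \<Longrightarrow> mvars_in V (Var i)"
  by (auto simp: mvars_in_def Var_def split: if_splits)

lemma mvars_in_add: "mvars_in V A \<Longrightarrow> mvars_in V B \<Longrightarrow> mvars_in V (A + B)"
  using keys_add[of A B] by (auto simp: mvars_in_def)

lemma mvars_in_uminus: "mvars_in V A \<Longrightarrow> mvars_in V (- A)" for A :: "'k::comm_ring_1 mpoly"
  by (auto simp: mvars_in_def in_keys_iff)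

lemma mvars_in_mult: "mvars_in V A \<Longrightarrow> mvars_in V B \<Longrightarrow> mvars_in V (A * B)"
  using keys_mult[of A B] by (fastforce simp: mvars_in_def)

lemma mvars_in_sum: "(\<And>x. x \<in> S \<Longrightarrow> mvars_in V (f x)) \<Longrightarrow> mvars_in V (sum f S)"
  by (induction S rule: infinite_finite_induct) (auto intro: mvars_in_add)

lemma mvars_in_mono: "mvars_in V A \<Longrightarrow> V \<subseteq> W \<Longrightarrow> mvars_in W A"
  by (auto simp: mvars_in_def)

lemma mvars_in_finite: "\<exists>n. mvars_in {..<n} A"
proof -
  have "finite (\<Union>m\<in>msupp A. set_mset m)" by auto
  then obtain n where "(\<Union>m\<in>msupp A. set_mset m) \<subseteq> {..<n}" using finite_nat_iff_bounded by blast
  then show ?thesis unfolding mvars_in_def by blast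
qed

lemma mdeg_le_exists: "\<exists>e. mdeg_le e A"
proof -
  have "finite (size ` msupp A)" by auto
  then obtain n where "size ` msupp A \<subseteq> {..<n}" using finite_nat_iff_bounded by blast
  then show ?thesis unfolding mdeg_le_def by (intro exI[of _ n]) auto
qed

lemma mev_cong_vars:
  assumes "mvars_in V A" "\<And>i. i \<in> V \<Longrightarrow> b i = b' i"
  shows "mev h b A = mev h b' A"
  unfolding mev_def
proof (rule sum.cong[OF refl])
  fix m assume "m \<in> msupp A"
  then have "(\<Prod>i\<in>#m. b i) = (\<Prod>i\<in>#m. b' i)"
    using assms by (intro arg_cong[where f = prod_mset] image_mset_cong) (auto simp: mvars_in_def)
  then show "h (mcoeff A m) * (\<Prod>i\<in>#m. b i) = h (mcoeff A m) * (\<Prod>i\<in>#m. b' i)" by simp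
qed

lemma mev_Cst_Var: "mev Cst Var A = A" for A :: "'k::comm_ring_1 mpoly"
  unfolding mev_def by (subst (3) mterm_sum) (simp add: mterm_conv)

lemma mdeg_le_mev:
  fixes b :: "nat \<Rightarrow> 'k::comm_ring_1 mpoly"
  assumes "mdeg_le e A" "\<And>i. mdeg_le d (b i)"
  shows "mdeg_le (e * d) (mev Cst b A)"
  unfolding mev_def
proof (intro mdeg_le_sum)
  fix m assume "m \<in> msupp A"
  then have "size m * d \<le> e * d" using assms(1) by (intro mult_right_mono) (auto simp: mdeg_le_def)
  moreover have "mdeg_le (0 + size m * d) (Cst (mcoeff A m) * (\<Prod>i\<in>#m. b i))"
    by (intro mdeg_le_mult mdeg_le_Cst mdeg_le_prod_mset assms)
  ultimately show "mdeg_le (e * d) (Cst (mcoeff A m) * (\<Prod>i\<in>#m. b i))" using mdeg_le_mono by (simp only: add_0) blast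
qed

lemma mvars_in_mev:
  fixes b :: "nat \<Rightarrow> 'k::comm_ring_1 mpoly"
  assumes "mvars_in W A" "\<And>i. i \<in> W \<Longrightarrow> mvars_in V (b i)"
  shows "mvars_in V (mev Cst b A)"
  unfolding mev_def
proof (intro mvars_in_sum mvars_in_mult mvars_in_Cst)
  fix m assume "m \<in> msupp A"
  then have "set_mset m \<subseteq> W" using assms(1) by (auto simp: mvars_in_def)
  then show "mvars_in V (\<Prod>i\<in>#m. b i)"
    by (induction m) (auto intro: mvars_in_mult assms(2))
qed

section \<open>Divisibility of multivariate polynomials via leading monomials\<close>

text \<open>The multiset order is a well-order compatible with addition, that is, a monomial
  order.\<close>

definition lead_mon :: "'k::zero mpoly \<Rightarrow> nat multiset" where
  "lead_mon A = Max (msupp A)"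

lemma lead_mon_in: "A \<noteq> 0 \<Longrightarrow> lead_mon A \<in> msupp A"
  unfolding lead_mon_def by (rule Max_in) (auto simp: poly_mapping_eq_iff in_keys_iff fun_eq_iff set_eq_iff)

lemma lead_mon_ge: "m \<in> msupp A \<Longrightarrow> m \<le> lead_mon A"
  unfolding lead_mon_def by (rule Max_ge) auto

text \<open>By compatibility of the order with addition, only the pair of leading monomials can
  produce the largest sum, so its coefficient is a single product, nonzero in a domain.\<close>

lemma lead_mon_times:
  fixes A B :: "'k::idom mpoly"
  assumes "A \<noteq> 0" "B \<noteq> 0"
  shows "lead_mon (A * B) = lead_mon A + lead_mon B"
    "mcoeff (A * B) (lead_mon A + lead_mon B) = mcoeff A (lead_mon A) * mcoeff B (lead_mon B)"
proof -
  have eq: "m = lead_mon A \<and> n = lead_mon B" if "m \<in> msupp A" "n \<in> msupp B" "m + n = lead_mon A + lead_mon B" for m n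
    using that lead_mon_ge[of m A] lead_mon_ge[of n B]
    by (metis add_le_imp_le_left add_right_cancel antisym add_mono_thms_linordered_semiring(3) add_left_imp_eq)
  have "mcoeff (A * B) (lead_mon A + lead_mon B)
     = (\<Sum>m\<in>msupp A. \<Sum>n\<in>msupp B. if m = lead_mon A then (if n = lead_mon B then mcoeff A m * mcoeff B n else 0) else 0)"
    unfolding mcoeff_times by (intro sum.cong refl) (use eq in auto)
  also have "\<dots> = (\<Sum>m\<in>msupp A. if m = lead_mon A then (\<Sum>n\<in>msupp B. if n = lead_mon B then mcoeff A m * mcoeff B n else 0) else 0)"
    by (intro sum.cong refl) auto
  also have "\<dots> = mcoeff A (lead_mon A) * mcoeff B (lead_mon B)"
    using lead_mon_in[OF assms(1)] lead_mon_in[OF assms(2)] by simp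
  finally show *: "mcoeff (A * B) (lead_mon A + lead_mon B) = mcoeff A (lead_mon A) * mcoeff B (lead_mon B)" .
  have "lead_mon A + lead_mon B \<in> msupp (A * B)"
    using lead_mon_in[OF assms(1)] lead_mon_in[OF assms(2)] * by (simp add: in_keys_iff)
  moreover have "m \<le> lead_mon A + lead_mon B" if m: "m \<in> msupp (A * B)" for m
    using keys_mult[of A B] m lead_mon_ge by (force intro: add_mono)
  ultimately show "lead_mon (A * B) = lead_mon A + lead_mon B"
    unfolding lead_mon_def[of "A * B"] by (intro Max_eqI) auto
qed


text \<open>This stands in for unique factorization: divisibility may be tested one variable at a
  time, up to multipliers free of that variable. Such a multiplier does not affect the exponent of
  variable \<open>i\<close> in the leading monomial, so the leading monomial of \<open>g\<close>
  divides that of \<open>P\<close>, and division with descent along the monomial order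
  finishes.\<close>

lemma dvd_mpolyI_lead_mon:
  fixes g P :: "'k::field mpoly"
  assumes "g \<noteq> 0" "\<And>i. \<exists>q R. q \<noteq> 0 \<and> mvars_in (- {i}) q \<and> q * P = g * R"
  shows "g dvd P"
  using assms(2)
proof (induction "lead_mon P" arbitrary: P rule: less_induct)
  case less
  show ?case
  proof (cases "P = 0")
    case False
    have "count (lead_mon g) i \<le> count (lead_mon P) i" for i
    proof -
      obtain q R where q: "q \<noteq> 0" "mvars_in (- {i}) q" "q * P = g * R" using less.prems by blast
      have R: "R \<noteq> 0" using q False by auto
      have "lead_mon q + lead_mon P = lead_mon g + lead_mon R"
        using lead_mon_times(1)[OF q(1) False] lead_mon_times(1)[OF assms(1) R] q(3) by simp
      moreover have "count (lead_mon q) i = 0"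
        using lead_mon_in[OF q(1)] q(2) by (auto simp: mvars_in_def count_eq_zero_iff)
      ultimately show ?thesis by (metis add_0 count_union le_add1)
    qed
    then have sub: "lead_mon g \<subseteq># lead_mon P" by (simp add: subseteq_mset_def)
    \<comment> \<open>The quotient of the leading terms. Subtracting \<open>g * s\<close> cancels
      the leading term of \<open>P\<close>, and the hypothesis survives for the difference with the
      same multipliers \<open>q\<close>.\<close>
    define s where "s = mterm (lead_mon P - lead_mon g) (mcoeff P (lead_mon P) / mcoeff g (lead_mon g))"
    define P' where "P' = P - g * s"
    have cg: "mcoeff g (lead_mon g) \<noteq> 0" and cP: "mcoeff P (lead_mon P) \<noteq> 0"
      using lead_mon_in[OF assms(1)] lead_mon_in[OF False] by (auto simp: in_keys_iff)
    then have s0: "s \<noteq> 0" by (metis s_def divide_eq_0_iff lookup_single_eq lookup_zero)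
    have ls: "lead_mon s = lead_mon P - lead_mon g" using cg cP by (simp add: s_def lead_mon_def)
    have lgs: "lead_mon (g * s) = lead_mon P" "mcoeff (g * s) (lead_mon P) = mcoeff P (lead_mon P)"
      using lead_mon_times[OF assms(1) s0] sub cg by (auto simp: ls) (simp add: s_def)
    have step: "\<exists>q R. q \<noteq> 0 \<and> mvars_in (- {i}) q \<and> q * P' = g * R" for i
    proof -
      obtain q R where q: "q \<noteq> 0" "mvars_in (- {i}) q" "q * P = g * R" using less.prems by blast
      have "q * P' = g * (R - q * s)" using q(3) by (simp add: P'_def algebra_simps)
      then show ?thesis using q by blast
    qed
    have "g dvd P'"
    proof (cases "P' = 0")
      case False
      have "lead_mon P' < lead_mon P"
      proof -
        have "lead_mon P' \<in> msupp P'" by (rule lead_mon_in) fact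
        then have "lead_mon P' \<in> msupp P \<or> lead_mon P' \<in> msupp (g * s)" "lead_mon P' \<noteq> lead_mon P"
          using lgs(2) by (auto simp: P'_def in_keys_iff lookup_minus)
        then show ?thesis using lead_mon_ge[of "lead_mon P'" P] lead_mon_ge[of "lead_mon P'" "g * s"] lgs(1) by auto
      qed
      then show ?thesis using less.hyps step by blast
    qed simp
    then have "g dvd P' + g * s" by simp
    then show ?thesis by (simp add: P'_def)
  qed simp
qed

lemma map_poly_pCons0: "f 0 = 0 \<Longrightarrow> map_poly f (pCons a p) = pCons (f a) (map_poly f p)"
  by (rule poly_eqI) (simp add: coeff_map_poly coeff_pCons split: nat.split)

text \<open>The polynomial seen as univariate in variable \<open>i\<close>. The coefficients remain
  in the full ring, although variable \<open>i\<close> no longer occurs in them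
  (\<open>mvars_in_coeff_split_var\<close>); evaluation at \<open>Var i\<close> undoes the splitting
  (\<open>poly_split_var\<close>).\<close>

definition split_var :: "nat \<Rightarrow> 'k::comm_ring_1 mpoly \<Rightarrow> 'k mpoly poly" where
  "split_var i = mev (\<lambda>a. [:Cst a:]) (\<lambda>j. if j = i then [:0, 1:] else [:Var j:])"

lemma comm_ring_hom_const_poly: "comm_ring_hom (\<lambda>a :: 'a::comm_ring_1. [:a:])"
  by unfold_locales auto

lemma comm_ring_hom_comp:
  assumes "comm_ring_hom f" "comm_ring_hom g"
  shows "comm_ring_hom (\<lambda>x. f (g x))"
proof -
  interpret f: comm_ring_hom f by fact
  interpret g: comm_ring_hom g by fact
  show ?thesis by unfold_locales (auto simp: f.hom_add g.hom_add f.hom_mult g.hom_mult)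
qed

lemma comm_ring_hom_poly_eval: "comm_ring_hom (\<lambda>p :: 'a::comm_ring_1 poly. poly p x)"
  by unfold_locales auto

lemma comm_ring_hom_map_poly:
  assumes "comm_ring_hom f" shows "comm_ring_hom (map_poly f)"
proof -
  interpret f: comm_ring_hom f by fact
  interpret map_poly_comm_ring_hom f ..
  show ?thesis ..
qed

lemma comm_ring_hom_to_fract: "comm_ring_hom (to_fract :: 'a::idom \<Rightarrow> _)"
  by unfold_locales auto

lemma split_var_hom: "comm_ring_hom (split_var i :: 'k::comm_ring_1 mpoly \<Rightarrow> _)"
  unfolding split_var_def
  by (rule mev_hom[OF comm_ring_hom_comp[OF comm_ring_hom_const_poly Cst_hom]])

lemma split_var_simps [simp]:
  "split_var i (Cst a) = [:Cst a:]" "split_var i (Var j) = (if j = i then [:0, 1:] else [:Var j:])"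
  by (simp_all add: split_var_def mev_Cst mev_Var)

lemma poly_split_var: "poly (split_var i A) (Var i) = A"
  by (rule mpoly_hom_eqI[where G = "\<lambda>x. x", OF comm_ring_hom_comp[OF comm_ring_hom_poly_eval split_var_hom]])
     (auto simp: split_var_hom intro!: comm_ring_hom_comp[OF comm_ring_hom_poly_eval split_var_hom] comm_ring_hom.intro, unfold_locales, auto)

lemma poly_common_denominator:
  fixes p :: "'a::idom fract poly"
  shows "\<exists>q p'. q \<noteq> 0 \<and> smult (to_fract q) p = map_poly to_fract p'"
proof (induction p)
  case 0
  show ?case by (rule exI[of _ 1], rule exI[of _ 0]) simp
next
  case (pCons a p)
  then obtain q p' where q: "q \<noteq> 0" "smult (to_fract q) p = map_poly to_fract p'" by blast
  obtain x y where a: "a = to_fract x / to_fract y" "y \<noteq> 0"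
    by (metis Fract_cases Fract_conv_to_fract)
  have "smult (to_fract (q * y)) (pCons a p) = pCons (to_fract (q * x)) (smult (to_fract y) (smult (to_fract q) p))"
    using a by (simp add: mult.commute)
  also have "\<dots> = map_poly to_fract (pCons (q * x) (smult y p'))"
    by (simp add: q(2) map_poly_pCons0 flip: fract_poly_smult)
  finally show ?case using q(1) a(2) by (metis no_zero_divisors)
qed

text \<open>Clearing denominators yields a multiplier \<open>q0\<close>, but the fraction field
  contains variable \<open>i\<close>, which may thus occur in \<open>q0\<close>. Exchanging it with
  a fresh variable repairs this.\<close>

lemma dvd_split_var_imp:
  fixes g P :: "'k::field mpoly"
  assumes "map_poly to_fract (split_var i g) dvd map_poly to_fract (split_var i P)"
  shows "\<exists>q R. q \<noteq> 0 \<and> mvars_in (- {i}) q \<and> q * P = g * R"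
proof -
  obtain \<rho> where r: "map_poly to_fract (split_var i P) = map_poly to_fract (split_var i g) * \<rho>"
    using assms by (auto simp: dvd_def)
  obtain q0 \<rho>0 where q0: "q0 \<noteq> 0" "smult (to_fract q0) \<rho> = map_poly to_fract \<rho>0"
    using poly_common_denominator by blast
  have "fract_poly (smult q0 (split_var i P)) = fract_poly (split_var i g * \<rho>0)"
    by (simp add: r q0(2)[symmetric])
  then have eq: "smult q0 (split_var i P) = split_var i g * \<rho>0" by (simp only: fract_poly_eq_iff)
  obtain n1 n2 n3 where n: "mvars_in {..<n1} q0" "mvars_in {..<n2} P" "mvars_in {..<n3} g"
    using mvars_in_finite by metis
  \<comment> \<open>A variable other than \<open>i\<close> that occurs in none of \<open>q0\<close>,
    \<open>P\<close>, \<open>g\<close>. The exchange of \<open>i\<close> and \<open>y\<close> fixes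
    both split polynomials, whose coefficients contain neither, and frees \<open>q0\<close> of
    variable \<open>i\<close>; afterwards the outer variable can be set to
    \<open>Var i\<close>.\<close>
  define y where "y = Suc (n1 + n2 + n3 + i)"
  have y: "mvars_in (- {y}) q0" "mvars_in (- {y}) P" "mvars_in (- {y}) g" "y \<noteq> i"
    by (rule mvars_in_mono[OF n(1)] mvars_in_mono[OF n(2)] mvars_in_mono[OF n(3)], force simp: y_def)+ (simp add: y_def)
  define sw :: "nat \<Rightarrow> nat" where "sw = (\<lambda>j. if j = i then y else if j = y then i else j)"
  define \<sigma> :: "'k mpoly \<Rightarrow> 'k mpoly" where "\<sigma> = mev Cst (\<lambda>j. Var (sw j))"
  have s_hom: "comm_ring_hom \<sigma>" unfolding \<sigma>_def by (rule mev_hom[OF Cst_hom])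
  interpret s: comm_ring_hom \<sigma> by fact
  have sC: "\<sigma> (Cst a) = Cst a" "\<sigma> (Var j) = Var (sw j)" for a j by (simp_all add: \<sigma>_def mev_Cst mev_Var)
  have id_hom: "comm_ring_hom (\<lambda>x :: 'k mpoly. x)" by unfold_locales auto
  have ss: "\<sigma> (\<sigma> A) = A" for A
    by (rule mpoly_hom_eqI[OF comm_ring_hom_comp[OF s_hom s_hom] id_hom]) (auto simp: sC sw_def)
  have fix_split: "map_poly \<sigma> (split_var i A) = split_var i A" if "mvars_in (- {y}) A" for A
  proof -
    have "map_poly \<sigma> (split_var i A) = mev (\<lambda>a. [:Cst a:]) (\<lambda>j. if j = i then [:0, 1:] else [:Var (sw j):]) A"
      by (rule mpoly_hom_eqI[OF comm_ring_hom_comp[OF comm_ring_hom_map_poly[OF s_hom] split_var_hom]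
            mev_hom[OF comm_ring_hom_comp[OF comm_ring_hom_const_poly Cst_hom]]])
         (auto simp: sC mev_Cst mev_Var map_poly_pCons0)
    also have "\<dots> = split_var i A"
      unfolding split_var_def by (rule mev_cong_vars[OF that]) (auto simp: sw_def)
    finally show ?thesis .
  qed
  interpret ms: comm_ring_hom "map_poly \<sigma>" by (rule comm_ring_hom_map_poly[OF s_hom])
  have "map_poly \<sigma> ([:q0:] * split_var i P) = map_poly \<sigma> (split_var i g * \<rho>0)" using eq by simp
  then have "[:\<sigma> q0:] * split_var i P = split_var i g * map_poly \<sigma> \<rho>0"
    by (simp only: ms.hom_mult fix_split[OF y(2)] fix_split[OF y(3)]) (simp add: map_poly_pCons0)
  then have "poly ([:\<sigma> q0:] * split_var i P) (Var i) = poly (split_var i g * map_poly \<sigma> \<rho>0) (Var i)" by simp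
  then have "\<sigma> q0 * P = g * poly (map_poly \<sigma> \<rho>0) (Var i)"
    by (simp add: poly_split_var)
  moreover have "\<sigma> q0 \<noteq> 0" using ss[of q0] q0(1) by auto
  moreover have "mvars_in (- {i}) (\<sigma> q0)"
    unfolding \<sigma>_def by (rule mvars_in_mev[OF y(1)]) (auto simp: sw_def intro!: mvars_in_Var)
  ultimately show ?thesis by blast
qed

section \<open>Gauss's lemma and the minimal monic relation\<close>

text \<open>Being monic, \<open>H\<close> has content 1. Hence, up to units,
  \<open>content Q * content G\<close> is the power of the leading coefficient \<open>g\<close> of
  \<open>G\<close>, which also equals \<open>lead_coeff Q * g\<close>. As \<open>content Q\<close>
  divides \<open>lead_coeff Q\<close>, cancelling it leaves that \<open>g\<close> divides
  \<open>content G\<close>.\<close>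

lemma lead_coeff_dvd_of_monic_multiple:
  fixes G H Q :: "'a::{factorial_semiring, semiring_gcd, normalization_semidom_multiplicative, idom} poly"
  assumes "smult (lead_coeff G ^ b) H = Q * G" "lead_coeff H = 1"
  shows "lead_coeff G dvd coeff G j"
proof (cases "G = 0")
  case False
  let ?g = "lead_coeff G"
  have g0: "?g \<noteq> 0" using False by simp
  have "content H dvd 1" using content_dvd_coeff[of H "degree H"] assms(2) by simp
  then have cH: "content H = 1" using normalize_content is_unit_normalize by metis
  have "content (smult (?g ^ b) H) = content Q * content G" by (simp only: assms(1) content_mult)
  then have c: "normalize (?g ^ b) = content Q * content G" by (simp add: cH)
  have l: "?g ^ b = lead_coeff Q * ?g"
    by (metis assms lead_coeff_mult lead_coeff_smult mult.right_neutral)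
  obtain x where x: "lead_coeff Q = content Q * x" using content_dvd_coeff[of Q "degree Q"] by (auto simp: dvd_def)
  have Q0: "content Q \<noteq> 0" using l g0 by auto
  have "content Q * (x * ?g) dvd content Q * content G"
    by (metis c l x dvd_normalize_iff dvd_refl mult.assoc)
  then have "?g dvd content G" using Q0 by (auto intro: dvd_trans[of _ "x * ?g"])
  then show ?thesis using content_dvd_coeff dvd_trans by blast
qed simp

text \<open>The preceding lemma is applied for each variable \<open>i\<close> separately, over
  univariate polynomials in that variable with coefficients in a fraction field, where contents
  exist. The resulting divisibilities are put together by
  \<open>dvd_mpolyI_lead_mon\<close>.\<close>

lemma mpoly_lead_coeff_dvd_of_monic_multiple:
  fixes G H Q :: "'k::field mpoly poly"
  assumes "smult (lead_coeff G ^ b) H = Q * G" "lead_coeff H = 1" "G \<noteq> 0"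
  shows "lead_coeff G dvd coeff G j"
proof (rule dvd_mpolyI_lead_mon)
  fix i
  define \<phi> :: "'k mpoly \<Rightarrow> 'k mpoly fract poly" where "\<phi> = (\<lambda>A. map_poly to_fract (split_var i A))"
  have ph: "comm_ring_hom \<phi>"
    unfolding \<phi>_def by (rule comm_ring_hom_comp[OF comm_ring_hom_map_poly[OF comm_ring_hom_to_fract] split_var_hom])
  interpret p: comm_ring_hom \<phi> by fact
  interpret mp: comm_ring_hom "map_poly \<phi>" by (rule comm_ring_hom_map_poly[OF ph])
  have p0: "\<phi> A = 0 \<longleftrightarrow> A = 0" for A
    using poly_split_var[of i A] p.hom_zero by (metis \<phi>_def fract_poly_eq_0_iff poly_0)
  have lc: "lead_coeff (map_poly \<phi> A) = \<phi> (lead_coeff A)" for A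
    by (cases "A = 0") (auto simp: p0 coeff_map_poly degree_map_poly)
  have "map_poly \<phi> ([:lead_coeff G ^ b:] * H) = map_poly \<phi> (Q * G)" using assms(1) by simp
  then have "smult (lead_coeff (map_poly \<phi> G) ^ b) (map_poly \<phi> H) = map_poly \<phi> Q * map_poly \<phi> G"
    unfolding mp.hom_mult lc by (simp add: map_poly_pCons0 p.hom_power)
  moreover have "lead_coeff (map_poly \<phi> H) = 1" by (simp only: lc assms(2) p.hom_one)
  ultimately have "\<phi> (lead_coeff G) dvd \<phi> (coeff G j)"
    using lead_coeff_dvd_of_monic_multiple[of "map_poly \<phi> G" b "map_poly \<phi> H" "map_poly \<phi> Q" j]
    unfolding lc by (simp add: coeff_map_poly)
  then show "\<exists>q R. q \<noteq> 0 \<and> mvars_in (- {i}) q \<and> q * coeff G j = lead_coeff G * R"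
    unfolding \<phi>_def by (rule dvd_split_var_imp)
qed (use assms in auto)

text \<open>A nonzero relation \<open>G\<close> of least degree pseudo-divides every relation, since
  the remainder is a relation of smaller degree. Applied to the monic \<open>H\<close>, Gauss's
  lemma shows that the leading coefficient divides all of \<open>G\<close>; injectivity of
  \<open>\<theta>\<close> lets it be cancelled. The quotient is monic, so division by it needs no
  powers of the leading coefficient.\<close>

lemma monic_minimal_relation:
  fixes \<theta> :: "'k::field mpoly \<Rightarrow> 'd::idom" and z :: 'd
  assumes hom: "comm_ring_hom \<theta>" and inj: "\<And>A. \<theta> A = 0 \<Longrightarrow> A = 0"
    and H: "lead_coeff H = 1" "poly (map_poly \<theta> H) z = 0"
  shows "\<exists>R. lead_coeff R = 1 \<and> poly (map_poly \<theta> R) z = 0 \<and>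
    (\<forall>A. poly (map_poly \<theta> A) z = 0 \<longrightarrow> R dvd A)"
proof -
  interpret t: comm_ring_hom \<theta> by fact
  define J where "J = {A. poly (map_poly \<theta> A) z = 0}"
  interpret ev: comm_ring_hom "\<lambda>A. poly (map_poly \<theta> A) z"
    by (rule comm_ring_hom_comp[OF comm_ring_hom_poly_eval comm_ring_hom_map_poly[OF hom]])
  have Jc: "smult a A - B * C \<in> J" if "A \<in> J" "B \<in> J" for A B C a
  proof -
    have "smult a A - B * C = [:a:] * A - B * C" by simp
    then show ?thesis using that unfolding J_def mem_Collect_eq by (simp only: ev.hom_minus ev.hom_mult) simp
  qed
  have "H \<in> J" "H \<noteq> 0" using H by (auto simp: J_def)
  then obtain G where G: "G \<in> J" "G \<noteq> 0" and min: "\<And>A. A \<in> J \<Longrightarrow> A \<noteq> 0 \<Longrightarrow> degree G \<le> degree A"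
    using exists_least_iff[of "\<lambda>n. \<exists>A. A \<in> J \<and> A \<noteq> 0 \<and> degree A = n"] by (metis linorder_not_le)
  have div: "\<exists>b q. smult (lead_coeff G' ^ b) A = G' * q" if "G' \<in> J" "G' \<noteq> 0" "degree G' = degree G" "A \<in> J" for A G'
  proof -
    obtain q r where qr: "pseudo_divmod A G' = (q, r)" by fastforce
    have *: "smult (lead_coeff G' ^ (Suc (degree A) - degree G')) A = G' * q + r" "r = 0 \<or> degree r < degree G'"
      using pseudo_divmod[OF that(2) qr] by auto
    have "r = smult (lead_coeff G' ^ (Suc (degree A) - degree G')) A - G' * q" using * by simp
    then have "r \<in> J" using Jc that by simp
    then have "r = 0" using min[of r] *(2) that(3) by (metis linorder_not_le)
    then show ?thesis using * by auto
  qed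
  let ?g = "lead_coeff G"
  obtain b Q where "smult (?g ^ b) H = G * Q" using div[OF G refl \<open>H \<in> J\<close>] by blast
  then have gd: "?g dvd coeff G j" for j
    using mpoly_lead_coeff_dvd_of_monic_multiple[OF _ H(1) G(2)] by (simp add: mult.commute)
  then have "[:?g:] dvd G" by (simp add: const_poly_dvd_iff)
  then obtain R where R: "G = smult ?g R" by (auto simp: dvd_def)
  have g0: "?g \<noteq> 0" using G by simp
  have lR: "lead_coeff R = 1" using R g0 by (metis lead_coeff_smult mult_cancel_left2 mult.commute)
  have dR: "degree R = degree G" using R g0 by (metis degree_smult_eq)
  have "poly (map_poly \<theta> ([:?g:] * R)) z = 0" using G(1) R by (simp add: J_def)
  then have "\<theta> ?g * poly (map_poly \<theta> R) z = 0" by (simp only: ev.hom_mult) (simp add: map_poly_pCons0)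
  then have RJ: "R \<in> J" using inj[of ?g] g0 unfolding J_def mult_eq_0_iff by blast
  have "R dvd A" if A: "A \<in> J" for A
  proof -
    have R0: "R \<noteq> 0" using lR by auto
    obtain b q where "smult (lead_coeff R ^ b) A = R * q" using div[OF RJ R0 dR A] by blast
    then show ?thesis by (simp add: lR)
  qed
  then show ?thesis using lR RJ by (auto simp: J_def)
qed

section \<open>A grading that bounds the degrees of divisors\<close>

definition shift_grade :: "'k::comm_ring_1 mpoly \<Rightarrow> 'k mpoly poly" where
  "shift_grade = mev (\<lambda>a. [:Cst a:]) (\<lambda>i. [:0, Var (Suc i):])"

text \<open>
  Grades \<open>K[t][T]\<close> by the degree in \<open>t\<close>: \<open>t\<^sub>i\<close> becomes \<open>t\<^sub>i\<^sub>+\<^sub>1 X\<close> and \<open>T\<close> becomes \<open>t\<^sub>0\<close>. Degrees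
  in \<open>X\<close> are additive, hence coefficients of divisors have no larger degree.
\<close>

definition grade :: "'k::comm_ring_1 mpoly poly \<Rightarrow> 'k mpoly poly" where
  "grade A = poly (map_poly shift_grade A) [:Var 0:]"

lemma shift_grade_hom: "comm_ring_hom (shift_grade :: 'k::comm_ring_1 mpoly \<Rightarrow> _)"
  unfolding shift_grade_def
  by (rule mev_hom[OF comm_ring_hom_comp[OF comm_ring_hom_const_poly Cst_hom]])

lemma grade_hom: "comm_ring_hom (grade :: 'k::comm_ring_1 mpoly poly \<Rightarrow> _)"
  unfolding grade_def
  by (rule comm_ring_hom_comp[OF comm_ring_hom_poly_eval comm_ring_hom_map_poly[OF shift_grade_hom]])

lemma shift_grade_eq:
  fixes A :: "'k::comm_ring_1 mpoly"
  shows
  "shift_grade A = (\<Sum>m\<in>msupp A. Polynomial.monom (mterm (image_mset Suc m) (mcoeff A m)) (size m))"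
proof -
  have "(\<Prod>i\<in>#m. [:0, Var (Suc i):]) = Polynomial.monom (mterm (image_mset Suc m) (1::'k)) (size m)" for m
  proof (induction m)
    case (add x m)
    have "[:0, Var (Suc x) :: 'k mpoly:] = Polynomial.monom (Var (Suc x)) 1" by (simp add: monom_Suc monom_0)
    then show ?case using add by (simp add: mult_monom Var_def mult_single)
  qed (simp add: monom_0)
  then show ?thesis
    by (auto simp: shift_grade_def mev_def Cst_def smult_monom mult_single intro!: sum.cong)
qed

text \<open>The map \<open>grade\<close> merely relabels monomials, and the coefficient index
  \<open>e\<close> records the degree in the \<open>t\<close>'s. This gives its injectivity as well
  as the translation of degree bounds back to \<open>A\<close>.\<close>

lemma mcoeff_grade:
  "mcoeff (coeff (grade A) e) (replicate_mset j 0 + image_mset Suc m) = (if size m = e then mcoeff (coeff A j) m else 0)"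
proof -
  have inj: "replicate_mset j' 0 + image_mset Suc m' = replicate_mset j 0 + image_mset Suc m \<longleftrightarrow> j' = j \<and> m' = m" for j' m'
  proof
    assume eq: "replicate_mset j' 0 + image_mset Suc m' = replicate_mset j 0 + image_mset Suc m"
    have "count (image_mset Suc x) 0 = 0" for x :: "nat multiset" by (simp add: count_eq_zero_iff)
    then have "j' = j" using arg_cong[OF eq, of "\<lambda>x. count x 0"] by simp
    with eq show "j' = j \<and> m' = m" using multiset.inj_map[OF inj_Suc] by (simp add: inj_eq)
  qed auto
  have rep: "replicate_mset x (0::nat) = replicate_mset y 0 \<longleftrightarrow> x = y" for x y by (metis size_replicate_mset)
  have g: "grade A = (\<Sum>j'\<le>degree A. \<Sum>m'\<in>msupp (coeff A j').
     Polynomial.monom (mterm (replicate_mset j' 0 + image_mset Suc m') (mcoeff (coeff A j') m')) (size m'))"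
  proof -
    have v: "(Var 0 :: 'a mpoly) ^ j = mterm (replicate_mset j 0) 1" for j
      by (induction j) (auto simp: Var_def mult_single)
    interpret s: comm_ring_hom "shift_grade :: 'a mpoly \<Rightarrow> _" by (rule shift_grade_hom)
    have "grade A = (\<Sum>j'\<le>degree (map_poly shift_grade A). shift_grade (coeff A j') * [:Var 0:] ^ j')"
      unfolding grade_def by (subst poly_altdef) (auto simp: coeff_map_poly)
    also have "\<dots> = (\<Sum>j'\<le>degree A. shift_grade (coeff A j') * [:Var 0:] ^ j')"
    proof (rule sum.mono_neutral_left)
      show "\<forall>j'\<in>{..degree A} - {..degree (map_poly shift_grade A)}. shift_grade (coeff A j') * [:Var 0:] ^ j' = 0"
        using coeff_eq_0[of "map_poly shift_grade A"] by (auto simp: coeff_map_poly)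
    qed (use degree_map_poly_le[of shift_grade A] in auto)
    also have "\<dots> = (\<Sum>j'\<le>degree A. \<Sum>m'\<in>msupp (coeff A j').
     Polynomial.monom (mterm (replicate_mset j' 0 + image_mset Suc m') (mcoeff (coeff A j') m')) (size m'))"
      by (auto simp: shift_grade_eq sum_distrib_right poly_const_pow v mult_single smult_monom smult_sum2 ac_simps mult.commute[of _ "[:_:]"] intro!: sum.cong)
    finally show ?thesis .
  qed
  have "mcoeff (coeff (grade A) e) (replicate_mset j 0 + image_mset Suc m)
    = (\<Sum>j'\<le>degree A. \<Sum>m'\<in>msupp (coeff A j'). if j' = j then (if m' = m then (if size m = e then mcoeff (coeff A j) m else 0) else 0) else 0)"
    unfolding g by (auto simp: Polynomial.coeff_sum lookup_sum lookup_single when_def inj rep intro!: sum.cong)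
  also have "\<dots> = (\<Sum>j'\<le>degree A. if j' = j then (\<Sum>m'\<in>msupp (coeff A j). if m' = m then (if size m = e then mcoeff (coeff A j) m else 0) else 0) else 0)"
    by (intro sum.cong refl) auto
  also have "\<dots> = (if size m = e then mcoeff (coeff A j) m else 0)"
    by (auto simp: in_keys_iff coeff_eq_0)
  finally show ?thesis .
qed

lemma degree_grade_le:
  assumes "\<And>j. mdeg_le e (coeff A j)"
  shows "degree (grade A) \<le> e"
proof -
  interpret s: comm_ring_hom "shift_grade :: 'a mpoly \<Rightarrow> _" by (rule shift_grade_hom)
  have "degree (shift_grade (coeff A j)) \<le> e" for j
    unfolding shift_grade_eq
    by (rule degree_sum_le) (use assms[of j] in \<open>auto simp: mdeg_le_def intro: order.trans[OF degree_monom_le]\<close>)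
  then have d: "degree (shift_grade (coeff A j) * [:Var 0:] ^ j) \<le> e" for j
    by (intro order.trans[OF degree_mult_le]) (auto simp: poly_const_pow)
  have "grade A = (\<Sum>j\<le>degree (map_poly shift_grade A). shift_grade (coeff A j) * [:Var 0:] ^ j)"
    unfolding grade_def by (subst poly_altdef) (auto simp: coeff_map_poly)
  also have "degree \<dots> \<le> e" by (rule degree_sum_le) (use d in auto)
  finally show ?thesis .
qed

lemma mdeg_le_coeff_grade:
  assumes "degree (grade A) \<le> e"
  shows "mdeg_le e (coeff A j)"
  unfolding mdeg_le_def
proof
  fix m assume m: "m \<in> msupp (coeff A j)"
  show "size m \<le> e"
  proof (rule ccontr)
    assume "\<not> size m \<le> e"
    then have "coeff (grade A) (size m) = 0" using assms by (intro coeff_eq_0) auto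
    then show False using mcoeff_grade[of A "size m" j m] m by (simp add: in_keys_iff)
  qed
qed

text \<open>The injective homomorphism \<open>grade\<close> turns the factorization into one of
  nonzero univariate polynomials over a domain, where a factor has no larger degree.\<close>

lemma mdeg_le_coeff_dvd:
  fixes A B :: "'k::idom mpoly poly"
  assumes "B dvd A" "A \<noteq> 0" "\<And>j. mdeg_le e (coeff A j)"
  shows "mdeg_le e (coeff B j)"
proof -
  obtain C where C: "A = B * C" using assms(1) by (auto simp: dvd_def)
  interpret g: comm_ring_hom "grade :: 'k mpoly poly \<Rightarrow> _" by (rule grade_hom)
  have inj: "X = 0" if "grade X = 0" for X :: "'k mpoly poly"
  proof (rule poly_eqI, rule poly_mapping_eqI)
    fix n m show "mcoeff (coeff X n) m = mcoeff (coeff 0 n) m"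
      using mcoeff_grade[of X "size m" n m] that by simp
  qed
  have "grade A = grade B * grade C" by (simp add: C g.hom_mult)
  moreover have "grade A \<noteq> 0" using inj assms(2) by blast
  ultimately have "degree (grade B) \<le> degree (grade A)" by (simp add: degree_mult_eq)
  then show ?thesis using degree_grade_le[of e A] assms(3) mdeg_le_coeff_grade[of B e] by force
qed


section \<open>Fraction-free solution of underdetermined linear systems\<close>

text \<open>Elimination by cross-multiplication: each eliminated equation doubles the degree of the
  entries, and back substitution adds one entry, whence the bound by \<open>\<delta> + 2 * \<delta>
  * (2 ^ k - 1) = \<delta> * (2 ^ (k + 1) - 1)\<close>. The filtration \<open>F n\<close> stands for
  "degree at most \<open>n\<close>".\<close>

lemma homogeneous_system_filtered:
  fixes e :: "'i \<Rightarrow> 'j \<Rightarrow> 'a::idom" and F :: "nat \<Rightarrow> 'a set"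
  assumes F: "\<And>n. 0 \<in> F n" "\<And>n. 1 \<in> F n" "\<And>n x y. x \<in> F n \<Longrightarrow> y \<in> F n \<Longrightarrow> x - y \<in> F n"
      "\<And>n k x y. x \<in> F n \<Longrightarrow> y \<in> F k \<Longrightarrow> x * y \<in> F (n + k)" "\<And>n k. n \<le> k \<Longrightarrow> F n \<subseteq> F k"
    and "finite I" "finite J" "card I < card J" "\<And>i j. i \<in> I \<Longrightarrow> j \<in> J \<Longrightarrow> e i j \<in> F \<delta>"
  shows "\<exists>x. (\<forall>j. x j \<in> F (\<delta> * (2 ^ card I - 1))) \<and> (\<exists>j\<in>J. x j \<noteq> 0) \<and> (\<forall>i\<in>I. (\<Sum>j\<in>J. e i j * x j) = 0)"
  using assms(6-)
proof (induction I arbitrary: J e \<delta> rule: finite_induct)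
  case empty
  then have "J \<noteq> {}" by auto
  then show ?case by (intro exI[of _ "\<lambda>_. 1"]) (auto simp: F)
next
  case (insert i I)
  have Fsum: "finite S \<Longrightarrow> (\<And>x. x \<in> S \<Longrightarrow> g x \<in> F n) \<Longrightarrow> - sum g S \<in> F n" for g n and S :: "'j set"
  proof (induction S rule: finite_induct)
    case (insert x S)
    then have "- sum g S - g x \<in> F n" using F(3) by blast
    moreover have "- sum g (insert x S) = - sum g S - g x" using insert by simp
    ultimately show ?case by (simp only:)
  qed (simp add: F)
  show ?case
  proof (cases "\<forall>j\<in>J. e i j = 0")
    case True
    have "card I < card J" using insert by simp
    then obtain x where x: "\<forall>j. x j \<in> F (\<delta> * (2 ^ card I - 1))" "\<exists>j\<in>J. x j \<noteq> 0" "\<forall>i\<in>I. (\<Sum>j\<in>J. e i j * x j) = 0"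
      using insert.IH[of J e \<delta>] insert.prems by auto
    have "\<delta> * (2 ^ card I - 1) \<le> \<delta> * (2 ^ card (insert i I) - 1)"
      by (intro mult_left_mono diff_le_mono power_increasing card_mono) (use insert in auto)
    with x(1) have "\<forall>j. x j \<in> F (\<delta> * (2 ^ card (insert i I) - 1))" using F(5) by blast
    with x(2,3) True show ?thesis by (intro exI[of _ x]) auto
  next
    case False
    then obtain j0 where j0: "j0 \<in> J" "e i j0 \<noteq> 0" by blast
    let ?J = "J - {j0}"
    \<comment> \<open>Equation \<open>i'\<close> times the pivot minus equation \<open>i\<close>
      times the entry of \<open>i'\<close> in the pivot column: unknown \<open>j0\<close> disappears
      without any division.\<close>
    define e' where "e' = (\<lambda>i' j. e i j0 * e i' j - e i' j0 * e i j)"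
    have "e' i' j \<in> F (2 * \<delta>)" if "i' \<in> I" "j \<in> ?J" for i' j
      using F(3)[OF F(4)[of "e i j0" \<delta> "e i' j" \<delta>] F(4)[of "e i' j0" \<delta> "e i j" \<delta>]] insert.prems(3) that j0
      by (simp add: e'_def mult_2)
    moreover have "card I < card ?J" using insert j0 by simp
    ultimately obtain x where x: "\<forall>j. x j \<in> F (2 * \<delta> * (2 ^ card I - 1))" "\<exists>j\<in>?J. x j \<noteq> 0"
        "\<forall>i\<in>I. (\<Sum>j\<in>?J. e' i j * x j) = 0"
      using insert.IH[of ?J e' "2 * \<delta>"] insert.prems by auto
    \<comment> \<open>Scaling the solution of the reduced system by the pivot makes equation
      \<open>i\<close> solvable for unknown \<open>j0\<close> inside the ring.\<close>
    define y where "y = (\<lambda>j. if j = j0 then - (\<Sum>j\<in>?J. e i j * x j) else if j \<in> J then e i j0 * x j else 0)"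
    have bnd: "\<delta> + 2 * \<delta> * (2 ^ card I - 1) = \<delta> * (2 ^ card (insert i I) - 1)"
    proof -
      have "(1::nat) \<le> 2 ^ card I" by simp
      then obtain q where "2 ^ card I = q + (1::nat)" by (metis add.commute le_Suc_ex)
      then show ?thesis using insert by (simp add: algebra_simps)
    qed
    have "- (\<Sum>j\<in>?J. e i j * x j) \<in> F (\<delta> + 2 * \<delta> * (2 ^ card I - 1))"
      by (rule Fsum) (use insert x F(4) in auto)
    moreover have "e i j0 * x j \<in> F (\<delta> + 2 * \<delta> * (2 ^ card I - 1))" for j
      using insert x j0 F(4) by auto
    ultimately have "\<forall>j. y j \<in> F (\<delta> * (2 ^ card (insert i I) - 1))"
      unfolding bnd by (auto simp: y_def F)
    moreover have "\<exists>j\<in>J. y j \<noteq> 0" using x(2) j0 by (auto simp: y_def)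
    moreover have "(\<Sum>j\<in>J. e i' j * y j) = 0" if i': "i' \<in> insert i I" for i'
    proof -
      have "(\<Sum>j\<in>J. e i' j * y j) = e i' j0 * y j0 + (\<Sum>j\<in>?J. e i' j * y j)"
        using insert.prems j0 by (simp add: sum.remove)
      also have "\<dots> = (\<Sum>j\<in>?J. e' i' j * x j)"
      proof -
        have "(\<Sum>j\<in>?J. e i' j * y j) = (\<Sum>j\<in>?J. e i j0 * e i' j * x j)"
          by (rule sum.cong) (auto simp: y_def)
        moreover have "e i' j0 * y j0 = - (\<Sum>j\<in>?J. e i' j0 * e i j * x j)"
          by (simp add: y_def sum_distrib_left mult.assoc)
        ultimately show ?thesis by (simp add: e'_def left_diff_distrib sum_subtractf)
      qed
      also have "\<dots> = 0" using i' x(3) by (auto simp: e'_def mult.commute)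
      finally show ?thesis .
    qed
    ultimately show ?thesis by blast
  qed
qed

section \<open>Finite maps and the elimination of generators\<close>

lemma coeff_mult_closed:
  assumes "\<And>x y. x \<in> S \<Longrightarrow> y \<in> S \<Longrightarrow> x + y \<in> S" "\<And>x y. x \<in> S \<Longrightarrow> y \<in> S \<Longrightarrow> x * y \<in> S" "0 \<in> S"
    "\<And>k. coeff p k \<in> S" "\<And>k. coeff q k \<in> S"
  shows "coeff (p * q) k \<in> (S :: 'a::comm_ring_1 set)"
proof -
  have sumS: "sum g X \<in> S" if "\<And>x. x \<in> X \<Longrightarrow> g x \<in> S" for g and X :: "nat set"
    using that by (induction X rule: infinite_finite_induct) (auto simp: assms)
  then show ?thesis unfolding coeff_mult by (intro sumS assms(2,4,5))
qed

lemma mvars_in_coeff_split_var: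
  fixes A :: "'k::comm_ring_1 mpoly"
  assumes "mvars_in V A"
  shows "mvars_in (V - {i}) (coeff (split_var i A) k)"
proof -
  let ?S = "{B :: 'k mpoly. mvars_in (V - {i}) B}"
  let ?b = "\<lambda>j. if j = i then [:0, 1:] else [:Var j :: 'k mpoly:]"
  have const: "\<And>k. coeff [:B:] k \<in> ?S" if "B \<in> ?S" for B using that by (simp add: coeff_pCons split: nat.split)
  have "coeff (\<Prod>j\<in>#m. ?b j) k \<in> ?S" if "set_mset m \<subseteq> V" for m k
    using that
  proof (induction m arbitrary: k)
    case (add x m)
    have "coeff (?b x * (\<Prod>j\<in>#m. ?b j)) k \<in> ?S"
      by (rule coeff_mult_closed)
        (use add in \<open>auto intro: mvars_in_add mvars_in_mult simp: coeff_pCons mvars_in_Var split: nat.split\<close>)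
    then show ?case by simp
  qed (simp add: coeff_1)
  then have "coeff ([:Cst (mcoeff A m):] * (\<Prod>j\<in>#m. ?b j)) k \<in> ?S" if "m \<in> msupp A" for m k
    using that assms by (auto simp: mvars_in_def[of _ A] intro!: mvars_in_mult)
  then show ?thesis
    unfolding split_var_def mev_def Polynomial.coeff_sum by (intro mvars_in_sum) auto
qed

lemma comm_ring_hom_id: "comm_ring_hom (\<lambda>x :: 'a::comm_ring_1. x)"
  by unfold_locales auto

lemma split_var_eq_0: "split_var i A = 0 \<longleftrightarrow> A = 0"
proof -
  interpret s: comm_ring_hom "split_var i :: 'a mpoly \<Rightarrow> _" by (rule split_var_hom)
  show ?thesis using poly_split_var[of i A] by auto
qed

text \<open>Induction on the number of variables: some coefficient with respect to the last variable
  does not vanish at a suitable point, and the resulting nonzero univariate polynomial has only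
  finitely many roots.\<close>

lemma mpoly_nonzero_point:
  fixes A :: "'k::field mpoly"
  assumes "infinite (UNIV :: 'k set)" "A \<noteq> 0"
  shows "\<exists>x. mev (\<lambda>a. a) x A \<noteq> 0"
proof -
  have "\<exists>x. mev (\<lambda>a. a) x A \<noteq> 0" if "mvars_in {..<n} A" "A \<noteq> 0" for n and A :: "'k mpoly"
    using that
  proof (induction n arbitrary: A)
    case 0
    then have "msupp A \<subseteq> {{#}}" by (auto simp: mvars_in_def)
    moreover have "msupp A \<noteq> {}" using lead_mon_in[OF 0(2)] by blast
    ultimately have "msupp A = {{#}}" by blast
    then show ?case by (auto simp: mev_def in_keys_iff)
  next
    case (Suc n)
    obtain k where k: "coeff (split_var n A) k \<noteq> 0"
      using split_var_eq_0[of n A] Suc.prems leading_coeff_0_iff by blast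
    have "mvars_in {..<n} (coeff (split_var n A) k)"
      using mvars_in_coeff_split_var[OF Suc.prems(1), of n k] by (rule mvars_in_mono) auto
    then obtain x where x: "mev (\<lambda>a. a) x (coeff (split_var n A) k) \<noteq> 0" using Suc.IH k by blast
    have mh: "comm_ring_hom (mev (\<lambda>a. a) x :: 'k mpoly \<Rightarrow> 'k)" for x by (rule mev_hom[OF comm_ring_hom_id])
    interpret mx: comm_ring_hom "mev (\<lambda>a. a) x :: 'k mpoly \<Rightarrow> 'k" by (rule mh)
    let ?p = "map_poly (mev (\<lambda>a. a) x) (split_var n A)"
    have "coeff ?p k \<noteq> 0" using x by (simp add: coeff_map_poly)
    then have "?p \<noteq> 0" by (metis coeff_0)
    then have "finite {t. poly ?p t = 0}" by (rule poly_roots_finite)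
    then obtain t where t: "poly ?p t \<noteq> 0" using assms(1) by (metis (mono_tags) ex_new_if_finite mem_Collect_eq)
    have "poly ?p t = mev (\<lambda>a. a) (x(n := t)) A"
      by (rule mpoly_hom_eqI[OF comm_ring_hom_comp[OF comm_ring_hom_poly_eval
            comm_ring_hom_comp[OF comm_ring_hom_map_poly[OF mh] split_var_hom]] mh])
         (auto simp: mev_Cst mev_Var map_poly_pCons0)
    with t show ?case by auto
  qed
  then show ?thesis using mvars_in_finite assms(2) by blast
qed

definition linform :: "nat \<Rightarrow> 'k::comm_ring_1 mpoly \<Rightarrow> bool" where
  "linform m L \<longleftrightarrow> (\<exists>a. L = (\<Sum>j<m. Cst (a j) * Var j))"

lemma linform_0: "linform m 0"
  unfolding linform_def by (rule exI[of _ "\<lambda>_. 0"]) simp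

lemma linform_diff_smult:
  assumes "linform m L" "linform m L'"
  shows "linform m (L - Cst a * L')"
proof -
  obtain b b' where "L = (\<Sum>j<m. Cst (b j) * Var j)" "L' = (\<Sum>j<m. Cst (b' j) * Var j)"
    using assms by (auto simp: linform_def)
  then have "L - Cst a * L' = (\<Sum>j<m. Cst (b j - a * b' j) * Var j)"
    by (simp add: Cst.hom_minus Cst.hom_mult sum_distrib_left sum_subtractf algebra_simps)
  then show ?thesis unfolding linform_def by (rule exI[of _ "\<lambda>j. b j - a * b' j"])
qed

lemma linform_Suc: "linform m L \<Longrightarrow> linform (Suc m) L"
  unfolding linform_def
proof -
  assume "\<exists>a. L = (\<Sum>j<m. Cst (a j) * Var j)"
  then obtain a where "L = (\<Sum>j<m. Cst (a j) * Var j)" by blast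
  then have "L = (\<Sum>j<Suc m. Cst ((a(m := 0)) j) * Var j)" by simp
  then show "\<exists>a. L = (\<Sum>j<Suc m. Cst (a j) * Var j)" by blast
qed

lemma linform_Var_add: "linform m L \<Longrightarrow> linform (Suc m) (Var m + L)"
  unfolding linform_def
proof -
  assume "\<exists>a. L = (\<Sum>j<m. Cst (a j) * Var j)"
  then obtain a where "L = (\<Sum>j<m. Cst (a j) * Var j)" by blast
  then have "Var m + L = (\<Sum>j<Suc m. Cst ((a(m := 1)) j) * Var j)" by simp
  then show "\<exists>a. Var m + L = (\<Sum>j<Suc m. Cst (a j) * Var j)" by blast
qed

text \<open>
  With \<open>z\<close> the variable of the outer polynomial ring, the first \<open>c\<close> generators are \<open>f\<^sub>i z + l\<^sub>i\<close>, the
  others are \<open>x\<^sub>m + l\<^sub>c, x\<^sub>m\<^sub>+\<^sub>1 + l\<^sub>c\<^sub>+\<^sub>1, \<dots>\<close>, where the \<open>l\<^sub>i\<close> are linear forms in the \<open>m\<close> eliminated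
  variables.
\<close>

definition gens :: "(nat \<Rightarrow> 'k::comm_ring_1 mpoly) \<Rightarrow> nat \<Rightarrow> nat \<Rightarrow> (nat \<Rightarrow> 'k mpoly) \<Rightarrow> nat \<Rightarrow> 'k mpoly poly" where
  "gens f c m l i = (if i < c then [:l i, f i:] else [:Var (m + (i - c)) + l i:])"

definition gen_map :: "(nat \<Rightarrow> 'k::comm_ring_1 mpoly) \<Rightarrow> nat \<Rightarrow> nat \<Rightarrow> (nat \<Rightarrow> 'k mpoly) \<Rightarrow> 'k mpoly \<Rightarrow> 'k mpoly poly" where
  "gen_map f c m l = mev (\<lambda>a. [:Cst a:]) (gens f c m l)"

text \<open>Module generators are indexed by lists because each elimination replaces a generator
  \<open>e i\<close> by the products of powers \<open>v ^ j\<close> with \<open>e i\<close>, for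
  which \<open>j # i\<close> is a ready-made index.\<close>

definition module_finite :: "('a::comm_ring_1 \<Rightarrow> 'b::comm_ring_1) \<Rightarrow> bool" where
  "module_finite \<theta> \<longleftrightarrow> (\<exists>(I :: nat list set) e. finite I \<and> (\<forall>x. \<exists>s. x = (\<Sum>i\<in>I. \<theta> (s i) * e i)))"

lemma gen_map_hom: "comm_ring_hom (gen_map f c m l :: 'k::comm_ring_1 mpoly \<Rightarrow> _)"
  unfolding gen_map_def
  by (rule mev_hom[OF comm_ring_hom_comp[OF comm_ring_hom_const_poly Cst_hom]])

lemma gen_map_simps [simp]:
  "gen_map f c m l (Cst a) = [:Cst a:]" "gen_map f c m l (Var i) = gens f c m l i"
  by (simp_all add: gen_map_def mev_Cst mev_Var)

text \<open>Before any elimination the map is onto: the generators from number \<open>c\<close> on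
  give all variables, and multiplying the unit equation by \<open>z\<close> gives \<open>z\<close>
  itself. Hence the single module generator 1 suffices.\<close>

lemma module_finite_start:
  fixes f g :: "nat \<Rightarrow> 'k::comm_ring_1 mpoly"
  assumes "(\<Sum>j<c. g j * f j) = 1"
  shows "module_finite (gen_map f c 0 (\<lambda>_. 0))"
proof -
  let ?t = "gen_map f c 0 (\<lambda>_. 0)"
  interpret t: comm_ring_hom ?t by (rule gen_map_hom)
  have c: "\<exists>s. [:A:] = ?t s" for A :: "'k mpoly"
  proof -
    have "?t (mev Cst (\<lambda>i. Var (c + i)) A) = [:A:]"
      by (rule mpoly_hom_eqI[OF comm_ring_hom_comp[OF gen_map_hom mev_hom[OF Cst_hom]] comm_ring_hom_const_poly])
         (auto simp: mev_Cst mev_Var gens_def)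
    then show ?thesis by metis
  qed
  then obtain G where G: "[:A:] = ?t (G A)" for A by metis
  have "[:0, 1:] = [:0, \<Sum>j<c. g j * f j:]" by (simp add: assms)
  also have "\<dots> = (\<Sum>j<c. [:0, g j * f j:])"
    by (rule poly_eqI) (auto simp: Polynomial.coeff_sum coeff_pCons split: nat.splits)
  also have "\<dots> = ?t (\<Sum>j<c. G (g j) * Var j)"
    by (auto simp: t.hom_sum t.hom_mult G[symmetric] gens_def intro!: sum.cong)
  finally obtain Z where Z: "[:0, 1:] = ?t Z" by blast
  have "\<exists>s. x = ?t s" for x
  proof (induction x)
    case (pCons a p)
    then obtain s where s: "p = ?t s" by blast
    have "pCons a p = [:a:] + [:0, 1:] * p" by simp
    also have "\<dots> = ?t (G a + Z * s)" by (simp only: t.hom_add t.hom_mult flip: Z s G)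
    finally show ?case by blast
  qed (metis t.hom_zero)
  then obtain s where s: "\<And>x. x = ?t (s x)" by metis
  have "\<exists>s. x = (\<Sum>i\<in>{[]::nat list}. ?t (s i) * 1)" for x
    by (rule exI[of _ "\<lambda>_. s x"]) (simp flip: s)
  then show ?thesis unfolding module_finite_def by (intro exI[of _ "{[]}"] exI[of _ "\<lambda>_. 1"]) blast
qed


text \<open>The step of Noether normalization. Put \<open>t_i = t'_i + x_i v\<close>, where
  \<open>v\<close> is the image of the generator to be dropped. If the top-degree form of
  \<open>P\<close> does not vanish at \<open>x\<close>, then \<open>P\<close> becomes, up to a unit,
  a monic equation for \<open>v\<close> over the remaining generators. So \<open>v\<close> is
  integral over them and finiteness is preserved.\<close>

lemma gen_map_eliminate:
  fixes f :: "nat \<Rightarrow> 'k::field mpoly"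
  assumes inf: "infinite (UNIV :: 'k set)"
    and lin: "\<And>i. linform m (l i)" and supp: "\<exists>N. \<forall>i\<ge>N. l i = 0"
    and fin: "module_finite (gen_map f c m l)"
    and P: "P \<noteq> 0" "gen_map f c m l P = 0"
  shows "\<exists>l'. (\<forall>i. linform (Suc m) (l' i)) \<and> (\<exists>N. \<forall>i\<ge>N. l' i = 0) \<and> module_finite (gen_map f c (Suc m) l')"
proof -
  define \<delta> where "\<delta> = Max (size ` msupp P)"
  have P0: "msupp P \<noteq> {}" using lead_mon_in[OF P(1)] by blast
  then have dP: "\<And>n. n \<in> msupp P \<Longrightarrow> size n \<le> \<delta>" "\<delta> \<in> size ` msupp P"
    unfolding \<delta>_def by (auto intro!: Max_in simp del: keys_eq_empty)
  \<comment> \<open>The homogeneous part of top degree \<open>\<delta>\<close>, which governs the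
    coefficient of \<open>v ^ \<delta>\<close> after the substitution.\<close>
  define H where "H = (\<Sum>n | n \<in> msupp P \<and> size n = \<delta>. mterm n (mcoeff P n))"
  have cH: "mcoeff H n = (if size n = \<delta> then mcoeff P n else 0)" for n
    by (auto simp: H_def lookup_sum lookup_single when_def in_keys_iff)
  then have H0: "H \<noteq> 0" using dP(2) by (metis imageE in_keys_iff lookup_zero)
  have "Var c \<noteq> (0 :: 'k mpoly)" by (metis Var_def lookup_single_eq lookup_zero one_neq_zero)
  then obtain x0 where x0: "mev (\<lambda>a. a) x0 (H * Var c) \<noteq> (0::'k)"
    using mpoly_nonzero_point[OF inf] H0 by (metis mult_eq_0_iff)
  interpret e0: comm_ring_hom "mev (\<lambda>a. a) x :: 'k mpoly \<Rightarrow> 'k" for x by (rule mev_hom[OF comm_ring_hom_id])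
  have x0': "mev (\<lambda>a. a) x0 H \<noteq> 0" "x0 c \<noteq> 0" using x0 by (auto simp: e0.hom_mult mev_Var)
  obtain N0 where N0: "mvars_in {..<N0} H" using mvars_in_finite by blast
  \<comment> \<open>Rescaling the point to have coordinate \<open>c\<close> equal to 1 is harmless
    since \<open>H\<close> is homogeneous, and makes \<open>t_c\<close> become exactly
    \<open>v\<close>. Coordinates outside \<open>H\<close> other than \<open>c\<close> are set to 0,
    so that almost all of the new linear forms vanish.\<close>
  define x where "x = (\<lambda>i. if i < N0 \<or> i = c then x0 i / x0 c else 0)"
  have xc: "x c = 1" using x0' by (simp add: x_def)
  have xH: "mev (\<lambda>a. a) x H \<noteq> 0"
  proof -
    have pr: "(\<Prod>i\<in>#n. x i) = (\<Prod>i\<in>#n. x0 i) / x0 c ^ size n" if "set_mset n \<subseteq> {..<N0}" for n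
      using that by (induction n) (auto simp: x_def)
    have "mev (\<lambda>a. a) x H = (\<Sum>n\<in>msupp H. mcoeff H n * (\<Prod>i\<in>#n. x0 i) / x0 c ^ \<delta>)"
      unfolding mev_def
    proof (rule sum.cong[OF refl])
      fix n assume n: "n \<in> msupp H"
      then have "size n = \<delta>" "set_mset n \<subseteq> {..<N0}"
        using cH[of n] N0 by (auto simp: in_keys_iff mvars_in_def split: if_splits)
      then show "mcoeff H n * (\<Prod>i\<in>#n. x i) = mcoeff H n * (\<Prod>i\<in>#n. x0 i) / x0 c ^ \<delta>"
        by (simp add: pr)
    qed
    also have "\<dots> = mev (\<lambda>a. a) x0 H / x0 c ^ \<delta>" by (simp add: mev_def sum_divide_distrib)
    finally show ?thesis using x0' by simp
  qed
  \<comment> \<open>The image of generator number \<open>c\<close>, which is dropped; its leading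
    variable \<open>m\<close> joins the eliminated variables.\<close>
  define v :: "'k mpoly" where "v = Var m + l c"
  define l' where "l' = (\<lambda>i. if i < c then l i - Cst (x i) * v else l (Suc i) - Cst (x (Suc i)) * v)"
  let ?t = "gen_map f c m l" and ?t' = "gen_map f c (Suc m) l'"
  interpret t: comm_ring_hom ?t by (rule gen_map_hom)
  interpret t': comm_ring_hom ?t' by (rule gen_map_hom)
  have lin_v: "linform (Suc m) v" unfolding v_def by (rule linform_Var_add[OF lin])
  have lin': "linform (Suc m) (l' i)" for i
    unfolding l'_def by (auto intro: linform_diff_smult[OF linform_Suc[OF lin] lin_v])
  have supp': "\<exists>N. \<forall>i\<ge>N. l' i = 0"
  proof -
    obtain N where "\<forall>i\<ge>N. l i = 0" using supp by blast
    then show ?thesis by (intro exI[of _ "N + N0 + c + 1"]) (auto simp: l'_def x_def)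
  qed
  \<comment> \<open>The substitution itself, the outer variable standing for \<open>v\<close>.
    Generators beyond \<open>c\<close> move down by one index to close the gap.\<close>
  define tt where "tt = mev (\<lambda>a. [:Cst a:]) (\<lambda>i. [:if i < c then Var i else if i = c then 0 else Var (i - 1), Cst (x i) :: 'k mpoly:])"
  have tt_hom: "comm_ring_hom tt"
    unfolding tt_def by (rule mev_hom[OF comm_ring_hom_comp[OF comm_ring_hom_const_poly Cst_hom]])
  interpret tt: comm_ring_hom tt by (rule tt_hom)
  have tt_ev: "poly (map_poly ?t' (tt A)) [:v:] = ?t A" for A
  proof (rule mpoly_hom_eqI[OF comm_ring_hom_comp[OF comm_ring_hom_poly_eval
        comm_ring_hom_comp[OF comm_ring_hom_map_poly[OF gen_map_hom] tt_hom]] gen_map_hom])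
    fix i
    have *: "Suc m + (i - 1 - c) = m + (i - c)" if "i > c" using that by auto
    have "tt (Var i) = [:if i < c then Var i else if i = c then 0 else Var (i - 1), Cst (x i):]"
      by (simp only: tt_def mev_Var Cst.hom_zero Cst.hom_one pCons_0_0 one_pCons)
    then have "poly (map_poly ?t' (tt (Var i))) [:v:]
        = ?t' (if i < c then Var i else if i = c then 0 else Var (i - 1)) + [:v * Cst (x i):]"
      by (simp only: map_poly_pCons0 t'.hom_zero gen_map_simps map_poly_0) simp
    also have "\<dots> = gens f c m l i"
    proof (cases i c rule: linorder_cases)
      case less
      then show ?thesis by (simp only: gen_map_simps if_True) (simp add: gens_def l'_def mult.commute)
    next
      case equal
      then show ?thesis by (simp add: gens_def v_def xc)
    next
      case greater
      then obtain j where j: "i = Suc j" "c \<le> j" by (metis less_Suc_eq_le not0_implies_Suc not_less_zero)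
      have "l' j = l i - Cst (x i) * v" unfolding l'_def j(1) if_not_P[OF j(2)[unfolded not_less[symmetric]]] by (rule refl)
      moreover have "Suc m + (j - c) = m + (i - c)" using j by simp
      ultimately have "gens f c (Suc m) l' j = [:Var (m + (i - c)) + (l i - Cst (x i) * v):]"
        using j(2) by (simp only: gens_def not_less[symmetric] if_False)
      then show ?thesis using greater by (simp add: j(1) gens_def mult.commute)
    qed
    finally show "poly (map_poly ?t' (tt (Var i))) [:v:] = ?t (Var i)" by (simp only: gen_map_simps)
  qed (auto simp: tt_def mev_Cst map_poly_pCons0)
  have ttP: "degree (tt P) \<le> \<delta>" "coeff (tt P) \<delta> = Cst (mev (\<lambda>a. a) x H)"
  proof -
    let ?b = "\<lambda>i. [:if i < c then Var i else if i = c then 0 else Var (i - 1), Cst (x i) :: 'k mpoly:]"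
    have pr: "degree (\<Prod>i\<in>#n. ?b i) \<le> size n \<and> coeff (\<Prod>i\<in>#n. ?b i) (size n) = Cst (\<Prod>i\<in>#n. x i)" for n
    proof (induction n)
      case (add i n)
      have "degree (?b i) \<le> 1" by simp
      then have "degree (?b i * (\<Prod>i\<in>#n. ?b i)) \<le> Suc (size n)"
        using degree_mult_le[of "?b i" "\<Prod>i\<in>#n. ?b i"] add by linarith
      moreover have "coeff (?b i * (\<Prod>i\<in>#n. ?b i)) (Suc (size n)) = Cst (x i) * Cst (\<Prod>i\<in>#n. x i)"
        using add coeff_eq_0[of "\<Prod>i\<in>#n. ?b i" "Suc (size n)"] by (simp add: coeff_pCons)
      ultimately show ?case by (simp add: Cst.hom_mult)
    qed simp
    have e: "tt P = (\<Sum>n\<in>msupp P. [:Cst (mcoeff P n):] * (\<Prod>i\<in>#n. ?b i))" by (simp add: tt_def mev_def)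
    show "degree (tt P) \<le> \<delta>"
      unfolding e
    proof (rule degree_sum_le)
      fix n assume n: "n \<in> msupp P"
      have "degree ([:Cst (mcoeff P n):] * (\<Prod>i\<in>#n. ?b i)) \<le> degree (\<Prod>i\<in>#n. ?b i)"
        by (simp add: degree_smult_le)
      also have "\<dots> \<le> \<delta>" using pr[of n] dP(1)[OF n] by simp
      finally show "degree ([:Cst (mcoeff P n):] * (\<Prod>i\<in>#n. ?b i)) \<le> \<delta>" .
    qed simp
    have "coeff ([:Cst (mcoeff P n):] * (\<Prod>i\<in>#n. ?b i)) \<delta> = Cst (mcoeff H n * (\<Prod>i\<in>#n. x i))" if "n \<in> msupp P" for n
    proof (cases "size n = \<delta>")
      case True
      then show ?thesis using pr[of n] by (simp add: cH Cst.hom_mult)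
    next
      case False
      then have "degree (\<Prod>i\<in>#n. ?b i) < \<delta>" using pr[of n] dP(1)[OF that] by simp
      then show ?thesis using False by (simp add: cH coeff_eq_0)
    qed
    then have "coeff (tt P) \<delta> = Cst (\<Sum>n\<in>msupp P. mcoeff H n * (\<Prod>i\<in>#n. x i))"
      by (simp add: e Polynomial.coeff_sum Cst.hom_sum del: mult_pCons_left)
    also have "(\<Sum>n\<in>msupp P. mcoeff H n * (\<Prod>i\<in>#n. x i)) = mev (\<lambda>a. a) x H"
      using mev_superset[of "msupp P" H "\<lambda>a. a" x] by (simp add: subset_iff in_keys_iff cH)
    finally show "coeff (tt P) \<delta> = Cst (mev (\<lambda>a. a) x H)" .
  qed
  define \<mu> where "\<mu> = mev (\<lambda>a. a) x H"
  \<comment> \<open>The top coefficient of \<open>tt P\<close> is the constant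
    \<open>\<mu> = H(x)\<close>, nonzero by choice of \<open>x\<close>; dividing by it makes the
    equation for \<open>v\<close> monic.\<close>
  define W where "W = smult (Cst (1 / \<mu>)) (tt P)"
  have W: "coeff W \<delta> = 1" "degree W = \<delta>"
  proof -
    show *: "coeff W \<delta> = 1" using xH by (simp add: W_def ttP(2) \<mu>_def flip: Cst.hom_mult)
    have "degree W \<le> \<delta>" unfolding W_def using ttP(1) degree_smult_le order.trans by blast
    moreover have "\<delta> \<le> degree W" using * by (intro le_degree) simp
    ultimately show "degree W = \<delta>" by simp
  qed
  have W0: "poly (map_poly ?t' W) [:v:] = 0"
  proof -
    interpret ev: comm_ring_hom "\<lambda>A. poly (map_poly ?t' A) [:v:]"
      by (rule comm_ring_hom_comp[OF comm_ring_hom_poly_eval comm_ring_hom_map_poly[OF gen_map_hom]])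
    have "W = [:Cst (1 / \<mu>):] * tt P" by (simp add: W_def)
    then show ?thesis using tt_ev[of P] P(2) by (simp only: ev.hom_mult) simp
  qed
  have red: "\<exists>r. ?t A = (\<Sum>j<\<delta>. ?t' (r j) * [:v:] ^ j)" for A
  proof -
    interpret ev: comm_ring_hom "\<lambda>A. poly (map_poly ?t' A) [:v:]"
      by (rule comm_ring_hom_comp[OF comm_ring_hom_poly_eval comm_ring_hom_map_poly[OF gen_map_hom]])
    obtain q r where qr: "pseudo_divmod (tt A) W = (q, r)" by fastforce
    have "W \<noteq> 0" using W by auto
    then have "tt A = W * q + r" "r = 0 \<or> degree r < \<delta>"
      using pseudo_divmod[OF _ qr] W by auto
    then have "?t A = poly (map_poly ?t' r) [:v:]"
      using W0 by (metis tt_ev ev.hom_add ev.hom_mult add_0 mult_zero_left)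
    also have "\<dots> = (\<Sum>j\<le>degree (map_poly ?t' r). ?t' (coeff r j) * [:v:] ^ j)"
      by (subst poly_altdef) (simp add: coeff_map_poly)
    also have "\<dots> = (\<Sum>j<\<delta>. ?t' (coeff r j) * [:v:] ^ j)"
    proof (cases "r = 0")
      case False
      then have d: "degree (map_poly ?t' r) < \<delta>"
        using \<open>r = 0 \<or> degree r < \<delta>\<close> degree_map_poly_le[of ?t' r] by linarith
      show ?thesis
      proof (rule sum.mono_neutral_left)
        show "\<forall>j\<in>{..<\<delta>} - {..degree (map_poly ?t' r)}. ?t' (coeff r j) * [:v:] ^ j = 0"
          using coeff_eq_0[of "map_poly ?t' r"] by (auto simp: coeff_map_poly)
      qed (use d in auto)
    qed simp
    finally show ?thesis by blast
  qed
  obtain I :: "nat list set" and e where I: "finite I" "\<And>x. \<exists>s. x = (\<Sum>i\<in>I. ?t (s i) * e i)"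
    using fin unfolding module_finite_def by blast
  obtain r where r: "\<And>A. ?t A = (\<Sum>j<\<delta>. ?t' (r A j) * [:v:] ^ j)" using red by metis
  define I' where "I' = (\<lambda>(j, i). j # i) ` ({..<\<delta>} \<times> I)"
  have inj: "inj_on (\<lambda>(j, i). j # i) ({..<\<delta>} \<times> I)" by (auto simp: inj_on_def)
  have gen: "\<exists>s. y = (\<Sum>i\<in>I'. ?t' (s i) * ([:v:] ^ hd i * e (tl i)))" for y
  proof -
    obtain s where s: "y = (\<Sum>i\<in>I. ?t (s i) * e i)" using I(2) by blast
    have "y = (\<Sum>i\<in>I. \<Sum>j<\<delta>. ?t' (r (s i) j) * ([:v:] ^ j * e i))"
      unfolding s by (rule sum.cong[OF refl]) (subst r, simp only: sum_distrib_right mult.assoc)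
    also have "\<dots> = (\<Sum>(j, i)\<in>{..<\<delta>} \<times> I. ?t' (r (s i) j) * ([:v:] ^ j * e i))"
      by (subst sum.swap) (simp add: sum.cartesian_product)
    also have "\<dots> = (\<Sum>i\<in>I'. ?t' (r (s (tl i)) (hd i)) * ([:v:] ^ hd i * e (tl i)))"
      unfolding I'_def by (subst sum.reindex[OF inj]) (auto intro!: sum.cong)
    finally show ?thesis by (intro exI[of _ "\<lambda>i. r (s (tl i)) (hd i)"])
  qed
  have "finite I'" using I(1) by (simp add: I'_def)
  then have "module_finite ?t'"
    unfolding module_finite_def
    by (intro exI[of _ I'] exI[of _ "\<lambda>i. [:v:] ^ hd i * e (tl i)"] conjI allI gen)
  then show ?thesis using lin' supp' by blast
qed


section \<open>A dimension count bounding the number of eliminations\<close>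

lemma size_le_counts:
  fixes a :: "nat multiset"
  assumes "set_mset a \<subseteq> {..<n}" "\<forall>i. count a i \<le> D"
  shows "size a \<le> n * D"
proof -
  have "size a = (\<Sum>i\<in>set_mset a. count a i)" by (simp add: size_multiset_overloaded_eq)
  also have "\<dots> \<le> (\<Sum>i<n. count a i)" by (rule sum_mono2) (use assms in auto)
  also have "\<dots> \<le> n * D" using sum_bounded_above[of "{..<n}" "count a" D] assms by simp
  finally show ?thesis .
qed

lemma card_multisets_lower:
  "finite {a :: nat multiset. set_mset a \<subseteq> {..<n} \<and> (\<forall>i. count a i \<le> D)}"
  "(D + 1) ^ n \<le> card {a :: nat multiset. set_mset a \<subseteq> {..<n} \<and> (\<forall>i. count a i \<le> D)}"
proof -
  let ?F = "{..<n} \<rightarrow>\<^sub>E {..D}" and ?M = "{a :: nat multiset. set_mset a \<subseteq> {..<n} \<and> (\<forall>i. count a i \<le> D)}"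
  define g where "g = (\<lambda>f. \<Sum>i<n. replicate_mset (f i) (i::nat))"
  have cg: "count (g f) i = (if i < n then f i else 0)" for f i
    by (auto simp: g_def count_sum)
  have "inj_on g ?F"
  proof (rule inj_onI)
    fix f f' assume ff: "f \<in> ?F" "f' \<in> ?F" and eq: "g f = g f'"
    show "f = f'"
    proof (rule PiE_ext[OF ff])
      fix i assume "i \<in> {..<n}"
      then show "f i = f' i" using cg[of f i] cg[of f' i] eq by simp
    qed
  qed
  moreover have "g ` ?F \<subseteq> ?M"
  proof safe
    fix f i assume "f \<in> ?F"
    then show "count (g f) i \<le> D" by (auto simp: cg PiE_iff)
    assume "i \<in># g f"
    then show "i < n" using cg[of f i] by (metis count_eq_zero_iff)
  qed
  moreover show finM: "finite ?M"
  proof -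
    have "?M \<subseteq> {a. set_mset a \<subseteq> {..<n} \<and> size a \<le> n * D}"
    proof safe
      fix a :: "nat multiset" assume a: "set_mset a \<subseteq> {..<n}" "\<forall>i. count a i \<le> D"
      then show "size a \<le> n * D" by (rule size_le_counts)
    qed
    moreover have "{a. set_mset a \<subseteq> {..<n} \<and> size a \<le> n * D} \<subseteq> mset ` {xs. set xs \<subseteq> {..<n} \<and> length xs \<le> n * D}"
    proof safe
      fix a :: "nat multiset" assume "set_mset a \<subseteq> {..<n}" "size a \<le> n * D"
      moreover obtain xs where "a = mset xs" by (metis ex_mset)
      ultimately show "a \<in> mset ` {xs. set xs \<subseteq> {..<n} \<and> length xs \<le> n * D}" by auto
    qed
    ultimately show ?thesis
      using finite_lists_length_le[of "{..<n}" "n * D"] by (meson finite_imageI finite_lessThan finite_subset)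
  qed
  ultimately have "card ?F \<le> card ?M" by (meson card_inj_on_le)
  then show "(D + 1) ^ n \<le> card ?M" by (simp add: card_PiE)
qed

lemma multisets_bounded:
  "finite {a :: nat multiset. set_mset a \<subseteq> {..<k} \<and> size a \<le> q}" (is "finite ?M")
  "card {a :: nat multiset. set_mset a \<subseteq> {..<k} \<and> size a \<le> q} \<le> (q + 1) ^ k"
proof -
  let ?F = "{..<k} \<rightarrow>\<^sub>E {..q}"
  define g where "g = (\<lambda>a :: nat multiset. restrict (count a) {..<k})"
  have inj: "inj_on g ?M"
  proof (rule inj_onI)
    fix a b assume a: "a \<in> ?M" and b: "b \<in> ?M" and eq: "g a = g b"
    show "a = b"
    proof (rule multiset_eqI)
      fix i
      show "count a i = count b i"
      proof (cases "i < k")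
        case True
        then show ?thesis using fun_cong[OF eq, of i] by (simp add: g_def)
      next
        case False
        then show ?thesis using a b by (metis (no_types, lifting) count_eq_zero_iff lessThan_iff mem_Collect_eq subsetD)
      qed
    qed
  qed
  have im: "g ` ?M \<subseteq> ?F"
  proof (rule image_subsetI)
    fix a assume "a \<in> ?M"
    then have "count a i \<le> q" for i using count_le_size[of a i] by auto
    then show "g a \<in> ?F" by (simp add: g_def restrict_PiE_iff)
  qed
  show "finite ?M" by (rule inj_on_finite[OF inj im]) (auto intro: finite_PiE)
  have "card ?M \<le> card ?F" by (rule card_inj_on_le[OF inj im]) (auto intro: finite_PiE)
  then show "card ?M \<le> (q + 1) ^ k" by (simp add: card_PiE)
qed

text \<open>A comparison of transcendence degrees, carried out by counting. Were
  \<open>c <= m\<close>, then after cutting down to finitely many variables, \<open>n + 1\<close>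
  variables would be finite over at most \<open>n\<close> generators. The monomials with all
  exponents at most \<open>D\<close>, of which there are at least \<open>(D + 1) ^ (n + 1)\<close>,
  would lie in a space of dimension at most a constant times \<open>(D + 1) ^ n\<close>.\<close>

lemma gen_map_module_finite_less:
  fixes f :: "nat \<Rightarrow> 'k::field mpoly"
  assumes supp: "\<exists>N. \<forall>i\<ge>N. l i = 0" and fin: "module_finite (gen_map f c m l)"
  shows "m < c"
proof (rule ccontr)
  assume "\<not> m < c"
  then have mc: "c \<le> m" by simp
  obtain N where N: "\<And>i. i \<ge> N \<Longrightarrow> l i = 0" using supp by blast
  let ?t = "gen_map f c m l"
  interpret t: comm_ring_hom ?t by (rule gen_map_hom)
  obtain I :: "nat list set" and e where I: "finite I" "\<And>x. \<exists>s. x = (\<Sum>i\<in>I. ?t (s i) * e i)"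
    using fin unfolding module_finite_def by blast
  \<comment> \<open>Beyond index \<open>N\<close> all linear forms vanish. Killing the variables
    from \<open>n\<close> on therefore kills exactly those generators that have index at least
    \<open>k\<close>, as far as needed here, and \<open>k <= n\<close> by the assumption
    \<open>c <= m\<close>.\<close>
  define n k where "n = m + N" and "k = c + N"
  have kn: "k \<le> n" using mc by (simp add: n_def k_def)
  \<comment> \<open>All variables of the truncated target: \<open>w j\<close> for
    \<open>j < n\<close> is an inner variable and \<open>w n\<close> is \<open>z\<close>.\<close>
  define w :: "nat \<Rightarrow> 'k mpoly poly" where "w = (\<lambda>j. if j < n then [:Var j:] else [:0, 1:])"
  define \<pi> :: "'k mpoly poly \<Rightarrow> 'k mpoly poly" where "\<pi> = map_poly (mev Cst (\<lambda>j. if j < n then Var j else 0))"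
  have p0: "comm_ring_hom (mev Cst (\<lambda>j. if j < n then Var j else 0 :: 'k mpoly))" by (rule mev_hom[OF Cst_hom])
  have p_hom: "comm_ring_hom \<pi>" unfolding \<pi>_def by (rule comm_ring_hom_map_poly[OF p0])
  interpret p0: comm_ring_hom "mev Cst (\<lambda>j. if j < n then Var j else 0 :: 'k mpoly)" by (rule p0)
  interpret p: comm_ring_hom \<pi> by (rule p_hom)
  have pw: "\<pi> (w j) = w j" for j
    by (auto simp: \<pi>_def w_def map_poly_pCons0 mev_Var)
  have pg: "\<pi> (gens f c m l i) = 0" if "i \<ge> k" for i
  proof -
    have "gens f c m l i = [:Var (m + (i - c)):]" "\<not> m + (i - c) < n"
      using that N[of i] by (auto simp: gens_def k_def n_def)
    then show ?thesis by (simp add: \<pi>_def map_poly_pCons0 mev_Var)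
  qed
  have pC: "\<pi> [:Cst a:] = [:Cst a:]" for a by (simp add: \<pi>_def map_poly_pCons0 mev_Cst)
  have pS: "\<pi> (smult (Cst a) x) = smult (Cst a) (\<pi> x)" for a x
    using p.hom_mult[of "[:Cst a:]" x] by (simp add: pC)
  obtain S where S: "\<And>x. x = (\<Sum>i\<in>I. ?t (S x i) * e i)" using I(2) by metis
  \<comment> \<open>Finitely many products \<open>w j * e i\<close>, together with 1, have to be
    expressed through the module generators; \<open>C\<close> bounds the degrees of all coefficients
    used.\<close>
  have "\<exists>C. \<forall>x\<in>insert 1 ((\<lambda>(j, i). w j * e i) ` ({..n} \<times> I)). \<forall>i\<in>I. mdeg_le C (S x i)"
  proof -
    let ?X = "insert 1 ((\<lambda>(j, i). w j * e i) ` ({..n} \<times> I))"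
    define b where "b = (\<lambda>x i. SOME d. mdeg_le d (S x i))"
    have b: "mdeg_le (b x i) (S x i)" for x i unfolding b_def by (rule someI_ex[OF mdeg_le_exists])
    have finX: "finite ?X" using I(1) by simp
    then have fin: "finite ((\<lambda>(x, i). b x i) ` (?X \<times> I))" using I(1) by blast
    have "mdeg_le (Max ((\<lambda>(x, i). b x i) ` (?X \<times> I))) (S x i)" if "x \<in> ?X" "i \<in> I" for x i
      by (rule mdeg_le_mono[OF b Max_ge[OF fin]]) (use that in force)
    then show ?thesis by blast
  qed
  then obtain C where C': "\<forall>x\<in>insert 1 ((\<lambda>(j, i). w j * e i) ` ({..n} \<times> I)). \<forall>i\<in>I. mdeg_le C (S x i)"
    by blast
  have C: "\<And>i. i \<in> I \<Longrightarrow> mdeg_le C (S 1 i)"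
    "\<And>j i i'. j \<le> n \<Longrightarrow> i \<in> I \<Longrightarrow> i' \<in> I \<Longrightarrow> mdeg_le C (S (w j * e i) i')"
    using C' by auto
  \<comment> \<open>Each further factor \<open>w j\<close> is absorbed by re-expanding
    \<open>w j * e i\<close>, at the cost of \<open>C\<close> more in degree: the degrees grow only
    linearly in the length of the word.\<close>
  have word: "\<exists>A. (\<Prod>j\<in>#\<alpha>. w j) = (\<Sum>i\<in>I. ?t (A i) * e i) \<and> (\<forall>i\<in>I. mdeg_le (C * (size \<alpha> + 1)) (A i))"
    if "set_mset \<alpha> \<subseteq> {..n}" for \<alpha>
    using that
  proof (induction \<alpha>)
    case empty
    show ?case using S[of 1] C(1) by (intro exI[of _ "S 1"]) simp
  next
    case (add j \<alpha>)
    then obtain A where A: "(\<Prod>j\<in>#\<alpha>. w j) = (\<Sum>i\<in>I. ?t (A i) * e i)" "\<And>i. i \<in> I \<Longrightarrow> mdeg_le (C * (size \<alpha> + 1)) (A i)"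
      by auto
    have "(\<Prod>j\<in>#add_mset j \<alpha>. w j) = (\<Sum>i\<in>I. ?t (A i) * (w j * e i))"
      by (simp add: A(1) sum_distrib_left ac_simps)
    also have "\<dots> = (\<Sum>i\<in>I. \<Sum>i'\<in>I. ?t (A i * S (w j * e i) i') * e i')"
      by (rule sum.cong[OF refl]) (subst S[of "w j * _"], simp only: sum_distrib_left t.hom_mult mult.assoc)
    also have "\<dots> = (\<Sum>i'\<in>I. ?t (\<Sum>i\<in>I. A i * S (w j * e i) i') * e i')"
      by (subst sum.swap) (simp add: t.hom_sum sum_distrib_right)
    finally have eq: "(\<Prod>j\<in>#add_mset j \<alpha>. w j) = \<dots>" .
    have "mdeg_le (C * (size (add_mset j \<alpha>) + 1)) (\<Sum>i\<in>I. A i * S (w j * e i) i')" if "i' \<in> I" for i'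
    proof (rule mdeg_le_sum)
      fix i assume "i \<in> I"
      then have "mdeg_le (C * (size \<alpha> + 1) + C) (A i * S (w j * e i) i')"
        using add.prems that by (intro mdeg_le_mult A C) auto
      then show "mdeg_le (C * (size (add_mset j \<alpha>) + 1)) (A i * S (w j * e i) i')" by (simp add: algebra_simps)
    qed
    with eq show ?case by (intro exI[of _ "\<lambda>i'. \<Sum>i\<in>I. A i * S (w j * e i) i'"]) blast
  qed
  interpret V: vector_space "\<lambda>a. smult (Cst (a::'k))"
    by unfold_locales (auto simp: Cst.hom_add Cst.hom_mult smult_add_left smult_add_right)
  define T where "T = (\<lambda>q. (\<lambda>(b, i). (\<Prod>j\<in>#b. \<pi> (gens f c m l j)) * \<pi> (e i)) ` ({b. set_mset b \<subseteq> {..<k} \<and> size b \<le> q} \<times> I))"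
  have finT: "finite (T q)" for q unfolding T_def using I(1) multisets_bounded(1) by blast
  have cardT: "card (T q) \<le> (q + 1) ^ k * card I" for q
    unfolding T_def
    by (rule order.trans[OF card_image_le]) (use I(1) multisets_bounded in \<open>auto simp: card_cartesian_product\<close>)
  have spanT: "\<pi> (?t A) * \<pi> (e i) \<in> V.span (T q)" if "mdeg_le q A" "i \<in> I" for A q i
  proof -
    have "\<pi> (?t A) = (\<Sum>b\<in>msupp A. smult (Cst (mcoeff A b)) (\<Prod>j\<in>#b. \<pi> (gens f c m l j)))"
      by (simp add: gen_map_def mev_def p.hom_sum pS p.hom_prod_mset image_mset.compositionality o_def)
    then have "\<pi> (?t A) * \<pi> (e i) = (\<Sum>b\<in>msupp A. smult (Cst (mcoeff A b)) ((\<Prod>j\<in>#b. \<pi> (gens f c m l j)) * \<pi> (e i)))"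
      by (simp add: sum_distrib_right)
    also have "\<dots> \<in> V.span (T q)"
    proof (intro V.span_sum V.span_scale)
      fix b assume b: "b \<in> msupp A"
      show "(\<Prod>j\<in>#b. \<pi> (gens f c m l j)) * \<pi> (e i) \<in> V.span (T q)"
      proof (cases "set_mset b \<subseteq> {..<k}")
        case True
        then show ?thesis using b that by (intro V.span_base) (auto simp: T_def mdeg_le_def)
      next
        case False
        then obtain j where j: "j \<in># b" "k \<le> j" by (meson lessThan_iff not_less subsetI)
        from multi_member_split[OF j(1)] obtain b' where "b = add_mset j b'" by blast
        then have "(\<Prod>j\<in>#b. \<pi> (gens f c m l j)) = 0" using pg[OF j(2)] by simp
        then show ?thesis by (simp only: mult_zero_left V.span_zero)
      qed
    qed
    finally show ?thesis .
  qed
  \<comment> \<open>Independent monomials inside the span of \<open>T q\<close>, with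
    \<open>q\<close> linear in \<open>D\<close>; after cancelling \<open>(D + 1) ^ n\<close> one
    factor \<open>D + 1\<close> is left on the smaller side.\<close>
  have main: "D + 1 \<le> (C * (n + 2) + 1) ^ n * card I" for D
  proof -
    define M where "M = {a :: nat multiset. set_mset a \<subseteq> {..<n} \<and> (\<forall>i. count a i \<le> D)}"
    define q where "q = C * ((n + 1) * D + 1)"
    define mon :: "nat multiset \<times> nat \<Rightarrow> 'k mpoly poly" where "mon = (\<lambda>(a, j). Polynomial.monom (mterm a 1) j)"
    have mon_span: "mon (a, j) \<in> V.span (T q)" if a: "a \<in> M" and j: "j \<le> D" for a j
    proof -
      let ?\<alpha> = "a + replicate_mset j n"
      have sa: "set_mset ?\<alpha> \<subseteq> {..n}" using a by (auto simp: M_def split: if_splits)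
      have "size a \<le> n * D" using a size_le_counts unfolding M_def by blast
      then have sz: "size ?\<alpha> \<le> (n + 1) * D"
        unfolding size_union size_replicate_mset add_mult_distrib mult_1 using j by (rule add_mono)
      have "(\<Prod>j\<in>#x. w j) = [:mterm x 1:]" if "set_mset x \<subseteq> {..<n}" for x
        using that
      proof (induction x)
        case (add y x)
        then have "w y * (\<Prod>j\<in>#x. w j) = [:mterm {#y#} 1:] * [:mterm x 1:]" by (simp add: w_def Var_def)
        also have "\<dots> = [:mterm (add_mset y x) 1:]" by (simp add: mult_single)
        finally show ?case by simp
      qed simp
      then have wa: "(\<Prod>j\<in>#a. w j) = [:mterm a 1:]" using a unfolding M_def by blast
      have wn: "w n = [:0, 1:]" by (simp add: w_def)
      have mon_eq: "mon (a, j) = (\<Prod>j\<in>#?\<alpha>. w j)"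
        unfolding mon_def image_mset_union prod_mset.union wa image_replicate_mset prod_mset_replicate_mset wn
        by (simp add: monom_altdef)
      from word[OF sa] obtain A where "(\<Prod>j\<in>#?\<alpha>. w j) = (\<Sum>i\<in>I. ?t (A i) * e i) \<and> (\<forall>i\<in>I. mdeg_le (C * (size ?\<alpha> + 1)) (A i))"
        by (rule exE)
      note A = conjunct1[OF this] conjunct2[OF this, rule_format]
      have "mon (a, j) = \<pi> (\<Prod>j\<in>#?\<alpha>. w j)"
        unfolding mon_eq by (simp add: p.hom_mult p.hom_prod_mset image_mset.compositionality o_def pw p.hom_power)
      also have "\<dots> = (\<Sum>i\<in>I. \<pi> (?t (A i)) * \<pi> (e i))" by (simp only: A(1) p.hom_sum p.hom_mult)
      also have "\<dots> \<in> V.span (T q)"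
        by (intro V.span_sum spanT mdeg_le_mono[OF A(2)]) (use sz in \<open>auto simp: q_def\<close>)
      finally show ?thesis .
    qed
    have inj: "inj_on mon (M \<times> {..D})"
    proof (rule inj_onI, clarify)
      fix a j a' j' assume eq: "mon (a, j) = mon (a', j')"
      have "mcoeff (coeff (mon (a, j)) j) a = 1" by (simp add: mon_def)
      then have "mcoeff (coeff (mon (a', j')) j) a = 1" by (simp only: eq)
      then show "a = a' \<and> j = j'" by (auto simp: mon_def lookup_single when_def split: if_splits)
    qed
    have finM: "finite M" unfolding M_def by (rule card_multisets_lower(1))
    have "V.independent (mon ` (M \<times> {..D}))"
    proof -
      have "\<forall>v\<in>mon ` (M \<times> {..D}). u v = 0"
        if u: "(\<Sum>v\<in>mon ` (M \<times> {..D}). smult (Cst (u v)) v) = 0" for u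
      proof (clarify)
        fix a j assume aj: "a \<in> M" "j \<le> D"
        have "0 = mcoeff (coeff (\<Sum>v\<in>mon ` (M \<times> {..D}). smult (Cst (u v)) v) j) a" by (simp add: u)
        also have "\<dots> = (\<Sum>x\<in>M \<times> {..D}. u (mon x) * mcoeff (coeff (mon x) j) a)"
          by (simp add: sum.reindex[OF inj] Polynomial.coeff_sum lookup_sum Cst_times_coeff)
        also have "\<dots> = (\<Sum>x\<in>M \<times> {..D}. if x = (a, j) then u (mon x) else 0)"
          by (intro sum.cong refl) (auto simp: mon_def lookup_single when_def split: if_splits)
        also have "\<dots> = u (mon (a, j))" using aj finM by simp
        finally show "u (mon (a, j)) = 0" ..
      qed
      then show ?thesis using finM by (subst V.dependent_finite) auto
    qed
    moreover have "mon ` (M \<times> {..D}) \<subseteq> V.span (T q)" using mon_span by auto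
    ultimately have "card (mon ` (M \<times> {..D})) \<le> card (T q)"
      using V.independent_span_bound[OF finT] by blast
    then have le1: "card M * (D + 1) \<le> (q + 1) ^ k * card I"
      using cardT[of q] by (simp add: card_image[OF inj] card_cartesian_product)
    have "(D + 1) ^ n \<le> card M" unfolding M_def by (rule card_multisets_lower(2))
    then have "(D + 1) ^ n * (D + 1) \<le> (q + 1) ^ k * card I"
      by (rule order.trans[OF mult_le_mono1 le1])
    also have "\<dots> \<le> (q + 1) ^ n * card I" by (intro mult_right_mono power_increasing kn) auto
    also have "\<dots> \<le> ((C * (n + 2) + 1) * (D + 1)) ^ n * card I"
      by (intro mult_right_mono power_mono) (auto simp: q_def algebra_simps)
    finally have "(D + 1) ^ n * (D + 1) \<le> (D + 1) ^ n * ((C * (n + 2) + 1) ^ n * card I)"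
      by (simp only: power_mult_distrib ac_simps)
    then show ?thesis by (rule mult_left_le_imp_le) simp
  qed
  define X where "X = (C * (n + 2) + 1) ^ n * card I"
  have "X + 1 \<le> X" unfolding X_def by (rule main)
  then show False by linarith
qed


section \<open>Monic relations and the cofactors they yield\<close>

text \<open>The determinant trick: multiplication by \<open>z\<close> acts on the module generators
  through a matrix over the source ring. Its characteristic polynomial is monic and annihilates
  \<open>z\<close>, because the vector of generators lies in the kernel of \<open>z\<close> minus
  the image matrix and the target is a domain.\<close>

lemma monic_relation_of_module_finite:
  fixes \<theta> :: "'a::comm_ring_1 \<Rightarrow> 'd::idom"
  assumes hom: "comm_ring_hom \<theta>" and fin: "module_finite \<theta>"
  shows "\<exists>H. lead_coeff H = 1 \<and> poly (map_poly \<theta> H) z = 0"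
proof -
  interpret t: comm_ring_hom \<theta> by fact
  obtain I :: "nat list set" and e where I: "finite I" "\<And>x. \<exists>s. x = (\<Sum>i\<in>I. \<theta> (s i) * e i)"
    using fin unfolding module_finite_def by blast
  obtain h where h: "bij_betw h {..<card I} I"
    using ex_bij_betw_nat_finite[OF I(1)] by (auto simp: atLeast0LessThan)
  define q where "q = card I"
  define S where "S = (\<lambda>x. SOME s. x = (\<Sum>i\<in>I. \<theta> (s i) * e i))"
  have S: "x = (\<Sum>i\<in>I. \<theta> (S x i) * e i)" for x
    unfolding S_def by (rule someI_ex[OF I(2)])
  have Sq: "x = (\<Sum>j<q. \<theta> (S x (h j)) * e (h j))" for x
    using S[of x] sum.reindex_bij_betw[OF h, of "\<lambda>i. \<theta> (S x i) * e i"] by (simp only: q_def)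
  define A where "A = mat q q (\<lambda>(i, j). S (z * e (h i)) (h j))"
  have A: "A \<in> carrier_mat q q" by (simp add: A_def)
  define B where "B = mat q q (\<lambda>(i, j). (if i = j then z else 0) - \<theta> (S (z * e (h i)) (h j)))"
  have B: "B \<in> carrier_mat q q" by (simp add: B_def)
  define v where "v = vec q (\<lambda>j. e (h j))"
  \<comment> \<open>Otherwise all generators would vanish, although 1 is a combination of
    them.\<close>
  have "v \<noteq> 0\<^sub>v q"
  proof
    assume "v = 0\<^sub>v q"
    then have "e (h j) = 0" if "j < q" for j using that by (metis index_vec index_zero_vec(1) v_def)
    then have "(1::'d) = 0" using Sq[of 1] by simp
    then show False by simp
  qed
  moreover have "B *\<^sub>v v = 0\<^sub>v q"
  proof (rule eq_vecI)
    fix i assume i: "i < dim_vec (0\<^sub>v q)"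
    then have "(B *\<^sub>v v) $ i = (\<Sum>j<q. ((if i = j then z else 0) - \<theta> (S (z * e (h i)) (h j))) * e (h j))"
      by (simp add: B_def v_def scalar_prod_def atLeast0LessThan)
    also have "\<dots> = (\<Sum>j<q. (if i = j then z * e (h j) else 0)) - (\<Sum>j<q. \<theta> (S (z * e (h i)) (h j)) * e (h j))"
      by (simp add: left_diff_distrib sum_subtractf if_distrib[of "\<lambda>x. x * _"] cong: if_cong)
    also have "\<dots> = 0" using i Sq[of "z * e (h i)"] by simp
    finally show "(B *\<^sub>v v) $ i = 0\<^sub>v q $ i" using i by simp
  qed (simp add: B_def)
  moreover have "v \<in> carrier_vec q" by (simp add: v_def)
  ultimately have "det B = 0" using det_0_iff_vec_prod_zero[OF B] by blast
  moreover have "poly (char_poly (map_mat \<theta> A)) z = det B"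
    unfolding char_poly_def
    by (rule poly_det_cong[OF B]) (auto simp: A_def B_def char_poly_matrix_def)
  ultimately have "poly (map_poly \<theta> (char_poly A)) z = 0" by (simp add: t.char_poly_hom[OF A])
  moreover have "lead_coeff (char_poly A) = 1" using degree_monic_char_poly[OF A] by simp
  ultimately show ?thesis by blast
qed

text \<open>Every generator is at most linear in \<open>z\<close>, and its coefficient of
  \<open>z\<close> is some \<open>f i\<close> or 0. Expanding a product, each positive power of
  \<open>z\<close> must have picked such a coefficient at least once, while every factor contributes
  degree at most \<open>d\<close>.\<close>

lemma gens_coeff_ideal:
  fixes f :: "nat \<Rightarrow> 'k::comm_ring_1 mpoly"
  assumes f: "\<And>j. j < c \<Longrightarrow> mdeg_le d (f j)" and d: "1 \<le> d" and l: "\<And>i. mdeg_le 1 (l i)"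
    and A: "mdeg_le e A" and k: "1 \<le> k"
  shows "\<exists>g. coeff (gen_map f c m l A) k = (\<Sum>j<c. g j * f j) \<and> (\<forall>j. mdeg_le (e * d) (g j))"
proof -
  \<comment> \<open>The elements of the ideal of the \<open>f j\<close> that have cofactors of
    degree at most \<open>e\<close>.\<close>
  define Id where "Id = (\<lambda>e. {x. \<exists>g. x = (\<Sum>j<c. g j * f j) \<and> (\<forall>j. mdeg_le e (g j))})"
  have Id_add: "x + y \<in> Id e" if "x \<in> Id e" "y \<in> Id e" for x y e
  proof -
    obtain g g' where "x = (\<Sum>j<c. g j * f j)" "y = (\<Sum>j<c. g' j * f j)" "\<forall>j. mdeg_le e (g j)" "\<forall>j. mdeg_le e (g' j)"
      using \<open>x \<in> Id e\<close> \<open>y \<in> Id e\<close> by (auto simp: Id_def)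
    then have "x + y = (\<Sum>j<c. (g j + g' j) * f j) \<and> (\<forall>j. mdeg_le e (g j + g' j))"
      by (auto simp: distrib_right sum.distrib intro: mdeg_le_add)
    then show ?thesis unfolding Id_def mem_Collect_eq by (intro exI[of _ "\<lambda>j. g j + g' j"])
  qed
  have Id_mult: "y * x \<in> Id (e' + e)" if "x \<in> Id e" "mdeg_le e' y" for x y e e'
  proof -
    obtain g where "x = (\<Sum>j<c. g j * f j)" "\<forall>j. mdeg_le e (g j)" using \<open>x \<in> Id e\<close> by (auto simp: Id_def)
    then have "y * x = (\<Sum>j<c. (y * g j) * f j) \<and> (\<forall>j. mdeg_le (e' + e) (y * g j))"
      using \<open>mdeg_le e' y\<close> by (auto simp: sum_distrib_left mult.assoc intro: mdeg_le_mult)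
    then show ?thesis unfolding Id_def mem_Collect_eq by (intro exI[of _ "\<lambda>j. y * g j"])
  qed
  have Id_mono: "x \<in> Id e'" if "x \<in> Id e" "e \<le> e'" for x e e'
    using that by (auto simp: Id_def intro: mdeg_le_mono)
  have Id_gen: "y * f i \<in> Id e" if "mdeg_le e y" "i < c" for y i e
  proof -
    have "(\<Sum>j<c. (if j = i then y else 0) * f j) = y * f i"
      using that by (simp add: if_distrib[of "\<lambda>x. x * _"] cong: if_cong)
    then show ?thesis using that unfolding Id_def mem_Collect_eq
      by (intro exI[of _ "\<lambda>j. if j = i then y else 0"]) auto
  qed
  have Id_0: "0 \<in> Id e" for e unfolding Id_def mem_Collect_eq by (intro exI[of _ "\<lambda>_. 0"]) simp
  have gd: "mdeg_le d (coeff (gens f c m l i) 0)" "mdeg_le d (coeff (gens f c m l i) 1)"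
      "i < c \<Longrightarrow> coeff (gens f c m l i) 1 = f i" "\<not> i < c \<Longrightarrow> coeff (gens f c m l i) 1 = 0"
      "\<And>k. 2 \<le> k \<Longrightarrow> coeff (gens f c m l i) k = 0" for i
    using mdeg_le_mono[OF l d] f d
    by (auto simp: gens_def coeff_pCons intro!: mdeg_le_add mdeg_le_Var split: nat.splits)
  have prod: "mdeg_le (size n * d) (coeff (\<Prod>i\<in>#n. gens f c m l i) 0) \<and>
      (\<forall>k\<ge>1. coeff (\<Prod>i\<in>#n. gens f c m l i) k \<in> Id (size n * d))" for n
  proof (induction n)
    case empty
    then show ?case by (auto simp: Id_0)
  next
    case (add i n)
    let ?p = "\<Prod>i\<in>#n. gens f c m l i" and ?g = "gens f c m l i"
    have c0: "coeff (?g * ?p) 0 = coeff ?g 0 * coeff ?p 0" by (simp add: coeff_mult)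
    have cS: "coeff (?g * ?p) (Suc k) = coeff ?g 0 * coeff ?p (Suc k) + coeff ?g 1 * coeff ?p k" for k
    proof -
      have "coeff (?g * ?p) (Suc k) = (\<Sum>j\<le>Suc k. coeff ?g j * coeff ?p (Suc k - j))" by (simp add: coeff_mult)
      also have "\<dots> = (\<Sum>j\<in>{0, 1}. coeff ?g j * coeff ?p (Suc k - j))"
        by (rule sum.mono_neutral_right) (auto simp: gd(5))
      finally show ?thesis by simp
    qed
    have "coeff ?g 0 * coeff ?p (Suc k) + coeff ?g 1 * coeff ?p k \<in> Id (d + size n * d)" for k
    proof (rule Id_add)
      show "coeff ?g 0 * coeff ?p (Suc k) \<in> Id (d + size n * d)"
        by (rule Id_mult[OF _ gd(1)]) (use add in auto)
      show "coeff ?g 1 * coeff ?p k \<in> Id (d + size n * d)"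
      proof (cases k)
        case 0
        show ?thesis
        proof (cases "i < c")
          case True
          have "coeff ?p 0 * f i \<in> Id (d + size n * d)"
            by (rule Id_gen[OF mdeg_le_mono[OF conjunct1[OF add]] True]) simp
          then show ?thesis using gd(3)[OF True] 0 by (simp add: mult.commute)
        next
          case False
          then show ?thesis using gd(4)[OF False] Id_0 by simp
        qed
      next
        case (Suc k')
        then show ?thesis by (intro Id_mult gd(2)) (use add in auto)
      qed
    qed
    then have "coeff (?g * ?p) k \<in> Id (d + size n * d)" if "k \<ge> 1" for k
      using that cS by (cases k) auto
    moreover have "mdeg_le (d + size n * d) (coeff (?g * ?p) 0)"
      unfolding c0 by (rule mdeg_le_mult[OF gd(1)]) (use add in auto)
    ultimately show ?case by simp
  qed
  have tm: "coeff ([:Cst (mcoeff A n):] * (\<Prod>i\<in>#n. gens f c m l i)) k \<in> Id (e * d)" if n: "n \<in> msupp A" for n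
  proof -
    have "Cst (mcoeff A n) * coeff (\<Prod>i\<in>#n. gens f c m l i) k \<in> Id (0 + size n * d)"
      by (rule Id_mult[OF _ mdeg_le_Cst]) (use prod k in auto)
    moreover have "size n \<le> e" using n A by (auto simp: mdeg_le_def)
    ultimately show ?thesis by (auto intro: Id_mono)
  qed
  have "coeff (\<Sum>n\<in>S. [:Cst (mcoeff A n):] * (\<Prod>i\<in>#n. gens f c m l i)) k \<in> Id (e * d)"
    if "finite S" "S \<subseteq> msupp A" for S
    using that
  proof (induction S rule: finite_induct)
    case (insert n S)
    then have S: "n \<in> msupp A" "S \<subseteq> msupp A" by auto
    show ?case unfolding sum.insert[OF insert(1,2)] Polynomial.coeff_add
      by (rule Id_add[OF tm[OF S(1)] insert(3)[OF S(2)]])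
  qed (simp add: Id_0)
  then have "coeff (gen_map f c m l A) k \<in> Id (e * d)" unfolding gen_map_def mev_def by (simp only: finite_keys order_refl)
  then show ?thesis by (simp add: Id_def)
qed

lemma mdeg_le_linform: "linform m L \<Longrightarrow> mdeg_le 1 L"
proof -
  assume "linform m L"
  then obtain a where L: "L = (\<Sum>j<m. Cst (a j) * Var j)" by (auto simp: linform_def)
  have "mdeg_le (0 + 1) (Cst x * Var j)" for x :: 'a and j
    by (intro mdeg_le_mult mdeg_le_Cst mdeg_le_Var) simp
  then show ?thesis unfolding L by (intro mdeg_le_sum) simp
qed

text \<open>
  Comparing coefficients of \<open>z\<^sup>N\<close> in a monic equation \<open>z\<^sup>N + \<Sum>\<^sub>j\<^sub><\<^sub>N \<theta>(R\<^sub>j) z\<^sup>j = 0\<close>: every positive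
  power of \<open>z\<close> in \<open>\<theta>(R\<^sub>j)\<close> carries a factor \<open>f\<^sub>i\<close>.
\<close>

lemma unit_ideal_of_monic_relation:
  fixes f :: "nat \<Rightarrow> 'k::comm_ring_1 mpoly"
  assumes f: "\<And>j. j < c \<Longrightarrow> mdeg_le d (f j)" and d: "1 \<le> d" and l: "\<And>i. linform m (l i)"
    and R: "lead_coeff R = 1" "poly (map_poly (gen_map f c m l) R) [:0, 1:] = 0" "\<And>j. mdeg_le e (coeff R j)"
  shows "\<exists>g. (\<Sum>j<c. g j * f j) = 1 \<and> (\<forall>j. mdeg_le (e * d) (g j))"
proof -
  let ?t = "gen_map f c m l"
  interpret t: comm_ring_hom ?t by (rule gen_map_hom)
  define N where "N = degree R"
  have "degree (map_poly ?t R) \<le> N" unfolding N_def by (rule degree_map_poly_le)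
  have "0 = (\<Sum>j\<le>degree (map_poly ?t R). ?t (coeff R j) * [:0, 1:] ^ j)"
    using R(2) by (simp add: poly_altdef coeff_map_poly)
  also have "\<dots> = (\<Sum>j\<le>N. ?t (coeff R j) * [:0, 1:] ^ j)"
  proof (rule sum.mono_neutral_left)
    show "\<forall>j\<in>{..N} - {..degree (map_poly ?t R)}. ?t (coeff R j) * [:0, 1:] ^ j = 0"
      using coeff_eq_0[of "map_poly ?t R"] by (auto simp: coeff_map_poly)
  qed (use \<open>degree (map_poly ?t R) \<le> N\<close> in auto)
  finally have "0 = coeff (\<Sum>j\<le>N. ?t (coeff R j) * [:0, 1:] ^ j) N" by (metis coeff_0)
  also have "\<dots> = (\<Sum>j\<le>N. coeff (?t (coeff R j)) (N - j))"
    unfolding Polynomial.coeff_sum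
  proof (rule sum.cong[OF refl])
    fix j assume "j \<in> {..N}"
    have "[:0, 1:] ^ j = Polynomial.monom (1 :: 'k mpoly) j" by (simp add: monom_altdef)
    then have "?t (coeff R j) * [:0, 1:] ^ j = Polynomial.monom 1 j * ?t (coeff R j)" by (simp add: mult.commute)
    then show "coeff (?t (coeff R j) * [:0, 1:] ^ j) N = coeff (?t (coeff R j)) (N - j)"
      using \<open>j \<in> {..N}\<close> by (simp add: coeff_monom_mult)
  qed
  also have "\<dots> = (\<Sum>j<N. coeff (?t (coeff R j)) (N - j)) + 1"
    using R(1) by (simp add: N_def lessThan_Suc_atMost[symmetric])
  finally have eq: "1 = (\<Sum>j<N. - coeff (?t (coeff R j)) (N - j))"
    by (simp add: sum_negf eq_neg_iff_add_eq_0 add.commute)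
  have "\<exists>g. coeff (?t (coeff R j)) (N - j) = (\<Sum>i<c. g i * f i) \<and> (\<forall>i. mdeg_le (e * d) (g i))" if "j < N" for j
    by (rule gens_coeff_ideal[OF f d mdeg_le_linform[OF l] R(3)]) (use that in auto)
  then obtain g where g: "\<And>j. j < N \<Longrightarrow> coeff (?t (coeff R j)) (N - j) = (\<Sum>i<c. g j i * f i)"
      "\<And>j i. j < N \<Longrightarrow> mdeg_le (e * d) (g j i)"
    by metis
  have "1 = (\<Sum>j<N. \<Sum>i<c. - g j i * f i)" unfolding eq by (simp add: g sum_negf)
  also have "\<dots> = (\<Sum>i<c. (\<Sum>j<N. - g j i) * f i)" by (subst sum.swap) (simp add: sum_distrib_right)
  finally have "(\<Sum>i<c. (\<Sum>j<N. - g j i) * f i) = 1" by simp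
  moreover have "mdeg_le (e * d) (\<Sum>j<N. - g j i)" for i
    by (intro mdeg_le_sum mdeg_le_uminus g(2)) auto
  ultimately show ?thesis by (intro exI[of _ "\<lambda>i. \<Sum>j<N. - g j i"]) blast
qed


section \<open>A small relation for \<open>z\<close>, by counting monomials\<close>

text \<open>
  \<open>rep f c m l a b e\<close> consists of the combinations of the monomials \<open>x\<^sup>\<alpha> z\<^sup>j\<close> in the eliminated
  variables, with \<open>|\<alpha>| \<le> a\<close> and \<open>j \<le> b\<close>, whose coefficients are polynomials of degree at most \<open>e\<close>
  in the generators from number \<open>c\<close> on.
\<close>

definition tail_polys :: "nat \<Rightarrow> nat \<Rightarrow> 'k::zero mpoly set" where
  "tail_polys c e = {A. mdeg_le e A \<and> mvars_in {c..} A}"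

definition rep_index :: "nat \<Rightarrow> nat \<Rightarrow> nat \<Rightarrow> (nat multiset \<times> nat) set" where
  "rep_index m a b = {\<alpha>. set_mset \<alpha> \<subseteq> {..<m} \<and> size \<alpha> \<le> a} \<times> {..b}"

definition rep_mon :: "nat multiset \<times> nat \<Rightarrow> 'k::comm_ring_1 mpoly poly" where
  "rep_mon p = Polynomial.monom (mterm (fst p) 1) (snd p)"

definition rep :: "(nat \<Rightarrow> 'k::comm_ring_1 mpoly) \<Rightarrow> nat \<Rightarrow> nat \<Rightarrow> (nat \<Rightarrow> 'k mpoly) \<Rightarrow> nat \<Rightarrow> nat \<Rightarrow> nat \<Rightarrow> 'k mpoly poly set" where
  "rep f c m l a b e = {x. \<exists>r. (\<forall>p. r p \<in> tail_polys c e) \<and> x = (\<Sum>p\<in>rep_index m a b. gen_map f c m l (r p) * rep_mon p)}"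

lemma tail_polys_closed:
  fixes A B :: "'k::comm_ring_1 mpoly" and a :: 'k
  shows "0 \<in> (tail_polys c e :: 'k mpoly set)" "1 \<in> (tail_polys c e :: 'k mpoly set)" "Cst a \<in> tail_polys c e"
    "A \<in> tail_polys c e \<Longrightarrow> B \<in> tail_polys c e \<Longrightarrow> A + B \<in> tail_polys c e"
    "A \<in> tail_polys c e \<Longrightarrow> B \<in> tail_polys c e \<Longrightarrow> A - B \<in> tail_polys c e"
    "A \<in> tail_polys c e \<Longrightarrow> B \<in> tail_polys c e' \<Longrightarrow> A * B \<in> tail_polys c (e + e')"
    "e \<le> e' \<Longrightarrow> tail_polys c e \<subseteq> (tail_polys c e' :: 'k mpoly set)"
proof -
  show "A - B \<in> tail_polys c e" if "A \<in> tail_polys c e" "B \<in> tail_polys c e" for A B :: "'k mpoly"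
    using that mvars_in_add[of "{c..}" A "- B"] mvars_in_uminus[of "{c..}" B]
    by (auto simp: tail_polys_def mdeg_le_diff)
qed (auto simp: tail_polys_def intro: mdeg_le_add mvars_in_add mdeg_le_mult mvars_in_mult mdeg_le_mono)

lemma finite_rep_index: "finite (rep_index m a b)"
  unfolding rep_index_def using multisets_bounded(1) by blast

lemma card_rep_index: "card (rep_index m a b) \<le> (a + 1) ^ m * (b + 1)"
  unfolding rep_index_def card_cartesian_product card_atMost Suc_eq_plus1
  by (rule mult_le_mono1[OF multisets_bounded(2)])

lemma rep_add:
  assumes "x \<in> rep f c m l a b e" "y \<in> rep f c m l a b e"
  shows "x + y \<in> rep f c m l a b e"
proof -
  interpret t: comm_ring_hom "gen_map f c m l" by (rule gen_map_hom)
  obtain r r' where "\<forall>p. r p \<in> tail_polys c e" "\<forall>p. r' p \<in> tail_polys c e"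
    "x = (\<Sum>p\<in>rep_index m a b. gen_map f c m l (r p) * rep_mon p)"
    "y = (\<Sum>p\<in>rep_index m a b. gen_map f c m l (r' p) * rep_mon p)"
    using assms unfolding rep_def by blast
  then have "(\<forall>p. r p + r' p \<in> tail_polys c e) \<and>
      x + y = (\<Sum>p\<in>rep_index m a b. gen_map f c m l (r p + r' p) * rep_mon p)"
    by (simp add: tail_polys_closed t.hom_add distrib_right sum.distrib)
  then show ?thesis unfolding rep_def mem_Collect_eq by (intro exI[of _ "\<lambda>p. r p + r' p"])
qed

lemma rep_0: "0 \<in> rep f c m l a b e"
proof -
  interpret t: comm_ring_hom "gen_map f c m l" by (rule gen_map_hom)
  show ?thesis unfolding rep_def mem_Collect_eq by (intro exI[of _ "\<lambda>p. 0"]) (simp add: tail_polys_closed)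
qed

lemma rep_sum: "(\<And>i. i \<in> S \<Longrightarrow> x i \<in> rep f c m l a b e) \<Longrightarrow> sum x S \<in> rep f c m l a b e"
  by (induction S rule: infinite_finite_induct) (auto intro: rep_0 rep_add)

lemma rep_mon_in:
  assumes "p \<in> rep_index m a b" "A \<in> tail_polys c e"
  shows "gen_map f c m l A * rep_mon p \<in> rep f c m l a b e"
proof -
  interpret t: comm_ring_hom "gen_map f c m l" by (rule gen_map_hom)
  have "(\<Sum>p'\<in>rep_index m a b. gen_map f c m l (if p' = p then A else 0) * rep_mon p')
      = (\<Sum>p'\<in>rep_index m a b. if p' = p then gen_map f c m l A * rep_mon p else 0)"
    by (rule sum.cong) auto
  also have "\<dots> = gen_map f c m l A * rep_mon p" using assms(1) finite_rep_index by simp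
  finally show ?thesis using assms(2) unfolding rep_def mem_Collect_eq
    by (intro exI[of _ "\<lambda>p'. if p' = p then A else 0"]) (simp add: tail_polys_closed)
qed

lemma rep_mult:
  assumes "x \<in> rep f c m l a b e" "y \<in> rep f c m l a' b' e'"
  shows "x * y \<in> rep f c m l (a + a') (b + b') (e + e')"
proof -
  interpret t: comm_ring_hom "gen_map f c m l" by (rule gen_map_hom)
  obtain r r' where r: "\<And>p. r p \<in> tail_polys c e" "\<And>p. r' p \<in> tail_polys c e'"
    "x = (\<Sum>p\<in>rep_index m a b. gen_map f c m l (r p) * rep_mon p)"
    "y = (\<Sum>p\<in>rep_index m a' b'. gen_map f c m l (r' p) * rep_mon p)"
    using assms unfolding rep_def by blast
  have "gen_map f c m l (r p) * rep_mon p * (gen_map f c m l (r' p') * rep_mon p') \<in> rep f c m l (a + a') (b + b') (e + e')"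
    if p: "p \<in> rep_index m a b" "p' \<in> rep_index m a' b'" for p p'
  proof -
    have "rep_mon p * rep_mon p' = (rep_mon (fst p + fst p', snd p + snd p') :: 'a mpoly poly)"
      by (simp add: rep_mon_def mult_monom mult_single)
    moreover have "gen_map f c m l (r p) * rep_mon p * (gen_map f c m l (r' p') * rep_mon p')
        = gen_map f c m l (r p) * gen_map f c m l (r' p') * (rep_mon p * rep_mon p')"
      by (simp only: ac_simps)
    ultimately have "gen_map f c m l (r p) * rep_mon p * (gen_map f c m l (r' p') * rep_mon p')
        = gen_map f c m l (r p * r' p') * rep_mon (fst p + fst p', snd p + snd p')"
      by (simp only: t.hom_mult)
    also have "\<dots> \<in> rep f c m l (a + a') (b + b') (e + e')"
      by (rule rep_mon_in) (use p r in \<open>auto simp: rep_index_def intro: tail_polys_closed\<close>)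
    finally show ?thesis .
  qed
  then show ?thesis unfolding r(3,4) sum_product by (intro rep_sum) auto
qed

lemma rep_mono:
  assumes "x \<in> rep f c m l a b e" "a \<le> a'" "b \<le> b'" "e \<le> e'"
  shows "x \<in> rep f c m l a' b' e'"
proof -
  obtain r where r: "\<And>p. r p \<in> tail_polys c e" "x = (\<Sum>p\<in>rep_index m a b. gen_map f c m l (r p) * rep_mon p)"
    using assms unfolding rep_def by blast
  show ?thesis unfolding r(2)
  proof (intro rep_sum rep_mon_in)
    fix p assume "p \<in> rep_index m a b"
    then show "p \<in> rep_index m a' b'" using assms by (auto simp: rep_index_def)
    show "r p \<in> tail_polys c e'" using r(1) tail_polys_closed(7)[OF assms(4)] by blast
  qed
qed

lemma gen_map_1 [simp]: "gen_map f c m l 1 = 1"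
proof -
  interpret t: comm_ring_hom "gen_map f c m l" by (rule gen_map_hom)
  show ?thesis by simp
qed

lemma const_poly_sum: "[:sum h S:] = (\<Sum>i\<in>S. [:h i:])"
  by (rule poly_eqI) (simp add: Polynomial.coeff_sum coeff_pCons split: nat.split)

lemma const_poly_mult: "[:a * b:] = [:a:] * [:b :: 'a::comm_ring_1:]"
  by (simp add: mult.commute)

lemma rep_Cst: "[:Cst a:] \<in> rep f c m l 0 0 0"
proof -
  have "gen_map f c m l (Cst a) * rep_mon ({#}, 0) \<in> rep f c m l 0 0 0"
    by (rule rep_mon_in) (auto simp: rep_index_def tail_polys_closed)
  then show ?thesis by (simp add: rep_mon_def)
qed

lemma rep_z: "[:0, 1:] \<in> rep f c m l 0 1 0"
proof -
  have "gen_map f c m l (Cst 1) * rep_mon ({#}, 1) \<in> rep f c m l 0 1 0"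
    by (rule rep_mon_in) (auto simp: rep_index_def tail_polys_closed simp del: Cst.hom_one)
  then show ?thesis by (simp add: rep_mon_def monom_altdef)
qed

lemma rep_Var_elim: "j < m \<Longrightarrow> [:Var j:] \<in> rep f c m l 1 0 0"
proof -
  assume "j < m"
  then have "gen_map f c m l (Cst 1) * rep_mon ({#j#}, 0) \<in> rep f c m l 1 0 0"
    by (intro rep_mon_in) (auto simp: rep_index_def tail_polys_closed simp del: Cst.hom_one)
  then show ?thesis by (simp add: rep_mon_def monom_0 Var_def)
qed

lemma rep_linform:
  assumes "linform m L" shows "[:L:] \<in> rep f c m l 1 0 0"
proof -
  obtain a where L: "L = (\<Sum>j<m. Cst (a j) * Var j)" using assms by (auto simp: linform_def)
  have "[:L:] = (\<Sum>j<m. [:Cst (a j):] * [:Var j:])"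
    by (simp only: L const_poly_sum const_poly_mult)
  also have "\<dots> \<in> rep f c m l 1 0 0"
    using rep_mult[OF rep_Cst rep_Var_elim] by (intro rep_sum) auto
  finally show ?thesis .
qed

text \<open>A variable that is not eliminated is a tail generator minus its linear form, and that
  form involves eliminated variables only.\<close>

lemma rep_Var:
  assumes l: "\<And>i. linform m (l i)"
  shows "[:Var j:] \<in> rep f c m l 1 0 1"
proof (cases "j < m")
  case True
  then show ?thesis by (intro rep_mono[OF rep_Var_elim]) auto
next
  case False
  let ?i = "c + (j - m)"
  have "gen_map f c m l (Var ?i) * rep_mon ({#}, 0) \<in> rep f c m l 1 0 1"
    by (rule rep_mon_in) (auto simp: rep_index_def tail_polys_def mdeg_le_Var mvars_in_Var)
  then have "gens f c m l ?i \<in> rep f c m l 1 0 1" by (simp add: rep_mon_def)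
  moreover have "[:- l ?i:] \<in> rep f c m l 1 0 1"
  proof -
    have "linform m (0 - Cst 1 * l ?i)" by (rule linform_diff_smult[OF linform_0 l])
    then show ?thesis by (intro rep_mono[OF rep_linform]) auto
  qed
  ultimately have "gens f c m l ?i + [:- l ?i:] \<in> rep f c m l 1 0 1" by (rule rep_add)
  moreover have "gens f c m l ?i = [:Var j + l ?i:]" using False by (simp add: gens_def)
  ultimately show ?thesis by simp
qed

lemma rep_const_poly:
  assumes l: "\<And>i. linform m (l i)" and A: "mdeg_le e A"
  shows "[:A:] \<in> rep f c m l e 0 e"
proof -
  have mon: "[:\<Prod>i\<in>#n. Var i:] \<in> rep f c m l (size n) 0 (size n)" for n
  proof (induction n)
    case (add i n)
    have "[:Var i:] * [:\<Prod>i\<in>#n. Var i:] \<in> rep f c m l (1 + size n) (0 + 0) (1 + size n)"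
      by (rule rep_mult[OF rep_Var[OF l] add])
    then show ?case by (simp add: mult.commute)
  qed (use rep_Cst[of 1] in simp)
  have "[:A:] = (\<Sum>n\<in>msupp A. [:Cst (mcoeff A n):] * [:\<Prod>i\<in>#n. Var i:])"
    by (subst mterm_sum) (simp only: const_poly_sum const_poly_mult mterm_conv)
  also have "\<dots> \<in> rep f c m l e 0 e"
  proof (rule rep_sum)
    fix n assume n: "n \<in> msupp A"
    have "[:Cst (mcoeff A n):] * [:\<Prod>i\<in>#n. Var i:] \<in> rep f c m l (0 + size n) (0 + 0) (0 + size n)"
      by (rule rep_mult[OF rep_Cst mon])
    then show "[:Cst (mcoeff A n):] * [:\<Prod>i\<in>#n. Var i:] \<in> rep f c m l e 0 e"
      by (rule rep_mono) (use n A in \<open>auto simp: mdeg_le_def\<close>)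
  qed
  finally show ?thesis .
qed

lemma rep_gens:
  assumes l: "\<And>i. linform m (l i)" and f: "\<And>j. j < c \<Longrightarrow> mdeg_le d (f j)" and d: "1 \<le> d" and i: "i < c"
  shows "gens f c m l i \<in> rep f c m l d 1 d"
proof -
  have "[:f i:] * [:0, 1:] \<in> rep f c m l (d + 0) (0 + 1) (d + 0)"
    by (rule rep_mult[OF rep_const_poly[OF l f[OF i]] rep_z])
  moreover have "[:l i:] \<in> rep f c m l d 1 d" by (rule rep_mono[OF rep_linform[OF l]]) (use d in auto)
  ultimately have "[:l i:] + [:f i:] * [:0, 1:] \<in> rep f c m l d 1 d" by (intro rep_add) auto
  then show ?thesis using i by (simp add: gens_def)
qed

lemma rep_gens_mon:
  assumes l: "\<And>i. linform m (l i)" and f: "\<And>j. j < c \<Longrightarrow> mdeg_le d (f j)" and d: "1 \<le> d"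
    and \<beta>: "set_mset \<beta> \<subseteq> {..<c}"
  shows "(\<Prod>i\<in>#\<beta>. gens f c m l i) * [:0, 1:] ^ j \<in> rep f c m l (d * size \<beta>) (size \<beta> + j) (d * size \<beta>)"
proof -
  have "(\<Prod>i\<in>#\<beta>. gens f c m l i) \<in> rep f c m l (d * size \<beta>) (size \<beta>) (d * size \<beta>)"
    using \<beta>
  proof (induction \<beta>)
    case (add i \<beta>)
    have "gens f c m l i * (\<Prod>i\<in>#\<beta>. gens f c m l i) \<in> rep f c m l (d + d * size \<beta>) (1 + size \<beta>) (d + d * size \<beta>)"
      by (rule rep_mult[OF rep_gens[OF l f d] add.IH]) (use add.prems in auto)
    then show ?case by simp
  qed (use rep_Cst[of 1] in simp)
  moreover have "[:0, 1:] ^ j \<in> rep f c m l 0 j 0"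
  proof (induction j)
    case (Suc j)
    show ?case using rep_mult[OF rep_z Suc] by simp
  qed (use rep_Cst[of 1] in simp)
  ultimately show ?thesis using rep_mult by fastforce
qed

text \<open>Here \<open>d * (c * B)\<close> bounds the degrees of the entries of the linear system,
  the tower exponent \<open>(q * (B + 1)) ^ c\<close> its number of equations, and
  \<open>c * B\<close> the degree of the monomials in the first \<open>c\<close> generators. The
  choice \<open>B = q ^ c\<close> makes \<open>(q * (B + 1)) ^ c = B * (B + 1) ^ c\<close>, just
  below the number \<open>(B + 1) ^ (c + 1)\<close> of unknowns.\<close>

definition relation_bound :: "nat \<Rightarrow> nat \<Rightarrow> nat" where
  "relation_bound c d = (let q = d * c + c + 1; B = q ^ c in d * (c * B) * 2 ^ ((q * (B + 1)) ^ c) + c * B)"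

text \<open>The columns are products of powers, up to \<open>B\<close>, of the first
  \<open>c\<close> generators and of \<open>z\<close>. Over the tail generators they expand in
  monomials in the \<open>m\<close> eliminated variables and \<open>z\<close>. Since
  \<open>m + 1 <= c\<close>, the rows grow at most like \<open>B ^ c\<close>, the columns at least
  like \<open>B ^ (c + 1)\<close>, and a nontrivial dependence with small tail coefficients
  exists.\<close>

lemma bounded_relation:
  fixes f :: "nat \<Rightarrow> 'k::field mpoly"
  assumes l: "\<And>i. linform m (l i)" and f: "\<And>j. j < c \<Longrightarrow> mdeg_le d (f j)" and d: "1 \<le> d" and mc: "m < c"
  shows "\<exists>G. G \<noteq> 0 \<and> poly (map_poly (gen_map f c m l) G) [:0, 1:] = 0 \<and>
    (\<forall>j. mdeg_le (relation_bound c d) (coeff G j))"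
proof -
  let ?t = "gen_map f c m l"
  interpret t: comm_ring_hom ?t by (rule gen_map_hom)
  define q where "q = d * c + c + 1"
  define B where "B = q ^ c"
  define \<delta> where "\<delta> = d * (c * B)"
  define J where "J = {\<beta> :: nat multiset. set_mset \<beta> \<subseteq> {..<c} \<and> (\<forall>i. count \<beta> i \<le> B)} \<times> {..B}"
  define I where "I = rep_index m \<delta> (c * B + B)"
  have finJ: "finite J" unfolding J_def using card_multisets_lower(1)[of c B] by blast
  have finI: "finite I" unfolding I_def by (rule finite_rep_index)
  have dB: "\<delta> + 1 \<le> q * (B + 1)" "c * B + B + 1 \<le> q * (B + 1)"
    by (auto simp: \<delta>_def q_def algebra_simps)
  \<comment> \<open>At most \<open>m + 1 <= c\<close> exponents index the rows, each ranging over
    fewer than \<open>q * (B + 1)\<close> values up to rounding; this is where \<open>m < c\<close>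
    enters.\<close>
  have "card I \<le> (\<delta> + 1) ^ m * (c * B + B + 1)" unfolding I_def by (rule card_rep_index)
  also have "\<dots> \<le> (q * (B + 1)) ^ m * (q * (B + 1))" by (intro mult_mono power_mono dB) auto
  also have "\<dots> = (q * (B + 1)) ^ Suc m" by (simp only: power_Suc mult.commute)
  also have "\<dots> \<le> (q * (B + 1)) ^ c"
    by (rule power_increasing) (use mc in \<open>auto simp: q_def\<close>)
  finally have cI: "card I \<le> (q * (B + 1)) ^ c" .
  also have "\<dots> = B * (B + 1) ^ c" by (simp only: power_mult_distrib B_def)
  also have "\<dots> < (B + 1) * (B + 1) ^ c" by simp
  also have "\<dots> \<le> card J"
    unfolding J_def card_cartesian_product card_atMost Suc_eq_plus1
    by (subst mult.commute, rule mult_le_mono1[OF card_multisets_lower(2)[unfolded Suc_eq_plus1]])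
  finally have IJ: "card I < card J" .
  have colrep: "(\<Prod>i\<in>#fst p. gens f c m l i) * [:0, 1:] ^ snd p \<in> rep f c m l \<delta> (c * B + B) \<delta>" if "p \<in> J" for p
  proof -
    have s: "size (fst p) \<le> c * B" by (rule size_le_counts) (use that in \<open>auto simp: J_def\<close>)
    then have "d * size (fst p) \<le> \<delta>" unfolding \<delta>_def by (rule mult_le_mono2)
    then show ?thesis using that s
      by (intro rep_mono[OF rep_gens_mon[OF l f d]] add_mono) (auto simp: J_def)
  qed
  define r where "r = (\<lambda>p. SOME r. (\<forall>i. r i \<in> tail_polys c \<delta>) \<and>
     (\<Prod>i\<in>#fst p. gens f c m l i) * [:0, 1:] ^ snd p = (\<Sum>i\<in>I. ?t (r i) * rep_mon i))"
  have r: "(\<forall>i. r p i \<in> tail_polys c \<delta>) \<and>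
     (\<Prod>i\<in>#fst p. gens f c m l i) * [:0, 1:] ^ snd p = (\<Sum>i\<in>I. ?t (r p i) * rep_mon i)" if "p \<in> J" for p
    using colrep[OF that] unfolding rep_def mem_Collect_eq I_def[symmetric] r_def by (rule someI_ex)
  \<comment> \<open>The system is solved over polynomials in the tail generators, filtered by
    degree, so that the unknowns have controlled degree as well.\<close>
  obtain x where x: "\<forall>p. x p \<in> tail_polys c (\<delta> * (2 ^ card I - 1))" "\<exists>p\<in>J. x p \<noteq> 0"
      "\<forall>i\<in>I. (\<Sum>p\<in>J. r p i * x p) = 0"
    using homogeneous_system_filtered[of "tail_polys c" I J "\<lambda>i p. r p i" \<delta>] r finI finJ IJ
    by (auto simp: tail_polys_closed)
  define G where "G = (\<Sum>p\<in>J. Polynomial.monom (x p * mterm (fst p) 1) (snd p))"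
  have "poly (map_poly ?t G) [:0, 1:] = 0"
  proof -
    interpret mt: comm_ring_hom "\<lambda>A. poly (map_poly ?t A) [:0, 1:]"
      by (rule comm_ring_hom_comp[OF comm_ring_hom_poly_eval comm_ring_hom_map_poly[OF gen_map_hom]])
    have tm: "?t (mterm b 1) = (\<Prod>i\<in>#b. gens f c m l i)" for b
      by (simp add: gen_map_def mev_mterm)
    have "poly (map_poly ?t G) [:0, 1:] = (\<Sum>p\<in>J. ?t (x p) * ((\<Prod>i\<in>#fst p. gens f c m l i) * [:0, 1:] ^ snd p))"
      unfolding G_def mt.hom_sum
      by (rule sum.cong) (auto simp: map_poly_monom poly_monom t.hom_mult tm ac_simps)
    also have "\<dots> = (\<Sum>p\<in>J. \<Sum>i\<in>I. ?t (r p i * x p) * rep_mon i)"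
      by (rule sum.cong) (use r in \<open>auto simp: sum_distrib_left t.hom_mult ac_simps\<close>)
    also have "\<dots> = (\<Sum>i\<in>I. ?t (\<Sum>p\<in>J. r p i * x p) * rep_mon i)"
      by (subst sum.swap) (simp add: t.hom_sum sum_distrib_right)
    also have "\<dots> = 0" using x(3) by simp
    finally show ?thesis .
  qed
  \<comment> \<open>The solution involves only variables from \<open>c\<close> on, the attached
    monomials \<open>fst p\<close> only those below \<open>c\<close>. Distinct columns therefore
    cannot cancel, and the coefficient at \<open>b0 + n0\<close> isolates one nonzero
    unknown.\<close>
  moreover have "G \<noteq> 0"
  proof -
    obtain b0 j0 where p0: "(b0, j0) \<in> J" "x (b0, j0) \<noteq> 0" using x(2) by auto
    obtain n0 where n0: "n0 \<in> msupp (x (b0, j0))" using lead_mon_in[OF p0(2)] by blast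
    have xc: "set_mset n \<subseteq> {c..}" if "n \<in> msupp (x p)" for n p
      using x(1)[rule_format, of p] that by (auto simp: tail_polys_def mvars_in_def)
    have n0c: "set_mset n0 \<subseteq> {c..}" by (rule xc[OF n0])
    have b0c: "set_mset b0 \<subseteq> {..<c}" using p0(1) by (auto simp: J_def)
    have coeff_term: "mcoeff (coeff (Polynomial.monom (x p * mterm (fst p) 1) (snd p)) j0) (b0 + n0)
        = (if p = (b0, j0) then mcoeff (x p) n0 else 0)" if p: "p \<in> J" for p
    proof (cases "snd p = j0 \<and> fst p \<subseteq># b0 + n0 \<and> b0 + n0 - fst p \<in> msupp (x p)")
      case True
      then have "set_mset (b0 + n0 - fst p) \<subseteq> {c..}" using xc by blast
      moreover have "set_mset (fst p) \<subseteq> {..<c}" using p by (auto simp: J_def)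
      ultimately have "count (fst p) i = count b0 i" for i
      proof (cases "i < c")
        case True
        have "count (b0 + n0 - fst p) i = 0" "count n0 i = 0"
          using True \<open>set_mset (b0 + n0 - fst p) \<subseteq> {c..}\<close> n0c by (auto simp: count_eq_zero_iff simp del: count_diff)
        then have "count b0 i \<le> count (fst p) i" by simp
        moreover have "count (fst p) i \<le> count b0 i"
          using mset_subset_eq_count[of "fst p" "b0 + n0" i] \<open>snd p = j0 \<and> _\<close> \<open>count n0 i = 0\<close> by simp
        ultimately show ?thesis by simp
      next
        case False
        then have "i \<notin># fst p" "i \<notin># b0" using b0c \<open>set_mset (fst p) \<subseteq> {..<c}\<close> by auto
        then show ?thesis by (simp only: not_in_iff)
      qed
      then have "fst p = b0" by (rule multiset_eqI)
      then show ?thesis using True by (cases p) (simp add: mcoeff_mterm_times mult.commute[of _ "mterm _ _"])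
    next
      case False
      have "mcoeff (coeff (Polynomial.monom (x p * mterm (fst p) 1) (snd p)) j0) (b0 + n0) = 0"
        using False by (auto simp: mcoeff_mterm_times mult.commute[of _ "mterm _ _"] in_keys_iff)
      moreover have "p \<noteq> (b0, j0)" using False n0 by auto
      ultimately show ?thesis by simp
    qed
    have "mcoeff (coeff G j0) (b0 + n0) = (\<Sum>p\<in>J. if p = (b0, j0) then mcoeff (x p) n0 else 0)"
      unfolding G_def Polynomial.coeff_sum lookup_sum by (rule sum.cong[OF refl coeff_term])
    also have "\<dots> = mcoeff (x (b0, j0)) n0" using p0(1) finJ by simp
    finally show ?thesis using n0 by (auto simp: in_keys_iff)
  qed
  moreover have "mdeg_le (relation_bound c d) (coeff G j)" for j
  proof -
    have "mdeg_le (\<delta> * (2 ^ card I - 1) + size (fst p)) (x p * mterm (fst p) 1)" for p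
      using x(1)[rule_format, of p] by (intro mdeg_le_mult) (auto simp: tail_polys_def mdeg_le_def)
    moreover have "\<delta> * (2 ^ card I - 1) + size (fst p) \<le> relation_bound c d" if "p \<in> J" for p
    proof -
      have "size (fst p) \<le> c * B" by (rule size_le_counts) (use that in \<open>auto simp: J_def\<close>)
      moreover have "(2 ^ card I - 1 :: nat) \<le> 2 ^ ((q * (B + 1)) ^ c)"
        by (rule order.trans[OF diff_le_self power_increasing[OF cI]]) simp
      ultimately have "\<delta> * (2 ^ card I - 1) + size (fst p) \<le> \<delta> * 2 ^ ((q * (B + 1)) ^ c) + c * B"
        by (intro add_mono mult_left_mono) auto
      then show ?thesis by (simp only: relation_bound_def Let_def \<delta>_def B_def q_def)
    qed
    ultimately have "mdeg_le (relation_bound c d) (x p * mterm (fst p) 1)" if "p \<in> J" for p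
      using that mdeg_le_mono by blast
    then show ?thesis unfolding G_def Polynomial.coeff_sum by (intro mdeg_le_sum) simp
  qed
  ultimately show ?thesis by blast
qed

section \<open>The weak Nullstellensatz with degree bounds independent of the number of
  variables\<close>

text \<open>A stage \<open>m\<close> at which no further elimination is possible has an injective
  map. Then the minimal monic relation of \<open>z\<close> exists, divides the bounded relation and
  so inherits its degree bound, and comparing powers of \<open>z\<close> in it yields the
  cofactors.\<close>

theorem weak_nullstellensatz_bounded:
  fixes f :: "nat \<Rightarrow> 'k::field mpoly"
  assumes inf: "infinite (UNIV :: 'k set)" and d: "1 \<le> d" and f: "\<And>j. j < c \<Longrightarrow> mdeg_le d (f j)"
    and unit: "(\<Sum>j<c. g j * f j) = 1"
  shows "\<exists>g. (\<Sum>j<c. g j * f j) = 1 \<and> (\<forall>j. mdeg_le (relation_bound c d * d) (g j))"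
proof -
  define P where "P = (\<lambda>m. \<exists>l. (\<forall>i. linform m (l i)) \<and> (\<exists>N. \<forall>i\<ge>N. l i = 0) \<and> module_finite (gen_map f c m l))"
  have "P 0" unfolding P_def using module_finite_start[OF unit] linform_0 by (intro exI[of _ "\<lambda>_. 0"]) auto
  moreover have lt: "m < c" if "P m" for m
    using that gen_map_module_finite_less unfolding P_def by blast
  \<comment> \<open>The stages satisfying \<open>P\<close> are bounded by \<open>c\<close>, so a
    last one exists; a kernel element there would produce one more by
    \<open>gen_map_eliminate\<close>.\<close>
  ultimately have ex: "\<exists>m. P m \<and> (\<forall>m'. P m' \<longrightarrow> m' \<le> m)"
    using ex_has_greatest_nat[of P 0 "\<lambda>x. x" c] by (meson less_imp_le)
  then obtain m where m: "P m" "\<not> P (Suc m)" by (metis Suc_n_not_le_n)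
  obtain l where l: "\<And>i. linform m (l i)" "\<exists>N. \<forall>i\<ge>N. l i = 0" "module_finite (gen_map f c m l)"
    using m(1) unfolding P_def by blast
  have inj: "A = 0" if "gen_map f c m l A = 0" for A
    using gen_map_eliminate[OF inf l _ that] m(2) unfolding P_def by blast
  obtain H where H: "lead_coeff H = 1" "poly (map_poly (gen_map f c m l) H) [:0, 1:] = 0"
    using monic_relation_of_module_finite[OF gen_map_hom l(3)] by blast
  obtain R where R: "lead_coeff R = 1" "poly (map_poly (gen_map f c m l) R) [:0, 1:] = 0"
    "\<And>A. poly (map_poly (gen_map f c m l) A) [:0, 1:] = 0 \<Longrightarrow> R dvd A"
    using monic_minimal_relation[OF gen_map_hom inj H] by blast
  obtain G where G: "G \<noteq> 0" "poly (map_poly (gen_map f c m l) G) [:0, 1:] = 0"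
    "\<And>j. mdeg_le (relation_bound c d) (coeff G j)"
    using bounded_relation[of m l c d f, OF l(1) f d lt[OF m(1)]] by blast
  have "mdeg_le (relation_bound c d) (coeff R j)" for j
    by (rule mdeg_le_coeff_dvd[OF R(3)[OF G(2)] G(1,3)])
  then show ?thesis using unit_ideal_of_monic_relation[of c d f m l R, OF f d l(1) R(1,2)] by blast
qed


definition map_coeffs :: "('a::zero \<Rightarrow> 'b::zero) \<Rightarrow> 'a mpoly \<Rightarrow> 'b mpoly" where
  "map_coeffs h A = Abs_poly_mapping (\<lambda>m. h (mcoeff A m))"

lemma mcoeff_map_coeffs: "h 0 = 0 \<Longrightarrow> mcoeff (map_coeffs h A) m = h (mcoeff A m)"
  unfolding map_coeffs_def
  by (subst lookup_Abs_poly_mapping) (auto intro: finite_subset[OF _ finite_lookup[of A]])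

lemma mdeg_le_map_coeffs: "h 0 = 0 \<Longrightarrow> mdeg_le e A \<Longrightarrow> mdeg_le e (map_coeffs h A)"
  by (auto simp: mdeg_le_def in_keys_iff mcoeff_map_coeffs)

lemma mcoeff_times_submultisets:
  "mcoeff (A * B) k = (\<Sum>a | a \<subseteq># k. mcoeff A a * mcoeff B (k - a))"
proof -
  have "mcoeff (A * B) k = mcoeff (\<Sum>m\<in>msupp A. mterm m (mcoeff A m) * B) k"
    by (subst (1) mterm_sum[of A]) (simp add: sum_distrib_right)
  also have "\<dots> = (\<Sum>m\<in>msupp A. if m \<subseteq># k then mcoeff A m * mcoeff B (k - m) else 0)"
    by (simp add: lookup_sum mcoeff_mterm_times)
  also have "\<dots> = (\<Sum>m\<in>msupp A \<union> {a. a \<subseteq># k}. if m \<subseteq># k then mcoeff A m * mcoeff B (k - m) else 0)"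
    by (rule sum.mono_neutral_left) (auto simp: finite_submultisets in_keys_iff)
  also have "\<dots> = (\<Sum>m | m \<subseteq># k. if m \<subseteq># k then mcoeff A m * mcoeff B (k - m) else 0)"
    by (rule sum.mono_neutral_right) (auto simp: finite_submultisets)
  finally show ?thesis by simp
qed

lemma infinite_UNIV_fract_poly: "infinite (UNIV :: 'a::field poly fract set)"
proof
  assume fin: "finite (UNIV :: 'a poly fract set)"
  have "inj (\<lambda>n. to_fract (Polynomial.monom (1::'a) n))"
    by (rule injI) (metis degree_monom_eq to_fract_eq_iff one_neq_zero)
  then have "finite (UNIV :: nat set)" using fin by (metis finite_imageD finite_subset subset_UNIV)
  then show False by simp
qed

text \<open>Extending scalars to the infinite field \<open>K(X)\<close> gives cofactors of bounded
  degree over it. A \<open>K\<close>-linear retraction of \<open>K(X)\<close> onto \<open>K\<close>,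
  applied to their coefficients, commutes with multiplication by the \<open>f j\<close>, which have
  coefficients in \<open>K\<close>, and does not raise degrees.\<close>

theorem weak_nullstellensatz_bounded_field:
  fixes f :: "nat \<Rightarrow> 'a::field mpoly"
  assumes d: "1 \<le> d" and f: "\<And>j. j < c \<Longrightarrow> mdeg_le d (f j)" and unit: "(\<Sum>j<c. g j * f j) = 1"
  shows "\<exists>g. (\<Sum>j<c. g j * f j) = 1 \<and> (\<forall>j. mdeg_le (relation_bound c d * d) (g j))"
proof -
  define \<iota> :: "'a \<Rightarrow> 'a poly fract" where "\<iota> = (\<lambda>a. to_fract [:a:])"
  have i_hom: "comm_ring_hom \<iota>"
    unfolding \<iota>_def by (rule comm_ring_hom_comp[OF comm_ring_hom_to_fract comm_ring_hom_const_poly])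
  interpret i: comm_ring_hom \<iota> by (rule i_hom)
  let ?m = "map_coeffs \<iota>"
  have m_mult: "?m (A * B) = ?m A * ?m B" for A B
    by (rule poly_mapping_eqI) (simp add: mcoeff_map_coeffs mcoeff_times_submultisets i.hom_sum i.hom_mult)
  have m_sum: "?m (sum h S) = (\<Sum>j\<in>S. ?m (h j))" for h :: "nat \<Rightarrow> _" and S
    by (rule poly_mapping_eqI) (simp add: mcoeff_map_coeffs lookup_sum i.hom_sum)
  have m_1: "?m 1 = 1"
    by (rule poly_mapping_eqI) (simp add: mcoeff_map_coeffs lookup_one when_def)
  have "(\<Sum>j<c. ?m (g j) * ?m (f j)) = 1"
    by (simp only: m_mult[symmetric] m_sum[symmetric] unit m_1)
  then obtain g' where g': "(\<Sum>j<c. g' j * ?m (f j)) = 1" "\<forall>j. mdeg_le (relation_bound c d * d) (g' j)"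
    using weak_nullstellensatz_bounded[OF infinite_UNIV_fract_poly d, of c "\<lambda>j. ?m (f j)" "\<lambda>j. ?m (g j)",
      OF mdeg_le_map_coeffs[of \<iota>, OF i.hom_zero f]] by blast
  interpret V: vector_space_pair "\<lambda>a (x :: 'a poly fract). \<iota> a * x" "\<lambda>a (x :: 'a). a * x"
    by unfold_locales (auto simp: algebra_simps i.hom_add i.hom_mult)
  \<comment> \<open>The retraction \<open>\<psi>\<close> is obtained by extending the assignment of
    1 to 1 linearly; multiplicativity is neither available nor needed beyond scalars from the base
    field.\<close>
  have "V.vs1.independent {1}" by (simp add: V.vs1.dependent_single)
  then obtain \<psi> where psi: "Vector_Spaces.linear (\<lambda>a (x :: 'a poly fract). \<iota> a * x) (\<lambda>a (x :: 'a). a * x) \<psi>" "\<psi> 1 = 1"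
    using V.linear_independent_extend[of "{1}" "\<lambda>_. 1"] by blast
  interpret psi: Vector_Spaces.linear "\<lambda>a (x :: 'a poly fract). \<iota> a * x" "\<lambda>a (x :: 'a). a * x" \<psi> by (rule psi(1))
  have \<psi>0: "\<psi> 0 = 0" by (rule psi.zero)
  let ?p = "map_coeffs \<psi>"
  have ps: "\<psi> (x * \<iota> b) = \<psi> x * b" for x b
    using psi.scale[of b x] by (simp only: mult.commute)
  have "?p (G * ?m A) = ?p G * A" for G A
    by (rule poly_mapping_eqI) (simp add: mcoeff_map_coeffs \<psi>0 mcoeff_times_submultisets psi.sum ps)
  then have "(\<Sum>j<c. ?p (g' j) * f j) = (\<Sum>j<c. ?p (g' j * ?m (f j)))" by simp
  also have "\<dots> = ?p (\<Sum>j<c. g' j * ?m (f j))"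
    by (rule poly_mapping_eqI) (simp add: mcoeff_map_coeffs \<psi>0 lookup_sum psi.sum)
  also have "\<dots> = 1"
    unfolding g' by (rule poly_mapping_eqI) (simp add: mcoeff_map_coeffs \<psi>0 lookup_one when_def psi(2))
  finally show ?thesis using mdeg_le_map_coeffs[of \<psi>, OF \<psi>0] g'(2)
    by (intro exI[of _ "\<lambda>j. ?p (g' j)"]) blast
qed

section \<open>Rabinowitsch's trick: from the unit ideal to radical membership\<close>

text \<open>Setting the surplus variables to 0 removes them from cofactors without disturbing an
  identity whose given polynomials do not contain them.\<close>

definition restrict_vars :: "nat \<Rightarrow> 'a::comm_ring_1 mpoly \<Rightarrow> 'a mpoly" where
  "restrict_vars n = mev Cst (\<lambda>i. if i < n then Var i else 0)"

lemma restrict_vars_hom: "comm_ring_hom (restrict_vars n :: 'a::comm_ring_1 mpoly \<Rightarrow> _)"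
  unfolding restrict_vars_def by (rule mev_hom[OF Cst_hom])

lemma restrict_vars_id: "mvars_in {..<n} A \<Longrightarrow> restrict_vars n A = A"
  unfolding restrict_vars_def
  by (subst (2) mev_Cst_Var[symmetric]) (auto intro: mev_cong_vars)

lemma mvars_in_restrict_vars: "mvars_in {..<n} (restrict_vars n A)"
proof -
  have "mvars_in UNIV A" by (simp add: mvars_in_def)
  then show ?thesis unfolding restrict_vars_def by (rule mvars_in_mev) (auto intro: mvars_in_Var)
qed

lemma mdeg_le_restrict_vars: "mdeg_le e A \<Longrightarrow> mdeg_le e (restrict_vars n A)"
  using mdeg_le_mev[of e A 1 "\<lambda>i. if i < n then Var i else 0"] by (simp add: restrict_vars_def mdeg_le_Var)

text \<open>The trick adds one polynomial and raises the degree by one, hence the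
  successors.\<close>

definition cofactor_bound :: "nat \<Rightarrow> nat \<Rightarrow> nat" where
  "cofactor_bound c d = relation_bound (Suc c) (Suc d) * Suc d"

text \<open>Forwards, a power of \<open>Q\<close> in the ideal makes the unit ideal with
  \<open>1 - y Q\<close> by a geometric sum, and the bounded Nullstellensatz improves the cofactors.
  Backwards, substituting \<open>1 / Q\<close> for \<open>y\<close> removes the last summand, and a
  power of \<open>Q\<close> clears the denominators.\<close>

theorem radical_membership_bounded:
  fixes P :: "nat \<Rightarrow> 'a::field mpoly"
  assumes P: "\<And>j. j < c \<Longrightarrow> mdeg_le d (P j)" "\<And>j. j < c \<Longrightarrow> mvars_in {..<n} (P j)"
    and Q: "mdeg_le d Q" "mvars_in {..<n} Q"
  shows "(\<exists>s A. (\<forall>j. mvars_in {..<n} (A j)) \<and> Q ^ Suc s = (\<Sum>j<c. A j * P j)) \<longleftrightarrow>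
    (\<exists>g. (\<forall>j. mdeg_le (cofactor_bound c d) (g j) \<and> mvars_in {..<Suc n} (g j)) \<and>
      (\<Sum>j<c. g j * P j) + g c * (1 - Var n * Q) = 1)" (is "?L \<longleftrightarrow> ?R")
proof
  assume ?L
  then obtain s A where A: "Q ^ Suc s = (\<Sum>j<c. A j * P j)" by blast
  define f where "f = (\<lambda>j. if j < c then P j else 1 - Var n * Q)"
  have fd: "mdeg_le (Suc d) (f j)" if "j < Suc c" for j
  proof (cases "j < c")
    case True
    then show ?thesis using mdeg_le_mono[OF P(1)] by (simp add: f_def)
  next
    case False
    have "mdeg_le (1 + d) (Var n * Q)" by (intro mdeg_le_mult mdeg_le_Var Q) simp
    then show ?thesis using False by (simp add: f_def mdeg_le_diff)
  qed
  let ?y = "Var n :: 'a mpoly"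
  \<comment> \<open>Here \<open>1 = (y Q)^(s+1) + (1 - (y Q)^(s+1))\<close>: the first part lies in
    the ideal of the \<open>P j\<close>, the second is divisible by \<open>1 - y Q\<close>.\<close>
  have "(\<Sum>j<Suc c. (if j < c then ?y ^ Suc s * A j else (\<Sum>i<Suc s. (?y * Q) ^ i)) * f j)
      = ?y ^ Suc s * (\<Sum>j<c. A j * P j) + (\<Sum>i<Suc s. (?y * Q) ^ i) * (1 - ?y * Q)"
    by (simp add: f_def sum_distrib_left mult.assoc del: sum.lessThan_Suc power_Suc add: sum.lessThan_Suc[of _ c])
  also have "(\<Sum>i<Suc s. (?y * Q) ^ i) * (1 - ?y * Q) = 1 - (?y * Q) ^ Suc s"
    by (subst mult.commute) (rule one_diff_power_eq[symmetric])
  also have "?y ^ Suc s * (\<Sum>j<c. A j * P j) + (1 - (?y * Q) ^ Suc s) = 1"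
    by (simp only: A[symmetric] power_mult_distrib) simp
  finally have unit: "(\<Sum>j<Suc c. (if j < c then ?y ^ Suc s * A j else (\<Sum>i<Suc s. (?y * Q) ^ i)) * f j) = 1" .
  have "1 \<le> Suc d" by simp
  from weak_nullstellensatz_bounded_field[OF this fd unit]
  obtain g where g: "(\<Sum>j<Suc c. g j * f j) = 1" "\<And>j. mdeg_le (cofactor_bound c d) (g j)"
    unfolding cofactor_bound_def by blast
  interpret r: comm_ring_hom "restrict_vars (Suc n) :: 'a mpoly \<Rightarrow> _" by (rule restrict_vars_hom)
  have rP: "restrict_vars (Suc n) (P j) = P j" if "j < c" for j
    by (rule restrict_vars_id[OF mvars_in_mono[OF P(2)[OF that]]]) auto
  have rQ: "restrict_vars (Suc n) Q = Q" by (rule restrict_vars_id[OF mvars_in_mono[OF Q(2)]]) auto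
  have ry: "restrict_vars (Suc n) ?y = ?y" by (rule restrict_vars_id[OF mvars_in_Var]) simp
  have "(\<Sum>j<c. g j * P j) + g c * (1 - ?y * Q) = 1" using g(1) by (simp add: f_def)
  then have "restrict_vars (Suc n) ((\<Sum>j<c. g j * P j) + g c * (1 - ?y * Q)) = 1" by simp
  then have "(\<Sum>j<c. restrict_vars (Suc n) (g j) * P j) + restrict_vars (Suc n) (g c) * (1 - ?y * Q) = 1"
    by (simp add: r.hom_add r.hom_sum r.hom_mult r.hom_minus rP rQ ry)
  then show ?R using mdeg_le_restrict_vars[OF g(2)] mvars_in_restrict_vars
    by (intro exI[of _ "\<lambda>j. restrict_vars (Suc n) (g j)"]) blast
next
  assume ?R
  then obtain g where g: "(\<Sum>j<c. g j * P j) + g c * (1 - Var n * Q) = 1" by blast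
  have "\<exists>s A. Q ^ Suc s = (\<Sum>j<c. A j * P j)"
  proof (cases "Q = 0")
    case True
    then show ?thesis by (intro exI[of _ 0] exI[of _ "\<lambda>_. 0"]) simp
  next
    case False
    \<comment> \<open>Evaluation in the fraction field with \<open>y = 1 / Q\<close>; the case
      \<open>Q = 0\<close>, where this is meaningless, is settled above.\<close>
    define b where "b = (\<lambda>i. if i = n then 1 / to_fract Q else to_fract (Var i))"
    define v where "v = mev (\<lambda>a. to_fract (Cst a)) b"
    have v_hom: "comm_ring_hom v"
      unfolding v_def by (rule mev_hom[OF comm_ring_hom_comp[OF comm_ring_hom_to_fract Cst_hom]])
    interpret v: comm_ring_hom v by (rule v_hom)
    have v_id: "v A = to_fract A" if "mvars_in {..<n} A" for A
    proof -
      have "v A = mev (\<lambda>a. to_fract (Cst a)) (\<lambda>i. to_fract (Var i)) A"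
        unfolding v_def by (rule mev_cong_vars[OF that]) (auto simp: b_def)
      also have "\<dots> = to_fract A"
        by (rule mpoly_hom_eqI[OF mev_hom[OF comm_ring_hom_comp[OF comm_ring_hom_to_fract Cst_hom]] comm_ring_hom_to_fract])
           (auto simp: mev_Cst mev_Var)
      finally show ?thesis .
    qed
    have den: "\<exists>s A. v B * to_fract Q ^ s = to_fract A" for B
    proof (induction B rule: mpoly_induct)
      case (Cst a)
      show ?case by (intro exI[of _ 0] exI[of _ "Cst a"]) (simp add: v_def mev_Cst)
    next
      case (Var i)
      show ?case
      proof (cases "i = n")
        case True
        then show ?thesis using False by (intro exI[of _ 1] exI[of _ 1]) (simp add: v_def mev_Var b_def)
      next
        case False
        then show ?thesis by (intro exI[of _ 0] exI[of _ "Var i"]) (simp add: v_def mev_Var b_def)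
      qed
    next
      case (add A B)
      then obtain s s' A' B' where e: "v A * to_fract Q ^ s = to_fract A'" "v B * to_fract Q ^ s' = to_fract B'" by blast
      have "v (A + B) * to_fract Q ^ (s + s') = (v A * to_fract Q ^ s) * to_fract Q ^ s' + (v B * to_fract Q ^ s') * to_fract Q ^ s"
        by (simp only: v.hom_add power_add distrib_right) (simp only: ac_simps)
      also have "\<dots> = to_fract (A' * Q ^ s' + B' * Q ^ s)" by (simp only: e to_fract_mult to_fract_add to_fract_hom.hom_power)
      finally show ?case by blast
    next
      case (mult A B)
      then obtain s s' A' B' where e: "v A * to_fract Q ^ s = to_fract A'" "v B * to_fract Q ^ s' = to_fract B'" by blast
      have "v (A * B) * to_fract Q ^ (s + s') = (v A * to_fract Q ^ s) * (v B * to_fract Q ^ s')"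
        by (simp only: v.hom_mult power_add ac_simps)
      also have "\<dots> = to_fract (A' * B')" by (simp only: e to_fract_mult)
      finally show ?case by blast
    qed
    then obtain s A where sA: "\<And>B. v B * to_fract Q ^ s B = to_fract (A B)" by meson
    have "v (Var n * Q) = 1"
      using v_id[OF Q(2)] False by (simp add: v.hom_mult) (simp add: v_def mev_Var b_def)
    then have "v ((\<Sum>j<c. g j * P j) + g c * (1 - Var n * Q)) = (\<Sum>j<c. v (g j) * v (P j))"
      by (simp only: v.hom_add v.hom_sum v.hom_mult v.hom_minus v.hom_one) simp
    then have one: "(\<Sum>j<c. v (g j) * to_fract (P j)) = 1" using g v_id[OF P(2)] by simp
    \<comment> \<open>A common exponent for all cofactors; the additional \<open>Suc\<close> keeps
      the resulting power of \<open>Q\<close> positive.\<close>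
    define S where "S = (\<Sum>j<c. s (g j))"
    have sS: "s (g j) \<le> S" if "j < c" for j
      unfolding S_def using that member_le_sum[of j "{..<c}" "\<lambda>j. s (g j)"] by simp
    have "to_fract (Q ^ Suc S) = to_fract Q ^ Suc S * (\<Sum>j<c. v (g j) * to_fract (P j))"
      unfolding one by (simp add: to_fract_hom.hom_power)
    also have "\<dots> = (\<Sum>j<c. (v (g j) * to_fract Q ^ s (g j)) * to_fract Q ^ (Suc S - s (g j)) * to_fract (P j))"
      unfolding sum_distrib_left
    proof (rule sum.cong[OF refl])
      fix j assume "j \<in> {..<c}"
      then have "Suc S = s (g j) + (Suc S - s (g j))" using sS[of j] by simp
      then have "to_fract Q ^ Suc S = to_fract Q ^ s (g j) * to_fract Q ^ (Suc S - s (g j))"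
        by (metis power_add)
      then show "to_fract Q ^ Suc S * (v (g j) * to_fract (P j))
          = (v (g j) * to_fract Q ^ s (g j)) * to_fract Q ^ (Suc S - s (g j)) * to_fract (P j)"
        by (simp only: ac_simps)
    qed
    also have "\<dots> = to_fract (\<Sum>j<c. (A (g j) * Q ^ (Suc S - s (g j))) * P j)"
      by (simp add: sA to_fract_hom.hom_power)
    finally show ?thesis unfolding to_fract_eq_iff by (intro exI[of _ S] exI[of _ "\<lambda>j. A (g j) * Q ^ (Suc S - s (g j))"])
  qed
  then obtain s A where A: "Q ^ Suc s = (\<Sum>j<c. A j * P j)" by blast
  interpret r: comm_ring_hom "restrict_vars n :: 'a mpoly \<Rightarrow> _" by (rule restrict_vars_hom)
  have "restrict_vars n (Q ^ Suc s) = restrict_vars n (\<Sum>j<c. A j * P j)" by (simp only: A)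
  then have "Q ^ Suc s = (\<Sum>j<c. restrict_vars n (A j) * P j)"
    by (simp add: r.hom_power r.hom_sum r.hom_mult restrict_vars_id P Q del: power_Suc)
  then show ?L using mvars_in_restrict_vars by (intro exI[of _ s] exI[of _ "\<lambda>j. restrict_vars n (A j)"]) blast
qed


section \<open>Transfer between a prime field as a type and the residue ring as a record\<close>

text \<open>The algebra above lives on a field type, the machine on the record
  \<open>residue_ring (int p)\<close>. The cast \<open>of_int\<close> leads from residues to the
  type, and \<open>rp\<close> picks the representative between 0 and \<open>p - 1\<close>.\<close>

locale prime_field_type =
  fixes p :: nat and rp :: "'a::field \<Rightarrow> int"
  assumes prime: "prime p"
    and rp_bounds: "0 \<le> rp x" "rp x < int p"
    and of_int_rp: "of_int (rp x) = x"
    and of_nat_p: "of_nat p = (0::'a)"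
begin

abbreviation "R \<equiv> residue_ring (int p)"

sublocale residues_prime p R
  by unfold_locales (rule prime)

lemma of_int_eq_0_iff: "(of_int x :: 'a) = 0 \<longleftrightarrow> int p dvd x"
proof
  assume x: "(of_int x :: 'a) = 0"
  show "int p dvd x"
  proof (rule ccontr)
    assume "\<not> int p dvd x"
    then have "gcd (int p) x = 1"
      using prime by (intro coprime_imp_gcd_eq_1 prime_imp_coprime) simp_all
    then obtain u v where "u * int p + v * x = 1" using bezout_int by metis
    then have "of_int (u * int p + v * x) = (1::'a)" by simp
    then show False using x of_nat_p by simp
  qed
next
  assume "int p dvd x"
  then obtain k where "x = int p * k" by (auto simp: dvd_def)
  then show "(of_int x :: 'a) = 0" using of_nat_p by simp
qed

lemma of_int_mod_p: "(of_int (x mod int p) :: 'a) = of_int x"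
proof -
  have "x mod int p - x = - (int p * (x div int p))" by (simp add: minus_mod_eq_mult_div[symmetric])
  then have "(of_int (x mod int p - x) :: 'a) = 0" by (subst of_int_eq_0_iff) simp
  then show ?thesis by simp
qed

lemma of_int_inj:
  assumes "x \<in> carrier R" "y \<in> carrier R" "(of_int x :: 'a) = of_int y"
  shows "x = y"
proof -
  have "(of_int (x - y) :: 'a) = 0" using assms(3) by simp
  then have "int p dvd x - y" by (simp only: of_int_eq_0_iff)
  then have "x mod int p = y mod int p" by (simp add: mod_eq_dvd_iff)
  then show ?thesis using assms(1,2) by (simp add: residue_ring_def)
qed

lemma rp_of_int: "x \<in> carrier R \<Longrightarrow> rp (of_int x) = x"
  using rp_bounds[of "of_int x"] by (intro of_int_inj) (auto simp: of_int_rp residue_ring_def)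

lemma rp_carrier: "rp x \<in> carrier R"
  using rp_bounds[of x] by (simp add: residue_ring_def)

lemma of_int_ops:
  "of_int (x \<oplus>\<^bsub>R\<^esub> y) = (of_int x + of_int y :: 'a)"
  "of_int (x \<otimes>\<^bsub>R\<^esub> y) = (of_int x * of_int y :: 'a)"
  "of_int \<zero>\<^bsub>R\<^esub> = (0 :: 'a)" "of_int \<one>\<^bsub>R\<^esub> = (1 :: 'a)"
  by (simp_all add: residue_ring_def of_int_mod_p)

lemma of_int_minus_R:
  assumes "x \<in> carrier R" "y \<in> carrier R"
  shows "of_int (x \<ominus>\<^bsub>R\<^esub> y) = (of_int x - of_int y :: 'a)"
proof -
  have "of_int (x \<ominus>\<^bsub>R\<^esub> y) + of_int y = (of_int x :: 'a)"
    using assms by (simp flip: of_int_ops) (simp add: a_minus_def a_assoc l_neg)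
  then show ?thesis by (simp add: eq_diff_eq)
qed

lemma of_int_inv_R:
  assumes "y \<in> carrier R" "y \<noteq> \<zero>\<^bsub>R\<^esub>"
  shows "inv\<^bsub>R\<^esub> y \<in> carrier R" "of_int (inv\<^bsub>R\<^esub> y) = (inverse (of_int y) :: 'a)"
proof -
  have u: "y \<in> Units R" using assms field.field_Units[OF is_field] by blast
  show c: "inv\<^bsub>R\<^esub> y \<in> carrier R" using u by simp
  have "of_int y * of_int (inv\<^bsub>R\<^esub> y) = (1 :: 'a)"
    using u by (simp flip: of_int_ops)
  then show "of_int (inv\<^bsub>R\<^esub> y) = (inverse (of_int y) :: 'a)" by (metis inverse_unique)
qed

lemma of_int_finsum_R:
  assumes "finite X" "\<And>x. x \<in> X \<Longrightarrow> h x \<in> carrier R"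
  shows "of_int (finsum R h X) = (\<Sum>x\<in>X. of_int (h x) :: 'a)"
  using assms
proof (induction X rule: finite_induct)
  case (insert x X)
  then have "finsum R h (insert x X) = h x \<oplus>\<^bsub>R\<^esub> finsum R h X" by (intro finsum_insert) auto
  then show ?case using insert by (simp add: of_int_ops)
qed (simp add: of_int_ops)

definition to_mpoly :: "(nat multiset \<Rightarrow> int) \<Rightarrow> 'a mpoly" where
  "to_mpoly f = Abs_poly_mapping (\<lambda>m. of_int (f m))"

definition of_mpoly :: "'a mpoly \<Rightarrow> nat multiset \<Rightarrow> int" where
  "of_mpoly A m = rp (mcoeff A m)"

context
  fixes n :: nat
begin

abbreviation "S \<equiv> mpoly_ring R n"

lemma carrier_S: "f \<in> carrier S \<longleftrightarrow> (\<forall>m. f m \<in> carrier R) \<and> finite {m. f m \<noteq> \<zero>\<^bsub>R\<^esub>} \<and>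
    (\<forall>m. f m \<noteq> \<zero>\<^bsub>R\<^esub> \<longrightarrow> set_mset m \<subseteq> {..<n})"
  by (simp add: mpoly_ring_def mpoly_carrier_def)

lemma cring_S: "cring S"
  by (rule mpoly_ring_cring)

lemma zero_R: "\<zero>\<^bsub>R\<^esub> = 0"
  by (simp add: residue_ring_def)

lemma mcoeff_to_mpoly: "f \<in> carrier S \<Longrightarrow> mcoeff (to_mpoly f) m = of_int (f m)"
  unfolding to_mpoly_def
  by (subst lookup_Abs_poly_mapping) (auto simp: carrier_S zero_R intro: rev_finite_subset)

lemma of_int_R_eq_0: "x \<in> carrier R \<Longrightarrow> (of_int x :: 'a) = 0 \<longleftrightarrow> x = 0"
  using of_int_inj[of x 0] by (auto simp: residue_ring_def)

lemma to_mpoly_vars: "f \<in> carrier S \<Longrightarrow> mvars_in {..<n} (to_mpoly f)"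
  unfolding mvars_in_def
  by (auto simp: in_keys_iff mcoeff_to_mpoly of_int_R_eq_0 carrier_S zero_R)

lemma to_mpoly_mult:
  assumes "f \<in> carrier S" "g \<in> carrier S"
  shows "to_mpoly (f \<otimes>\<^bsub>S\<^esub> g) = to_mpoly f * to_mpoly g"
proof (rule poly_mapping_eqI)
  fix m
  interpret S: cring S by (rule cring_S)
  have "mcoeff (to_mpoly (f \<otimes>\<^bsub>S\<^esub> g)) m = of_int ((f \<otimes>\<^bsub>S\<^esub> g) m)" using assms by (intro mcoeff_to_mpoly) simp
  also have "\<dots> = of_int (\<Oplus>\<^bsub>R\<^esub>a\<in>{a. a \<subseteq># m}. f a \<otimes>\<^bsub>R\<^esub> g (m - a))" by (simp add: mpoly_ring_def)
  also have "\<dots> = (\<Sum>a | a \<subseteq># m. of_int (f a) * of_int (g (m - a)))"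
    using assms by (subst of_int_finsum_R) (auto simp: finite_submultisets of_int_ops carrier_S)
  also have "\<dots> = mcoeff (to_mpoly f * to_mpoly g) m"
    using assms by (simp add: mcoeff_times_submultisets mcoeff_to_mpoly)
  finally show "mcoeff (to_mpoly (f \<otimes>\<^bsub>S\<^esub> g)) m = mcoeff (to_mpoly f * to_mpoly g) m" .
qed

lemma to_mpoly_add:
  assumes "f \<in> carrier S" "g \<in> carrier S"
  shows "to_mpoly (f \<oplus>\<^bsub>S\<^esub> g) = to_mpoly f + to_mpoly g"
proof (rule poly_mapping_eqI)
  fix m
  interpret S: cring S by (rule cring_S)
  have "mcoeff (to_mpoly (f \<oplus>\<^bsub>S\<^esub> g)) m = of_int ((f \<oplus>\<^bsub>S\<^esub> g) m)" using assms by (intro mcoeff_to_mpoly) simp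
  also have "\<dots> = mcoeff (to_mpoly f + to_mpoly g) m"
    using assms by (simp add: mpoly_ring_def of_int_ops lookup_add mcoeff_to_mpoly)
  finally show "mcoeff (to_mpoly (f \<oplus>\<^bsub>S\<^esub> g)) m = mcoeff (to_mpoly f + to_mpoly g) m" .
qed

lemma to_mpoly_zero_one: "to_mpoly \<zero>\<^bsub>S\<^esub> = 0" "to_mpoly \<one>\<^bsub>S\<^esub> = 1"
proof -
  interpret S: cring S by (rule cring_S)
  show "to_mpoly \<zero>\<^bsub>S\<^esub> = 0"
    by (rule poly_mapping_eqI) (simp add: mcoeff_to_mpoly, simp add: mpoly_ring_def of_int_ops)
  show "to_mpoly \<one>\<^bsub>S\<^esub> = 1"
    by (rule poly_mapping_eqI)
       (simp add: mcoeff_to_mpoly, simp add: mpoly_ring_def of_int_ops lookup_one when_def eq_commute)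
qed

lemma to_mpoly_inj:
  assumes "f \<in> carrier S" "g \<in> carrier S" "to_mpoly f = to_mpoly g"
  shows "f = g"
proof
  fix m
  have "of_int (f m) = (of_int (g m) :: 'a)" using assms by (metis mcoeff_to_mpoly)
  then show "f m = g m" using assms by (intro of_int_inj) (auto simp: carrier_S)
qed

lemma rp_0: "rp 0 = 0"
  using rp_of_int[of 0] prime_gt_0_nat[OF prime] by (simp add: residue_ring_def)

lemma of_mpoly_carrier:
  assumes "mvars_in {..<n} A" shows "of_mpoly A \<in> carrier S"
proof -
  have nz: "m \<in> msupp A" if "of_mpoly A m \<noteq> 0" for m
    using that rp_0 by (auto simp: of_mpoly_def in_keys_iff)
  then have "finite {m. of_mpoly A m \<noteq> 0}" by (intro finite_subset[OF _ finite_keys[of A]]) auto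
  with nz show ?thesis using assms unfolding carrier_S zero_R
    by (auto simp: mvars_in_def of_mpoly_def rp_carrier)
qed

lemma to_of_mpoly: "mvars_in {..<n} A \<Longrightarrow> to_mpoly (of_mpoly A) = A"
  by (rule poly_mapping_eqI) (simp add: mcoeff_to_mpoly of_mpoly_carrier, simp add: of_mpoly_def of_int_rp)

lemma to_mpoly_pow:
  assumes "f \<in> carrier S" shows "to_mpoly (f [^]\<^bsub>S\<^esub> (k::nat)) = to_mpoly f ^ k"
proof -
  interpret S: cring S by (rule cring_S)
  show ?thesis using assms by (induction k) (simp_all add: to_mpoly_zero_one to_mpoly_mult mult.commute)
qed

text \<open>The combinations form an ideal containing the \<open>P i\<close>, so minimality of
  \<open>Idl\<close> gives one inclusion; the other holds because \<open>Idl\<close> is closed under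
  the operations. Cofactors are confined to the first \<open>n\<close> variables so that they have
  preimages in the carrier.\<close>

lemma Idl_iff:
  fixes c :: nat
  assumes P: "\<And>i. i < c \<Longrightarrow> P i \<in> carrier S" and f: "f \<in> carrier S"
  shows "f \<in> Idl\<^bsub>S\<^esub> (P ` {..<c}) \<longleftrightarrow>
    (\<exists>A. (\<forall>j. mvars_in {..<n} (A j)) \<and> to_mpoly f = (\<Sum>j<c. A j * to_mpoly (P j)))"
proof -
  interpret S: cring S by (rule cring_S)
  define X where "X = {f \<in> carrier S. \<exists>A. (\<forall>j. mvars_in {..<n} (A j)) \<and> to_mpoly f = (\<Sum>j<c. A j * to_mpoly (P j))}"
  have add: "g \<oplus>\<^bsub>S\<^esub> h \<in> X" if gh: "g \<in> X" "h \<in> X" for g h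
  proof -
    obtain A B where "\<forall>j. mvars_in {..<n} (A j)" "to_mpoly g = (\<Sum>j<c. A j * to_mpoly (P j))"
      "\<forall>j. mvars_in {..<n} (B j)" "to_mpoly h = (\<Sum>j<c. B j * to_mpoly (P j))"
      using gh unfolding X_def by blast
    then show ?thesis using gh unfolding X_def mem_Collect_eq
      by (intro conjI exI[of _ "\<lambda>j. A j + B j"])
         (auto simp: to_mpoly_add distrib_right sum.distrib intro: mvars_in_add)
  qed
  have mult: "h \<otimes>\<^bsub>S\<^esub> g \<in> X" if gh: "g \<in> X" "h \<in> carrier S" for g h
  proof -
    obtain A where "\<forall>j. mvars_in {..<n} (A j)" "to_mpoly g = (\<Sum>j<c. A j * to_mpoly (P j))"
      using gh unfolding X_def by blast
    then show ?thesis using gh unfolding X_def mem_Collect_eq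
      by (intro conjI exI[of _ "\<lambda>j. to_mpoly h * A j"])
         (auto simp: to_mpoly_mult sum_distrib_left mult.assoc to_mpoly_vars intro: mvars_in_mult)
  qed
  have zero: "\<zero>\<^bsub>S\<^esub> \<in> X" unfolding X_def mem_Collect_eq
    by (intro conjI exI[of _ "\<lambda>_. 0"]) (auto simp: to_mpoly_zero_one)
  have "ideal X S"
  proof (rule idealI)
    show "subgroup X (add_monoid S)"
    proof (rule S.add.subgroupI)
      show "X \<subseteq> carrier S" by (auto simp: X_def)
      show "X \<noteq> {}" using zero by blast
      fix g assume g: "g \<in> X"
      then have gS: "g \<in> carrier S" by (simp add: X_def)
      have "(\<ominus>\<^bsub>S\<^esub> \<one>\<^bsub>S\<^esub>) \<otimes>\<^bsub>S\<^esub> g = \<ominus>\<^bsub>S\<^esub> (\<one>\<^bsub>S\<^esub> \<otimes>\<^bsub>S\<^esub> g)" by (rule S.l_minus[OF S.one_closed gS])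
      then have "\<ominus>\<^bsub>S\<^esub> g = (\<ominus>\<^bsub>S\<^esub> \<one>\<^bsub>S\<^esub>) \<otimes>\<^bsub>S\<^esub> g" using S.l_one[OF gS] by simp
      then show "\<ominus>\<^bsub>S\<^esub> g \<in> X" using mult[OF g S.a_inv_closed[OF S.one_closed]] by simp
    next
      fix g h assume "g \<in> X" "h \<in> X"
      then show "g \<oplus>\<^bsub>S\<^esub> h \<in> X" by (rule add)
    qed
    fix g h assume gh: "g \<in> X" "h \<in> carrier S"
    then show "h \<otimes>\<^bsub>S\<^esub> g \<in> X" by (rule mult)
    moreover have "g \<in> carrier S" using gh(1) by (simp add: X_def)
    ultimately show "g \<otimes>\<^bsub>S\<^esub> h \<in> X" using S.m_comm[of g h] gh by simp
  qed (rule S.ring_axioms)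
  moreover have "P ` {..<c} \<subseteq> X"
  proof (rule image_subsetI)
    fix i assume i: "i \<in> {..<c}"
    define A where "A = (\<lambda>j. if j = i then 1 else 0 :: 'a mpoly)"
    have "(\<Sum>j<c. A j * to_mpoly (P j)) = (\<Sum>j<c. if j = i then to_mpoly (P i) else 0)"
      by (rule sum.cong) (auto simp: A_def)
    also have "\<dots> = to_mpoly (P i)" using i by simp
    finally have "to_mpoly (P i) = (\<Sum>j<c. A j * to_mpoly (P j))" ..
    moreover have "\<forall>j. mvars_in {..<n} (A j)" by (simp add: A_def)
    ultimately show "P i \<in> X" using P[of i] i unfolding X_def by blast
  qed
  ultimately have sub: "Idl\<^bsub>S\<^esub> (P ` {..<c}) \<subseteq> X" by (rule S.genideal_minimal)
  interpret I: ideal "Idl\<^bsub>S\<^esub> (P ` {..<c})" S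
    by (rule S.genideal_ideal) (use P in auto)
  have inI: "\<exists>g \<in> Idl\<^bsub>S\<^esub> (P ` {..<c}). to_mpoly g = (\<Sum>j<k. A j * to_mpoly (P j))"
    if A: "\<And>j. mvars_in {..<n} (A j)" and k: "k \<le> c" for A k
    using k
  proof (induction k)
    case 0
    then show ?case using I.zero_closed by (intro bexI[of _ "\<zero>\<^bsub>S\<^esub>"]) (auto simp: to_mpoly_zero_one)
  next
    case (Suc k)
    then obtain g where g: "g \<in> Idl\<^bsub>S\<^esub> (P ` {..<c})" "to_mpoly g = (\<Sum>j<k. A j * to_mpoly (P j))" by auto
    have Pk: "P k \<in> Idl\<^bsub>S\<^esub> (P ` {..<c})" using S.genideal_self[of "P ` {..<c}"] P Suc.prems by (simp add: image_subset_iff)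
    have cA: "of_mpoly (A k) \<in> carrier S" by (rule of_mpoly_carrier[OF A])
    have m: "of_mpoly (A k) \<otimes>\<^bsub>S\<^esub> P k \<in> Idl\<^bsub>S\<^esub> (P ` {..<c})" by (rule I.I_l_closed[OF Pk cA])
    have "to_mpoly (g \<oplus>\<^bsub>S\<^esub> of_mpoly (A k) \<otimes>\<^bsub>S\<^esub> P k) = (\<Sum>j<Suc k. A j * to_mpoly (P j))"
      using g cA I.Icarr[OF g(1)] I.Icarr[OF Pk] I.Icarr[OF m] A
      by (simp add: to_mpoly_add to_mpoly_mult to_of_mpoly)
    then show ?case using I.a_closed g(1) m by (intro bexI[of _ "g \<oplus>\<^bsub>S\<^esub> of_mpoly (A k) \<otimes>\<^bsub>S\<^esub> P k"]) auto
  qed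
  show ?thesis
  proof
    assume "f \<in> Idl\<^bsub>S\<^esub> (P ` {..<c})"
    then show "\<exists>A. (\<forall>j. mvars_in {..<n} (A j)) \<and> to_mpoly f = (\<Sum>j<c. A j * to_mpoly (P j))"
      using sub by (auto simp: X_def)
  next
    assume "\<exists>A. (\<forall>j. mvars_in {..<n} (A j)) \<and> to_mpoly f = (\<Sum>j<c. A j * to_mpoly (P j))"
    then obtain A where "\<forall>j. mvars_in {..<n} (A j)" "to_mpoly f = (\<Sum>j<c. A j * to_mpoly (P j))" by blast
    then obtain g where "g \<in> Idl\<^bsub>S\<^esub> (P ` {..<c})" "to_mpoly g = to_mpoly f" using inI[of A c] by auto
    then show "f \<in> Idl\<^bsub>S\<^esub> (P ` {..<c})" using to_mpoly_inj[OF I.Icarr f] by blast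
  qed
qed

lemma radical_iff:
  fixes c :: nat
  assumes P: "\<And>i. i < c \<Longrightarrow> P i \<in> carrier S" and Q: "Q \<in> carrier S"
  shows "Q \<in> radical S (Idl\<^bsub>S\<^esub> (P ` {..<c})) \<longleftrightarrow>
    (\<exists>s A. (\<forall>j. mvars_in {..<n} (A j)) \<and> to_mpoly Q ^ Suc s = (\<Sum>j<c. A j * to_mpoly (P j)))"
proof -
  interpret S: cring S by (rule cring_S)
  have "Q \<in> radical S (Idl\<^bsub>S\<^esub> (P ` {..<c})) \<longleftrightarrow> (\<exists>s. Q [^]\<^bsub>S\<^esub> Suc s \<in> Idl\<^bsub>S\<^esub> (P ` {..<c}))"
  proof -
    have "(\<exists>m\<ge>1::nat. X m) \<longleftrightarrow> (\<exists>s. X (Suc s))" for X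
      by (rule iffI, metis One_nat_def Suc_le_D, metis One_nat_def Suc_leI zero_less_Suc)
    then show ?thesis unfolding radical_def using Q by (simp del: S.nat_pow_Suc)
  qed
  also have "\<dots> \<longleftrightarrow> (\<exists>s A. (\<forall>j. mvars_in {..<n} (A j)) \<and> to_mpoly Q ^ Suc s = (\<Sum>j<c. A j * to_mpoly (P j)))"
    using Idl_iff[OF P S.nat_pow_closed[OF Q]] by (simp only: to_mpoly_pow[OF Q])
  finally show ?thesis .
qed

end

end


section \<open>A timed Hoare calculus for the machine\<close>

text \<open>A total-correctness triple with a step bound. As \<open>exec\<close> is deterministic,
  the halting run it provides is the only one.\<close>

definition tri :: "('a, 'b) ring_scheme \<Rightarrow> ((nat \<Rightarrow> nat) \<times> (nat \<Rightarrow> 'a) \<Rightarrow> bool) \<Rightarrow> prog \<Rightarrow> nat \<Rightarrow>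
    ((nat \<Rightarrow> nat) \<times> (nat \<Rightarrow> 'a) \<Rightarrow> bool) \<Rightarrow> bool" where
  "tri R P c T Q \<longleftrightarrow> (\<forall>s. P s \<longrightarrow> (\<exists>t s'. exec R c s t s' \<and> t \<le> T \<and> Q s'))"

lemma triI: "(\<And>N F. P (N, F) \<Longrightarrow> \<exists>t s'. exec R c (N, F) t s' \<and> t \<le> T \<and> Q s') \<Longrightarrow> tri R P c T Q"
  unfolding tri_def by auto

lemma triE: "tri R P c T Q \<Longrightarrow> P s \<Longrightarrow> \<exists>t s'. exec R c s t s' \<and> t \<le> T \<and> Q s'"
  unfolding tri_def by blast

lemma tri_conseq: "tri R P c T Q \<Longrightarrow> (\<And>s. P' s \<Longrightarrow> P s) \<Longrightarrow> (\<And>s. Q s \<Longrightarrow> Q' s) \<Longrightarrow> T \<le> T' \<Longrightarrow> tri R P' c T' Q'"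
  unfolding tri_def by (meson order.trans)

lemma tri_Skip: "1 \<le> T \<Longrightarrow> (\<And>N F. P (N, F) \<Longrightarrow> Q (N, F)) \<Longrightarrow> tri R P Skip T Q"
  by (rule triI) (blast intro: exec.Skip)

lemma tri_SetI: "1 \<le> T \<Longrightarrow> (\<And>N F. P (N, F) \<Longrightarrow> Q (N(ival N e1 := ival N e2), F)) \<Longrightarrow> tri R P (SetI e1 e2) T Q"
  by (rule triI) (blast intro: exec.SetI)

lemma tri_SetZero: "1 \<le> T \<Longrightarrow> (\<And>N F. P (N, F) \<Longrightarrow> Q (N, F(ival N e := \<zero>\<^bsub>R\<^esub>))) \<Longrightarrow> tri R P (SetZero e) T Q"
  by (rule triI) (blast intro: exec.SetZero)

lemma tri_SetOne: "1 \<le> T \<Longrightarrow> (\<And>N F. P (N, F) \<Longrightarrow> Q (N, F(ival N e := \<one>\<^bsub>R\<^esub>))) \<Longrightarrow> tri R P (SetOne e) T Q"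
  by (rule triI) (blast intro: exec.SetOne)

lemma tri_SetF:
  "1 \<le> T \<Longrightarrow> (\<And>N F. P (N, F) \<Longrightarrow> fop_defined R op (F (ival N e2)) \<and>
     Q (N, F(ival N e0 := fop_val R op (F (ival N e1)) (F (ival N e2))))) \<Longrightarrow> tri R P (SetF e0 op e1 e2) T Q"
  by (rule triI) (blast intro: exec.SetF)

lemma tri_Seq: "tri R P c1 T1 Q \<Longrightarrow> tri R Q c2 T2 S \<Longrightarrow> tri R P (Seq c1 c2) (T1 + T2) S"
  unfolding tri_def by (meson exec.Seq add_mono)

lemma tri_Cond:
  assumes "tri R (\<lambda>s. P s \<and> holds s b) c1 T Q" "tri R (\<lambda>s. P s \<and> \<not> holds s b) c2 T Q"
  shows "tri R P (Cond b c1 c2) (T + 1) Q"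
  unfolding tri_def
proof safe
  fix N F assume "P (N, F)"
  then show "\<exists>t s'. exec R (Cond b c1 c2) (N, F) t s' \<and> t \<le> T + 1 \<and> Q s'"
    using triE[OF assms(1), of "(N, F)"] triE[OF assms(2), of "(N, F)"]
    by (cases "holds (N, F) b") (metis exec.IfTrue add_le_mono1, metis exec.IfFalse add_le_mono1)
qed

definition For :: "nat \<Rightarrow> iexp \<Rightarrow> prog \<Rightarrow> prog" where
  "For v e c = Seq (SetI (Const v) (Const 0))
     (While (Less (Cell (Const v)) e) (Seq c (SetI (Const v) (Plus (Cell (Const v)) (Const 1)))))"

definition for_time :: "nat \<Rightarrow> nat \<Rightarrow> nat" where
  "for_time m T = m * (T + 2) + 2"

text \<open>The bound expression is re-evaluated before every round, so the invariant has to
  determine its value, and the body has to hand back the counter unchanged. A round costs the body,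
  the increment and the test.\<close>

lemma tri_For:
  assumes init: "\<And>N F. P (N, F) \<Longrightarrow> J 0 (N(v := 0), F)"
    and test: "\<And>i N F. J i (N, F) \<Longrightarrow> ival N e = m \<and> N v = i"
    and body: "\<And>i. i < m \<Longrightarrow> tri R (J i) c T (\<lambda>(N, F). N v = i \<and> J (Suc i) (N(v := Suc i), F))"
  shows "tri R P (For v e c) (for_time m T) (J m)"
proof -
  let ?b = "Less (Cell (Const v)) e" and ?c = "Seq c (SetI (Const v) (Plus (Cell (Const v)) (Const 1)))"
  have loop: "\<exists>t s'. exec R (While ?b ?c) s t s' \<and> t \<le> k * (T + 2) + 1 \<and> J m s'"
    if "J i s" "i + k = m" for i k s
    using that
  proof (induction k arbitrary: i s)
    case 0
    obtain N F where s: "s = (N, F)" by fastforce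
    have "\<not> holds s ?b" using test[of i N F] 0 s by simp
    from exec.WhileFalse[OF this] show ?case using 0 by (intro exI[of _ 1] exI[of _ s]) simp
  next
    case (Suc k)
    obtain N F where s: "s = (N, F)" by fastforce
    have h: "holds s ?b" using test[of i N F] Suc.prems s by simp
    obtain t1 N1 F1 where 1: "exec R c s t1 (N1, F1)" "t1 \<le> T" "N1 v = i" "J (Suc i) (N1(v := Suc i), F1)"
      using triE[OF body[of i], of s] Suc.prems by auto
    have "exec R (SetI (Const v) (Plus (Cell (Const v)) (Const 1))) (N1, F1) 1 (N1(v := Suc i), F1)"
      using exec.SetI[of R "Const v" "Plus (Cell (Const v)) (Const 1)" N1 F1] 1(3) by simp
    then have e: "exec R ?c s (t1 + 1) (N1(v := Suc i), F1)" by (rule exec.Seq[OF 1(1)])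
    obtain t2 s' where 2: "exec R (While ?b ?c) (N1(v := Suc i), F1) t2 s'" "t2 \<le> k * (T + 2) + 1" "J m s'"
      using Suc.IH[OF 1(4)] Suc.prems by auto
    have "exec R (While ?b ?c) s (t1 + 1 + t2 + 1) s'" by (rule exec.WhileTrue[OF h e 2(1)])
    then show ?case using 1(2) 2 by (intro exI[of _ "t1 + 1 + t2 + 1"] exI[of _ s']) auto
  qed
  show ?thesis
  proof (rule triI)
    fix N F assume "P (N, F)"
    then obtain t s' where w: "exec R (While ?b ?c) (N(v := 0), F) t s'" "t \<le> m * (T + 2) + 1" "J m s'"
      using loop[OF init, of N F m] by auto
    have "exec R (SetI (Const v) (Const 0)) (N, F) 1 (N(v := 0), F)"
      using exec.SetI[of R "Const v" "Const 0" N F] by simp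
    from exec.Seq[OF this w(1)] show "\<exists>t s'. exec R (For v e c) (N, F) t s' \<and> t \<le> for_time m T \<and> J m s'"
      unfolding For_def for_time_def using w(2,3) by (intro exI[of _ "1 + t"] exI[of _ s']) simp
  qed
qed

section \<open>Nested loops as counters in base \<open>B\<close>\<close>

text \<open>An odometer: \<open>k\<close> nested loops run through all indices below
  \<open>B ^ k\<close> while keeping the base-\<open>B\<close> digits in cells. This replaces the
  multiplication and division that the machine does not offer.\<close>

fun nest :: "nat list \<Rightarrow> iexp \<Rightarrow> prog \<Rightarrow> prog" where
  "nest [] e c = c"
| "nest (v # vs) e c = For v e (nest vs e c)"

fun nest_time :: "nat \<Rightarrow> nat \<Rightarrow> nat \<Rightarrow> nat" where
  "nest_time B 0 T = T"
| "nest_time B (Suc k) T = for_time B (nest_time B k T)"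

text \<open>The most significant digit comes first, as the outermost loop of a nest.\<close>

fun digits :: "nat \<Rightarrow> nat \<Rightarrow> nat \<Rightarrow> nat list" where
  "digits B 0 j = []"
| "digits B (Suc k) j = (j div B ^ k mod B) # digits B k j"

lemma length_digits [simp]: "length (digits B k j) = k"
  by (induction k) auto

lemma digits_lt: "0 < B \<Longrightarrow> x \<in> set (digits B k j) \<Longrightarrow> x < B"
  by (induction k) auto

lemma digits_offset:
  assumes "0 < B" shows "digits B k (i * B ^ k + j) = digits B k j"
proof -
  have "digits B l (i * B ^ k + j) = digits B l j" if "l \<le> k" for l
    using that
  proof (induction l)
    case (Suc l)
    define q where "q = i * B ^ (k - Suc l)"
    have "B ^ k = B ^ (k - Suc l + Suc l)" using Suc.prems by simp
    then have "i * B ^ k = (q * B) * B ^ l" by (simp only: power_add power_Suc q_def ac_simps)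
    moreover have "B ^ l \<noteq> 0" using assms by simp
    ultimately have "(i * B ^ k + j) div B ^ l = q * B + j div B ^ l"
      by (metis add.commute div_mult_self1)
    then show ?case using Suc by simp
  qed simp
  then show ?thesis by simp
qed

text \<open>With the outer digit fixed to \<open>i\<close>, the inner nest runs through indices
  shifted by \<open>i * B ^ k\<close>, whose lower digits are unaffected by the shift. The invariant
  must be insensitive to the counter cells, because the loops reset them.\<close>

lemma tri_nest:
  assumes "distinct vs"
    and "\<And>j N F v x. I j (N, F) \<Longrightarrow> v \<in> set vs \<Longrightarrow> I j (N(v := x), F)"
    and "\<And>j N F. I j (N, F) \<Longrightarrow> ival N e = B"
    and "\<And>N v x. v \<in> set vs \<Longrightarrow> ival (N(v := x)) e = ival N e"
    and "\<And>j. j < B ^ length vs \<Longrightarrow> tri R (\<lambda>s. I j s \<and> map (fst s) vs = digits B (length vs) j) c T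
       (\<lambda>s. I (Suc j) s \<and> map (fst s) vs = digits B (length vs) j)"
  shows "tri R (I 0) (nest vs e c) (nest_time B (length vs) T) (I (B ^ length vs))"
  using assms
proof (induction vs arbitrary: I)
  case Nil
  then show ?case by (auto intro: tri_conseq[OF Nil(5)[of 0]])
next
  case (Cons v vs)
  let ?k = "length vs"
  define I' where "I' = (\<lambda>i j (s :: (nat \<Rightarrow> nat) \<times> (nat \<Rightarrow> 'a)). I (i * B ^ ?k + j) s \<and> fst s v = i)"
  have inner: "tri R (I' i 0) (nest vs e c) (nest_time B ?k T) (I' i (B ^ ?k))" if i: "i < B" for i
  proof (rule Cons.IH)
    show "distinct vs" using Cons.prems by simp
    show "I' i j (N(w := x), F)" if "I' i j (N, F)" "w \<in> set vs" for j N F w x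
    proof -
      have "w \<noteq> v" using that Cons.prems(1) by auto
      moreover have "I (i * B ^ ?k + j) (N(w := x), F)"
        by (rule Cons.prems(2)) (use that in \<open>auto simp: I'_def\<close>)
      ultimately show ?thesis using that by (simp add: I'_def)
    qed
    show "ival N e = B" if "I' i j (N, F)" for j N F using that Cons.prems(3) by (auto simp: I'_def)
    show "ival (N(w := x)) e = ival N e" if "w \<in> set vs" for N w x
      by (rule Cons.prems(4)) (use that in auto)
    fix j assume j: "j < B ^ ?k"
    have lt: "i * B ^ ?k + j < B ^ length (v # vs)"
    proof -
      have "i * B ^ ?k + j < Suc i * B ^ ?k" using j by simp
      also have "\<dots> \<le> B * B ^ ?k" using i by (intro mult_right_mono) auto
      finally show ?thesis by simp
    qed
    have dig: "digits B (length (v # vs)) (i * B ^ ?k + j) = i # digits B ?k j"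
    proof -
      have "digits B ?k (i * B ^ ?k + j) = digits B ?k j" by (rule digits_offset) (use i in simp)
      then show ?thesis using i j by simp
    qed
    show "tri R (\<lambda>s. I' i j s \<and> map (fst s) vs = digits B ?k j) c T (\<lambda>s. I' i (Suc j) s \<and> map (fst s) vs = digits B ?k j)"
      by (rule tri_conseq[OF Cons.prems(5)[OF lt, unfolded dig]]) (auto simp: I'_def)
  qed
  have "tri R (I 0) (For v e (nest vs e c)) (for_time B (nest_time B ?k T)) (\<lambda>s. I (B * B ^ ?k) s \<and> fst s v = B)"
  proof (rule tri_For[where J = "\<lambda>i s. I (i * B ^ ?k) s \<and> fst s v = i"])
    fix i assume "i < B"
    then show "tri R (\<lambda>s. I (i * B ^ ?k) s \<and> fst s v = i) (nest vs e c) (nest_time B ?k T)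
      (\<lambda>(N, F). N v = i \<and> I (Suc i * B ^ ?k) (N(v := Suc i), F) \<and> fst (N(v := Suc i), F) v = Suc i)"
      by (intro tri_conseq[OF inner]) (auto simp: I'_def add.commute intro!: Cons.prems(2))
  next
    show "I (0 * B ^ ?k) (N(v := 0), F) \<and> fst (N(v := 0), F) v = 0" if "I 0 (N, F)" for N F
    proof -
      have "I 0 (N(v := 0), F)" by (rule Cons.prems(2)[OF that]) simp
      then show ?thesis by (simp only: mult_0 fst_conv fun_upd_same simp_thms)
    qed
    show "ival N e = B \<and> N v = i" if "I (i * B ^ ?k) (N, F) \<and> fst (N, F) v = i" for i N F
      using Cons.prems(3)[of "i * B ^ ?k" N F] that by simp
  qed
  then show ?case by (auto intro: tri_conseq)
qed

lemma mset_digits: "mset (digits B k j) = mset (map (\<lambda>l. j div B ^ l mod B) [0..<k])"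
  by (induction k) auto

lemma digits_surj:
  assumes "length xs = k" "\<forall>x\<in>set xs. x < B"
  shows "\<exists>j<B ^ k. digits B k j = xs"
  using assms
proof (induction xs arbitrary: k)
  case (Cons x xs)
  then obtain k' where k: "k = Suc k'" "length xs = k'" by auto
  then obtain j where j: "j < B ^ k'" "digits B k' j = xs" using Cons by auto
  have "x * B ^ k' + j < Suc x * B ^ k'" using j by simp
  also have "\<dots> \<le> B * B ^ k'" using Cons.prems by (intro mult_right_mono) auto
  finally have "x * B ^ k' + j < B ^ k" by (simp add: k)
  moreover have "digits B k (x * B ^ k' + j) = x # xs" using j Cons.prems by (simp add: k digits_offset[of B])
  ultimately show ?case by blast
qed simp

text \<open>Cells 20, 21 and 22 hold the two counters and the result of the comparison.\<close>

fun count_cells :: "nat \<Rightarrow> nat \<Rightarrow> nat list \<Rightarrow> prog" where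
  "count_cells a r [] = SetI (Const r) (Const 0)"
| "count_cells a r (x # xs) = Seq (count_cells a r xs)
     (Cond (Less (Cell (Const a)) (Cell (Const x))) Skip
       (Cond (Less (Cell (Const x)) (Cell (Const a))) Skip (SetI (Const r) (Plus (Cell (Const r)) (Const 1)))))"

fun compare_cells :: "nat list \<Rightarrow> nat list \<Rightarrow> nat list \<Rightarrow> prog" where
  "compare_cells xs ys [] = SetI (Const 22) (Const 1)"
| "compare_cells xs ys (a # as) = Seq (compare_cells xs ys as) (Seq (count_cells a 20 xs) (Seq (count_cells a 21 ys)
     (Cond (Less (Cell (Const 21)) (Cell (Const 20))) (SetI (Const 22) (Const 0)) Skip)))"

lemma tri_count_cells:
  assumes "r \<notin> set xs" "r \<noteq> a"
  shows "tri R (\<lambda>(N', F'). F' = F \<and> (\<forall>x. x \<noteq> r \<longrightarrow> N' x = N x)) (count_cells a r xs) (3 * length xs + 1)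
    (\<lambda>(N', F'). F' = F \<and> N' r = count_list (map N xs) (N a) \<and> (\<forall>x. x \<noteq> r \<longrightarrow> N' x = N x))"
  using assms
proof (induction xs)
  case Nil
  show ?case unfolding count_cells.simps by (rule tri_SetI) auto
next
  case (Cons x xs)
  have IH: "tri R (\<lambda>(N', F'). F' = F \<and> (\<forall>x. x \<noteq> r \<longrightarrow> N' x = N x)) (count_cells a r xs) (3 * length xs + 1)
    (\<lambda>(N', F'). F' = F \<and> N' r = count_list (map N xs) (N a) \<and> (\<forall>x. x \<noteq> r \<longrightarrow> N' x = N x))"
    by (rule Cons.IH) (use Cons.prems in auto)
  have eq: "3 * length (x # xs) + 1 = (3 * length xs + 1) + ((1 + 1) + 1)" by simp
  show ?case unfolding count_cells.simps eq
  proof (rule tri_Seq[OF IH], intro tri_Cond)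
  qed (rule tri_Skip tri_SetI, simp, use Cons.prems in auto)+
qed

lemma tri_count_cells_conseq:
  assumes "r \<notin> set xs" "r \<noteq> a" "length xs \<le> l"
    and "\<And>N F N'. P (N, F) \<Longrightarrow> \<forall>x. x \<noteq> r \<longrightarrow> N' x = N x \<Longrightarrow> N' r = count_list (map N xs) (N a) \<Longrightarrow> Q (N', F)"
  shows "tri R P (count_cells a r xs) (3 * l + 1) Q"
proof (rule triI)
  fix N F assume P: "P (N, F)"
  obtain t s' where 1: "exec R (count_cells a r xs) (N, F) t s'" "t \<le> 3 * length xs + 1"
    and 2: "case s' of (N', F') \<Rightarrow> F' = F \<and> N' r = count_list (map N xs) (N a) \<and> (\<forall>x. x \<noteq> r \<longrightarrow> N' x = N x)"
    using triE[OF tri_count_cells[OF assms(1,2), of R F N], of "(N, F)"] by auto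
  have "Q s'" using 2 assms(4)[OF P] by (cases s') auto
  then show "\<exists>t s'. exec R (count_cells a r xs) (N, F) t s' \<and> t \<le> 3 * l + 1 \<and> Q s'"
    using 1 assms(3) by (intro exI[of _ t] exI[of _ s']) auto
qed

definition compare_time :: "nat \<Rightarrow> nat" where
  "compare_time l = 1 + l * (6 * l + 4)"

lemma tri_compare_cells:
  assumes "{20, 21, 22} \<inter> (set xs \<union> set ys \<union> set as) = {}" "length xs \<le> l" "length ys \<le> l"
  shows "tri R (\<lambda>(N', F'). F' = F \<and> (\<forall>x. x \<notin> {20, 21, 22} \<longrightarrow> N' x = N x)) (compare_cells xs ys as)
    (1 + length as * (6 * l + 4))
    (\<lambda>(N', F'). F' = F \<and> N' 22 = (if \<forall>a\<in>set as. count_list (map N xs) (N a) \<le> count_list (map N ys) (N a) then 1 else 0)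
       \<and> (\<forall>x. x \<notin> {20, 21, 22} \<longrightarrow> N' x = N x))"
  using assms(1)
proof (induction as)
  case Nil
  show ?case unfolding compare_cells.simps by (rule tri_SetI) auto
next
  case (Cons a as)
  let ?P = "\<lambda>(N', F'). F' = F \<and> (\<forall>x. x \<notin> {20, 21, 22} \<longrightarrow> N' x = N x)"
  let ?ok = "\<lambda>as. if \<forall>a\<in>set as. count_list (map N xs) (N a) \<le> count_list (map N ys) (N a) then 1 else (0::nat)"
  have nin: "20 \<notin> set xs" "21 \<notin> set xs" "22 \<notin> set xs" "20 \<notin> set ys" "21 \<notin> set ys" "22 \<notin> set ys" "a \<noteq> 20" "a \<noteq> 21" "a \<noteq> 22"
    using Cons.prems by auto
  have IH: "tri R ?P (compare_cells xs ys as) (1 + length as * (6 * l + 4)) (\<lambda>s. ?P s \<and> fst s 22 = ?ok as)"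
    by (rule tri_conseq[OF Cons.IH]) (use Cons.prems in auto)
  have same: "map N' zs = map N zs" "N' a = N a"
    if "\<forall>x. x \<notin> {20, 21, 22} \<longrightarrow> N' x = N x" "zs = xs \<or> zs = ys" for N' zs
  proof -
    have "x \<notin> {20, 21, 22}" if "x \<in> set zs" for x using that nin \<open>zs = xs \<or> zs = ys\<close> by auto
    then show "map N' zs = map N zs" using that(1) by (intro map_cong refl) blast
    show "N' a = N a" using that(1) nin by blast
  qed
  have c1: "tri R (\<lambda>s. ?P s \<and> fst s 22 = ?ok as) (count_cells a 20 xs) (3 * l + 1)
      (\<lambda>s. ?P s \<and> fst s 22 = ?ok as \<and> fst s 20 = count_list (map N xs) (N a))"
  proof (rule tri_count_cells_conseq)
    fix N1 F1 N2 assume a: "?P (N1, F1) \<and> fst (N1, F1) 22 = ?ok as" "\<forall>x. x \<noteq> 20 \<longrightarrow> N2 x = N1 x"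
      "N2 20 = count_list (map N1 xs) (N1 a)"
    then have "map N1 xs = map N xs" "N1 a = N a" using same[of N1 xs] by auto
    with a show "?P (N2, F1) \<and> fst (N2, F1) 22 = ?ok as \<and> fst (N2, F1) 20 = count_list (map N xs) (N a)" by auto
  qed (use nin assms in auto)
  have c2: "tri R (\<lambda>s. ?P s \<and> fst s 22 = ?ok as \<and> fst s 20 = count_list (map N xs) (N a)) (count_cells a 21 ys) (3 * l + 1)
      (\<lambda>s. ?P s \<and> fst s 22 = ?ok as \<and> fst s 20 = count_list (map N xs) (N a) \<and> fst s 21 = count_list (map N ys) (N a))"
  proof (rule tri_count_cells_conseq)
    fix N1 F1 N2 assume a: "?P (N1, F1) \<and> fst (N1, F1) 22 = ?ok as \<and> fst (N1, F1) 20 = count_list (map N xs) (N a)"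
      "\<forall>x. x \<noteq> 21 \<longrightarrow> N2 x = N1 x" "N2 21 = count_list (map N1 ys) (N1 a)"
    then have "map N1 ys = map N ys" "N1 a = N a" using same[of N1 ys] by auto
    with a show "?P (N2, F1) \<and> fst (N2, F1) 22 = ?ok as \<and> fst (N2, F1) 20 = count_list (map N xs) (N a)
        \<and> fst (N2, F1) 21 = count_list (map N ys) (N a)" by auto
  qed (use nin assms in auto)
  have c3: "tri R (\<lambda>s. ?P s \<and> fst s 22 = ?ok as \<and> fst s 20 = count_list (map N xs) (N a) \<and> fst s 21 = count_list (map N ys) (N a))
      (Cond (Less (Cell (Const 21)) (Cell (Const 20))) (SetI (Const 22) (Const 0)) Skip) (1 + 1)
      (\<lambda>s. ?P s \<and> fst s 22 = ?ok (a # as))"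
    by (rule tri_Cond; (rule tri_SetI tri_Skip)) auto
  have le: "1 + length as * (6 * l + 4) + ((3 * l + 1) + ((3 * l + 1) + (1 + 1))) \<le> 1 + length (a # as) * (6 * l + 4)" by simp
  show ?case unfolding compare_cells.simps
    by (rule tri_conseq[OF tri_Seq[OF IH tri_Seq[OF c1 tri_Seq[OF c2 c3]]] _ _ le]) auto
qed

text \<open>Inequalities between counts give inclusion of multisets, and equal sizes turn inclusion
  into equality; so one-sided comparisons suffice in \<open>compare_cells\<close>.\<close>

lemma mset_eq_iff_count_le:
  assumes "length xs = length ys"
  shows "mset xs = mset ys \<longleftrightarrow> (\<forall>a\<in>set xs. count_list xs a \<le> count_list ys a)"
proof
  assume le: "\<forall>a\<in>set xs. count_list xs a \<le> count_list ys a"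
  have "mset xs \<subseteq># mset ys"
    unfolding subseteq_mset_def
  proof
    fix a show "count (mset xs) a \<le> count (mset ys) a"
      using le by (cases "a \<in> set xs") (auto simp: count_mset count_list_0_iff)
  qed
  then show "mset xs = mset ys"
    using assms by (metis mset_subset_size size_mset subset_mset.less_le less_irrefl)
next
  assume "mset xs = mset ys"
  then show "\<forall>a\<in>set xs. count_list xs a \<le> count_list ys a" by (metis count_mset order_refl)
qed

definition compare :: "nat list \<Rightarrow> nat list \<Rightarrow> prog" where
  "compare xs ys = compare_cells xs ys xs"

lemma exec_compare:
  assumes "{20, 21, 22} \<inter> (set xs \<union> set ys) = {}" "length xs = l" "length ys = l"
  shows "\<exists>t N'. exec R (compare xs ys) (N, F) t (N', F) \<and> t \<le> compare_time l \<and>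
    N' 22 = (if mset (map N xs) = mset (map N ys) then 1 else 0) \<and> (\<forall>x. x \<notin> {20, 21, 22} \<longrightarrow> N' x = N x)"
proof -
  have "length (map N xs) = length (map N ys)" using assms by simp
  note eq = mset_eq_iff_count_le[OF this]
  have "{20, 21, 22} \<inter> (set xs \<union> set ys \<union> set xs) = {}" using assms(1) by auto
  from triE[OF tri_compare_cells[OF this, of l R F N], of "(N, F)"] assms(2,3)
  show ?thesis unfolding compare_def compare_time_def eq by auto
qed


section \<open>Gaussian elimination: algebra, program and verification\<close>

text \<open>Column \<open>w - 1\<close> of the augmented matrix is the right-hand side. Only rows
  from \<open>r\<close> on are considered: those above are pivot rows, which can be satisfied
  afterwards, or have been checked to be trivial.\<close>

definition solvable :: "nat \<Rightarrow> nat \<Rightarrow> (nat \<Rightarrow> nat \<Rightarrow> 'a::field) \<Rightarrow> nat \<Rightarrow> bool" where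
  "solvable m w A r \<longleftrightarrow> (\<exists>x. \<forall>i. r \<le> i \<and> i < m \<longrightarrow> (\<Sum>k<w - 1. A i k * x k) = A i (w - 1))"

lemma solvable_no_pivot:
  assumes "r < m" "\<And>k. k < w - 1 \<Longrightarrow> A r k = 0"
  shows "solvable m w A r \<longleftrightarrow> A r (w - 1) = 0 \<and> solvable m w A (Suc r)"
proof -
  have z: "(\<Sum>k<w - 1. A r k * x k) = 0" for x using assms(2) by simp
  show ?thesis
  proof
    assume "solvable m w A r"
    then obtain x where x: "\<And>i. r \<le> i \<Longrightarrow> i < m \<Longrightarrow> (\<Sum>k<w - 1. A i k * x k) = A i (w - 1)" by (auto simp: solvable_def)
    have "A r (w - 1) = 0" using x[of r] z[of x] assms(1) by simp
    moreover have "solvable m w A (Suc r)" unfolding solvable_def using x by (intro exI[of _ x]) simp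
    ultimately show "A r (w - 1) = 0 \<and> solvable m w A (Suc r)" by blast
  next
    assume a: "A r (w - 1) = 0 \<and> solvable m w A (Suc r)"
    then obtain x where x: "\<And>i. Suc r \<le> i \<Longrightarrow> i < m \<Longrightarrow> (\<Sum>k<w - 1. A i k * x k) = A i (w - 1)" by (auto simp: solvable_def)
    have "(\<Sum>k<w - 1. A i k * x k) = A i (w - 1)" if "r \<le> i" "i < m" for i
      using x[of i] z[of x] a that by (cases "i = r") auto
    then show "solvable m w A r" unfolding solvable_def by blast
  qed
qed

text \<open>The parameter \<open>j\<close> counts the rows below \<open>r\<close> already reduced,
  so that intermediate states of the loop are covered too.\<close>

definition pivot_step :: "nat \<Rightarrow> nat \<Rightarrow> nat \<Rightarrow> (nat \<Rightarrow> nat \<Rightarrow> 'a::field) \<Rightarrow> nat \<Rightarrow> nat \<Rightarrow> 'a" where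
  "pivot_step r q j A = (\<lambda>i k. if r < i \<and> i < r + 1 + j then A i k - A i q / A r q * A r k else A i k)"

text \<open>In the reduced rows unknown \<open>q\<close> has coefficient 0, so a solution of them
  stays one when \<open>q\<close> is reassigned to satisfy row \<open>r\<close>; the row operations
  are reversible.\<close>

lemma solvable_pivot:
  assumes r: "r < m" and q: "q < w - 1" "A r q \<noteq> 0"
  shows "solvable m w A r \<longleftrightarrow> solvable m w (pivot_step r q (m - (r + 1)) A) (Suc r)"
proof -
  define B where "B = pivot_step r q (m - (r + 1)) A"
  have B: "B i k = A i k - A i q / A r q * A r k" if "Suc r \<le> i" "i < m" for i k
    using that by (auto simp: B_def pivot_step_def)
  have sB: "(\<Sum>k<w - 1. B i k * x k) = (\<Sum>k<w - 1. A i k * x k) - A i q / A r q * (\<Sum>k<w - 1. A r k * x k)"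
    if "Suc r \<le> i" "i < m" for i x
    using B[OF that] by (simp add: left_diff_distrib sum_subtractf sum_distrib_left mult.assoc)
  show ?thesis unfolding B_def[symmetric]
  proof
    assume "solvable m w A r"
    then obtain x where x: "\<And>i. r \<le> i \<Longrightarrow> i < m \<Longrightarrow> (\<Sum>k<w - 1. A i k * x k) = A i (w - 1)" by (auto simp: solvable_def)
    have "(\<Sum>k<w - 1. B i k * x k) = B i (w - 1)" if "Suc r \<le> i" "i < m" for i
    proof -
      have "(\<Sum>k<w - 1. A i k * x k) = A i (w - 1)" "(\<Sum>k<w - 1. A r k * x k) = A r (w - 1)"
        using x[of i] x[of r] that r by simp_all
      then show ?thesis unfolding sB[OF that] unfolding B[OF that] by (simp only:)
    qed
    then show "solvable m w B (Suc r)" unfolding solvable_def by blast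
  next
    assume "solvable m w B (Suc r)"
    then obtain x where x: "\<And>i. Suc r \<le> i \<Longrightarrow> i < m \<Longrightarrow> (\<Sum>k<w - 1. B i k * x k) = B i (w - 1)" by (auto simp: solvable_def)
    \<comment> \<open>The value of unknown \<open>q\<close> that row \<open>r\<close> dictates once
      the others are given.\<close>
    define t where "t = (A r (w - 1) - (\<Sum>k\<in>{..<w - 1} - {q}. A r k * x k)) / A r q"
    define y where "y = x(q := t)"
    have sy: "(\<Sum>k<w - 1. C k * y k) = C q * t + (\<Sum>k\<in>{..<w - 1} - {q}. C k * x k)" for C
    proof -
      have "(\<Sum>k<w - 1. C k * y k) = C q * y q + (\<Sum>k\<in>{..<w - 1} - {q}. C k * y k)" using q by (simp add: sum.remove)
      moreover have "(\<Sum>k\<in>{..<w - 1} - {q}. C k * y k) = (\<Sum>k\<in>{..<w - 1} - {q}. C k * x k)"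
        by (rule sum.cong) (auto simp: y_def)
      ultimately show ?thesis by (simp add: y_def)
    qed
    have ry: "(\<Sum>k<w - 1. A r k * y k) = A r (w - 1)" unfolding sy t_def using q by simp
    have "(\<Sum>k<w - 1. A i k * y k) = A i (w - 1)" if i: "r \<le> i" "i < m" for i
    proof (cases "i = r")
      case False
      then have i': "Suc r \<le> i" "i < m" using i by auto
      have Bq: "B i q = 0" using B[OF i'] q by simp
      have "(\<Sum>k<w - 1. B i k * x k) = B i q * x q + (\<Sum>k\<in>{..<w - 1} - {q}. B i k * x k)" using q by (simp add: sum.remove)
      then have "(\<Sum>k<w - 1. B i k * y k) = B i (w - 1)" using x[OF i'] Bq unfolding sy[of "B i"] by simp
      then have "(\<Sum>k<w - 1. A i k * y k) - A i q / A r q * A r (w - 1) = A i (w - 1) - A i q / A r q * A r (w - 1)"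
        unfolding sB[OF i'] ry unfolding B[OF i'] .
      then show ?thesis by simp
    qed (simp only: ry)
    then show "solvable m w A r" unfolding solvable_def by blast
  qed
qed

abbreviation "cell k \<equiv> Cell (Const k)"

text \<open>Registers of the elimination: 5 matrix start, 6 address of a zero, 7 width, 8 height, 9
  index of the last column, 10 address and 11 index of the current row, 12 column counter, 13 pivot
  column, 14 pivot found, 15 inconsistency found, 16 address of the row being reduced, 17 number of
  rows below, 18 their counter.\<close>

definition pivot_search :: prog where
  "pivot_search = Seq (SetI (Const 14) (Const 0)) (For 12 (cell 9)
     (Cond (EqF (Plus (cell 10) (cell 12)) (cell 6)) Skip (Seq (SetI (Const 13) (cell 12)) (SetI (Const 14) (Const 1)))))"

text \<open>The quotient is saved in the scratch cell after the zero before the entry it depends on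
  is overwritten; the second scratch cell holds the products.\<close>

definition reduce_row :: prog where
  "reduce_row = Seq (SetF (Plus (cell 6) (Const 1)) FDiv (Plus (cell 16) (cell 13)) (Plus (cell 10) (cell 13)))
     (Seq (For 12 (cell 7) (Seq (SetF (Plus (cell 6) (Const 2)) FMul (Plus (cell 6) (Const 1)) (Plus (cell 10) (cell 12)))
        (SetF (Plus (cell 16) (cell 12)) FSub (Plus (cell 16) (cell 12)) (Plus (cell 6) (Const 2)))))
     (SetI (Const 16) (Plus (cell 16) (cell 7))))"

definition reduce_rows :: prog where
  "reduce_rows = Seq (SetI (Const 16) (Plus (cell 10) (cell 7)))
     (Seq (SetI (Const 17) (Minus (cell 8) (Plus (cell 11) (Const 1)))) (For 18 (cell 17) reduce_row))"

text \<open>Row exchanges are avoided: any nonzero coefficient of the current row may serve as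
  pivot. A row without one either is trivial or shows inconsistency.\<close>

definition row_step :: prog where
  "row_step = Seq pivot_search (Seq (Cond (Less (Const 0) (cell 14)) reduce_rows
     (Cond (EqF (Plus (cell 10) (cell 9)) (cell 6)) Skip (SetI (Const 15) (Const 1))))
     (SetI (Const 10) (Plus (cell 10) (cell 7))))"

definition eliminate :: prog where
  "eliminate = Seq (SetI (Const 10) (cell 5)) (Seq (SetI (Const 15) (Const 0)) (For 11 (cell 8) row_step))"

lemma tri_ex: "(\<And>A. tri R (P A) c T Q) \<Longrightarrow> tri R (\<lambda>s. \<exists>A. P A s) c T Q"
  unfolding tri_def by blast

lemma tri_assume: "(\<And>N F. P (N, F) \<Longrightarrow> X) \<Longrightarrow> (X \<Longrightarrow> tri R P c T Q) \<Longrightarrow> tri R P c T Q"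
  unfolding tri_def by (metis surj_pair)

lemma for_time_mono: "m \<le> m' \<Longrightarrow> T \<le> T' \<Longrightarrow> for_time m T \<le> for_time m' T'"
  unfolding for_time_def by (intro add_mono mult_mono) auto

definition rows_time :: "nat \<Rightarrow> nat \<Rightarrow> nat" where
  "rows_time m w = 1 + (1 + for_time m (1 + (for_time w 2 + 1)))"

definition step_time :: "nat \<Rightarrow> nat \<Rightarrow> nat" where
  "step_time m w = (1 + for_time (w - 1) (2 + 1)) + ((rows_time m w + 2 + 1) + 1)"

definition eliminate_time :: "nat \<Rightarrow> nat \<Rightarrow> nat" where
  "eliminate_time m w = 1 + (1 + for_time m (step_time m w))"

context prime_field_type
begin

lemma fop_val_carrier:
  assumes "x \<in> carrier R" "y \<in> carrier R"
  shows "fop_val R FMul x y \<in> carrier R" "of_int (fop_val R FMul x y) = (of_int x * of_int y :: 'a)"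
    "fop_val R FSub x y \<in> carrier R" "of_int (fop_val R FSub x y) = (of_int x - of_int y :: 'a)"
    "fop_val R FAdd x y \<in> carrier R" "of_int (fop_val R FAdd x y) = (of_int x + of_int y :: 'a)"
    "y \<noteq> 0 \<Longrightarrow> fop_val R FDiv x y \<in> carrier R" "y \<noteq> 0 \<Longrightarrow> of_int (fop_val R FDiv x y) = (of_int x / of_int y :: 'a)"
  using assms of_int_inv_R[of y] by (simp_all add: of_int_ops of_int_minus_R divide_inverse zero_R)

context
  fixes z0 m w :: nat
  assumes w: "1 \<le> w"
begin

abbreviation "addr i k \<equiv> z0 + 3 + i * w + k"

text \<open>The matrix \<open>A\<close> over the field type is stored row by row from
  \<open>z0 + 3\<close> on, as residues. Cell \<open>z0\<close> holds the zero for the tests, the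
  two cells in between are scratch space.\<close>

definition cfg :: "(nat \<Rightarrow> nat \<Rightarrow> 'a) \<Rightarrow> (nat \<Rightarrow> nat) \<Rightarrow> (nat \<Rightarrow> int) \<Rightarrow> bool" where
  "cfg A N F \<longleftrightarrow> N 5 = z0 + 3 \<and> N 6 = z0 \<and> N 7 = w \<and> N 8 = m \<and> N 9 = w - 1 \<and> F z0 = 0 \<and>
     (\<forall>x. F x \<in> carrier R) \<and> (\<forall>i<m. \<forall>k<w. of_int (F (addr i k)) = A i k)"

lemma addr_inj: "k < w \<Longrightarrow> k' < w \<Longrightarrow> addr i k = addr i' k' \<longleftrightarrow> i = i' \<and> k = k'"
proof
  assume k: "k < w" "k' < w" and "addr i k = addr i' k'"
  then have eq: "k + w * i = k' + w * i'" by (simp add: mult.commute)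
  have "(k + w * i) mod w = k" "(k' + w * i') mod w = k'" "(k + w * i) div w = i" "(k' + w * i') div w = i'"
    using k by simp_all
  then show "i = i' \<and> k = k'" using eq by metis
qed simp

lemma cfg_upd_N: "cfg A N F \<Longrightarrow> c \<notin> {5, 6, 7, 8, 9} \<Longrightarrow> cfg A (N(c := x)) F"
  by (auto simp: cfg_def)

lemma cfg_scratch:
  assumes "cfg A N F" "x \<in> carrier R" shows "cfg A N (F(Suc z0 := x))" "cfg A N (F(Suc (Suc z0) := x))"
  using assms by (auto simp: cfg_def)

lemma cfg_store:
  assumes "cfg A N F" "x \<in> carrier R" "i0 < m" "k0 < w"
  shows "cfg (\<lambda>i k. if i = i0 \<and> k = k0 then of_int x else A i k) N (F(addr i0 k0 := x))"
proof -
  have "of_int ((F(addr i0 k0 := x)) (addr i k)) = (if i = i0 \<and> k = k0 then of_int x else A i k)"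
    if "i < m" "k < w" for i k
    using addr_inj[OF that(2) assms(4), of i i0] assms(1) that unfolding cfg_def fun_upd_apply by simp
  then show ?thesis using assms unfolding cfg_def by simp
qed

lemma cfg_load: "cfg A N F \<Longrightarrow> i < m \<Longrightarrow> k < w \<Longrightarrow> of_int (F (addr i k)) = A i k"
  by (simp add: cfg_def)

lemma cfg_carrier: "cfg A N F \<Longrightarrow> F x \<in> carrier R"
  by (simp add: cfg_def)

lemma cfg_test: "cfg A N F \<Longrightarrow> i < m \<Longrightarrow> k < w \<Longrightarrow> F (addr i k) = F z0 \<longleftrightarrow> A i k = 0"
  using cfg_load[of A N F i k] of_int_R_eq_0[OF cfg_carrier, of A N F "addr i k"] by (simp add: cfg_def)

lemma tri_pivot_search:
  assumes r: "r < m"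
  shows "tri R (\<lambda>(N, F). cfg A N F \<and> N 10 = addr r 0 \<and> N 11 = r \<and> N 15 = v) pivot_search (1 + for_time (w - 1) (2 + 1))
    (\<lambda>(N, F). cfg A N F \<and> N 10 = addr r 0 \<and> N 11 = r \<and> N 15 = v \<and>
      (N 14 = 0 \<and> (\<forall>k<w - 1. A r k = 0) \<or> N 14 = 1 \<and> N 13 < w - 1 \<and> A r (N 13) \<noteq> 0))"
proof -
  let ?B = "\<lambda>(N, F). cfg A N F \<and> N 10 = addr r 0 \<and> N 11 = r \<and> N 15 = v"
  let ?J = "\<lambda>k (N, F). cfg A N F \<and> N 10 = addr r 0 \<and> N 11 = r \<and> N 15 = v \<and> N 12 = k \<and>
     (N 14 = 0 \<and> (\<forall>k'<k. A r k' = 0) \<or> N 14 = 1 \<and> N 13 < w - 1 \<and> A r (N 13) \<noteq> 0)"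
  have f: "tri R (\<lambda>(N, F). cfg A N F \<and> N 10 = addr r 0 \<and> N 11 = r \<and> N 15 = v \<and> N 14 = 0)
     (For 12 (cell 9) (Cond (EqF (Plus (cell 10) (cell 12)) (cell 6)) Skip (Seq (SetI (Const 13) (cell 12)) (SetI (Const 14) (Const 1)))))
     (for_time (w - 1) (2 + 1)) (?J (w - 1))"
  proof (rule tri_For[where J = ?J])
    show "?J 0 (N(12 := 0), F)" if "case (N, F) of (N, F) \<Rightarrow> cfg A N F \<and> N 10 = addr r 0 \<and> N 11 = r \<and> N 15 = v \<and> N 14 = 0" for N F
      using that by (simp add: cfg_upd_N)
    show "ival N (cell 9) = w - 1 \<and> N 12 = k" if "?J k (N, F)" for k N F
      using that by (simp add: cfg_def)
    fix k assume k: "k < w - 1"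
    have t: "F (N 10 + N 12) = F (N 6) \<longleftrightarrow> A r k = 0" if "?J k (N, F)" for N F
      using that cfg_test[of A N F r k] r k by (simp add: cfg_def)
    show "tri R (?J k) (Cond (EqF (Plus (cell 10) (cell 12)) (cell 6)) Skip (Seq (SetI (Const 13) (cell 12)) (SetI (Const 14) (Const 1)))) (2 + 1)
       (\<lambda>(N, F). N 12 = k \<and> ?J (Suc k) (N(12 := Suc k), F))"
    proof (rule tri_Cond)
      show "tri R (\<lambda>s. ?J k s \<and> holds s (EqF (Plus (cell 10) (cell 12)) (cell 6))) Skip 2
         (\<lambda>(N, F). N 12 = k \<and> ?J (Suc k) (N(12 := Suc k), F))"
      proof (rule tri_Skip)
        fix N F assume a: "?J k (N, F) \<and> holds (N, F) (EqF (Plus (cell 10) (cell 12)) (cell 6))"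
        then have J: "?J k (N, F)" and h: "F (N 10 + N 12) = F (N 6)" by auto
        have "A r k = 0" using t[OF J] h by blast
        then show "case (N, F) of (N, F) \<Rightarrow> N 12 = k \<and> ?J (Suc k) (N(12 := Suc k), F)"
          using a by (auto simp: cfg_upd_N less_Suc_eq)
      qed simp
      have s1: "tri R (\<lambda>s. ?J k s \<and> \<not> holds s (EqF (Plus (cell 10) (cell 12)) (cell 6))) (SetI (Const 13) (cell 12)) 1
         (\<lambda>(N, F). ?B (N, F) \<and> N 12 = k \<and> N 13 = k \<and> A r k \<noteq> 0)"
      proof (rule tri_SetI)
        fix N F assume a: "?J k (N, F) \<and> \<not> holds (N, F) (EqF (Plus (cell 10) (cell 12)) (cell 6))"
        then have J: "?J k (N, F)" and h: "F (N 10 + N 12) \<noteq> F (N 6)" by auto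
        have "A r k \<noteq> 0" using t[OF J] h by blast
        then show "case (N(ival N (Const 13) := ival N (cell 12)), F) of (N, F) \<Rightarrow> ?B (N, F) \<and> N 12 = k \<and> N 13 = k \<and> A r k \<noteq> 0"
          using a by (simp add: cfg_upd_N)
      qed simp
      have s2: "tri R (\<lambda>(N, F). ?B (N, F) \<and> N 12 = k \<and> N 13 = k \<and> A r k \<noteq> 0) (SetI (Const 14) (Const 1)) 1
         (\<lambda>(N, F). N 12 = k \<and> ?J (Suc k) (N(12 := Suc k), F))"
        by (rule tri_SetI) (use k in \<open>auto simp: cfg_upd_N\<close>)
      show "tri R (\<lambda>s. ?J k s \<and> \<not> holds s (EqF (Plus (cell 10) (cell 12)) (cell 6))) (Seq (SetI (Const 13) (cell 12)) (SetI (Const 14) (Const 1))) 2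
         (\<lambda>(N, F). N 12 = k \<and> ?J (Suc k) (N(12 := Suc k), F))"
        using tri_Seq[OF s1 s2] by (simp only: one_add_one)
    qed
  qed
  have i: "tri R ?B (SetI (Const 14) (Const 0)) 1 (\<lambda>(N, F). cfg A N F \<and> N 10 = addr r 0 \<and> N 11 = r \<and> N 15 = v \<and> N 14 = 0)"
    by (rule tri_SetI) (auto simp: cfg_upd_N)
  show ?thesis unfolding pivot_search_def
    by (rule tri_conseq[OF tri_Seq[OF i f]]) auto
qed

lemma tri_reduce_row:
  assumes r: "r < m" and q: "q < w" "A r q \<noteq> 0" and j: "r + 1 + j < m"
  shows "tri R (\<lambda>(N, F). cfg (pivot_step r q j A) N F \<and> N 10 = addr r 0 \<and> N 11 = r \<and> N 13 = q \<and> N 15 = v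
       \<and> N 16 = addr (r + 1 + j) 0 \<and> N 17 = m - (r + 1) \<and> N 18 = j)
     reduce_row (1 + (for_time w 2 + 1))
     (\<lambda>(N, F). cfg (pivot_step r q (Suc j) A) N F \<and> N 10 = addr r 0 \<and> N 11 = r \<and> N 13 = q \<and> N 15 = v
       \<and> N 16 = addr (r + 1 + Suc j) 0 \<and> N 17 = m - (r + 1) \<and> N 18 = j)"
proof -
  let ?i = "r + 1 + j"
  let ?K = "\<lambda>N. N 10 = addr r 0 \<and> N 11 = r \<and> N 13 = q \<and> N 15 = v \<and> N 16 = addr ?i 0 \<and> N 17 = m - (r + 1) \<and> N 18 = j"
  define f where "f = A ?i q / A r q"
  \<comment> \<open>The matrix after the first \<open>k\<close> columns of row \<open>?i\<close>
    have been reduced; the factor \<open>f\<close> is frozen, and row \<open>r\<close> is never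
    touched.\<close>
  define B where "B = (\<lambda>k i k'. if i = ?i \<and> k' < k then A i k' - f * A r k' else pivot_step r q j A i k')"
  have B0: "B 0 = pivot_step r q j A" by (simp add: B_def)
  have BS: "(\<lambda>i k'. if i = ?i \<and> k' = k then A ?i k - f * A r k else B k i k') = B (Suc k)" for k
    by (auto simp: B_def fun_eq_iff less_Suc_eq)
  have Br: "B k r k' = A r k'" for k k' by (simp add: B_def pivot_step_def)
  have Bi: "B k ?i k = A ?i k" for k by (simp add: B_def pivot_step_def)
  have Bw: "cfg (B w) N F \<longleftrightarrow> cfg (pivot_step r q (Suc j) A) N F" for N F
  proof -
    have "B w i k = pivot_step r q (Suc j) A i k" if "k < w" for i k
      using that by (auto simp: B_def pivot_step_def f_def)
    then show ?thesis unfolding cfg_def by simp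
  qed
  let ?J = "\<lambda>k (N, F). cfg (B k) N F \<and> ?K N \<and> N 12 = k \<and> of_int (F (Suc z0)) = f"
  have s1: "tri R (\<lambda>(N, F). cfg (B 0) N F \<and> ?K N) (SetF (Plus (cell 6) (Const 1)) FDiv (Plus (cell 16) (cell 13)) (Plus (cell 10) (cell 13))) 1
     (\<lambda>(N, F). cfg (B 0) N F \<and> ?K N \<and> of_int (F (Suc z0)) = f)"
  proof (rule tri_SetF)
    fix N F assume "case (N, F) of (N, F) \<Rightarrow> cfg (B 0) N F \<and> ?K N"
    then have c: "cfg (B 0) N F" and K: "?K N" by auto
    have N6: "N 6 = z0" using c by (simp add: cfg_def)
    have a: "N 16 + N 13 = addr ?i q" "N 10 + N 13 = addr r q" using K by auto
    have x: "F (addr ?i q) \<in> carrier R" "F (addr r q) \<in> carrier R" using cfg_carrier[OF c] by auto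
    have y: "of_int (F (addr r q)) = A r q" using cfg_load[OF c r q(1)] by (simp add: Br)
    have z: "of_int (F (addr ?i q)) = A ?i q" using cfg_load[OF c j q(1)] by (simp add: B0 pivot_step_def)
    have nz: "F (addr r q) \<noteq> 0" using y q(2) by auto
    let ?x = "fop_val R FDiv (F (addr ?i q)) (F (addr r q))"
    have "?x \<in> carrier R" "of_int ?x = f"
      using fop_val_carrier(7,8)[OF x nz] y z by (simp_all add: f_def)
    then have "case (N, F(Suc z0 := ?x)) of (N, F) \<Rightarrow> cfg (B 0) N F \<and> ?K N \<and> of_int (F (Suc z0)) = f"
      using cfg_scratch(1)[OF c] K by simp
    then show "fop_defined R FDiv (F (ival N (Plus (cell 10) (cell 13)))) \<and>
       (case (N, F(ival N (Plus (cell 6) (Const 1)) := fop_val R FDiv (F (ival N (Plus (cell 16) (cell 13)))) (F (ival N (Plus (cell 10) (cell 13)))))) of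
         (N, F) \<Rightarrow> cfg (B 0) N F \<and> ?K N \<and> of_int (F (Suc z0)) = f)"
      using nz a N6 by (simp only: ival.simps fop_defined.simps zero_R Suc_eq_plus1 simp_thms)
  qed simp
  have s2: "tri R (\<lambda>(N, F). cfg (B 0) N F \<and> ?K N \<and> of_int (F (Suc z0)) = f)
     (For 12 (cell 7) (Seq (SetF (Plus (cell 6) (Const 2)) FMul (Plus (cell 6) (Const 1)) (Plus (cell 10) (cell 12)))
        (SetF (Plus (cell 16) (cell 12)) FSub (Plus (cell 16) (cell 12)) (Plus (cell 6) (Const 2))))) (for_time w 2) (?J w)"
  proof (rule tri_For[where J = ?J])
    show "?J 0 (N(12 := 0), F)" if "case (N, F) of (N, F) \<Rightarrow> cfg (B 0) N F \<and> ?K N \<and> of_int (F (Suc z0)) = f" for N F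
      using that by (simp add: cfg_upd_N)
    show "ival N (cell 7) = w \<and> N 12 = k" if "?J k (N, F)" for k N F
      using that by (simp add: cfg_def)
    fix k assume k: "k < w"
    have t1: "tri R (?J k) (SetF (Plus (cell 6) (Const 2)) FMul (Plus (cell 6) (Const 1)) (Plus (cell 10) (cell 12))) 1
       (\<lambda>(N, F). ?J k (N, F) \<and> of_int (F (Suc (Suc z0))) = f * A r k)"
    proof (rule tri_SetF)
      fix N F assume J: "?J k (N, F)"
      then have c: "cfg (B k) N F" and K: "?K N" "N 12 = k" and ff: "of_int (F (Suc z0)) = f" by auto
      have N6: "N 6 = z0" using c by (simp add: cfg_def)
      have a: "N 10 + N 12 = addr r k" using K by auto
      have x: "F (Suc z0) \<in> carrier R" "F (addr r k) \<in> carrier R" using cfg_carrier[OF c] by auto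
      have y: "of_int (F (addr r k)) = A r k" using cfg_load[OF c r k] by (simp add: Br)
      let ?x = "fop_val R FMul (F (Suc z0)) (F (addr r k))"
      have "?x \<in> carrier R" "of_int ?x = f * A r k" using fop_val_carrier(1,2)[OF x] y ff by simp_all
      then have "?J k (N, F(Suc (Suc z0) := ?x)) \<and> of_int ((F(Suc (Suc z0) := ?x)) (Suc (Suc z0))) = f * A r k"
        using cfg_scratch(2)[OF c] K ff by simp
      moreover have "N 6 + 1 = Suc z0" "N 6 + 2 = Suc (Suc z0)" using N6 by simp_all
      ultimately show "fop_defined R FMul (F (ival N (Plus (cell 10) (cell 12)))) \<and>
        (case (N, F(ival N (Plus (cell 6) (Const 2)) := fop_val R FMul (F (ival N (Plus (cell 6) (Const 1)))) (F (ival N (Plus (cell 10) (cell 12)))))) of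
          (N, F) \<Rightarrow> ?J k (N, F) \<and> of_int (F (Suc (Suc z0))) = f * A r k)"
        using a by (simp only: ival.simps fop_defined.simps split_conv simp_thms)
    qed simp
    have t2: "tri R (\<lambda>(N, F). ?J k (N, F) \<and> of_int (F (Suc (Suc z0))) = f * A r k)
       (SetF (Plus (cell 16) (cell 12)) FSub (Plus (cell 16) (cell 12)) (Plus (cell 6) (Const 2))) 1
       (\<lambda>(N, F). N 12 = k \<and> ?J (Suc k) (N(12 := Suc k), F))"
    proof (rule tri_SetF)
      fix N F assume "case (N, F) of (N, F) \<Rightarrow> ?J k (N, F) \<and> of_int (F (Suc (Suc z0))) = f * A r k"
      then have c: "cfg (B k) N F" and K: "?K N" "N 12 = k" and ff: "of_int (F (Suc z0)) = f" "of_int (F (Suc (Suc z0))) = f * A r k" by auto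
      have N6: "N 6 + 2 = Suc (Suc z0)" using c by (simp add: cfg_def)
      have a: "N 16 + N 12 = addr ?i k" using K by auto
      have x: "F (addr ?i k) \<in> carrier R" "F (Suc (Suc z0)) \<in> carrier R" using cfg_carrier[OF c] by auto
      have y: "of_int (F (addr ?i k)) = A ?i k" using cfg_load[OF c j k] unfolding Bi .
      let ?x = "fop_val R FSub (F (addr ?i k)) (F (Suc (Suc z0)))"
      have xc: "?x \<in> carrier R" "of_int ?x = A ?i k - f * A r k" using fop_val_carrier(3,4)[OF x] y ff by simp_all
      have c': "cfg (B (Suc k)) N (F(addr ?i k := ?x))"
        using cfg_store[OF c xc(1) j k] unfolding xc(2) BS .
      have "(F(addr ?i k := ?x)) (Suc z0) = F (Suc z0)" by simp
      then have "?J (Suc k) (N(12 := Suc k), F(addr ?i k := ?x))"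
        using cfg_upd_N[OF c', of 12 "Suc k"] K ff by simp
      then show "fop_defined R FSub (F (ival N (Plus (cell 6) (Const 2)))) \<and>
        (case (N, F(ival N (Plus (cell 16) (cell 12)) := fop_val R FSub (F (ival N (Plus (cell 16) (cell 12)))) (F (ival N (Plus (cell 6) (Const 2)))))) of
          (N, F) \<Rightarrow> N 12 = k \<and> ?J (Suc k) (N(12 := Suc k), F))"
        using a N6 K(2) by (simp only: ival.simps fop_defined.simps split_conv simp_thms)
    qed simp
    show "tri R (?J k) (Seq (SetF (Plus (cell 6) (Const 2)) FMul (Plus (cell 6) (Const 1)) (Plus (cell 10) (cell 12)))
        (SetF (Plus (cell 16) (cell 12)) FSub (Plus (cell 16) (cell 12)) (Plus (cell 6) (Const 2)))) 2
        (\<lambda>(N, F). N 12 = k \<and> ?J (Suc k) (N(12 := Suc k), F))"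
      using tri_Seq[OF t1 t2] by (simp only: one_add_one)
  qed
  have s3: "tri R (?J w) (SetI (Const 16) (Plus (cell 16) (cell 7))) 1
     (\<lambda>(N, F). cfg (pivot_step r q (Suc j) A) N F \<and> N 10 = addr r 0 \<and> N 11 = r \<and> N 13 = q \<and> N 15 = v
       \<and> N 16 = addr (r + 1 + Suc j) 0 \<and> N 17 = m - (r + 1) \<and> N 18 = j)"
  proof (rule tri_SetI)
    fix N F assume J: "?J w (N, F)"
    then have c: "cfg (pivot_step r q (Suc j) A) N F" by (simp add: Bw)
    then have "N 7 = w" by (simp add: cfg_def)
    then show "case (N(ival N (Const 16) := ival N (Plus (cell 16) (cell 7))), F) of (N, F) \<Rightarrow>
       cfg (pivot_step r q (Suc j) A) N F \<and> N 10 = addr r 0 \<and> N 11 = r \<and> N 13 = q \<and> N 15 = v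
       \<and> N 16 = addr (r + 1 + Suc j) 0 \<and> N 17 = m - (r + 1) \<and> N 18 = j"
      using J cfg_upd_N[OF c] by simp
  qed simp
  show ?thesis unfolding reduce_row_def
    by (rule tri_conseq[OF tri_Seq[OF s1 tri_Seq[OF s2 s3]]]) (auto simp: B0)
qed


lemma tri_reduce_rows:
  assumes r: "r < m" and q: "q < w" "A r q \<noteq> 0"
  shows "tri R (\<lambda>(N, F). cfg A N F \<and> N 10 = addr r 0 \<and> N 11 = r \<and> N 13 = q \<and> N 15 = v) reduce_rows (rows_time m w)
     (\<lambda>(N, F). cfg (pivot_step r q (m - (r + 1)) A) N F \<and> N 10 = addr r 0 \<and> N 11 = r \<and> N 15 = v)"
proof -
  let ?B = "\<lambda>N. N 10 = addr r 0 \<and> N 11 = r \<and> N 13 = q \<and> N 15 = v"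
  let ?J = "\<lambda>j (N, F). cfg (pivot_step r q j A) N F \<and> N 10 = addr r 0 \<and> N 11 = r \<and> N 13 = q \<and> N 15 = v
       \<and> N 16 = addr (r + 1 + j) 0 \<and> N 17 = m - (r + 1) \<and> N 18 = j"
  have s1: "tri R (\<lambda>(N, F). cfg A N F \<and> ?B N) (SetI (Const 16) (Plus (cell 10) (cell 7))) 1
     (\<lambda>(N, F). cfg A N F \<and> ?B N \<and> N 16 = addr (r + 1) 0)"
    by (rule tri_SetI) (auto simp: cfg_upd_N, auto simp: cfg_def)
  have s2: "tri R (\<lambda>(N, F). cfg A N F \<and> ?B N \<and> N 16 = addr (r + 1) 0) (SetI (Const 17) (Minus (cell 8) (Plus (cell 11) (Const 1)))) 1
     (\<lambda>(N, F). cfg A N F \<and> ?B N \<and> N 16 = addr (r + 1) 0 \<and> N 17 = m - (r + 1))"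
    by (rule tri_SetI) (auto simp: cfg_upd_N, auto simp: cfg_def)
  have p0: "pivot_step r q 0 A = A" by (auto simp: pivot_step_def fun_eq_iff)
  have s3: "tri R (\<lambda>(N, F). cfg A N F \<and> ?B N \<and> N 16 = addr (r + 1) 0 \<and> N 17 = m - (r + 1)) (For 18 (cell 17) reduce_row)
     (for_time (m - (r + 1)) (1 + (for_time w 2 + 1))) (?J (m - (r + 1)))"
  proof (rule tri_For[where J = ?J])
    show "?J 0 (N(18 := 0), F)" if "case (N, F) of (N, F) \<Rightarrow> cfg A N F \<and> ?B N \<and> N 16 = addr (r + 1) 0 \<and> N 17 = m - (r + 1)" for N F
      using that by (simp add: cfg_upd_N p0)
    show "ival N (cell 17) = m - (r + 1) \<and> N 18 = j" if "?J j (N, F)" for j N F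
      using that by simp
    fix j assume "j < m - (r + 1)"
    then have j: "r + 1 + j < m" by simp
    show "tri R (?J j) reduce_row (1 + (for_time w 2 + 1)) (\<lambda>(N, F). N 18 = j \<and> ?J (Suc j) (N(18 := Suc j), F))"
      by (rule tri_conseq[OF tri_reduce_row[where v = v and A = A, OF r q j]]) (auto simp: cfg_upd_N)
  qed
  show ?thesis unfolding reduce_rows_def rows_time_def
    by (rule tri_conseq[OF tri_Seq[OF s1 tri_Seq[OF s2 s3]]]) (auto intro!: add_mono for_time_mono)
qed

text \<open>Here \<open>X\<close> is a fixed truth value, later the solvability of the initial
  system. While flag 15 is 0, it agrees with solvability of the remaining rows; flag 1 certifies
  that it is false.\<close>

lemma tri_row_step:
  assumes r: "r < m"
  shows "tri R (\<lambda>(N, F). \<exists>A. cfg A N F \<and> N 10 = addr r 0 \<and> N 11 = r \<and>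
       (if N 15 = 0 then X \<longleftrightarrow> solvable m w A r else N 15 = 1 \<and> \<not> X)) row_step (step_time m w)
     (\<lambda>(N, F). \<exists>A. cfg A N F \<and> N 10 = addr (Suc r) 0 \<and> N 11 = r \<and>
       (if N 15 = 0 then X \<longleftrightarrow> solvable m w A (Suc r) else N 15 = 1 \<and> \<not> X))"
proof -
  let ?G = "\<lambda>A r v. if v = 0 then X \<longleftrightarrow> solvable m w A r else v = 1 \<and> \<not> X"
  have main: "tri R (\<lambda>(N, F). cfg A N F \<and> N 10 = addr r 0 \<and> N 11 = r \<and> N 15 = v) row_step (step_time m w)
     (\<lambda>(N, F). \<exists>A. cfg A N F \<and> N 10 = addr (Suc r) 0 \<and> N 11 = r \<and> ?G A (Suc r) (N 15))" if G: "?G A r v" for A v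
  proof -
    let ?P = "\<lambda>(N, F). cfg A N F \<and> N 10 = addr r 0 \<and> N 11 = r \<and> N 15 = v \<and>
      (N 14 = 0 \<and> (\<forall>k<w - 1. A r k = 0) \<or> N 14 = 1 \<and> N 13 < w - 1 \<and> A r (N 13) \<noteq> 0)"
    let ?Q = "\<lambda>(N, F). \<exists>A. cfg A N F \<and> N 10 = addr r 0 \<and> N 11 = r \<and> ?G A (Suc r) (N 15)"
    have piv: "tri R (\<lambda>s. ?P s \<and> holds s (Less (Const 0) (cell 14))) reduce_rows ((rows_time m w) + 2) ?Q"
    proof (rule triI)
      fix N F assume a: "?P (N, F) \<and> holds (N, F) (Less (Const 0) (cell 14))"
      then have q: "N 13 < w - 1" "A r (N 13) \<noteq> 0" and c: "cfg A N F" "N 10 = addr r 0" "N 11 = r" "N 15 = v" by auto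
      have qw: "N 13 < w" using q(1) by simp
      define A' where "A' = pivot_step r (N 13) (m - (r + 1)) A"
      have sol: "solvable m w A r \<longleftrightarrow> solvable m w A' (Suc r)" unfolding A'_def by (rule solvable_pivot[where A = A, OF r q])
      have "case (N, F) of (N', F) \<Rightarrow> cfg A N' F \<and> N' 10 = addr r 0 \<and> N' 11 = r \<and> N' 13 = N 13 \<and> N' 15 = v" using c by simp
      from triE[OF tri_reduce_rows[where A = A, OF r qw q(2)] this] obtain t N' F' where
        "exec R reduce_rows (N, F) t (N', F')" "t \<le> (rows_time m w)" "cfg A' N' F' \<and> N' 10 = addr r 0 \<and> N' 11 = r \<and> N' 15 = v"
        unfolding A'_def by auto
      moreover have "?G A' (Suc r) v" using G sol by (simp split: if_splits)
      ultimately show "\<exists>t s'. exec R reduce_rows (N, F) t s' \<and> t \<le> (rows_time m w) + 2 \<and> ?Q s'"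
        by (intro exI[of _ t] exI[of _ "(N', F')"]) auto
    qed
    have nopiv: "tri R (\<lambda>s. ?P s \<and> \<not> holds s (Less (Const 0) (cell 14)))
       (Cond (EqF (Plus (cell 10) (cell 9)) (cell 6)) Skip (SetI (Const 15) (Const 1))) (((rows_time m w) + 1) + 1) ?Q"
    proof (rule tri_Cond)
      let ?H = "\<lambda>s. (?P s \<and> \<not> holds s (Less (Const 0) (cell 14)))"
      have k: "cfg A N F" "N 10 = addr r 0" "N 11 = r" "N 15 = v"
        "solvable m w A r \<longleftrightarrow> A r (w - 1) = 0 \<and> solvable m w A (Suc r)"
        "holds (N, F) (EqF (Plus (cell 10) (cell 9)) (cell 6)) \<longleftrightarrow> A r (w - 1) = 0" if H: "?H (N, F)" for N F
      proof -
        show c: "cfg A N F" "N 10 = addr r 0" "N 11 = r" "N 15 = v" using H by auto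
        show "solvable m w A r \<longleftrightarrow> A r (w - 1) = 0 \<and> solvable m w A (Suc r)"
          by (rule solvable_no_pivot[OF r]) (use H in auto)
        have "N 9 = w - 1" "N 6 = z0" using c by (auto simp: cfg_def)
        then have "N 10 + N 9 = addr r (w - 1)" "N 6 = z0" using c by simp_all
        then show "holds (N, F) (EqF (Plus (cell 10) (cell 9)) (cell 6)) \<longleftrightarrow> A r (w - 1) = 0"
          using cfg_test[OF c(1) r, of "w - 1"] w by (simp only: holds.simps ival.simps)
      qed
      show "tri R (\<lambda>s. ?H s \<and> holds s (EqF (Plus (cell 10) (cell 9)) (cell 6))) Skip ((rows_time m w) + 1) ?Q"
      proof (rule tri_Skip)
        fix N F assume a: "?H (N, F) \<and> holds (N, F) (EqF (Plus (cell 10) (cell 9)) (cell 6))"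
        note k' = k[OF conjunct1[OF a]]
        have "?G A (Suc r) v" using G k'(5) k'(6) conjunct2[OF a] by (simp split: if_splits)
        then show "case (N, F) of (N, F) \<Rightarrow> \<exists>A. cfg A N F \<and> N 10 = addr r 0 \<and> N 11 = r \<and> ?G A (Suc r) (N 15)"
          using k'(1-4) by auto
      qed simp
      show "tri R (\<lambda>s. ?H s \<and> \<not> holds s (EqF (Plus (cell 10) (cell 9)) (cell 6))) (SetI (Const 15) (Const 1)) ((rows_time m w) + 1) ?Q"
      proof (rule tri_SetI)
        fix N F assume a: "?H (N, F) \<and> \<not> holds (N, F) (EqF (Plus (cell 10) (cell 9)) (cell 6))"
        note k' = k[OF conjunct1[OF a]]
        have "\<not> X" using G k'(5) k'(6) conjunct2[OF a] by (auto split: if_splits)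
        then show "case (N(ival N (Const 15) := ival N (Const 1)), F) of (N, F) \<Rightarrow> \<exists>A. cfg A N F \<and> N 10 = addr r 0 \<and> N 11 = r \<and> ?G A (Suc r) (N 15)"
          using k'(2,3) cfg_upd_N[OF k'(1), of 15 1] by auto
      qed simp
    qed
    have c: "tri R ?P (Cond (Less (Const 0) (cell 14)) reduce_rows (Cond (EqF (Plus (cell 10) (cell 9)) (cell 6)) Skip (SetI (Const 15) (Const 1))))
       ((rows_time m w) + 2 + 1) ?Q"
      by (rule tri_Cond[OF piv tri_conseq[OF nopiv]]) auto
    have e: "tri R ?Q (SetI (Const 10) (Plus (cell 10) (cell 7))) 1
       (\<lambda>(N, F). \<exists>A. cfg A N F \<and> N 10 = addr (Suc r) 0 \<and> N 11 = r \<and> ?G A (Suc r) (N 15))"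
    proof (rule tri_SetI)
      fix N F assume "?Q (N, F)"
      then obtain A where A: "cfg A N F" "N 10 = addr r 0" "N 11 = r" "?G A (Suc r) (N 15)" by auto
      have "N 7 = w" using A(1) by (simp add: cfg_def)
      then show "case (N(ival N (Const 10) := ival N (Plus (cell 10) (cell 7))), F) of (N, F) \<Rightarrow>
         \<exists>A. cfg A N F \<and> N 10 = addr (Suc r) 0 \<and> N 11 = r \<and> ?G A (Suc r) (N 15)"
        unfolding split_conv using A(2-4) by (intro exI[of _ A] conjI cfg_upd_N[OF A(1)]) (simp_all split: if_splits)
    qed simp
    show ?thesis unfolding row_step_def step_time_def
      by (rule tri_Seq[OF tri_pivot_search[OF r] tri_Seq[OF c e]])
  qed
  show ?thesis
  proof (rule triI)
    fix N F assume "case (N, F) of (N, F) \<Rightarrow> \<exists>A. cfg A N F \<and> N 10 = addr r 0 \<and> N 11 = r \<and> ?G A r (N 15)"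
    then obtain A where A: "cfg A N F" "N 10 = addr r 0" "N 11 = r" "?G A r (N 15)" by auto
    show "\<exists>t s'. exec R row_step (N, F) t s' \<and> t \<le> (step_time m w) \<and>
       (case s' of (N, F) \<Rightarrow> \<exists>A. cfg A N F \<and> N 10 = addr (Suc r) 0 \<and> N 11 = r \<and> ?G A (Suc r) (N 15))"
      by (rule triE[OF main[OF A(4)]]) (use A in simp)
  qed
qed

lemma tri_eliminate:
  "tri R (\<lambda>(N, F). cfg A N F) eliminate (eliminate_time m w) (\<lambda>(N, F). N 15 = (if solvable m w A 0 then 0 else 1))"
proof -
  let ?J = "\<lambda>r (N, F). \<exists>A'. cfg A' N F \<and> N 10 = addr r 0 \<and> N 11 = r \<and>
     (if N 15 = 0 then solvable m w A 0 \<longleftrightarrow> solvable m w A' r else N 15 = 1 \<and> \<not> solvable m w A 0)"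
  have s1: "tri R (\<lambda>(N, F). cfg A N F) (SetI (Const 10) (cell 5)) 1 (\<lambda>(N, F). cfg A N F \<and> N 10 = addr 0 0)"
    by (rule tri_SetI) (auto simp: cfg_upd_N, auto simp: cfg_def)
  have s2: "tri R (\<lambda>(N, F). cfg A N F \<and> N 10 = addr 0 0) (SetI (Const 15) (Const 0)) 1 (\<lambda>(N, F). cfg A N F \<and> N 10 = addr 0 0 \<and> N 15 = 0)"
    by (rule tri_SetI) (auto simp: cfg_upd_N)
  have s3: "tri R (\<lambda>(N, F). cfg A N F \<and> N 10 = addr 0 0 \<and> N 15 = 0) (For 11 (cell 8) row_step) (for_time m (step_time m w)) (?J m)"
  proof (rule tri_For[where J = ?J])
    show "?J 0 (N(11 := 0), F)" if "case (N, F) of (N, F) \<Rightarrow> cfg A N F \<and> N 10 = addr 0 0 \<and> N 15 = 0" for N F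
      unfolding split_conv by (intro exI[of _ A]) (use that cfg_upd_N in simp)
    show "ival N (cell 8) = m \<and> N 11 = r" if "?J r (N, F)" for r N F
      using that by (auto simp: cfg_def)
    fix r assume r: "r < m"
    show "tri R (?J r) row_step (step_time m w) (\<lambda>(N, F). N 11 = r \<and> ?J (Suc r) (N(11 := Suc r), F))"
    proof (rule tri_conseq[OF tri_row_step[OF r, where X = "solvable m w A 0"]])
      fix s assume a: "case s of (N, F) \<Rightarrow> \<exists>A'. cfg A' N F \<and> N 10 = addr (Suc r) 0 \<and> N 11 = r \<and>
        (if N 15 = 0 then solvable m w A 0 \<longleftrightarrow> solvable m w A' (Suc r) else N 15 = 1 \<and> \<not> solvable m w A 0)"
      obtain N F where s: "s = (N, F)" by fastforce
      obtain A' where A': "cfg A' N F" "N 10 = addr (Suc r) 0" "N 11 = r"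
        "if N 15 = 0 then solvable m w A 0 \<longleftrightarrow> solvable m w A' (Suc r) else N 15 = 1 \<and> \<not> solvable m w A 0"
        using a unfolding s split_conv by blast
      show "case s of (N, F) \<Rightarrow> N 11 = r \<and> ?J (Suc r) (N(11 := Suc r), F)"
        unfolding s split_conv by (intro conjI exI[of _ A'] cfg_upd_N[OF A'(1)]) (use A' in \<open>simp_all split: if_splits\<close>)
    qed auto
  qed
  have last: "solvable m w A' m" for A' :: "nat \<Rightarrow> nat \<Rightarrow> 'a" by (auto simp: solvable_def)
  show ?thesis unfolding eliminate_def eliminate_time_def
    by (rule tri_conseq[OF tri_Seq[OF s1 tri_Seq[OF s2 s3]]]) (auto simp: last split: if_splits)
qed

end

end


section \<open>The linear system for the cofactors\<close>

text \<open>
  The digits \<open>0, \<dots>, n - 1\<close> stand for the variables of the given polynomials, \<open>n\<close> for the constant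
  \<open>1\<close> and \<open>n + 1\<close> for the additional variable of Rabinowitsch's trick, whose index is \<open>n\<close>.
\<close>

definition digit_mon :: "nat \<Rightarrow> nat \<Rightarrow> nat multiset" where
  "digit_mon n x = (if x < n then {#x#} else if x = n then {#} else {#n#})"

definition digits_mon :: "nat \<Rightarrow> nat list \<Rightarrow> nat multiset" where
  "digits_mon n xs = (\<Sum>x\<in>#mset xs. digit_mon n x)"

lemma digits_mon_Nil [simp]: "digits_mon n [] = {#}"
  and digits_mon_Cons [simp]: "digits_mon n (x # xs) = digit_mon n x + digits_mon n xs"
  and digits_mon_append [simp]: "digits_mon n (xs @ ys) = digits_mon n xs + digits_mon n ys"
  by (simp_all add: digits_mon_def)

lemma digits_mon_replicate [simp]: "digits_mon n (replicate k n) = {#}"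
  by (induction k) (auto simp: digit_mon_def)

lemma count_digits_mon:
  "i < n \<Longrightarrow> count (digits_mon n xs) i = count_list xs i"
  "\<forall>x\<in>set xs. x \<le> Suc n \<Longrightarrow> count (digits_mon n xs) n = count_list xs (Suc n)"
  by (induction xs) (auto simp: digit_mon_def)

lemma size_digits_mon: "size (digits_mon n xs) \<le> length xs"
  by (induction xs) (auto simp: digit_mon_def)

lemma set_digits_mon: "set_mset (digits_mon n xs) \<subseteq> {..<Suc n}"
  by (induction xs) (auto simp: digit_mon_def split: if_splits)

lemma set_digits_mon_le: "\<forall>x\<in>set xs. x \<le> n \<Longrightarrow> set_mset (digits_mon n xs) \<subseteq> {..<n}"
  by (induction xs) (auto simp: digit_mon_def split: if_splits)

lemma count_list_length:
  assumes "\<forall>x\<in>set xs. x \<le> Suc n"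
  shows "(\<Sum>i<n. count_list xs i) + count_list xs n + count_list xs (Suc n) = length xs"
proof -
  have "(\<Sum>i<Suc (Suc n). count_list xs i) = length xs"
    by (rule sum_count_set) (use assms in auto)
  then show ?thesis by simp
qed

text \<open>For lists of equal length the number of padding digits \<open>n\<close> is determined by
  the other counts. Hence the program may compare monomials through multisets of digits, without
  removing the padding.\<close>

lemma digits_mon_eq_iff:
  assumes "length xs = length ys" "\<forall>x\<in>set xs. x \<le> Suc n" "\<forall>y\<in>set ys. y \<le> Suc n"
  shows "digits_mon n xs = digits_mon n ys \<longleftrightarrow> mset xs = mset ys"
proof
  assume e: "digits_mon n xs = digits_mon n ys"
  have lt: "count_list xs i = count_list ys i" if "i < n" for i
    using count_digits_mon(1)[OF that, of xs] count_digits_mon(1)[OF that, of ys] e by simp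
  moreover have Sn: "count_list xs (Suc n) = count_list ys (Suc n)"
    using count_digits_mon(2)[OF assms(2)] count_digits_mon(2)[OF assms(3)] e by simp
  moreover have "count_list xs n = count_list ys n"
    using count_list_length[OF assms(2)] count_list_length[OF assms(3)] lt Sn assms(1) by simp
  moreover have "count_list xs i = 0" "count_list ys i = 0" if "Suc n < i" for i
    using that assms by (auto simp: count_list_0_iff)
  ultimately have "count_list xs i = count_list ys i" for i
    by (metis less_antisym linorder_less_linear)
  then show "mset xs = mset ys" by (intro multiset_eqI) (simp add: count_mset)
qed (simp add: digits_mon_def)

lemma digits_mon_surj:
  assumes "size u \<le> l" "set_mset u \<subseteq> {..<n} \<and> B = Suc n \<or> set_mset u \<subseteq> {..<Suc n} \<and> B = Suc (Suc n)"
  shows "\<exists>k<B ^ l. digits_mon n (digits B l k) = u"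
proof -
  obtain us where us: "mset us = u" using ex_mset by blast
  define xs where "xs = map (\<lambda>x. if x = n then Suc n else x) us @ replicate (l - size u) n"
  have "digits_mon n (map (\<lambda>x. if x = n then Suc n else x) us) = mset us" if "set us \<subseteq> {..n}" for us
    using that by (induction us) (auto simp: digit_mon_def)
  moreover have "set us \<subseteq> {..n}" using assms(2) us by auto
  ultimately have "digits_mon n xs = u" by (simp add: xs_def us)
  moreover have "length xs = l" using assms(1) us by (auto simp: xs_def)
  moreover have "\<forall>x\<in>set xs. x < B" using assms(2) us by (auto simp: xs_def)
  ultimately show ?thesis using digits_surj by metis
qed

lemma monomial_at_digits: "monomial_at n d j = digits_mon n (digits (n + 1) d j)"
proof -
  have "filter_mset (\<lambda>i. i < n) (mset xs) = digits_mon n xs" if "\<forall>x\<in>set xs. x \<le> n" for xs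
    using that by (induction xs) (auto simp: digit_mon_def)
  then have "filter_mset (\<lambda>i. i < n) (mset (digits (n + 1) d j)) = digits_mon n (digits (n + 1) d j)"
    using digits_lt[of "n + 1"] by fastforce
  then show ?thesis unfolding monomial_at_def mset_digits .
qed

text \<open>A Macaulay-type matrix: the rows are monomials \<open>t\<close>, the columns are pairs
  of a polynomial and a multiplier monomial, and the entry is the coefficient of \<open>t\<close> in
  their product. The final column is the constant polynomial 1.\<close>

definition entry :: "nat \<Rightarrow> nat \<Rightarrow> nat \<Rightarrow> (nat \<Rightarrow> 'k::comm_ring_1 mpoly) \<Rightarrow> nat multiset \<Rightarrow> nat \<Rightarrow> 'k" where
  "entry n e c P t k =
     (let B = (n + 2) ^ e in
      if k < c * B then mcoeff (mterm (digits_mon n (digits (n + 2) e (k mod B))) 1 * P (k div B)) t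
      else if t = {#} then 1 else 0)"

lemma sum_div_mod:
  fixes B :: nat assumes "0 < B"
  shows "(\<Sum>k<c * B. f (k div B) (k mod B)) = (\<Sum>j<c. \<Sum>s<B. f j s)"
proof (induction c)
  case (Suc c)
  have "(\<Sum>k<Suc c * B. f (k div B) (k mod B))
      = (\<Sum>k<c * B. f (k div B) (k mod B)) + (\<Sum>k\<in>{c * B..<c * B + B}. f (k div B) (k mod B))"
    by (simp add: sum.atLeastLessThan_concat lessThan_atLeast0 add.commute)
  also have "(\<Sum>k\<in>{c * B..<c * B + B}. f (k div B) (k mod B)) = (\<Sum>s<B. f c s)"
  proof (rule sum.reindex_bij_witness[of _ "\<lambda>s. c * B + s" "\<lambda>k. k - c * B"])
    fix k assume k: "k \<in> {c * B..<c * B + B}"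
    then have "k div B = c" by (intro div_nat_eqI) (auto simp: mult.commute)
    moreover from this have "k mod B = k - c * B" using minus_div_mult_eq_mod[of k B] by simp
    ultimately show "f c (k - c * B) = f (k div B) (k mod B)" by simp
  qed auto
  finally show ?case using Suc by simp
qed simp

text \<open>A solution vector lists the coefficients of the cofactors, and both sides have degree at
  most \<open>e + d\<close>, so comparing the enumerated coefficients suffices. Monomials are
  enumerated with repetitions, which adds only redundant rows and columns.\<close>

lemma solvable_entry_iff:
  fixes P :: "nat \<Rightarrow> 'k::field mpoly"
  assumes P: "\<And>j. mdeg_le d (P j)" "\<And>j. mvars_in {..<Suc n} (P j)"
  shows "solvable ((n + 2) ^ (e + d)) (c * (n + 2) ^ e + 1)
      (\<lambda>i. entry n e c P (digits_mon n (digits (n + 2) (e + d) i))) 0 \<longleftrightarrow>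
    (\<exists>g. (\<forall>j. mdeg_le e (g j) \<and> mvars_in {..<Suc n} (g j)) \<and> (\<Sum>j<c. g j * P j) = 1)"
proof -
  let ?D = "e + d" and ?B = "(n + 2) ^ e"
  let ?u = "\<lambda>s. digits_mon n (digits (n + 2) e s)" and ?t = "\<lambda>i. digits_mon n (digits (n + 2) ?D i)"
  define G where "G x j = (\<Sum>s<?B. mterm (?u s) (x (j * ?B + s)))" for x :: "nat \<Rightarrow> 'k" and j
  have row: "(\<Sum>k<c * ?B + 1 - 1. entry n e c P t k * x k) = mcoeff (\<Sum>j<c. G x j * P j) t" for x t
  proof -
    have "(\<Sum>k<c * ?B + 1 - 1. entry n e c P t k * x k)
        = (\<Sum>k<c * ?B. (\<lambda>j s. mcoeff (mterm (?u s) 1 * P j) t * x (j * ?B + s)) (k div ?B) (k mod ?B))"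
      by (simp add: entry_def Let_def div_mult_mod_eq del: add_2_eq_Suc add_2_eq_Suc')
    also have "\<dots> = (\<Sum>j<c. \<Sum>s<?B. mcoeff (mterm (?u s) 1 * P j) t * x (j * ?B + s))"
      by (rule sum_div_mod) simp
    also have "\<dots> = (\<Sum>j<c. \<Sum>s<?B. mcoeff (mterm (?u s) (x (j * ?B + s)) * P j) t)"
      by (intro sum.cong refl) (simp add: mcoeff_mterm_times)
    also have "\<dots> = mcoeff (\<Sum>j<c. G x j * P j) t"
      by (simp add: G_def sum_distrib_right lookup_sum)
    finally show ?thesis .
  qed
  have "entry n e c P t (c * ?B + 1 - 1) = mcoeff 1 t" for t
    by (auto simp: entry_def Let_def lookup_one when_def)
  then have sol: "solvable ((n + 2) ^ ?D) (c * ?B + 1) (\<lambda>i. entry n e c P (?t i)) 0 \<longleftrightarrow>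
      (\<exists>x. \<forall>i<(n + 2) ^ ?D. mcoeff (\<Sum>j<c. G x j * P j) (?t i) = mcoeff 1 (?t i))"
    unfolding solvable_def row by simp
  have small: "mdeg_le ?D (\<Sum>j<c. g j * P j)" "mvars_in {..<Suc n} (\<Sum>j<c. g j * P j)"
    if "\<And>j. mdeg_le e (g j)" "\<And>j. mvars_in {..<Suc n} (g j)" for g
    using that P by (auto intro!: mdeg_le_sum mvars_in_sum mdeg_le_mult mvars_in_mult)
  have G: "mdeg_le e (G x j)" "mvars_in {..<Suc n} (G x j)" for x j
  proof -
    have "mdeg_le e (mterm (?u s) a)" for s and a :: 'k using size_digits_mon[of n "digits (n + 2) e s"]
      by (auto simp: mdeg_le_def split: if_splits)
    then show "mdeg_le e (G x j)" unfolding G_def by (intro mdeg_le_sum)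
    have "mvars_in {..<Suc n} (mterm (?u s) a)" for s and a :: 'k using set_digits_mon[of n "digits (n + 2) e s"]
      by (auto simp: mvars_in_def split: if_splits)
    then show "mvars_in {..<Suc n} (G x j)" unfolding G_def by (intro mvars_in_sum)
  qed
  show ?thesis unfolding sol
  proof
    assume "\<exists>x. \<forall>i<(n + 2) ^ ?D. mcoeff (\<Sum>j<c. G x j * P j) (?t i) = mcoeff 1 (?t i)"
    then obtain x where x: "\<And>i. i < (n + 2) ^ ?D \<Longrightarrow> mcoeff (\<Sum>j<c. G x j * P j) (?t i) = mcoeff 1 (?t i)" by blast
    have "(\<Sum>j<c. G x j * P j) = 1"
    proof (rule poly_mapping_eqI)
      fix t
      let ?L = "\<Sum>j<c. G x j * P j"
      have sm: "mdeg_le ?D ?L" "mvars_in {..<Suc n} ?L" by (rule small[OF G])+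
      show "mcoeff ?L t = mcoeff 1 t"
      proof (cases "size t \<le> ?D \<and> set_mset t \<subseteq> {..<Suc n}")
        case True
        then show ?thesis using digits_mon_surj[of t ?D n "n + 2"] x by auto
      next
        case False
        then have "t \<notin> msupp ?L" using sm by (auto simp: mdeg_le_def mvars_in_def)
        moreover have "t \<noteq> {#}" using False by auto
        ultimately show ?thesis by (simp add: in_keys_iff lookup_one when_def)
      qed
    qed
    then show "\<exists>g. (\<forall>j. mdeg_le e (g j) \<and> mvars_in {..<Suc n} (g j)) \<and> (\<Sum>j<c. g j * P j) = 1"
      using G by (intro exI[of _ "G x"]) blast
  next
    assume "\<exists>g. (\<forall>j. mdeg_le e (g j) \<and> mvars_in {..<Suc n} (g j)) \<and> (\<Sum>j<c. g j * P j) = 1"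
    then obtain g where g: "\<And>j. mdeg_le e (g j)" "\<And>j. mvars_in {..<Suc n} (g j)" "(\<Sum>j<c. g j * P j) = 1" by blast
    \<comment> \<open>Columns for the same monomial add up, so each coefficient of
      \<open>g j\<close> is placed at the least index encoding its monomial and 0 at the
      others.\<close>
    define idx where "idx u = (LEAST s. s < ?B \<and> ?u s = u)" for u
    define x where "x k = (let u = ?u (k mod ?B) in if k mod ?B = idx u then mcoeff (g (k div ?B)) u else 0)" for k
    have "G x j = g j" for j
    proof (rule poly_mapping_eqI)
      fix v
      have "mcoeff (G x j) v = (\<Sum>s<?B. if ?u s = v then x (j * ?B + s) else 0)"
        by (simp only: G_def lookup_sum lookup_single when_def)
      also have "\<dots> = (\<Sum>s<?B. if s = idx v \<and> ?u s = v then mcoeff (g j) v else 0)"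
        by (intro sum.cong refl) (auto simp: x_def Let_def)
      also have "\<dots> = mcoeff (g j) v"
      proof (cases "v \<in> msupp (g j)")
        case True
        then have "\<exists>s. s < ?B \<and> ?u s = v"
          using g(1,2)[of j] digits_mon_surj[of v e n "n + 2"] by (auto simp: mdeg_le_def mvars_in_def)
        then have i: "idx v < ?B \<and> ?u (idx v) = v" unfolding idx_def by (rule LeastI_ex)
        have "(\<Sum>s<?B. if s = idx v \<and> ?u s = v then mcoeff (g j) v else 0) = (\<Sum>s<?B. if s = idx v then mcoeff (g j) v else 0)"
          by (intro sum.cong refl) (use i in auto)
        also have "\<dots> = mcoeff (g j) v" using i by simp
        finally show ?thesis .
      qed (simp add: in_keys_iff cong: if_cong)
      finally show "mcoeff (G x j) v = mcoeff (g j) v" .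
    qed
    then show "\<exists>x. \<forall>i<(n + 2) ^ ?D. mcoeff (\<Sum>j<c. G x j * P j) (?t i) = mcoeff 1 (?t i)"
      using g(3) by (intro exI[of _ x]) simp
  qed
qed


section \<open>The program that writes the matrix\<close>

lemma div_mod_offset: "r < b \<Longrightarrow> (a * b + r) div b = a" "r < b \<Longrightarrow> (a * b + r) mod b = r" for a b r :: nat
  by simp_all

definition when_equal :: "nat list \<Rightarrow> nat list \<Rightarrow> prog \<Rightarrow> prog" where
  "when_equal xs ys c = Seq (compare xs ys) (Cond (Less (Const 0) (cell 22)) c Skip)"

lemma tri_when_equal:
  assumes cells: "{20, 21, 22} \<inter> (set xs \<union> set ys) = {}" "length xs = l" "length ys = l"
    and eq: "\<And>N F N'. X (N, F) \<Longrightarrow> \<forall>x. x \<notin> {20, 21, 22} \<longrightarrow> N' x = N x \<Longrightarrow> mset (map N xs) = mset (map N ys) \<Longrightarrow>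
      \<exists>s'. exec R c (N', F) 1 s' \<and> Y s'"
    and neq: "\<And>N F N'. X (N, F) \<Longrightarrow> \<forall>x. x \<notin> {20, 21, 22} \<longrightarrow> N' x = N x \<Longrightarrow> mset (map N xs) \<noteq> mset (map N ys) \<Longrightarrow> Y (N', F)"
  shows "tri R X (when_equal xs ys c) (compare_time l + 2) Y"
proof (rule triI)
  fix N F assume X: "X (N, F)"
  obtain t N' where c: "exec R (compare xs ys) (N, F) t (N', F)" "t \<le> compare_time l"
    "N' 22 = (if mset (map N xs) = mset (map N ys) then 1 else 0)" "\<forall>x. x \<notin> {20, 21, 22} \<longrightarrow> N' x = N x"
    using exec_compare[OF cells, of R N F] by blast
  have "\<exists>s'. exec R (Cond (Less (Const 0) (cell 22)) c Skip) (N', F) (1 + 1) s' \<and> Y s'"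
  proof (cases "mset (map N xs) = mset (map N ys)")
    case True
    then have h: "holds (N', F) (Less (Const 0) (cell 22))" using c(3) by simp
    obtain s' where "exec R c (N', F) 1 s'" "Y s'" using eq[OF X c(4) True] by blast
    then show ?thesis using exec.IfTrue[OF h] by blast
  next
    case False
    then have h: "\<not> holds (N', F) (Less (Const 0) (cell 22))" using c(3) by simp
    show ?thesis using exec.IfFalse[OF h exec.Skip] neq[OF X c(4) False] by blast
  qed
  then obtain s' where s: "exec R (Cond (Less (Const 0) (cell 22)) c Skip) (N', F) (1 + 1) s'" "Y s'" by blast
  show "\<exists>t s'. exec R (when_equal xs ys c) (N, F) t s' \<and> t \<le> compare_time l + 2 \<and> Y s'"
    unfolding when_equal_def using exec.Seq[OF c(1) s(1)] c(2) s(2)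
    by (intro exI[of _ "t + (1 + 1)"] exI[of _ s']) auto
qed

text \<open>Cells from 30 on hold the digits of the row monomial, the multiplier monomial and the
  monomial in the coefficient table; they are disjoint from all other registers.\<close>

definition row_cells :: "nat \<Rightarrow> nat list" where "row_cells D = [30..<30 + D]"
definition col_cells :: "nat \<Rightarrow> nat \<Rightarrow> nat list" where "col_cells D e = [30 + D..<30 + D + e]"
definition tab_cells :: "nat \<Rightarrow> nat \<Rightarrow> nat \<Rightarrow> nat list" where "tab_cells D e d = [30 + D + e..<30 + D + e + d]"

lemma length_cells [simp]: "length (row_cells D) = D" "length (col_cells D e) = e" "length (tab_cells D e d) = d"
  by (simp_all add: row_cells_def col_cells_def tab_cells_def)

lemma distinct_cells [simp]: "distinct (row_cells D)" "distinct (col_cells D e)" "distinct (tab_cells D e d)"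
  by (simp_all add: row_cells_def col_cells_def tab_cells_def)

lemma set_cells: "set (row_cells D) = {30..<30 + D}" "set (col_cells D e) = {30 + D..<30 + D + e}"
  "set (tab_cells D e d) = {30 + D + e..<30 + D + e + d}"
  by (simp_all add: row_cells_def col_cells_def tab_cells_def)

text \<open>One entry is computed by searching the coefficient table for a monomial that, times the
  multiplier, gives the row monomial. The extra digit is the padding \<open>n\<close> from cell 1,
  or, for the product with \<open>y\<close>, the digit \<open>n + 1\<close> from cell 3. Values are
  written rather than accumulated: repeated codes of one monomial carry the same coefficient. Adding
  to or subtracting from the zero cell copies or negates.\<close>

definition scan :: "nat \<Rightarrow> nat \<Rightarrow> bool \<Rightarrow> prog" where
  "scan d e neg = (let D = e + Suc d in
     Seq (SetI (Const 23) (cell 24)) (nest (tab_cells D e d) (cell 3)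
       (Seq (when_equal (row_cells D) (col_cells D e @ tab_cells D e d @ [if neg then 3 else 1])
              (SetF (cell 4) (if neg then FSub else FAdd) (cell 6) (cell 23)))
            (SetI (Const 23) (Plus (cell 23) (Const 1))))))"

definition next_entry :: prog where
  "next_entry = SetI (Const 4) (Plus (cell 4) (Const 1))"

text \<open>With \<open>neg\<close> set the polynomial is \<open>1 - y Q\<close>: after the negated
  search, the summand 1 contributes an entry 1 where row and multiplier monomials coincide.\<close>

definition entry_prog :: "nat \<Rightarrow> nat \<Rightarrow> bool \<Rightarrow> prog" where
  "entry_prog d e neg = Seq (scan d e neg) (Seq
     (if neg then when_equal (row_cells (e + Suc d)) (col_cells (e + Suc d) e @ replicate (Suc d) 1) (SetOne (cell 4)) else Skip)
     next_entry)"

definition block :: "nat \<Rightarrow> nat \<Rightarrow> bool \<Rightarrow> prog" where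
  "block d e neg = Seq (nest (col_cells (e + Suc d) e) (cell 2) (entry_prog d e neg))
     (SetI (Const 24) (Plus (cell 24) (cell 25)))"

fun blocks :: "nat \<Rightarrow> nat \<Rightarrow> nat \<Rightarrow> prog" where
  "blocks d e 0 = SetI (Const 24) (Const 0)"
| "blocks d e (Suc j) = Seq (blocks d e j) (block d e False)"

definition fill_row :: "nat \<Rightarrow> nat \<Rightarrow> nat \<Rightarrow> prog" where
  "fill_row c d e = Seq (blocks d e c) (Seq (block d e True)
     (Seq (when_equal (row_cells (e + Suc d)) (replicate (e + Suc d) 1) (SetOne (cell 4))) next_entry))"

definition fill :: "nat \<Rightarrow> nat \<Rightarrow> nat \<Rightarrow> prog" where
  "fill c d e = nest (row_cells (e + Suc d)) (cell 2) (fill_row c d e)"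

definition scan_time :: "nat \<Rightarrow> nat \<Rightarrow> nat \<Rightarrow> nat" where
  "scan_time n d e = 1 + nest_time (n + 1) d ((compare_time (e + Suc d) + 2) + 1)"

definition entry_time :: "nat \<Rightarrow> nat \<Rightarrow> nat \<Rightarrow> nat" where
  "entry_time n d e = scan_time n d e + ((compare_time (e + Suc d) + 2) + 1)"

definition block_time :: "nat \<Rightarrow> nat \<Rightarrow> nat \<Rightarrow> nat" where
  "block_time n d e = nest_time (n + 2) e (entry_time n d e) + 1"

definition fill_row_time :: "nat \<Rightarrow> nat \<Rightarrow> nat \<Rightarrow> nat \<Rightarrow> nat" where
  "fill_row_time n c d e = (1 + c * block_time n d e) + (block_time n d e + ((compare_time (e + Suc d) + 2) + 1))"

definition fill_time :: "nat \<Rightarrow> nat \<Rightarrow> nat \<Rightarrow> nat \<Rightarrow> nat" where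
  "fill_time n c d e = nest_time (n + 2) (e + Suc d) (fill_row_time n c d e)"

definition rabinowitsch :: "nat \<Rightarrow> nat \<Rightarrow> (nat \<Rightarrow> 'k::comm_ring_1 mpoly) \<Rightarrow> nat \<Rightarrow> 'k mpoly" where
  "rabinowitsch n c P j = (if j < c then P j else 1 - Var n * P c)"

context prime_field_type
begin

context
  fixes n c d e :: nat and F0 :: "nat \<Rightarrow> int" and P :: "nat \<Rightarrow> 'a mpoly"
  assumes F0_table: "\<And>j r. j \<le> c \<Longrightarrow> r < (n + 1) ^ d \<Longrightarrow>
        of_int (F0 (j * (n + 1) ^ d + r)) = mcoeff (P j) (digits_mon n (digits (n + 1) d r))"
    and P_deg: "\<And>j. j \<le> c \<Longrightarrow> mdeg_le d (P j)" and P_vars: "\<And>j. j \<le> c \<Longrightarrow> mvars_in {..<n} (P j)"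
begin

abbreviation "D \<equiv> e + Suc d"
abbreviation "B \<equiv> (n + 1) ^ d"
abbreviation "C \<equiv> (n + 2) ^ e"
abbreviation "z0 \<equiv> Suc c * B"
abbreviation "w \<equiv> Suc c * C + 1"
abbreviation "m \<equiv> (n + 2) ^ D"
abbreviation "dmon \<equiv> digits_mon n"

definition value_at :: "nat \<Rightarrow> 'a" where
  "value_at i = entry n e (Suc c) (rabinowitsch n c P) (dmon (digits (n + 2) D (i div w))) (i mod w)"

definition regs :: "nat \<Rightarrow> nat \<Rightarrow> (nat \<Rightarrow> nat) \<Rightarrow> bool" where
  "regs q i N \<longleftrightarrow> N 1 = n \<and> N 2 = n + 2 \<and> N 3 = n + 1 \<and> N 4 = z0 + 3 + i \<and> N 5 = z0 + 3 \<and> N 6 = z0 \<and> N 7 = w \<and>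
     N 8 = m \<and> N 9 = w - 1 \<and> N 24 = q \<and> N 25 = B"

text \<open>Entries before \<open>i\<close> are finished, entry \<open>i\<close> currently holds
  \<open>v\<close>, and all cells beyond are still 0, which is the value of an entry for which no
  match is found. The input tables stay intact.\<close>

definition mem :: "nat \<Rightarrow> 'a \<Rightarrow> (nat \<Rightarrow> int) \<Rightarrow> bool" where
  "mem i v F \<longleftrightarrow> (\<forall>x. F x \<in> carrier R) \<and> (\<forall>x<z0. F x = F0 x) \<and> F z0 = 0 \<and> (\<forall>x>z0 + 3 + i. F x = 0) \<and>
     (\<forall>i'<i. of_int (F (z0 + 3 + i')) = value_at i') \<and> of_int (F (z0 + 3 + i)) = v"

lemma regs_cong: "regs q i N \<Longrightarrow> \<forall>x. x \<notin> {20, 21, 22} \<longrightarrow> N' x = N x \<Longrightarrow> regs q i N'"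
  by (simp add: regs_def)

lemma regs_upd: "regs q i N \<Longrightarrow> x = 23 \<or> 30 \<le> x \<Longrightarrow> regs q i (N(x := y))"
  by (auto simp: regs_def)

lemma regs_next: "regs q i N \<Longrightarrow> regs q (Suc i) (N(4 := N 4 + 1))"
  by (simp add: regs_def)

lemma regs_24: "regs q i N \<Longrightarrow> regs q' i (N(24 := q'))"
  by (simp add: regs_def)

lemma mem_carrier: "mem i v F \<Longrightarrow> F x \<in> carrier R"
  by (simp add: mem_def)

lemma mem_store: "mem i v F \<Longrightarrow> x \<in> carrier R \<Longrightarrow> mem i (of_int x) (F(z0 + 3 + i := x))"
  by (auto simp: mem_def)

lemma mem_next: "mem i (value_at i) F \<Longrightarrow> mem (Suc i) 0 F"
  by (auto simp: mem_def less_Suc_eq)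

lemma map_cong_cells: "\<forall>x. x \<notin> {20, 21, 22} \<longrightarrow> N' x = N x \<Longrightarrow> \<forall>x\<in>set xs. 30 \<le> x \<Longrightarrow> map N' xs = map N xs"
  for N' N :: "nat \<Rightarrow> nat" by fastforce

lemma map_upd_cells: "x \<notin> set xs \<Longrightarrow> map (N(x := y)) xs = map N xs"
  by auto

lemma tri_scan:
  fixes neg :: bool
  assumes j: "j \<le> c" and T: "length T = D" "\<forall>x\<in>set T. x \<le> Suc n" and U: "length U = e" "\<forall>x\<in>set U. x \<le> Suc n"
  defines "u \<equiv> dmon U + (if neg then {#n#} else {#})"
  shows "tri R (\<lambda>(N, F). regs (j * B) i N \<and> mem i 0 F \<and> map N (row_cells D) = T \<and> map N (col_cells D e) = U)
     (scan d e neg) (scan_time n d e)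
     (\<lambda>(N, F). regs (j * B) i N \<and> mem i ((if neg then - 1 else 1) * mcoeff (mterm u 1 * P j) (dmon T)) F \<and>
        map N (row_cells D) = T \<and> map N (col_cells D e) = U)"
proof -
  let ?u = "\<lambda>r. dmon (digits (n + 1) d r)" and ?q = "j * B"
  let ?x = "if neg then 3 else 1 :: nat" and ?xv = "if neg then n + 1 else n" and ?op = "if neg then FSub else FAdd"
  define sg :: 'a where "sg = (if neg then - 1 else 1)"
  define match where "match r \<longleftrightarrow> mset T = mset (U @ digits (n + 1) d r @ [?xv])" for r
  \<comment> \<open>After \<open>r\<close> table positions the entry is the signed coefficient at
    some matching position, or 0 if none has matched.\<close>
  define val where "val r v \<longleftrightarrow> (\<exists>r'<r. match r' \<and> v = sg * mcoeff (P j) (?u r')) \<or> (\<forall>r'<r. \<not> match r') \<and> v = 0" for r v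
  define K where "K N \<longleftrightarrow> regs ?q i N \<and> map N (row_cells D) = T \<and> map N (col_cells D e) = U" for N
  have K_upd: "K (N(v := x))" if "K N" "v \<in> insert 23 (set (tab_cells D e d))" for N v x
    using that unfolding K_def by (subst (1 2) map_upd_cells) (auto simp: set_cells intro: regs_upd)
  have K_cong: "K N'" if "K N" "\<forall>x. x \<notin> {20, 21, 22} \<longrightarrow> N' x = N x" for N N'
    using that(1) regs_cong[OF _ that(2)] map_cong_cells[OF that(2), of "row_cells D"] map_cong_cells[OF that(2), of "col_cells D e"]
    unfolding K_def by (auto simp: set_cells)
  define I where "I = (\<lambda>r (N, F). K N \<and> N 23 = ?q + r \<and> (\<exists>v. mem i v F \<and> val r v))"
  define I' where "I' = (\<lambda>r (N, F). K N \<and> N 23 = ?q + r \<and> (\<exists>v. mem i v F \<and> val (Suc r) v) \<and> map N (tab_cells D e d) = digits (n + 1) d r)"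
  have dl: "\<forall>x\<in>set (digits (n + 1) d r). x \<le> n" for r using digits_lt[of "n + 1"] by fastforce
  have body: "tri R (\<lambda>s. I r s \<and> map (fst s) (tab_cells D e d) = digits (n + 1) d r)
     (Seq (when_equal (row_cells D) (col_cells D e @ tab_cells D e d @ [?x]) (SetF (cell 4) ?op (cell 6) (cell 23)))
        (SetI (Const 23) (Plus (cell 23) (Const 1)))) ((compare_time D + 2) + 1)
     (\<lambda>s. I (Suc r) s \<and> map (fst s) (tab_cells D e d) = digits (n + 1) d r)" if r: "r < B" for r
  proof (rule tri_Seq[where Q = "I' r"])
    let ?X = "\<lambda>s. I r s \<and> map (fst s) (tab_cells D e d) = digits (n + 1) d r"
    show "tri R ?X (when_equal (row_cells D) (col_cells D e @ tab_cells D e d @ [?x]) (SetF (cell 4) ?op (cell 6) (cell 23)))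
        (compare_time D + 2) (I' r)"
    proof (rule tri_when_equal)
      fix N F N' assume X: "?X (N, F)" and N': "\<forall>x. x \<notin> {20, 21, 22} \<longrightarrow> N' x = N x"
      from X obtain v where K: "K N" "N 23 = ?q + r" and v: "mem i v F" "val r v"
        and tab: "map N (tab_cells D e d) = digits (n + 1) d r" by (auto simp: I_def)
      have K': "K N'" by (rule K_cong[OF K(1) N'])
      have tab': "map N' (tab_cells D e d) = digits (n + 1) d r"
        using tab map_cong_cells[OF N', of "tab_cells D e d"] by (simp add: set_cells)
      have N'23: "N' 23 = ?q + r" using N' K(2) by simp
      have N'46: "N' 4 = z0 + 3 + i" "N' 6 = z0" using K' by (auto simp: K_def regs_def)
      have "N ?x = ?xv" using K(1) by (simp add: K_def regs_def)
      then have mt: "mset (map N (row_cells D)) = mset (map N (col_cells D e @ tab_cells D e d @ [?x])) \<longleftrightarrow> match r"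
        using K(1) tab by (simp add: match_def K_def)
      {
        assume "mset (map N (row_cells D)) = mset (map N (col_cells D e @ tab_cells D e d @ [?x]))"
        then have ma: "match r" using mt by simp
        have lt: "?q + r < z0"
        proof -
          have "?q + r < Suc j * B" using r by simp
          also have "\<dots> \<le> z0" using j by (intro mult_right_mono) auto
          finally show ?thesis .
        qed
        then have y: "of_int (F (?q + r)) = mcoeff (P j) (?u r)" "F z0 = 0"
          using v(1) F0_table[OF j r] by (auto simp: mem_def)
        have Fq: "F (?q + r) \<in> carrier R" by (rule mem_carrier[OF v(1)])
        have z: "F z0 \<in> carrier R" by (rule mem_carrier[OF v(1)])
        let ?y = "fop_val R ?op (F z0) (F (?q + r))"
        have y': "?y \<in> carrier R" "of_int ?y = sg * mcoeff (P j) (?u r)"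
          using fop_val_carrier(3-6)[OF z Fq] y unfolding sg_def by (cases neg; simp)+
        have def: "fop_defined R ?op (F (ival N' (cell 23)))" by simp
        have "I' r (N', F(z0 + 3 + i := ?y))"
          unfolding I'_def split_conv using K' N'23 tab' mem_store[OF v(1) y'(1)] y'(2) ma
          by (intro conjI exI[of _ "of_int ?y"]) (auto simp: val_def)
        then show "\<exists>s'. exec R (SetF (cell 4) ?op (cell 6) (cell 23)) (N', F) 1 s' \<and> I' r s'"
          using exec.SetF[where R = R and op = ?op and F = F and N = N' and ?e2.0 = "cell 23" and ?e0.0 = "cell 4" and ?e1.0 = "cell 6", OF def] by (intro exI[of _ "(N', F(z0 + 3 + i := ?y))"]) (simp add: N'46 N'23)
      next
        assume "mset (map N (row_cells D)) \<noteq> mset (map N (col_cells D e @ tab_cells D e d @ [?x]))"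
        then have "\<not> match r" using mt by simp
        then have "val (Suc r) v" using v(2) unfolding val_def by (auto simp: less_Suc_eq)
        then show "I' r (N', F)" unfolding I'_def using K' N'23 tab' v(1) by auto
      }
    qed (use T U in \<open>auto simp: set_cells\<close>)
    show "tri R (I' r) (SetI (Const 23) (Plus (cell 23) (Const 1))) 1
       (\<lambda>s. I (Suc r) s \<and> map (fst s) (tab_cells D e d) = digits (n + 1) d r)"
    proof (rule tri_SetI)
      fix N F assume a: "I' r (N, F)"
      then have "K (N(23 := ?q + Suc r))" by (intro K_upd) (auto simp: I'_def)
      then have "I (Suc r) (N(23 := ?q + Suc r), F)" using a by (simp add: I_def I'_def)
      moreover have "map (N(23 := ?q + Suc r)) (tab_cells D e d) = digits (n + 1) d r"
        using a by (subst map_upd_cells) (auto simp: I'_def set_cells)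
      moreover have "ival N (Const 23) = 23" "ival N (Plus (cell 23) (Const 1)) = ?q + Suc r" using a by (auto simp: I'_def)
      ultimately show "I (Suc r) (N(ival N (Const 23) := ival N (Plus (cell 23) (Const 1))), F) \<and>
         map (fst (N(ival N (Const 23) := ival N (Plus (cell 23) (Const 1))), F)) (tab_cells D e d) = digits (n + 1) d r"
        by (simp only: fst_conv)
    qed simp
  qed
  have loop: "tri R (I 0) (nest (tab_cells D e d) (cell 3)
     (Seq (when_equal (row_cells D) (col_cells D e @ tab_cells D e d @ [?x]) (SetF (cell 4) ?op (cell 6) (cell 23)))
        (SetI (Const 23) (Plus (cell 23) (Const 1))))) (nest_time (n + 1) (length (tab_cells D e d)) ((compare_time D + 2) + 1))
     (I ((n + 1) ^ length (tab_cells D e d)))"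
  proof (rule tri_nest)
    show "I r (N(v := x), F)" if "I r (N, F)" "v \<in> set (tab_cells D e d)" for r N F v x
      using that K_upd[of N v x] by (auto simp: I_def set_cells)
    show "ival N (cell 3) = n + 1" if "I r (N, F)" for r N F
      using that by (simp add: I_def K_def regs_def)
    show "ival (N(v := x)) (cell 3) = ival N (cell 3)" if "v \<in> set (tab_cells D e d)" for N v x
      using that by (auto simp: set_cells)
  qed (use body in simp_all)
  have init: "tri R (\<lambda>(N, F). regs ?q i N \<and> mem i 0 F \<and> map N (row_cells D) = T \<and> map N (col_cells D e) = U)
     (SetI (Const 23) (cell 24)) 1 (I 0)"
  proof (rule tri_SetI)
    fix N F assume a: "case (N, F) of (N, F) \<Rightarrow> regs ?q i N \<and> mem i 0 F \<and> map N (row_cells D) = T \<and> map N (col_cells D e) = U"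
    then have "K (N(23 := ?q))" by (intro K_upd) (auto simp: K_def)
    moreover have "val 0 0" by (simp add: val_def)
    ultimately have "I 0 (N(23 := ?q), F)" using a by (auto simp: I_def)
    moreover have "ival N (Const 23) = 23" "ival N (cell 24) = ?q" using a by (auto simp: regs_def)
    ultimately show "I 0 (N(ival N (Const 23) := ival N (cell 24)), F)" by (simp only:)
  qed simp
  have xm: "digit_mon n ?xv = (if neg then {#n#} else {#})" by (simp add: digit_mon_def)
  \<comment> \<open>If nothing matched, the coefficient is indeed 0: the table lists every monomial
    of degree at most \<open>d\<close>, and the polynomial has no others.\<close>
  have final: "v = sg * mcoeff (mterm u 1 * P j) (dmon T)" if v: "val B v" for v
  proof (cases "\<exists>r<B. match r \<and> v = sg * mcoeff (P j) (?u r)")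
    case True
    then obtain r where r: "match r" "v = sg * mcoeff (P j) (?u r)" by blast
    have "dmon T = dmon (U @ digits (n + 1) d r @ [?xv])" using r(1) unfolding match_def digits_mon_def by (simp only:)
    then have "dmon T = u + ?u r" by (simp add: u_def xm)
    then show ?thesis using r(2) by (simp add: mcoeff_mterm_times)
  next
    case False
    then have v0: "v = 0" and no: "\<And>r. r < B \<Longrightarrow> \<not> match r" using v by (auto simp: val_def)
    have "mcoeff (mterm u 1 * P j) (dmon T) = 0"
    proof (rule ccontr)
      assume "mcoeff (mterm u 1 * P j) (dmon T) \<noteq> 0"
      then have u: "u \<subseteq># dmon T" "dmon T - u \<in> msupp (P j)" by (auto simp: mcoeff_mterm_times in_keys_iff split: if_splits)
      then obtain r where r: "r < B" "?u r = dmon T - u"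
        using digits_mon_surj[of "dmon T - u" d n "n + 1"] P_deg[OF j] P_vars[OF j] by (auto simp: mdeg_le_def mvars_in_def)
      have "dmon T = u + ?u r" using u(1) r(2) by (simp only: subset_mset.add_diff_inverse)
      also have "\<dots> = dmon (U @ digits (n + 1) d r @ [?xv])" by (simp add: u_def xm)
      finally have "dmon T = dmon (U @ digits (n + 1) d r @ [?xv])" .
      moreover have "\<forall>x\<in>set (U @ digits (n + 1) d r @ [?xv]). x \<le> Suc n" using U dl[of r] by (auto simp: le_SucI)
      ultimately have "match r" unfolding match_def using T U by (subst (asm) digits_mon_eq_iff) auto
      then show False using no r(1) by blast
    qed
    then show ?thesis using v0 by simp
  qed
  show ?thesis unfolding scan_def Let_def scan_time_def
  proof (rule tri_conseq[OF tri_Seq[OF init loop]])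
    fix s assume "I ((n + 1) ^ length (tab_cells D e d)) s"
    then obtain N F v where s: "s = (N, F)" and K: "K N" and v: "mem i v F" "val B v"
      unfolding I_def length_cells by (cases s) auto
    show "case s of (N, F) \<Rightarrow> regs ?q i N \<and> mem i ((if neg then - 1 else 1) * mcoeff (mterm u 1 * P j) (dmon T)) F \<and>
       map N (row_cells D) = T \<and> map N (col_cells D e) = U"
      using K v(1) unfolding s split_conv K_def final[OF v(2)] sg_def by blast
  qed simp_all
qed

lemma value_at_column:
  assumes "j \<le> c" "s < C"
  shows "value_at (i0 * w + (j * C + s)) =
    mcoeff (mterm (dmon (digits (n + 2) e s)) 1 * rabinowitsch n c P j) (dmon (digits (n + 2) D i0))"
proof -
  have "j * C + s < Suc j * C" using assms(2) by simp
  also have "\<dots> \<le> Suc c * C" using assms(1) by (intro mult_right_mono) auto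
  finally have lt: "j * C + s < Suc c * C" .
  then have "j * C + s < w" by (rule less_trans) simp
  note div_mod_offset[OF this, of i0]
  moreover note div_mod_offset[OF assms(2), of j]
  ultimately show ?thesis unfolding value_at_def entry_def Let_def using lt by (simp only: if_True)
qed

lemma value_at_rhs:
  "value_at (i0 * w + Suc c * C) = (if dmon (digits (n + 2) D i0) = {#} then 1 else 0)"
proof -
  have "Suc c * C < w" by simp
  note div_mod_offset[OF this, of i0]
  then show ?thesis unfolding value_at_def entry_def Let_def by (simp only: less_irrefl if_False)
qed

lemma tri_mark:
  assumes T: "length T = D" "\<forall>x\<in>set T. x \<le> Suc n" and U: "length U \<le> D" "\<forall>x\<in>set U. x \<le> Suc n"
    and xs: "length xs = length U" "\<forall>x\<in>set xs. 30 \<le> x"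
  shows "tri R (\<lambda>(N, F). regs q i N \<and> mem i v F \<and> map N (row_cells D) = T \<and> map N xs = U)
     (when_equal (row_cells D) (xs @ replicate (D - length U) 1) (SetOne (cell 4))) (compare_time D + 2)
     (\<lambda>(N, F). regs q i N \<and> mem i (if dmon T = dmon U then 1 else v) F \<and> map N (row_cells D) = T \<and> map N xs = U)"
proof (rule tri_when_equal)
  fix N N' :: "nat \<Rightarrow> nat" and F
  assume a: "case (N, F) of (N, F) \<Rightarrow> regs q i N \<and> mem i v F \<and> map N (row_cells D) = T \<and> map N xs = U"
    and N': "\<forall>x. x \<notin> {20, 21, 22} \<longrightarrow> N' x = N x"
  then have r: "regs q i N'" "regs q i N" and M: "mem i v F" by (auto intro: regs_cong)
  have rows: "map N' (row_cells D) = T" "map N' xs = U"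
    using a map_cong_cells[OF N', of "row_cells D"] map_cong_cells[OF N' xs(2)] by (auto simp: set_cells)
  have "mset T = mset (U @ replicate (D - length U) n) \<longleftrightarrow> dmon T = dmon (U @ replicate (D - length U) n)"
    by (rule digits_mon_eq_iff[symmetric]) (use T U in auto)
  moreover have "N 1 = n" using r(2) by (simp add: regs_def)
  ultimately have eq: "mset (map N (row_cells D)) = mset (map N (xs @ replicate (D - length U) 1)) \<longleftrightarrow> dmon T = dmon U"
    using a by (simp add: map_replicate)
  {
    assume "mset (map N (row_cells D)) = mset (map N (xs @ replicate (D - length U) 1))"
    then have e: "dmon T = dmon U" using eq by simp
    have "mem i 1 (F(z0 + 3 + i := \<one>\<^bsub>R\<^esub>))" using mem_store[OF M one_closed] by (simp only: of_int_ops)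
    moreover have "ival N' (cell 4) = z0 + 3 + i" using r(1) by (simp add: regs_def)
    ultimately show "\<exists>s'. exec R (SetOne (cell 4)) (N', F) 1 s' \<and>
       (case s' of (N, F) \<Rightarrow> regs q i N \<and> mem i (if dmon T = dmon U then 1 else v) F \<and> map N (row_cells D) = T \<and> map N xs = U)"
      using exec.SetOne[of R "cell 4" N' F] r(1) rows e by (intro exI[of _ "(N', F(z0 + 3 + i := \<one>\<^bsub>R\<^esub>))"]) simp
  next
    assume "mset (map N (row_cells D)) \<noteq> mset (map N (xs @ replicate (D - length U) 1))"
    then have "dmon T \<noteq> dmon U" using eq by simp
    then show "case (N', F) of (N, F) \<Rightarrow> regs q i N \<and> mem i (if dmon T = dmon U then 1 else v) F \<and> map N (row_cells D) = T \<and> map N xs = U"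
      using r(1) M rows by simp
  }
qed (use xs U(1) in \<open>auto simp: set_cells\<close>)

lemma tri_next_entry:
  assumes "\<forall>x\<in>set xs. 30 \<le> x" "v = value_at i"
  shows "tri R (\<lambda>(N, F). regs q i N \<and> mem i v F \<and> map N (row_cells D) = T \<and> map N xs = U) next_entry 1
     (\<lambda>(N, F). regs q (Suc i) N \<and> mem (Suc i) 0 F \<and> map N (row_cells D) = T \<and> map N xs = U)"
  unfolding next_entry_def
proof (rule tri_SetI)
  fix N F assume a: "case (N, F) of (N, F) \<Rightarrow> regs q i N \<and> mem i v F \<and> map N (row_cells D) = T \<and> map N xs = U"
  have "map (N(4 := x)) (row_cells D) = map N (row_cells D)" "map (N(4 := x)) xs = map N xs" for x
    using assms(1) by (subst map_upd_cells, auto simp: set_cells)+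
  moreover have r: "regs q i N" "mem i (value_at i) F" using a assms(2) by auto
  note regs_next[OF r(1)] mem_next[OF r(2)]
  ultimately show "case (N(ival N (Const 4) := ival N (Plus (cell 4) (Const 1))), F) of (N, F) \<Rightarrow>
     regs q (Suc i) N \<and> mem (Suc i) 0 F \<and> map N (row_cells D) = T \<and> map N xs = U"
    using a by (simp only: split_conv ival.simps)
qed simp

lemma digits_le: "\<forall>x\<in>set (digits (n + 2) k j). x \<le> Suc n"
  using digits_lt[of "n + 2"] by fastforce

lemma tri_entry_prog:
  fixes i0 :: nat
  assumes j: "j \<le> c" "neg \<longleftrightarrow> j = c" and s: "s < C"
  defines "T \<equiv> digits (n + 2) D i0" and "U \<equiv> digits (n + 2) e s" and "i \<equiv> i0 * w + (j * C + s)"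
  shows "tri R (\<lambda>(N, F). regs (j * B) i N \<and> mem i 0 F \<and> map N (row_cells D) = T \<and> map N (col_cells D e) = U)
     (entry_prog d e neg) (entry_time n d e)
     (\<lambda>(N, F). regs (j * B) (Suc i) N \<and> mem (Suc i) 0 F \<and> map N (row_cells D) = T \<and> map N (col_cells D e) = U)"
proof -
  let ?K = "\<lambda>v (N, F). regs (j * B) i N \<and> mem i v F \<and> map N (row_cells D) = T \<and> map N (col_cells D e) = U"
  have T: "length T = D" "\<forall>x\<in>set T. x \<le> Suc n" and U: "length U = e" "\<forall>x\<in>set U. x \<le> Suc n"
    using digits_le by (auto simp: T_def U_def)
  define v where "v = (if neg then - 1 else 1) * mcoeff (mterm (dmon U + (if neg then {#n#} else {#})) 1 * P j) (dmon T)"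
  have s1: "tri R (?K 0) (scan d e neg) (scan_time n d e) (?K v)"
    unfolding v_def by (rule tri_scan[OF j(1) T U])
  have val: "value_at i = mcoeff (mterm (dmon U) 1 * rabinowitsch n c P j) (dmon T)"
    unfolding i_def T_def U_def by (rule value_at_column[OF j(1) s])
  have s2: "tri R (?K v) (if neg then when_equal (row_cells D) (col_cells D e @ replicate (Suc d) 1) (SetOne (cell 4)) else Skip)
     (compare_time D + 2) (?K (value_at i))"
  proof (cases neg)
    case True
    \<comment> \<open>The two contributions never overlap: a product with \<open>y\<close> times the
      multiplier cannot contain the multiplier monomial itself. Hence overwriting by 1 is
      correct.\<close>
    have "value_at i = mcoeff (mterm (dmon U) 1 - mterm (dmon U + {#n#}) 1 * P j) (dmon T)"
      using True j by (simp add: val rabinowitsch_def right_diff_distrib Var_def mult_single flip: mult.assoc)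
    also have "\<dots> = (if dmon T = dmon U then 1 else v)"
      using True by (auto simp: lookup_minus lookup_single when_def mcoeff_mterm_times v_def)
    finally have eq: "value_at i = (if dmon T = dmon U then 1 else v)" .
    have D: "D - length U = Suc d" using U by simp
    have l: "length U \<le> D" "length (col_cells D e) = length U" "\<forall>x\<in>set (col_cells D e). 30 \<le> x" using U by (auto simp: set_cells)
    show ?thesis using tri_mark[OF T l(1) U(2) l(2,3), of "j * B" i v] unfolding D eq using True by simp
  next
    case False
    then have "value_at i = v" using j by (simp add: val rabinowitsch_def v_def)
    then show ?thesis using False by (auto intro!: tri_Skip)
  qed
  show ?thesis unfolding entry_prog_def entry_time_def
    by (rule tri_Seq[OF s1 tri_Seq[OF s2 tri_next_entry]]) (auto simp: set_cells)
qed

lemma tri_block: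
  fixes i0 :: nat
  assumes j: "j \<le> c" "neg \<longleftrightarrow> j = c"
  defines "T \<equiv> digits (n + 2) D i0"
  shows "tri R (\<lambda>(N, F). regs (j * B) (i0 * w + j * C) N \<and> mem (i0 * w + j * C) 0 F \<and> map N (row_cells D) = T)
     (block d e neg) (block_time n d e)
     (\<lambda>(N, F). regs (Suc j * B) (i0 * w + Suc j * C) N \<and> mem (i0 * w + Suc j * C) 0 F \<and> map N (row_cells D) = T)"
proof -
  define I where "I s = (\<lambda>(N, F). regs (j * B) (i0 * w + (j * C + s)) N \<and> mem (i0 * w + (j * C + s)) 0 F \<and> map N (row_cells D) = T)" for s
  have loop: "tri R (I 0) (nest (col_cells D e) (cell 2) (entry_prog d e neg)) (nest_time (n + 2) (length (col_cells D e)) (entry_time n d e))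
     (I ((n + 2) ^ length (col_cells D e)))"
  proof (rule tri_nest)
    show "I s (N(v := x), F)" if "I s (N, F)" "v \<in> set (col_cells D e)" for s N F v x
      using that unfolding I_def split_conv by (subst map_upd_cells) (auto simp: set_cells intro: regs_upd)
    show "ival N (cell 2) = n + 2" if "I s (N, F)" for s N F
      using that by (simp add: I_def regs_def)
    show "ival (N(v := x)) (cell 2) = ival N (cell 2)" if "v \<in> set (col_cells D e)" for N v x
      using that by (auto simp: set_cells)
    show "tri R (\<lambda>t. I s t \<and> map (fst t) (col_cells D e) = digits (n + 2) (length (col_cells D e)) s) (entry_prog d e neg) (entry_time n d e)
       (\<lambda>t. I (Suc s) t \<and> map (fst t) (col_cells D e) = digits (n + 2) (length (col_cells D e)) s)"
      if "s < (n + 2) ^ length (col_cells D e)" for s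
    proof -
      have "s < C" using that by simp
      from tri_entry_prog[OF j this, of i0] show ?thesis unfolding T_def[symmetric]
        by (rule tri_conseq) (auto simp: I_def)
    qed
  qed simp
  show ?thesis unfolding block_def block_time_def
  proof (rule tri_Seq)
    show "tri R (\<lambda>(N, F). regs (j * B) (i0 * w + j * C) N \<and> mem (i0 * w + j * C) 0 F \<and> map N (row_cells D) = T)
       (nest (col_cells D e) (cell 2) (entry_prog d e neg)) (nest_time (n + 2) e (entry_time n d e)) (I C)"
      using loop unfolding length_cells by (rule tri_conseq) (auto simp: I_def)
    show "tri R (I C) (SetI (Const 24) (Plus (cell 24) (cell 25))) 1
       (\<lambda>(N, F). regs (Suc j * B) (i0 * w + Suc j * C) N \<and> mem (i0 * w + Suc j * C) 0 F \<and> map N (row_cells D) = T)"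
    proof (rule tri_SetI)
      fix N F assume a: "I C (N, F)"
      have e: "j * C + C = Suc j * C" by simp
      have r: "regs (j * B) (i0 * w + Suc j * C) N" "mem (i0 * w + Suc j * C) 0 F" "map N (row_cells D) = T"
        using a unfolding I_def e by auto
      have v: "ival N (Plus (cell 24) (cell 25)) = Suc j * B" "ival N (Const 24) = 24" using r(1) by (simp_all add: regs_def)
      show "case (N(ival N (Const 24) := ival N (Plus (cell 24) (cell 25))), F) of (N, F) \<Rightarrow>
         regs (Suc j * B) (i0 * w + Suc j * C) N \<and> mem (i0 * w + Suc j * C) 0 F \<and> map N (row_cells D) = T"
        unfolding v split_conv using regs_24[OF r(1)] r(2,3) by (subst map_upd_cells) (auto simp: set_cells)
    qed simp
  qed
qed

lemma tri_blocks:
  fixes i0 :: nat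
  assumes "j \<le> c"
  defines "T \<equiv> digits (n + 2) D i0"
  shows "tri R (\<lambda>(N, F). (\<exists>q. regs q (i0 * w) N) \<and> mem (i0 * w) 0 F \<and> map N (row_cells D) = T)
     (blocks d e j) (1 + j * block_time n d e)
     (\<lambda>(N, F). regs (j * B) (i0 * w + j * C) N \<and> mem (i0 * w + j * C) 0 F \<and> map N (row_cells D) = T)"
  using assms(1)
proof (induction j)
  case 0
  show ?case unfolding blocks.simps
  proof (rule tri_SetI)
    fix N F assume "case (N, F) of (N, F) \<Rightarrow> (\<exists>q. regs q (i0 * w) N) \<and> mem (i0 * w) 0 F \<and> map N (row_cells D) = T"
    then obtain q where "regs q (i0 * w) N" "mem (i0 * w) 0 F" "map N (row_cells D) = T" by blast
    then show "case (N(ival N (Const 24) := ival N (Const 0)), F) of (N, F) \<Rightarrow>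
       regs (0 * B) (i0 * w + 0 * C) N \<and> mem (i0 * w + 0 * C) 0 F \<and> map N (row_cells D) = T"
      using regs_24[of q "i0 * w" N 0] unfolding split_conv ival.simps mult_0 add_0_right
      by (subst map_upd_cells) (auto simp: set_cells)
  qed simp
next
  case (Suc j)
  have t: "1 + Suc j * block_time n d e = (1 + j * block_time n d e) + block_time n d e" by simp
  show ?case unfolding blocks.simps t T_def
    by (rule tri_Seq[OF Suc.IH[unfolded T_def] tri_block]) (use Suc.prems in auto)
qed

lemma tri_fill_row:
  fixes i0 :: nat
  defines "T \<equiv> digits (n + 2) D i0"
  shows "tri R (\<lambda>(N, F). (\<exists>q. regs q (i0 * w) N) \<and> mem (i0 * w) 0 F \<and> map N (row_cells D) = T)
     (fill_row c d e) (fill_row_time n c d e)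
     (\<lambda>(N, F). (\<exists>q. regs q (Suc i0 * w) N) \<and> mem (Suc i0 * w) 0 F \<and> map N (row_cells D) = T)"
proof -
  let ?i = "i0 * w + Suc c * C"
  let ?K = "\<lambda>v (N, F). regs (Suc c * B) ?i N \<and> mem ?i v F \<and> map N (row_cells D) = T \<and> map N [] = []"
  have s1: "tri R (\<lambda>(N, F). (\<exists>q. regs q (i0 * w) N) \<and> mem (i0 * w) 0 F \<and> map N (row_cells D) = T) (blocks d e c) (1 + c * block_time n d e)
     (\<lambda>(N, F). regs (c * B) (i0 * w + c * C) N \<and> mem (i0 * w + c * C) 0 F \<and> map N (row_cells D) = T)"
    unfolding T_def by (rule tri_blocks) simp
  have s2: "tri R (\<lambda>(N, F). regs (c * B) (i0 * w + c * C) N \<and> mem (i0 * w + c * C) 0 F \<and> map N (row_cells D) = T) (block d e True)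
     (block_time n d e) (?K 0)"
    unfolding T_def by (rule tri_conseq[OF tri_block[where j = c and neg = True and ?i0.0 = i0]]) auto
  have "tri R (?K 0) (when_equal (row_cells D) ([] @ replicate (D - length ([] :: nat list)) 1) (SetOne (cell 4))) (compare_time D + 2)
     (?K (if dmon T = dmon [] then 1 else 0))"
    by (rule tri_mark) (use digits_le in \<open>auto simp: T_def\<close>)
  then have s3: "tri R (?K 0) (when_equal (row_cells D) (replicate D 1) (SetOne (cell 4))) (compare_time D + 2) (?K (value_at ?i))"
    unfolding value_at_rhs T_def by simp
  have e: "Suc ?i = Suc i0 * w" by simp
  have s4: "tri R (?K (value_at ?i)) next_entry 1
     (\<lambda>(N, F). regs (Suc c * B) (Suc i0 * w) N \<and> mem (Suc i0 * w) 0 F \<and> map N (row_cells D) = T \<and> map N [] = [])"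
    unfolding e[symmetric] by (rule tri_next_entry) simp_all
  show ?thesis unfolding fill_row_def fill_row_time_def
    by (rule tri_conseq[OF tri_Seq[OF s1 tri_Seq[OF s2 tri_Seq[OF s3 s4]]]]) blast+
qed

lemma tri_fill:
  "tri R (\<lambda>(N, F). regs 0 0 N \<and> mem 0 0 F) (fill c d e) (fill_time n c d e)
     (\<lambda>(N, F). cfg z0 m w (\<lambda>i k. value_at (i * w + k)) N F)"
proof -
  define I where "I i = (\<lambda>(N, F). (\<exists>q. regs q (i * w) N) \<and> mem (i * w) 0 F)" for i
  have loop: "tri R (I 0) (nest (row_cells D) (cell 2) (fill_row c d e)) (nest_time (n + 2) (length (row_cells D)) (fill_row_time n c d e))
     (I ((n + 2) ^ length (row_cells D)))"
  proof (rule tri_nest)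
    show "I i (N(v := x), F)" if "I i (N, F)" "v \<in> set (row_cells D)" for i N F v x
      using that unfolding I_def split_conv by (auto simp: set_cells intro: regs_upd)
    show "ival N (cell 2) = n + 2" if "I i (N, F)" for i N F
      using that by (auto simp: I_def regs_def)
    show "ival (N(v := x)) (cell 2) = ival N (cell 2)" if "v \<in> set (row_cells D)" for N v x
      using that by (auto simp: set_cells)
    show "tri R (\<lambda>t. I i t \<and> map (fst t) (row_cells D) = digits (n + 2) (length (row_cells D)) i) (fill_row c d e) (fill_row_time n c d e)
       (\<lambda>t. I (Suc i) t \<and> map (fst t) (row_cells D) = digits (n + 2) (length (row_cells D)) i)" for i
      unfolding length_cells by (rule tri_conseq[OF tri_fill_row[where ?i0.0 = i]]) (auto simp: I_def)
  qed simp
  have w1: "1 \<le> w" by simp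
  have fin: "cfg z0 m w (\<lambda>i k. value_at (i * w + k)) N F" if "I m (N, F)" for N F
  proof -
    from that obtain q where r: "regs q (m * w) N" "mem (m * w) 0 F" unfolding I_def by blast
    have h: "\<forall>i'<m * w. of_int (F (z0 + 3 + i')) = value_at i'" using r(2) unfolding mem_def by (elim conjE)
    have "of_int (F (z0 + 3 + i * w + k)) = value_at (i * w + k)" if "i < m" "k < w" for i k
    proof -
      have "i * w + k < Suc i * w" using that(2) by simp
      also have "Suc i * w \<le> m * w" by (rule mult_right_mono) (use that(1) in auto)
      finally show ?thesis using h by (simp only: add.assoc)
    qed
    moreover have "N 5 = z0 + 3" "N 6 = z0" "N 7 = w" "N 8 = m" "N 9 = w - 1" using r(1) by (simp_all only: regs_def)
    moreover have "F z0 = 0" using r(2) unfolding mem_def by (elim conjE)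
    moreover note mem_carrier[OF r(2)]
    ultimately show ?thesis unfolding cfg_def[OF w1] by (intro conjI allI impI)
  qed
  show ?thesis unfolding fill_def fill_time_def
    using loop unfolding length_cells by (rule tri_conseq) (use fin in \<open>auto simp: I_def\<close>)
qed

end

end


section \<open>Setting up the registers; the complete program\<close>

text \<open>Powers are computed by letting an odometer run through all digit vectors and counting
  the rounds, within time proportional to the value up to constants depending on the number of
  digits.\<close>

definition count_up :: "nat \<Rightarrow> nat list \<Rightarrow> nat \<Rightarrow> prog" where
  "count_up a vs b = nest vs (cell b) (SetI (Const a) (Plus (cell a) (Const 1)))"

lemma tri_count_up:
  assumes "distinct vs" "a \<notin> set vs" "b \<notin> set vs"
    and upd: "\<And>j N F v x. X j (N, F) \<Longrightarrow> v \<in> set vs \<Longrightarrow> X j (N(v := x), F)"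
    and bound: "\<And>j N F. X j (N, F) \<Longrightarrow> N b = m"
    and inc: "\<And>j N F. X j (N, F) \<Longrightarrow> X (Suc j) (N(a := N a + 1), F)"
  shows "tri R (X 0) (count_up a vs b) (nest_time m (length vs) 1) (X (m ^ length vs))"
  unfolding count_up_def
proof (rule tri_nest)
  show "ival N (cell b) = m" if "X j (N, F)" for j N F using bound[OF that] by simp
  show "ival (N(v := x)) (cell b) = ival N (cell b)" if "v \<in> set vs" for N v x using that assms(3) by auto
  show "tri R (\<lambda>s. X j s \<and> map (fst s) vs = digits m (length vs) j) (SetI (Const a) (Plus (cell a) (Const 1))) 1
     (\<lambda>s. X (Suc j) s \<and> map (fst s) vs = digits m (length vs) j)" for j
  proof (rule tri_SetI)
    fix N F assume h: "X j (N, F) \<and> map (fst (N, F)) vs = digits m (length vs) j"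
    have "map (N(a := N a + 1)) vs = map N vs" using assms(2) by auto
    then show "X (Suc j) (N(ival N (Const a) := ival N (Plus (cell a) (Const 1))), F) \<and>
       map (fst (N(ival N (Const a) := ival N (Plus (cell a) (Const 1))), F)) vs = digits m (length vs) j"
      using h inc[of j N F] by (simp only: ival.simps fst_conv)
  qed simp
qed (use assms in auto)

definition setup_regs :: "nat \<Rightarrow> nat \<Rightarrow> nat \<Rightarrow> prog" where
  "setup_regs c d e = (let D = e + Suc d in
     Seq (SetI (Const 2) (Plus (cell 1) (Const 2))) (Seq (SetI (Const 3) (Plus (cell 1) (Const 1)))
       (Seq (count_up 25 (tab_cells D e d) 3) (Seq (count_up 26 (col_cells D e) 2) (Seq (count_up 8 (row_cells D) 2)
         (Seq (For 27 (Const (Suc c)) (SetI (Const 6) (Plus (cell 6) (cell 25))))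
           (Seq (For 27 (Const (Suc c)) (SetI (Const 9) (Plus (cell 9) (cell 26))))
             (Seq (SetI (Const 7) (Plus (cell 9) (Const 1))) (Seq (SetI (Const 5) (Plus (cell 6) (Const 3)))
               (SetI (Const 4) (cell 5)))))))))))"

definition setup_time :: "nat \<Rightarrow> nat \<Rightarrow> nat \<Rightarrow> nat \<Rightarrow> nat" where
  "setup_time n c d e = 1 + (1 + (nest_time (n + 1) d 1 + (nest_time (n + 2) e 1 + (nest_time (n + 2) (e + Suc d) 1 +
     (for_time (Suc c) 1 + (for_time (Suc c) 1 + (1 + (1 + 1))))))))"

definition contents :: "nat \<Rightarrow> (nat \<Rightarrow> 'a) \<Rightarrow> nat list \<Rightarrow> (nat \<Rightarrow> nat) \<times> (nat \<Rightarrow> 'a) \<Rightarrow> bool" where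
  "contents n F0 vs = (\<lambda>(N, F). F = F0 \<and> map N [1, 24, 2, 3, 25, 26, 8, 6, 9, 7, 5, 4] = n # 0 # vs)"

lemma tri_setup_regs:
  fixes n c d e :: nat
  defines "B \<equiv> (n + 1) ^ d" and "C \<equiv> (n + 2) ^ e" and "m \<equiv> (n + 2) ^ (e + Suc d)"
  shows "tri R (contents n F0 [0, 0, 0, 0, 0, 0, 0, 0, 0, 0]) (setup_regs c d e) (setup_time n c d e)
     (contents n F0 [n + 2, n + 1, B, C, m, Suc c * B, Suc c * C, Suc c * C + 1, Suc c * B + 3, Suc c * B + 3])"
proof -
  let ?D = "e + Suc d"
  have s1: "tri R (contents n F0 [0, 0, 0, 0, 0, 0, 0, 0, 0, 0]) (SetI (Const 2) (Plus (cell 1) (Const 2))) 1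
     (contents n F0 [n + 2, 0, 0, 0, 0, 0, 0, 0, 0, 0])"
    by (rule tri_SetI) (auto simp: contents_def)
  have s2: "tri R (contents n F0 [n + 2, 0, 0, 0, 0, 0, 0, 0, 0, 0]) (SetI (Const 3) (Plus (cell 1) (Const 1))) 1
     (contents n F0 [n + 2, n + 1, 0, 0, 0, 0, 0, 0, 0, 0])"
    by (rule tri_SetI) (auto simp: contents_def)
  have "tri R (contents n F0 [n + 2, n + 1, 0, 0, 0, 0, 0, 0, 0, 0]) (count_up 25 (tab_cells ?D e d) 3)
     (nest_time (n + 1) (length (tab_cells ?D e d)) 1) (contents n F0 [n + 2, n + 1, (n + 1) ^ length (tab_cells ?D e d), 0, 0, 0, 0, 0, 0, 0])"
    by (rule tri_count_up[where X = "\<lambda>j. contents n F0 [n + 2, n + 1, j, 0, 0, 0, 0, 0, 0, 0]"]) (auto simp: contents_def set_cells)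
  then have s3: "tri R (contents n F0 [n + 2, n + 1, 0, 0, 0, 0, 0, 0, 0, 0]) (count_up 25 (tab_cells ?D e d) 3) (nest_time (n + 1) d 1)
     (contents n F0 [n + 2, n + 1, B, 0, 0, 0, 0, 0, 0, 0])"
    unfolding length_cells B_def .
  have "tri R (contents n F0 [n + 2, n + 1, B, 0, 0, 0, 0, 0, 0, 0]) (count_up 26 (col_cells ?D e) 2)
     (nest_time (n + 2) (length (col_cells ?D e)) 1) (contents n F0 [n + 2, n + 1, B, (n + 2) ^ length (col_cells ?D e), 0, 0, 0, 0, 0, 0])"
    by (rule tri_count_up[where X = "\<lambda>j. contents n F0 [n + 2, n + 1, B, j, 0, 0, 0, 0, 0, 0]"]) (auto simp: contents_def set_cells)
  then have s4: "tri R (contents n F0 [n + 2, n + 1, B, 0, 0, 0, 0, 0, 0, 0]) (count_up 26 (col_cells ?D e) 2) (nest_time (n + 2) e 1)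
     (contents n F0 [n + 2, n + 1, B, C, 0, 0, 0, 0, 0, 0])"
    unfolding length_cells C_def .
  have "tri R (contents n F0 [n + 2, n + 1, B, C, 0, 0, 0, 0, 0, 0]) (count_up 8 (row_cells ?D) 2)
     (nest_time (n + 2) (length (row_cells ?D)) 1) (contents n F0 [n + 2, n + 1, B, C, (n + 2) ^ length (row_cells ?D), 0, 0, 0, 0, 0])"
    by (rule tri_count_up[where X = "\<lambda>j. contents n F0 [n + 2, n + 1, B, C, j, 0, 0, 0, 0, 0]"]) (auto simp: contents_def set_cells)
  then have s5: "tri R (contents n F0 [n + 2, n + 1, B, C, 0, 0, 0, 0, 0, 0]) (count_up 8 (row_cells ?D) 2) (nest_time (n + 2) ?D 1)
     (contents n F0 [n + 2, n + 1, B, C, m, 0, 0, 0, 0, 0])"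
    unfolding length_cells m_def .
  let ?J = "\<lambda>k s. contents n F0 [n + 2, n + 1, B, C, m, k * B, 0, 0, 0, 0] s \<and> fst s 27 = k"
  have s6: "tri R (contents n F0 [n + 2, n + 1, B, C, m, 0, 0, 0, 0, 0]) (For 27 (Const (Suc c)) (SetI (Const 6) (Plus (cell 6) (cell 25))))
     (for_time (Suc c) 1) (?J (Suc c))"
  proof (rule tri_For[where J = ?J])
    show "tri R (?J k) (SetI (Const 6) (Plus (cell 6) (cell 25))) 1 (\<lambda>(N, F). N 27 = k \<and> ?J (Suc k) (N(27 := Suc k), F))" for k
      by (rule tri_SetI) (auto simp: contents_def)
  qed (auto simp: contents_def)
  let ?J' = "\<lambda>k s. contents n F0 [n + 2, n + 1, B, C, m, Suc c * B, k * C, 0, 0, 0] s \<and> fst s 27 = k"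
  have s7: "tri R (?J (Suc c)) (For 27 (Const (Suc c)) (SetI (Const 9) (Plus (cell 9) (cell 26)))) (for_time (Suc c) 1) (?J' (Suc c))"
  proof (rule tri_For[where J = ?J'])
    show "tri R (?J' k) (SetI (Const 9) (Plus (cell 9) (cell 26))) 1 (\<lambda>(N, F). N 27 = k \<and> ?J' (Suc k) (N(27 := Suc k), F))" for k
      by (rule tri_SetI) (auto simp: contents_def)
  qed (auto simp: contents_def)
  have s8: "tri R (?J' (Suc c)) (SetI (Const 7) (Plus (cell 9) (Const 1))) 1
     (contents n F0 [n + 2, n + 1, B, C, m, Suc c * B, Suc c * C, Suc c * C + 1, 0, 0])"
    by (rule tri_SetI) (auto simp: contents_def)
  have s9: "tri R (contents n F0 [n + 2, n + 1, B, C, m, Suc c * B, Suc c * C, Suc c * C + 1, 0, 0])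
     (SetI (Const 5) (Plus (cell 6) (Const 3))) 1
     (contents n F0 [n + 2, n + 1, B, C, m, Suc c * B, Suc c * C, Suc c * C + 1, Suc c * B + 3, 0])"
    by (rule tri_SetI) (auto simp: contents_def)
  have s10: "tri R (contents n F0 [n + 2, n + 1, B, C, m, Suc c * B, Suc c * C, Suc c * C + 1, Suc c * B + 3, 0]) (SetI (Const 4) (cell 5)) 1
     (contents n F0 [n + 2, n + 1, B, C, m, Suc c * B, Suc c * C, Suc c * C + 1, Suc c * B + 3, Suc c * B + 3])"
    by (rule tri_SetI) (auto simp: contents_def)
  show ?thesis unfolding setup_regs_def Let_def setup_time_def
    by (rule tri_Seq[OF s1 tri_Seq[OF s2 tri_Seq[OF s3 tri_Seq[OF s4 tri_Seq[OF s5 tri_Seq[OF s6 tri_Seq[OF s7 tri_Seq[OF s8 tri_Seq[OF s9 s10]]]]]]]]])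
qed

definition radical_prog :: "nat \<Rightarrow> nat \<Rightarrow> prog" where
  "radical_prog c d = (let e = cofactor_bound c d in
     Seq (setup_regs c d e) (Seq (fill c d e) (Seq eliminate (SetI (Const 0) (Minus (Const 1) (cell 15))))))"

definition radical_time :: "nat \<Rightarrow> nat \<Rightarrow> nat \<Rightarrow> nat" where
  "radical_time c d n = (let e = cofactor_bound c d in setup_time n c d e + (fill_time n c d e +
     (eliminate_time ((n + 2) ^ (e + Suc d)) (Suc c * (n + 2) ^ e + 1) + 1)))"

text \<open>Correctness at a single characteristic, phrased without any field type, so that it can
  be carried from one prime to all others.\<close>

definition decides_radical :: "nat \<Rightarrow> bool" where
  "decides_radical p \<longleftrightarrow> (\<forall>c d n (P :: nat \<Rightarrow> nat multiset \<Rightarrow> int) Q.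
     (\<forall>i<c. P i \<in> mpoly_deg_le (residue_ring (int p)) n d) \<longrightarrow> Q \<in> mpoly_deg_le (residue_ring (int p)) n d \<longrightarrow>
     (\<exists>t N F. exec (residue_ring (int p)) (radical_prog c d) (input (residue_ring (int p)) c d p n P Q) t (N, F) \<and>
        t \<le> radical_time c d n \<and>
        N 0 = (if Q \<in> radical (mpoly_ring (residue_ring (int p)) n)
                 (Idl\<^bsub>mpoly_ring (residue_ring (int p)) n\<^esub> (P ` {..<c})) then 1 else 0)))"

lemma solvable_cong:
  assumes "\<And>i k. r \<le> i \<Longrightarrow> i < m \<Longrightarrow> k < w \<Longrightarrow> A i k = A' i k" "0 < w"
  shows "solvable m w A r = solvable m w A' r"
proof -
  have "(\<Sum>k<w - 1. A i k * x k) = (\<Sum>k<w - 1. A' i k * x k)" "A i (w - 1) = A' i (w - 1)" if "r \<le> i" "i < m" for i x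
    using assms(2) that by (auto intro!: sum.cong assms(1))
  then show ?thesis unfolding solvable_def by (simp cong: conj_cong imp_cong)
qed

context prime_field_type
begin

text \<open>The chain of equivalences runs from solvability of the stored system to bounded
  cofactors of the Rabinowitsch polynomials, to a power of \<open>Q\<close> being a combination of
  the \<open>P j\<close>, to membership in the radical of the record ring.\<close>

lemma tri_radical_prog:
  fixes c d n :: nat
  assumes P: "\<And>i. i < c \<Longrightarrow> P i \<in> mpoly_deg_le R n d" and Q: "Q \<in> mpoly_deg_le R n d"
  defines "F0 \<equiv> snd (input R c d p n P Q)"
  shows "tri R (contents n F0 [0, 0, 0, 0, 0, 0, 0, 0, 0, 0]) (radical_prog c d) (radical_time c d n)
     (\<lambda>(N, F). N 0 = (if Q \<in> radical (mpoly_ring R n) (Idl\<^bsub>mpoly_ring R n\<^esub> (P ` {..<c})) then 1 else 0))"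
proof -
  let ?e = "cofactor_bound c d"
  let ?B = "(n + 1) ^ d" and ?C = "(n + 2) ^ ?e" and ?m = "(n + 2) ^ (?e + Suc d)" and ?w = "Suc c * (n + 2) ^ ?e + 1"
  have PS: "P i \<in> carrier (mpoly_ring R n)" if "i < c" for i using P[OF that] by (simp add: mpoly_deg_le_def)
  have QS: "Q \<in> carrier (mpoly_ring R n)" using Q by (simp add: mpoly_deg_le_def)
  define f where "f j = (if j < c then P j else Q)" for j
  have f: "f j \<in> mpoly_deg_le R n d" "f j \<in> carrier (mpoly_ring R n)" for j
    using P Q PS QS by (auto simp: f_def)
  define G where "G j = to_mpoly (f j)" for j
  have B: "0 < ?B" by simp
  have F0: "F0 x = (let k = x div ?B; u = monomial_at n d (x mod ?B) in if k < c then P k u else if k = c then Q u else 0)" for x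
    by (simp add: F0_def input_def zero_R Let_def)
  have table: "of_int (F0 (j * ?B + r)) = mcoeff (G j) (digits_mon n (digits (n + 1) d r))" if "j \<le> c" "r < ?B" for j r
    using that(1) unfolding F0 div_mod_offset[OF that(2)] monomial_at_digits Let_def G_def mcoeff_to_mpoly[OF f(2)]
    by (auto simp: f_def)
  have Gdeg: "mdeg_le d (G j)" for j
    using f[of j] by (auto simp: mdeg_le_def G_def in_keys_iff mcoeff_to_mpoly of_int_R_eq_0 carrier_S zero_R mpoly_deg_le_def)
  have Gvars: "mvars_in {..<n} (G j)" for j unfolding G_def by (rule to_mpoly_vars[OF f(2)])
  have F0c: "F0 x \<in> carrier R" for x
    using PS QS zero_closed unfolding F0 Let_def by (auto simp: carrier_S zero_R)
  have F0z: "F0 x = 0" if "Suc c * ?B \<le> x" for x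
  proof -
    have "Suc c \<le> x div ?B" using that B by (simp only: less_eq_div_iff_mult_less_eq)
    then show ?thesis unfolding F0 Let_def by simp
  qed
  let ?A = "\<lambda>i k. value_at n c d ?e G (i * ?w + k)"
  have s1: "tri R (contents n F0 [0, 0, 0, 0, 0, 0, 0, 0, 0, 0]) (setup_regs c d ?e) (setup_time n c d ?e)
     (\<lambda>(N, F). regs n c d ?e 0 0 N \<and> mem n c d ?e F0 G 0 0 F)"
  proof (rule tri_conseq[OF tri_setup_regs])
    fix s
    assume s: "contents n F0 [n + 2, n + 1, ?B, ?C, ?m, Suc c * ?B, Suc c * ?C, Suc c * ?C + 1, Suc c * ?B + 3, Suc c * ?B + 3] s"
    obtain N F where NF: "s = (N, F)" by fastforce
    have "regs n c d ?e 0 0 N" 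
      by (rule iffD2[OF regs_def[OF table Gdeg Gvars]]) (use s in \<open>simp_all add: NF contents_def\<close>)
    moreover have "F = F0" using s by (simp add: NF contents_def)
    moreover have "mem n c d ?e F0 G 0 0 F0" 
      by (rule iffD2[OF mem_def[OF table Gdeg Gvars]]) (use F0c F0z in simp_all)
    ultimately show "case s of (N, F) \<Rightarrow> regs n c d ?e 0 0 N \<and> mem n c d ?e F0 G 0 0 F" by (simp add: NF)
  qed simp_all
  have s2: "tri R (\<lambda>(N, F). regs n c d ?e 0 0 N \<and> mem n c d ?e F0 G 0 0 F) (fill c d ?e) (fill_time n c d ?e)
     (\<lambda>(N, F). cfg (Suc c * ?B) ?m ?w ?A N F)"
    by (rule tri_fill[OF table Gdeg Gvars])
  have w1: "1 \<le> ?w" by simp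
  have s3: "tri R (\<lambda>(N, F). cfg (Suc c * ?B) ?m ?w ?A N F) eliminate (eliminate_time ?m ?w)
     (\<lambda>(N, F). N 15 = (if solvable ?m ?w ?A 0 then 0 else 1))"
    by (rule tri_eliminate[OF w1])
  have sol: "solvable ?m ?w ?A 0 \<longleftrightarrow> Q \<in> radical (mpoly_ring R n) (Idl\<^bsub>mpoly_ring R n\<^esub> (P ` {..<c}))"
  proof -
    have "solvable ?m ?w ?A 0 \<longleftrightarrow> solvable ?m ?w (\<lambda>i. entry n ?e (Suc c) (rabinowitsch n c G) (digits_mon n (digits (n + 2) (?e + Suc d) i))) 0"
    proof (rule solvable_cong)
      have v: "value_at n c d ?e G i = entry n ?e (Suc c) (rabinowitsch n c G) (digits_mon n (digits (n + 2) (?e + Suc d) (i div ?w))) (i mod ?w)" for i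
        by (rule value_at_def[OF table Gdeg Gvars])
      show "?A i k = entry n ?e (Suc c) (rabinowitsch n c G) (digits_mon n (digits (n + 2) (?e + Suc d) i)) k" if "k < ?w" for i k
        unfolding v div_mod_offset[OF that] ..
    qed simp
    also have "\<dots> \<longleftrightarrow> (\<exists>g. (\<forall>j. mdeg_le ?e (g j) \<and> mvars_in {..<Suc n} (g j)) \<and> (\<Sum>j<Suc c. g j * rabinowitsch n c G j) = 1)"
    proof (rule solvable_entry_iff)
      fix j
      have "mdeg_le (1 + d) (Var n * G c)" by (rule mdeg_le_mult[OF mdeg_le_Var Gdeg]) simp
      then show "mdeg_le (Suc d) (rabinowitsch n c G j)"
        using mdeg_le_mono[OF Gdeg, of "Suc d"] by (auto simp: rabinowitsch_def intro!: mdeg_le_diff)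
      have v: "mvars_in {..<Suc n} (G i)" for i by (rule mvars_in_mono[OF Gvars]) auto
      have "mvars_in {..<Suc n} (1 + - (Var n * G c))"
        by (intro mvars_in_add mvars_in_uminus mvars_in_mult mvars_in_Var v) auto
      then show "mvars_in {..<Suc n} (rabinowitsch n c G j)" using v by (auto simp: rabinowitsch_def)
    qed
    also have "\<dots> \<longleftrightarrow> (\<exists>g. (\<forall>j. mdeg_le ?e (g j) \<and> mvars_in {..<Suc n} (g j)) \<and>
        (\<Sum>j<c. g j * to_mpoly (P j)) + g c * (1 - Var n * to_mpoly Q) = 1)"
      by (simp add: rabinowitsch_def G_def f_def)
    also have "\<dots> \<longleftrightarrow> (\<exists>s A. (\<forall>j. mvars_in {..<n} (A j)) \<and> to_mpoly Q ^ Suc s = (\<Sum>j<c. A j * to_mpoly (P j)))"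
    proof (rule radical_membership_bounded[symmetric])
      show "mdeg_le d (to_mpoly (P j))" "mvars_in {..<n} (to_mpoly (P j))" if "j < c" for j
        using that Gdeg[of j] Gvars[of j] by (simp_all add: G_def f_def)
      show "mdeg_le d (to_mpoly Q)" "mvars_in {..<n} (to_mpoly Q)"
        using Gdeg[of c] Gvars[of c] by (simp_all add: G_def f_def)
    qed
    also have "\<dots> \<longleftrightarrow> Q \<in> radical (mpoly_ring R n) (Idl\<^bsub>mpoly_ring R n\<^esub> (P ` {..<c}))"
      by (rule radical_iff[symmetric, OF PS QS])
    finally show ?thesis .
  qed
  have s4: "tri R (\<lambda>(N, F). N 15 = (if X then 0 else 1)) (SetI (Const 0) (Minus (Const 1) (cell 15))) 1
     (\<lambda>(N, F). N 0 = (if X then 1 else 0))" for X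
    by (rule tri_SetI) simp_all
  show ?thesis unfolding radical_prog_def radical_time_def Let_def sol[symmetric]
    by (rule tri_Seq[OF s1 tri_Seq[OF s2 tri_Seq[OF s3 s4]]])
qed

lemma decides_radical: "decides_radical p"
  unfolding decides_radical_def
proof (intro allI impI)
  fix c d n :: nat and P Q
  assume P: "\<forall>i<c. P i \<in> mpoly_deg_le R n d" and Q: "Q \<in> mpoly_deg_le R n d"
  have "contents n (snd (input R c d p n P Q)) [0, 0, 0, 0, 0, 0, 0, 0, 0, 0] (input R c d p n P Q)"
    by (simp add: contents_def input_def)
  from triE[OF tri_radical_prog[OF P[rule_format] Q] this]
  show "\<exists>t N F. exec R (radical_prog c d) (input R c d p n P Q) t (N, F) \<and> t \<le> radical_time c d n \<and>
      N 0 = (if Q \<in> radical (mpoly_ring R n) (Idl\<^bsub>mpoly_ring R n\<^esub> (P ` {..<c})) then 1 else 0)"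
    by auto
qed

end


section \<open>The polynomial time bound and the passage to all primes\<close>

text \<open>A single constant serves as factor and as exponent; \<open>n + 1\<close> keeps the bound
  meaningful at \<open>n = 0\<close>.\<close>

definition poly_bounded :: "(nat \<Rightarrow> nat) \<Rightarrow> bool" where
  "poly_bounded f \<longleftrightarrow> (\<exists>K. \<forall>n. f n \<le> K * (n + 1) ^ K)"

lemma poly_boundedI: "(\<And>n. f n \<le> K * (n + 1) ^ L) \<Longrightarrow> poly_bounded f"
proof -
  assume f: "\<And>n. f n \<le> K * (n + 1) ^ L"
  have "f n \<le> (K + L) * (n + 1) ^ (K + L)" for n
    by (rule order.trans[OF f]) (intro mult_mono power_increasing; simp)
  then show ?thesis unfolding poly_bounded_def by blast
qed

lemma poly_bounded_mono: "poly_bounded g \<Longrightarrow> (\<And>n. f n \<le> g n) \<Longrightarrow> poly_bounded f"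
  unfolding poly_bounded_def by (meson order.trans)

lemma poly_bounded_const [simp]: "poly_bounded (\<lambda>n. a)"
  by (rule poly_boundedI[of _ a 0]) simp

lemma poly_bounded_id [simp]: "poly_bounded (\<lambda>n. n)"
  by (rule poly_boundedI[of _ 1 1]) simp

lemma poly_bounded_add: "poly_bounded f \<Longrightarrow> poly_bounded g \<Longrightarrow> poly_bounded (\<lambda>n. f n + g n)"
proof -
  assume "poly_bounded f" "poly_bounded g"
  then obtain K L where f: "\<And>n. f n \<le> K * (n + 1) ^ K" and g: "\<And>n. g n \<le> L * (n + 1) ^ L"
    unfolding poly_bounded_def by blast
  have "K * (n + 1) ^ K \<le> K * (n + 1) ^ (K + L)" "L * (n + 1) ^ L \<le> L * (n + 1) ^ (K + L)" for n
    by (intro mult_mono power_increasing; simp)+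
  then have "f n + g n \<le> (K + L) * (n + 1) ^ (K + L)" for n
    using order.trans[OF f] order.trans[OF g] by (simp only: distrib_right add_mono)
  then show ?thesis by (rule poly_boundedI)
qed

lemma poly_bounded_mult: "poly_bounded f \<Longrightarrow> poly_bounded g \<Longrightarrow> poly_bounded (\<lambda>n. f n * g n)"
proof -
  assume "poly_bounded f" "poly_bounded g"
  then obtain K L where f: "\<And>n. f n \<le> K * (n + 1) ^ K" and g: "\<And>n. g n \<le> L * (n + 1) ^ L"
    unfolding poly_bounded_def by blast
  have "f n * g n \<le> (K * L) * (n + 1) ^ (K + L)" for n
    using mult_mono[OF f g, of n n] by (simp only: power_add mult.assoc mult.left_commute zero_le)
  then show ?thesis by (rule poly_boundedI)
qed

lemma poly_bounded_power: "poly_bounded f \<Longrightarrow> poly_bounded (\<lambda>n. f n ^ k)"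
  by (induction k) (simp_all add: poly_bounded_mult)

lemma poly_bounded_for_time: "poly_bounded f \<Longrightarrow> poly_bounded g \<Longrightarrow> poly_bounded (\<lambda>n. for_time (f n) (g n))"
  unfolding for_time_def by (intro poly_bounded_add poly_bounded_mult poly_bounded_const)

lemma poly_bounded_nest_time: "poly_bounded f \<Longrightarrow> poly_bounded g \<Longrightarrow> poly_bounded (\<lambda>n. nest_time (f n) k (g n))"
  by (induction k) (simp_all add: poly_bounded_for_time)

lemma poly_bounded_eliminate_time:
  assumes "poly_bounded f" "poly_bounded g" shows "poly_bounded (\<lambda>n. eliminate_time (f n) (g n))"
  unfolding eliminate_time_def step_time_def rows_time_def
  by (intro poly_bounded_add poly_bounded_for_time poly_bounded_const assms poly_bounded_mono[OF assms(2), of "\<lambda>n. g n - 1"]) simp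

lemma poly_bounded_radical_time: "poly_bounded (radical_time c d)"
  unfolding radical_time_def Let_def setup_time_def fill_time_def fill_row_time_def block_time_def entry_time_def scan_time_def
  by (intro poly_bounded_add poly_bounded_mult poly_bounded_nest_time poly_bounded_eliminate_time poly_bounded_power
      poly_bounded_const poly_bounded_id)

text \<open>
  A type cannot depend on the bound variable \<open>p\<close>. It suffices to have one prime field as a type,
  of a characteristic that is a counterexample to correctness whenever there is one.
\<close>

definition test_prime :: nat where
  "test_prime = (if \<forall>p. prime p \<longrightarrow> decides_radical p then 2 else (SOME p. prime p \<and> \<not> decides_radical p))"

lemma test_prime: "prime test_prime" "decides_radical test_prime \<Longrightarrow> prime p \<Longrightarrow> decides_radical p"
proof -
  have "prime test_prime \<and> (decides_radical test_prime \<longrightarrow> (\<forall>p. prime p \<longrightarrow> decides_radical p))"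
  proof (cases "\<forall>p. prime p \<longrightarrow> decides_radical p")
    case False
    then have "\<exists>p. prime p \<and> \<not> decides_radical p" by blast
    then have "prime (SOME p. prime p \<and> \<not> decides_radical p) \<and> \<not> decides_radical (SOME p. prime p \<and> \<not> decides_radical p)"
      by (rule someI_ex)
    then show ?thesis unfolding test_prime_def using False by (simp only: if_False) blast
  qed (simp add: test_prime_def)
  then show "prime test_prime" "decides_radical test_prime \<Longrightarrow> prime p \<Longrightarrow> decides_radical p" by blast+
qed

typedef test_index = "{..<test_prime}"
  using prime_gt_0_nat[OF test_prime(1)] by auto

lemma card_test_index: "CARD(test_index) = test_prime"
  using type_definition.card[OF type_definition_test_index] by simp

instance test_index :: prime_card
  by standard (simp add: card_test_index test_prime(1))

interpretation test_field: prime_field_type test_prime "to_int_mod_ring :: test_index mod_ring \<Rightarrow> int"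
proof
  show "prime test_prime" by (rule test_prime(1))
  fix x :: "test_index mod_ring"
  have "to_int_mod_ring x \<in> {0..<int test_prime}"
    using range_to_int_mod_ring[where ?'a = test_index] by (auto simp: card_test_index)
  then show "0 \<le> to_int_mod_ring x" "to_int_mod_ring x < int test_prime" by auto
  show "of_int (to_int_mod_ring x) = x" by (simp add: of_int_of_int_mod_ring)
  show "of_nat test_prime = (0 :: test_index mod_ring)"
    using of_nat_card_eq_0[where ?'a = test_index] by (simp add: card_test_index)
qed

theorem theorem1p4:
  fixes c d :: nat
  shows "\<exists>(A :: prog) (K :: nat). \<forall>(p :: nat) (n :: nat)
      (P :: nat \<Rightarrow> nat multiset \<Rightarrow> int) (Q :: nat multiset \<Rightarrow> int).
      prime p \<longrightarrow>
      (\<forall>i<c. P i \<in> mpoly_deg_le (residue_ring (int p)) n d) \<longrightarrow>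
      Q \<in> mpoly_deg_le (residue_ring (int p)) n d \<longrightarrow>
      (let R = residue_ring (int p);
           S = mpoly_ring R n;
           I = Idl\<^bsub>S\<^esub> (P ` {..<c})
       in \<exists>t N F. exec R A (input R c d p n P Q) t (N, F) \<and>
            t \<le> K * (n + 1) ^ K \<and>
            N 0 = (if Q \<in> radical S I then 1 else 0))"
proof -
  obtain K where K: "\<And>n. radical_time c d n \<le> K * (n + 1) ^ K"
    using poly_bounded_radical_time[of c d] unfolding poly_bounded_def by blast
  show ?thesis unfolding Let_def
  proof (rule exI[of _ "radical_prog c d"], rule exI[of _ K], intro allI impI)
    fix p n P Q
    assume p: "prime p" and P: "\<forall>i<c. P i \<in> mpoly_deg_le (residue_ring (int p)) n d" and Q: "Q \<in> mpoly_deg_le (residue_ring (int p)) n d"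
    \<comment> \<open>Correctness is known at the prime realized by a type; by the choice of
      \<open>test_prime\<close>, a failure anywhere would have been a failure there.\<close>
    have "decides_radical p" by (rule test_prime(2)[OF test_field.decides_radical p])
    from this[unfolded decides_radical_def, THEN spec, THEN spec, THEN spec, THEN spec, THEN spec, THEN mp, THEN mp, OF P Q] obtain t N F where
      *: "exec (residue_ring (int p)) (radical_prog c d) (input (residue_ring (int p)) c d p n P Q) t (N, F)" "t \<le> radical_time c d n"
      "N 0 = (if Q \<in> radical (mpoly_ring (residue_ring (int p)) n)
                 (Idl\<^bsub>mpoly_ring (residue_ring (int p)) n\<^esub> (P ` {..<c})) then 1 else 0)" by blast
    show "\<exists>t N F. exec (residue_ring (int p)) (radical_prog c d) (input (residue_ring (int p)) c d p n P Q) t (N, F) \<and>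
        t \<le> K * (n + 1) ^ K \<and> N 0 = (if Q \<in> radical (mpoly_ring (residue_ring (int p)) n)
                 (Idl\<^bsub>mpoly_ring (residue_ring (int p)) n\<^esub> (P ` {..<c})) then 1 else 0)"
      using *(1,3) order.trans[OF *(2) K] by blast
  qed
qed



end
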